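(* Let $S$ be a real-valued $C^\infty$ function defined in a neighborhood of the origin in $\mathbb{R}^2$, and suppose that $H=\partial_x\partial_y(\partial_x-\partial_y)S$ is of finite type at the origin. Let $d$ be the order of $H$ at $(0,0)$. Then there is a neighborhood $V$ of the origin such that for every $\varphi\in C_0^\infty(\mathbb{R}^2)$ supported in $V$ there is a constant $C>0$ (independent of $\lambda,f_1,f_2,f_3$) such that for all real $\lambda\neq 0$ and all $f_1,f_2,f_3\in L^2(\mathbb{R})$, $$|\Lambda_\lambda(f_1,f_2,f_3)|\le C|\lambda|^{-\frac{1}{2(3+d)}}\|f_1\|_2\|f_2\|_2\|f_3\|_2 .$$ Moreover, if $\varphi(0,0)\neq 0$, this decay estimate is sharp: for no $\epsilon>\frac{1}{2(3+d)}$ does there exist a constant $C$ such that $|\Lambda_\lambda(f_1,f_2,f_3)|\le C|\lambda|^{-\epsilon}\|f_1\|_2\|f_2\|_2\|f_3\|_2$ for all $|\lambda|\ge 1$ and all $f_1,f_2,f_3\in L^2(\mathbb{R})$.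
   Context: For a phase $S$ and a cut-off function $\varphi$ supported in the domain of $S$, $$\Lambda_\lambda(f_1,f_2,f_3)=\iint_{\mathbb{R}^2}e^{i\lambda S(x,y)}f_1(x)f_2(y)f_3(x+y)\varphi(x,y)\,dx\,dy .$$ Here $\|\cdot\|_2$ is the $L^2(\mathbb{R})$ norm. A smooth function $H$ near the origin of $\mathbb{R}^2$ is of finite type at $(0,0)$ if $\partial_x^\alpha\partial_y^\beta H(0,0)\neq 0$ for some non-negative integers $\alpha,\beta$ (the case $\alpha=\beta=0$ is allowed). Its order at $(0,0)$ is then $d=\min\{\alpha+\beta:\ \alpha,\beta\ge 0 \text{ integers},\ \partial_x^\alpha\partial_y^\beta H(0,0)\neq 0\}$. *)

theory Defs
  imports "HOL-Analysis.Analysis"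
begin

definition partial_x :: "(real \<times> real \<Rightarrow> 'a::real_normed_vector) \<Rightarrow> real \<times> real \<Rightarrow> 'a" where
  "partial_x f = (\<lambda>(x, y). vector_derivative (\<lambda>t. f (t, y)) (at x))"

definition partial_y :: "(real \<times> real \<Rightarrow> 'a::real_normed_vector) \<Rightarrow> real \<times> real \<Rightarrow> 'a" where
  "partial_y f = (\<lambda>(x, y). vector_derivative (\<lambda>t. f (x, t)) (at y))"

text \<open>Continuous differentiability of order \<open>k\<close> on an open set: all partial derivatives of order
  at most \<open>k\<close>, taken in any sequence, exist and are continuous. Only meant for open sets;
  values of the function outside the set are irrelevant.\<close>

primrec Ck_on :: "nat \<Rightarrow> (real \<times> real) set \<Rightarrow> (real \<times> real \<Rightarrow> 'a::real_normed_vector) \<Rightarrow> bool" where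
  "Ck_on 0 U f \<longleftrightarrow> continuous_on U f"
| "Ck_on (Suc k) U f \<longleftrightarrow> continuous_on U f \<and>
     (\<forall>(x, y)\<in>U. (\<lambda>t. f (t, y)) differentiable (at x) \<and> (\<lambda>t. f (x, t)) differentiable (at y)) \<and>
     Ck_on k U (partial_x f) \<and> Ck_on k U (partial_y f)"

definition smooth_on :: "(real \<times> real) set \<Rightarrow> (real \<times> real \<Rightarrow> 'a::real_normed_vector) \<Rightarrow> bool" where
  "smooth_on U f \<longleftrightarrow> (\<forall>k. Ck_on k U f)"

definition test_function_on :: "(real \<times> real) set \<Rightarrow> (real \<times> real \<Rightarrow> complex) \<Rightarrow> bool" where
  "test_function_on V \<phi> \<longleftrightarrow> smooth_on UNIV \<phi> \<and>
     compact (closure {p. \<phi> p \<noteq> 0}) \<and> closure {p. \<phi> p \<noteq> 0} \<subseteq> V"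

definition finite_type_at_origin :: "(real \<times> real \<Rightarrow> real) \<Rightarrow> bool" where
  "finite_type_at_origin H \<longleftrightarrow>
     (\<exists>\<alpha> \<beta>. (partial_x ^^ \<alpha>) ((partial_y ^^ \<beta>) H) (0, 0) \<noteq> 0)"

definition order_at_origin :: "(real \<times> real \<Rightarrow> real) \<Rightarrow> nat" where
  "order_at_origin H =
     (LEAST n. \<exists>\<alpha> \<beta>. n = \<alpha> + \<beta> \<and> (partial_x ^^ \<alpha>) ((partial_y ^^ \<beta>) H) (0, 0) \<noteq> 0)"

definition L2_fun :: "(real \<Rightarrow> complex) \<Rightarrow> bool" where
  "L2_fun f \<longleftrightarrow> f \<in> borel_measurable lebesgue \<and> integrable lebesgue (\<lambda>x. (norm (f x))\<^sup>2)"

definition L2_norm :: "(real \<Rightarrow> complex) \<Rightarrow> real" where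
  "L2_norm f = sqrt (LINT x|lebesgue. (norm (f x))\<^sup>2)"

text \<open>For \<open>L2\<close> functions \<open>f1, f2, f3\<close>, a continuous compactly supported \<open>\<phi>\<close> and a phase
  continuous near the support of \<open>\<phi>\<close>, the integrand is absolutely integrable, so the library's
  default value \<open>0\<close> for non-integrable functions plays no role. Values of the phase outside
  the support of \<open>\<phi>\<close> do not matter.\<close>

definition trilinear_form :: "(real \<times> real \<Rightarrow> real) \<Rightarrow> (real \<times> real \<Rightarrow> complex) \<Rightarrow> real \<Rightarrow>
    (real \<Rightarrow> complex) \<Rightarrow> (real \<Rightarrow> complex) \<Rightarrow> (real \<Rightarrow> complex) \<Rightarrow> complex" where
  "trilinear_form S \<phi> lam f1 f2 f3 =
     (LINT p|lebesgue. (case p of (x, y) \<Rightarrow>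
        exp (\<i> * complex_of_real (lam * S (x, y))) * f1 x * f2 y * f3 (x + y) * \<phi> (x, y)))"

end

theory Submission
  imports Defs "HOL-Analysis.Analysis"
begin

text \<open>
  Duality in \<open>f3\<close> and squaring turn the form into an integral over \<open>\<tau>\<close> of bilinear oscillatory
  integrals with phase \<open>S (x, y) - S (x + \<tau>, y - \<tau>)\<close>, whose mixed derivative is \<open>\<tau>\<close> times a value
  of \<open>H\<close>. On a square of side \<open>l\<close> where \<open>H\<close> is comparable to its maximum (which is at least
  \<open>c l\<^sup>d\<close>) this gives decay. If pure derivatives of \<open>H\<close> of order at most \<open>d\<close> in \<open>x\<close> and in
  \<open>y\<close> are bounded below, every row or column of a grid contains boundedly many other squares; these
  are halved repeatedly, until at side \<open>\<bar>\<lambda>\<bar> powr (- 1 / (3 + d))\<close> the Cauchy-Schwarz inequality suffices.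
  After rescaling, Taylor expansion along rays provides such lower bounds near every point of the
  dyadic annuli; for points on an axis one first permutes the roles of \<open>f1\<close>, \<open>f2\<close> and \<open>f3\<close>. The
  annuli can be summed without loss, since on each piece at least two of \<open>x\<close>, \<open>y\<close>, \<open>x + y\<close> are
  comparable to the radius. For sharpness, \<open>S\<close> differs from some \<open>a x - b y + c (x + y)\<close> by
  \<open>O(\<delta>\<^sup>d\<^sup>+\<^sup>3)\<close> on the square of side \<open>\<delta>\<close>, so modulated indicators of intervals of length comparable
  to \<open>\<delta> = \<bar>\<lambda>\<bar> powr (- 1 / (3 + d))\<close> remove the oscillation.
\<close>

text \<open>The exponent comes from a balance. On a square of side l where |H| is at least a
  multiple of l^d, the squared form is bounded by a multiple of (|\<lambda>| l^d)^(-1/3), while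
  Cauchy-Schwarz gives l; both agree at l = |\<lambda>|^(-1/(3+d)). The first bound worsens like
  l^(-d/3), so the sum over scales is geometric and governed by its last term. For d = 0 it does not
  worsen, but then no small square is bad. Dilation by r turns \<lambda> into \<lambda> r^(3+d), and
  the powers of r from the Jacobian, the norms and \<lambda> cancel exactly. Hence all annuli obey
  the same bound with no decay in the radius, and only orthogonality of the pieces can sum them. The
  obstacle is the zero set of H, about which nothing is known. It is never described: on a line, a
  lower bound for one derivative forces small logarithmic derivatives of the function away from
  boundedly many points. Taylor expansion along the ray through p yields such a bound in a
  coordinate direction only if this direction and p span the plane. This fails on the axes and is
  the reason for permuting the functions there.\<close>

section \<open>Families of partial derivatives\<close>

text \<open>A jet \<open>g\<close> lists all partial derivatives of \<open>g 0 0\<close>: \<open>g i j\<close> stands for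
  \<open>\<partial>\<^sub>x\<^sup>i\<partial>\<^sub>y\<^sup>j (g 0 0)\<close>. \<open>hjet g\<close> below is the jet of \<open>H = \<partial>\<^sub>x\<partial>\<^sub>y(\<partial>\<^sub>x - \<partial>\<^sub>y)(g 0 0)\<close>.\<close>

definition jet :: "(real \<times> real) set \<Rightarrow> (nat \<Rightarrow> nat \<Rightarrow> real \<times> real \<Rightarrow> real) \<Rightarrow> bool" where
  "jet U g \<longleftrightarrow> open U \<and> (\<forall>i j. continuous_on U (g i j)) \<and>
     (\<forall>i j x y. (x, y) \<in> U \<longrightarrow>
        ((\<lambda>t. g i j (t, y)) has_real_derivative g (Suc i) j (x, y)) (at x) \<and>
        ((\<lambda>t. g i j (x, t)) has_real_derivative g i (Suc j) (x, y)) (at y))"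

lemma jet_open: "jet U g \<Longrightarrow> open U"
  by (simp only: jet_def)

lemma jet_cont: "jet U g \<Longrightarrow> continuous_on U (g i j)"
  by (simp only: jet_def)

lemma jet_dx: "jet U g \<Longrightarrow> (x, y) \<in> U \<Longrightarrow>
     ((\<lambda>t. g i j (t, y)) has_real_derivative g (Suc i) j (x, y)) (at x)"
  by (simp only: jet_def)

lemma jet_dy: "jet U g \<Longrightarrow> (x, y) \<in> U \<Longrightarrow>
     ((\<lambda>t. g i j (x, t)) has_real_derivative g i (Suc j) (x, y)) (at y)"
  by (simp only: jet_def)

section \<open>Symmetry of mixed second derivatives\<close>

lemma open_prod_boxE:
  fixes U :: "(real \<times> real) set"
  assumes "open U" "(x, y) \<in> U"
  obtains e where "e > 0" "\<And>s t. \<bar>s - x\<bar> < e \<Longrightarrow> \<bar>t - y\<bar> < e \<Longrightarrow> (s, t) \<in> U"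
proof -
  obtain A B where AB: "open A" "open B" "(x, y) \<in> A \<times> B" "A \<times> B \<subseteq> U"
    using open_prod_elim[OF assms] by metis
  then have xy: "x \<in> A" "y \<in> B" by auto
  obtain e1 where e1: "e1 > 0" "ball x e1 \<subseteq> A" using openE[OF AB(1) xy(1)] .
  obtain e2 where e2: "e2 > 0" "ball y e2 \<subseteq> B" using openE[OF AB(2) xy(2)] .
  have "(s, t) \<in> U" if "\<bar>s - x\<bar> < min e1 e2" "\<bar>t - y\<bar> < min e1 e2" for s t
  proof -
    have "s \<in> A" "t \<in> B"
      using that e1(2) e2(2) by (auto simp: subset_iff dist_real_def abs_minus_commute)
    then show ?thesis using AB(4) by blast
  qed
  then show thesis using that[of "min e1 e2"] e1(1) e2(1) by simp
qed

lemma MVT_between: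
  fixes f f' :: "real \<Rightarrow> real"
  assumes "\<And>t. min a b \<le> t \<Longrightarrow> t \<le> max a b \<Longrightarrow> (f has_real_derivative f' t) (at t)"
  shows "\<exists>t. min a b \<le> t \<and> t \<le> max a b \<and> f b - f a = (b - a) * f' t"
proof -
  consider "a < b" | "b < a" | "a = b" by linarith
  then show ?thesis
  proof cases
    case 1
    then obtain z where "a < z" "z < b" "f b - f a = (b - a) * f' z"
      using MVT2[of a b f f'] assms by auto
    then show ?thesis using 1 by (intro exI[of _ z]) auto
  next
    case 2
    then obtain z where "b < z" "z < a" "f a - f b = (a - b) * f' z"
      using MVT2[of b a f f'] assms by auto
    then show ?thesis using 2 by (intro exI[of _ z]) (auto simp: algebra_simps)
  qed auto
qed

lemma mixed_difference:
  fixes f fx fxy :: "real \<times> real \<Rightarrow> real"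
  assumes "\<And>s t. \<bar>s - x\<bar> \<le> \<bar>h\<bar> \<Longrightarrow> \<bar>t - y\<bar> \<le> \<bar>h\<bar> \<Longrightarrow> ((\<lambda>s. f (s, t)) has_real_derivative fx (s, t)) (at s)"
    and "\<And>s t. \<bar>s - x\<bar> \<le> \<bar>h\<bar> \<Longrightarrow> \<bar>t - y\<bar> \<le> \<bar>h\<bar> \<Longrightarrow> ((\<lambda>t. fx (s, t)) has_real_derivative fxy (s, t)) (at t)"
  shows "\<exists>s t. \<bar>s - x\<bar> \<le> \<bar>h\<bar> \<and> \<bar>t - y\<bar> \<le> \<bar>h\<bar> \<and>
    f (x + h, y + h) - f (x + h, y) - f (x, y + h) + f (x, y) = h * h * fxy (s, t)"
proof -
  have "\<exists>s. min x (x + h) \<le> s \<and> s \<le> max x (x + h) \<and>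
     (f (x + h, y + h) - f (x + h, y)) - (f (x, y + h) - f (x, y)) = (x + h - x) * (fx (s, y + h) - fx (s, y))"
    by (rule MVT_between) (auto intro!: derivative_eq_intros assms(1))
  then obtain s where s: "min x (x + h) \<le> s" "s \<le> max x (x + h)"
     "(f (x + h, y + h) - f (x + h, y)) - (f (x, y + h) - f (x, y)) = h * (fx (s, y + h) - fx (s, y))"
    by auto
  have s': "\<bar>s - x\<bar> \<le> \<bar>h\<bar>" using s by auto
  have "\<exists>t. min y (y + h) \<le> t \<and> t \<le> max y (y + h) \<and>
     fx (s, y + h) - fx (s, y) = (y + h - y) * fxy (s, t)"
    using s' by (intro MVT_between assms(2)) auto
  then obtain t where "min y (y + h) \<le> t" "t \<le> max y (y + h)"
     "fx (s, y + h) - fx (s, y) = h * fxy (s, t)" by auto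
  then show ?thesis using s' s(3) by (intro exI[of _ s] exI[of _ t]) auto
qed

text \<open>The second difference over a square of side \<open>h\<close> is \<open>h * h\<close>
  times a value of either mixed derivative, depending on the order in which the mean value theorem
  is applied. Continuity then forces the two derivatives to agree at the corner.\<close>

lemma mixed_partials_eq:
  fixes f fx fy fxy fyx :: "real \<times> real \<Rightarrow> real"
  assumes U: "open U" "(x, y) \<in> U"
    and fx: "\<And>s t. (s, t) \<in> U \<Longrightarrow> ((\<lambda>s. f (s, t)) has_real_derivative fx (s, t)) (at s)"
    and fy: "\<And>s t. (s, t) \<in> U \<Longrightarrow> ((\<lambda>t. f (s, t)) has_real_derivative fy (s, t)) (at t)"
    and fxy: "\<And>s t. (s, t) \<in> U \<Longrightarrow> ((\<lambda>t. fx (s, t)) has_real_derivative fxy (s, t)) (at t)"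
    and fyx: "\<And>s t. (s, t) \<in> U \<Longrightarrow> ((\<lambda>s. fy (s, t)) has_real_derivative fyx (s, t)) (at s)"
    and cont: "continuous_on U fxy" "continuous_on U fyx"
  shows "fxy (x, y) = fyx (x, y)"
proof (rule ccontr)
  assume ne: "fxy (x, y) \<noteq> fyx (x, y)"
  define e where "e = \<bar>fxy (x, y) - fyx (x, y)\<bar> / 2"
  have e: "e > 0" using ne by (simp add: e_def)
  have c1: "isCont fxy (x, y)" and c2: "isCont fyx (x, y)"
    using cont U continuous_on_eq_continuous_at by blast+
  obtain d1 where d1: "d1 > 0" "\<And>p. dist p (x, y) < d1 \<Longrightarrow> \<bar>fxy p - fxy (x, y)\<bar> < e"
    using c1 e unfolding continuous_at_eps_delta dist_real_def by metis
  obtain d2 where d2: "d2 > 0" "\<And>p. dist p (x, y) < d2 \<Longrightarrow> \<bar>fyx p - fyx (x, y)\<bar> < e"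
    using c2 e unfolding continuous_at_eps_delta dist_real_def by metis
  obtain d3 where d3: "d3 > 0" "\<And>s t. \<bar>s - x\<bar> < d3 \<Longrightarrow> \<bar>t - y\<bar> < d3 \<Longrightarrow> (s, t) \<in> U"
    using open_prod_boxE[OF U] by metis
  define h where "h = min d3 (min d1 d2) / 4"
  have h: "h > 0" "h < d3" "2 * h < d1" "2 * h < d2" using d1 d2 d3 by (auto simp: h_def)
  have near: "dist (s, t) (x, y) < d1" "dist (s, t) (x, y) < d2" if "\<bar>s - x\<bar> \<le> h" "\<bar>t - y\<bar> \<le> h" for s t
  proof -
    have "dist (s, t) (x, y) \<le> \<bar>s - x\<bar> + \<bar>t - y\<bar>"
      unfolding dist_prod_def dist_real_def by (simp add: sqrt_sum_squares_le_sum_abs)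
    then show "dist (s, t) (x, y) < d1" "dist (s, t) (x, y) < d2" using that h by auto
  qed
  have "\<exists>s t. \<bar>s - x\<bar> \<le> \<bar>h\<bar> \<and> \<bar>t - y\<bar> \<le> \<bar>h\<bar> \<and>
    f (x + h, y + h) - f (x + h, y) - f (x, y + h) + f (x, y) = h * h * fxy (s, t)"
    by (rule mixed_difference[where fx = fx]) (use h d3 fx fxy in auto)
  then obtain s t where st: "\<bar>s - x\<bar> \<le> h" "\<bar>t - y\<bar> \<le> h"
    "f (x + h, y + h) - f (x + h, y) - f (x, y + h) + f (x, y) = h * h * fxy (s, t)"
    using h by auto
  \<comment> \<open>The same difference for the transposed function, so that the y-derivative is
    taken first.\<close>
  have "\<exists>s t. \<bar>s - y\<bar> \<le> \<bar>h\<bar> \<and> \<bar>t - x\<bar> \<le> \<bar>h\<bar> \<and>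
    (\<lambda>(a, b). f (b, a)) (y + h, x + h) - (\<lambda>(a, b). f (b, a)) (y + h, x) - (\<lambda>(a, b). f (b, a)) (y, x + h)
      + (\<lambda>(a, b). f (b, a)) (y, x) = h * h * (\<lambda>(a, b). fyx (b, a)) (s, t)"
    by (rule mixed_difference[where fx = "\<lambda>(a, b). fy (b, a)"]) (use h d3 fy fyx in auto)
  then obtain s' t' where st': "\<bar>s' - x\<bar> \<le> h" "\<bar>t' - y\<bar> \<le> h"
    "f (x + h, y + h) - f (x, y + h) - f (x + h, y) + f (x, y) = h * h * fyx (s', t')"
    using h(1) unfolding case_prod_conv by (metis abs_of_pos)
  have "h * h * fxy (s, t) = h * h * fyx (s', t')" using st(3) st'(3) by linarith
  then have "fxy (s, t) = fyx (s', t')" using h(1) by simp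
  moreover have "\<bar>fxy (s, t) - fxy (x, y)\<bar> < e" "\<bar>fyx (s', t') - fyx (x, y)\<bar> < e"
    using d1(2)[OF near(1)[OF st(1,2)]] d2(2)[OF near(2)[OF st'(1,2)]] by auto
  moreover have "\<bar>fxy (x, y) - fyx (x, y)\<bar> = 2 * e" by (simp add: e_def)
  ultimately show False by linarith
qed

section \<open>From iterated partial derivatives to jets\<close>

lemma partial_x_eqI:
  "((\<lambda>t. f (t, y)) has_real_derivative D) (at x) \<Longrightarrow> partial_x f (x, y) = D"
  unfolding partial_x_def by (auto intro!: vector_derivative_at has_field_derivative_imp_has_derivative
      simp: has_real_derivative_iff_has_vector_derivative)

lemma partial_y_eqI:
  "((\<lambda>t. f (x, t)) has_real_derivative D) (at y) \<Longrightarrow> partial_y f (x, y) = D"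
  unfolding partial_y_def by (auto intro!: vector_derivative_at
      simp: has_real_derivative_iff_has_vector_derivative)

lemma smooth_on_partial:
  assumes "smooth_on U f"
  shows "smooth_on U (partial_x f)" "smooth_on U (partial_y f)" "continuous_on U f"
  using assms unfolding smooth_on_def by (metis Ck_on.simps(2))+

lemma smooth_on_DERIV:
  fixes f :: "real \<times> real \<Rightarrow> real"
  assumes "smooth_on U f" "(x, y) \<in> U"
  shows "((\<lambda>t. f (t, y)) has_real_derivative partial_x f (x, y)) (at x)"
        "((\<lambda>t. f (x, t)) has_real_derivative partial_y f (x, y)) (at y)"
proof -
  have "Ck_on (Suc 0) U f" using assms by (auto simp: smooth_on_def)
  then have "(\<lambda>t. f (t, y)) differentiable (at x)" "(\<lambda>t. f (x, t)) differentiable (at y)"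
    using assms(2) by auto
  then show "((\<lambda>t. f (t, y)) has_real_derivative partial_x f (x, y)) (at x)"
        "((\<lambda>t. f (x, t)) has_real_derivative partial_y f (x, y)) (at y)"
    unfolding partial_x_def partial_y_def
    by (auto simp: has_real_derivative_iff_has_vector_derivative vector_derivative_works)
qed

text \<open>Identities between iterated partials hold on \<open>U\<close> only. Differentiating them
  needs just that much, because a derivative depends on values near the point alone.\<close>

lemma DERIV_cong_open:
  fixes f g :: "real \<times> real \<Rightarrow> real"
  assumes "open U" "(x, y) \<in> U" "\<And>p. p \<in> U \<Longrightarrow> f p = g p"
  shows "((\<lambda>t. f (t, y)) has_real_derivative D) (at x) \<longleftrightarrow> ((\<lambda>t. g (t, y)) has_real_derivative D) (at x)"
    "((\<lambda>t. f (x, t)) has_real_derivative D) (at y) \<longleftrightarrow> ((\<lambda>t. g (x, t)) has_real_derivative D) (at y)"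
proof -
  obtain e where e: "e > 0" "\<And>s t. \<bar>s - x\<bar> < e \<Longrightarrow> \<bar>t - y\<bar> < e \<Longrightarrow> (s, t) \<in> U"
    using open_prod_boxE[OF assms(1,2)] by metis
  have "\<forall>\<^sub>F t in nhds x. f (t, y) = g (t, y)"
    unfolding eventually_nhds_metric using e assms(3) by (intro exI[of _ e]) (auto simp: dist_real_def)
  then show "((\<lambda>t. f (t, y)) has_real_derivative D) (at x) \<longleftrightarrow> ((\<lambda>t. g (t, y)) has_real_derivative D) (at x)"
    by (intro DERIV_cong_ev) auto
  have "\<forall>\<^sub>F t in nhds y. f (x, t) = g (x, t)"
    unfolding eventually_nhds_metric using e assms(3) by (intro exI[of _ e]) (auto simp: dist_real_def)
  then show "((\<lambda>t. f (x, t)) has_real_derivative D) (at y) \<longleftrightarrow> ((\<lambda>t. g (x, t)) has_real_derivative D) (at y)"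
    by (intro DERIV_cong_ev) auto
qed

lemma smooth_on_funpow:
  assumes "smooth_on U f"
  shows "smooth_on U ((partial_x ^^ i) ((partial_y ^^ j) f))"
proof (induction i)
  case 0
  show ?case by (induction j) (use assms smooth_on_partial in auto)
qed (auto intro: smooth_on_partial)

lemma smooth_partial_commute:
  fixes f :: "real \<times> real \<Rightarrow> real"
  assumes "open U" "smooth_on U f" "p \<in> U"
  shows "partial_y (partial_x f) p = partial_x (partial_y f) p"
proof -
  obtain x y where p: "p = (x, y)" by fastforce
  show ?thesis unfolding p
    using assms smooth_on_partial[OF assms(2)] p
    by (intro mixed_partials_eq[where f = f and fx = "partial_x f" and fy = "partial_y f" and U = U]
        smooth_on_DERIV smooth_on_partial(3) smooth_on_partial(1)[of U "partial_y f"] smooth_on_partial(2)[of U "partial_x f"]) auto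
qed

lemma smooth_partial_funpow_commute:
  fixes f :: "real \<times> real \<Rightarrow> real"
  assumes "open U" "smooth_on U f" "p \<in> U"
  shows "partial_y ((partial_x ^^ i) f) p = (partial_x ^^ i) (partial_y f) p"
  using assms(3)
proof (induction i arbitrary: p)
  case (Suc i)
  obtain x y where p: "p = (x, y)" by fastforce
  have sm: "smooth_on U ((partial_x ^^ i) f)"
    using smooth_on_funpow[OF assms(2), of i 0] by simp
  have "partial_y ((partial_x ^^ Suc i) f) p = partial_x (partial_y ((partial_x ^^ i) f)) p"
    using smooth_partial_commute[OF assms(1) sm Suc.prems] by simp
  also have "\<dots> = partial_x ((partial_x ^^ i) (partial_y f)) p"
    unfolding p
  proof (rule partial_x_eqI)
    show "((\<lambda>t. partial_y ((partial_x ^^ i) f) (t, y)) has_real_derivative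
       partial_x ((partial_x ^^ i) (partial_y f)) (x, y)) (at x)"
      using DERIV_cong_open(1)[where f = "partial_y ((partial_x ^^ i) f)" and g = "(partial_x ^^ i) (partial_y f)", OF assms(1) Suc.prems[unfolded p] Suc.IH]
        smooth_on_DERIV(1)[OF _ Suc.prems[unfolded p]] smooth_on_funpow[OF smooth_on_partial(2)[OF assms(2)], of i 0]
      by simp
  qed
  finally show ?case by simp
qed simp

text \<open>With all x-derivatives outside, one more x-derivative is immediate. One more
  y-derivative has to be carried inward through \<open>partial_x ^^ i\<close>, which is where
  symmetry of mixed derivatives enters.\<close>

lemma smooth_on_imp_jet:
  fixes f :: "real \<times> real \<Rightarrow> real"
  assumes "open U" "smooth_on U f"
  shows "jet U (\<lambda>i j. (partial_x ^^ i) ((partial_y ^^ j) f))"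
  unfolding jet_def
proof (intro conjI allI impI)
  fix i j x y assume xy: "(x, y) \<in> U"
  note sm = smooth_on_funpow[OF assms(2), of i j]
  show "((\<lambda>t. (partial_x ^^ i) ((partial_y ^^ j) f) (t, y)) has_real_derivative
        (partial_x ^^ Suc i) ((partial_y ^^ j) f) (x, y)) (at x)"
    using smooth_on_DERIV(1)[OF sm xy] by simp
  have sm0: "smooth_on U ((partial_y ^^ j) f)" using smooth_on_funpow[OF assms(2), of 0 j] by simp
  show "((\<lambda>t. (partial_x ^^ i) ((partial_y ^^ j) f) (x, t)) has_real_derivative
        (partial_x ^^ i) ((partial_y ^^ Suc j) f) (x, y)) (at y)"
    using smooth_on_DERIV(2)[OF sm xy] smooth_partial_funpow_commute[OF assms(1) sm0 xy, of i] by simp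
next
  show "open U" by (rule assms)
  show "continuous_on U ((partial_x ^^ i) ((partial_y ^^ j) f))" for i j
    by (rule smooth_on_partial(3)[OF smooth_on_funpow[OF assms(2)]])
qed

lemma jet_partial:
  assumes "jet U g" "\<And>p. p \<in> U \<Longrightarrow> F p = g i j p" "p \<in> U"
  shows "partial_x F p = g (Suc i) j p" "partial_y F p = g i (Suc j) p"
proof -
  obtain x y where p: "p = (x, y)" by fastforce
  show "partial_x F p = g (Suc i) j p" "partial_y F p = g i (Suc j) p"
    unfolding p using DERIV_cong_open[where f = F and g = "g i j", OF jet_open[OF assms(1)] assms(3)[unfolded p] assms(2)]
      jet_dx[OF assms(1)] jet_dy[OF assms(1)] assms(3)[unfolded p]
    by (auto intro!: partial_x_eqI partial_y_eqI)
qed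

text \<open>This translates the iterated operators in the definitions of order and finite type,
  applied to a function known only on \<open>U\<close>, into entries of a jet.\<close>

lemma jet_partial_funpow:
  assumes "jet U g" "\<And>p. p \<in> U \<Longrightarrow> F p = g i j p" "p \<in> U"
  shows "(partial_x ^^ a) ((partial_y ^^ b) F) p = g (a + i) (b + j) p"
  using assms(3)
proof (induction a arbitrary: p)
  case 0
  then show ?case
  proof (induction b arbitrary: p)
    case (Suc b)
    then show ?case using jet_partial(2)[OF assms(1), of "(partial_y ^^ b) F" i "b + j"] by simp
  qed (simp add: assms(2))
next
  case (Suc a)
  then show ?case
    using jet_partial(1)[OF assms(1), of "(partial_x ^^ a) ((partial_y ^^ b) F)" "a + i" "b + j"] by simp
qed

section \<open>Operations on jets and directional derivatives\<close>

lemma jet_shift_diff: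
  assumes "jet U g"
  shows "jet U (\<lambda>i j p. c * g (i + a) (j + b) p + e * g (i + a') (j + b') p)"
  unfolding jet_def
  by (auto intro!: derivative_eq_intros continuous_intros jet_dx[OF assms] jet_dy[OF assms]
      jet_cont[OF assms] simp: jet_open[OF assms])

definition hjet :: "(nat \<Rightarrow> nat \<Rightarrow> real \<times> real \<Rightarrow> real) \<Rightarrow> nat \<Rightarrow> nat \<Rightarrow> real \<times> real \<Rightarrow> real" where
  "hjet g i j p = g (i + 2) (j + 1) p - g (i + 1) (j + 2) p"

lemma jet_hjet: "jet U g \<Longrightarrow> jet U (hjet g)"
  using jet_shift_diff[of U g 1 2 1 "-1" 1 2] by (simp add: hjet_def[abs_def])

text \<open>The derivative in direction \<open>v\<close> acts on the whole jet, so that it can be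
  iterated and different directions commute.\<close>

definition dird :: "real \<times> real \<Rightarrow> (nat \<Rightarrow> nat \<Rightarrow> real \<times> real \<Rightarrow> real) \<Rightarrow> nat \<Rightarrow> nat \<Rightarrow> real \<times> real \<Rightarrow> real" where
  "dird v g i j p = fst v * g (Suc i) j p + snd v * g i (Suc j) p"

lemma jet_dird: "jet U g \<Longrightarrow> jet U (dird v g)"
  using jet_shift_diff[of U g "fst v" 1 0 "snd v" 0 1] by (simp add: dird_def[abs_def])

lemma jet_dird_funpow: "jet U g \<Longrightarrow> jet U ((dird v ^^ n) g)"
  by (induction n) (auto intro: jet_dird)

lemma dird_commute: "dird v (dird w g) = dird w (dird v g)"
  by (auto simp: dird_def fun_eq_iff algebra_simps)

lemma dird_funpow_commute: "dird v ((dird w ^^ n) g) = (dird w ^^ n) (dird v g)"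
proof (induction n)
  case (Suc n)
  show ?case by (simp add: dird_commute[of v w] Suc)
qed simp

text \<open>Total differentiability at a point follows from the existence of both partials together
  with continuity of one of them, here the y-derivative.\<close>

lemma jet_has_derivative:
  assumes g: "jet U g" and p: "p \<in> U"
  shows "(g i j has_derivative (\<lambda>v. dird v g i j p)) (at p)"
proof -
  obtain x y where xy: "p = (x, y)" by fastforce
  obtain e where e: "e > 0" "\<And>s t. \<bar>s - x\<bar> < e \<Longrightarrow> \<bar>t - y\<bar> < e \<Longrightarrow> (s, t) \<in> U"
    using open_prod_boxE[OF jet_open[OF g] p[unfolded xy]] by metis
  let ?X = "ball x e" and ?Y = "ball y e"
  have sub: "?X \<times> ?Y \<subseteq> U" using e(2) by (auto simp: dist_real_def abs_minus_commute)
  have fx: "((\<lambda>s. g i j (s, y)) has_derivative (\<lambda>h. h * g (Suc i) j (x, y))) (at x within ?X)"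
    using jet_dx[OF g p[unfolded xy], of i j]
    by (auto simp: has_field_derivative_def intro!: has_derivative_at_withinI elim!: has_derivative_eq_rhs)
  have fy: "((\<lambda>t. g i j (s, t)) has_derivative blinfun_apply (blinfun_scaleR_left (g i (Suc j) (s, t)))) (at t within ?Y)"
    if "s \<in> ?X" "t \<in> ?Y" for s t
    using jet_dy[OF g, of s t i j] sub that
    by (auto simp: has_field_derivative_def mult.commute subset_iff intro!: has_derivative_at_withinI elim!: has_derivative_eq_rhs)
  have "continuous_on (?X \<times> ?Y) (g i (Suc j))"
    using continuous_on_subset[OF jet_cont[OF g] sub] .
  then have c: "continuous_on (?X \<times> ?Y) (\<lambda>(s, t). blinfun_scaleR_left (g i (Suc j) (s, t)) :: real \<Rightarrow>\<^sub>L real)"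
    by (auto simp: case_prod_beta intro!: continuous_intros)
  have xyin: "(x, y) \<in> ?X \<times> ?Y" using e by auto
  have "((\<lambda>(s, t). g i j (s, t)) has_derivative (\<lambda>(tx, ty). tx * g (Suc i) j (x, y) +
     blinfun_apply (blinfun_scaleR_left (g i (Suc j) (x, y))) ty)) (at (x, y) within ?X \<times> ?Y)"
    by (rule has_derivative_partialsI[OF fx fy])
      (use c[unfolded continuous_on_eq_continuous_within, rule_format, OF xyin] e in auto)
  moreover have "at (x, y) within ?X \<times> ?Y = at (x, y)"
    by (rule at_within_open[OF xyin]) (auto intro: open_Times)
  ultimately show ?thesis unfolding xy
    by (auto simp: dird_def case_prod_beta elim!: has_derivative_eq_rhs)
qed

lemma jet_line:
  assumes g: "jet U g" and p: "q + t *\<^sub>R v \<in> U"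
  shows "((\<lambda>t. g i j (q + t *\<^sub>R v)) has_real_derivative dird v g i j (q + t *\<^sub>R v)) (at t)"
proof -
  have "((\<lambda>t. g i j (q + t *\<^sub>R v)) has_derivative (\<lambda>h. dird (h *\<^sub>R v) g i j (q + t *\<^sub>R v))) (at t)"
    by (rule has_derivative_compose[where g = "g i j" and f = "\<lambda>t. q + t *\<^sub>R v" and x = t, OF _ jet_has_derivative[OF g p, of i j]])
      (auto intro!: derivative_eq_intros)
  then show ?thesis
    by (auto simp: has_field_derivative_def dird_def algebra_simps elim!: has_derivative_eq_rhs)
qed

definition affmap :: "real \<times> real \<Rightarrow> real \<times> real \<Rightarrow> real \<times> real \<Rightarrow> real \<times> real \<Rightarrow> real \<times> real" where
  "affmap q v w p = q + fst p *\<^sub>R v + snd p *\<^sub>R w"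

text \<open>By the chain rule the coordinate derivatives of the pulled back function are
  \<open>dird v\<close> and \<open>dird w\<close>. The factor \<open>c\<close> is there for
  normalisation after a dilation.\<close>

lemma jet_affmap:
  assumes g: "jet U g"
  shows "jet (affmap q v w -` U) (\<lambda>i j p. c * ((dird v ^^ i) ((dird w ^^ j) g)) 0 0 (affmap q v w p))"
  unfolding jet_def
proof (intro conjI allI impI)
  have ca: "continuous_on UNIV (affmap q v w)" unfolding affmap_def by (intro continuous_intros)
  show "open (affmap q v w -` U)" using ca jet_open[OF g] by (simp add: continuous_on_open_vimage open_vimage)
  fix i j
  have J: "jet U ((dird v ^^ i) ((dird w ^^ j) g))" by (intro jet_dird_funpow g)
  show "continuous_on (affmap q v w -` U) (\<lambda>p. c * ((dird v ^^ i) ((dird w ^^ j) g)) 0 0 (affmap q v w p))"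
    by (intro continuous_on_mult continuous_on_const continuous_on_compose2[OF jet_cont[OF J]] continuous_on_subset[OF ca]) auto
  fix x y assume "(x, y) \<in> affmap q v w -` U"
  then have 1: "(q + y *\<^sub>R w) + x *\<^sub>R v \<in> U" and 2: "(q + x *\<^sub>R v) + y *\<^sub>R w \<in> U"
    by (auto simp: affmap_def algebra_simps)
  show "((\<lambda>t. c * (dird v ^^ i) ((dird w ^^ j) g) 0 0 (affmap q v w (t, y))) has_real_derivative
        c * (dird v ^^ Suc i) ((dird w ^^ j) g) 0 0 (affmap q v w (x, y))) (at x)"
    using DERIV_cmult[OF jet_line[OF J 1, of 0 0], of c] by (simp add: affmap_def algebra_simps)
  show "((\<lambda>t. c * (dird v ^^ i) ((dird w ^^ j) g) 0 0 (affmap q v w (x, t))) has_real_derivative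
        c * (dird v ^^ i) ((dird w ^^ Suc j) g) 0 0 (affmap q v w (x, y))) (at y)"
    using DERIV_cmult[OF jet_line[OF J 2, of 0 0], of c] by (simp add: affmap_def algebra_simps dird_funpow_commute)
qed

section \<open>One-dimensional oscillatory integrals\<close>

lemma node_bound:
  fixes f :: "nat \<Rightarrow> real \<Rightarrow> real"
  assumes "h > 0" "a \<le> b" "M \<ge> 0" "A \<ge> 0"
    and "\<And>j t. j < n \<Longrightarrow> t \<in> {a..b} \<Longrightarrow> (f j has_real_derivative f (Suc j) t) (at t)"
    and "\<And>t. t \<in> {a..b} \<Longrightarrow> \<bar>f n t\<bar> \<le> A"
    and "\<And>i. i < 2 ^ n \<Longrightarrow> \<tau> i \<in> {a..b} \<and> \<bar>f 0 (\<tau> i)\<bar> \<le> M"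
    and "\<And>i. Suc i < 2 ^ n \<Longrightarrow> \<tau> i + h \<le> \<tau> (Suc i)"
    and "t \<in> {a..b}" "j \<le> n"
  shows "\<bar>f j t\<bar> * (b - a) ^ j \<le> (1 + 2 * (b - a) / h) ^ n * (M + A * (b - a) ^ n)"
  using assms
proof (induction n arbitrary: f M \<tau> t j)
  case 0
  have "\<bar>f 0 t\<bar> \<le> A" "j = 0" using 0(6)[OF 0(9)] 0(10) by simp_all
  then show ?case using 0(3) by simp
next
  case (Suc n)
  define L where "L = b - a"
  define \<rho> where "\<rho> = L / h"
  have L: "L \<ge> 0" and \<rho>: "\<rho> \<ge> 0" using Suc.prems by (auto simp: L_def \<rho>_def)
  \<comment> \<open>Nodes are paired: between the nodes \<open>2 * i\<close> and
    \<open>Suc (2 * i)\<close> the mean value theorem supplies a point where \<open>f 1\<close> is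
    at most \<open>2 * M / h\<close>. The gap between consecutive pairs keeps the new nodes
    separated by \<open>h\<close>. Their number halves with each derivative, whence the
    \<open>2 ^ n\<close> nodes at the start.\<close>
  have "\<exists>\<xi>. \<tau> (2 * i) \<le> \<xi> \<and> \<xi> \<le> \<tau> (Suc (2 * i)) \<and> \<bar>f 1 \<xi>\<bar> \<le> 2 * M / h" if i: "i < 2 ^ n" for i
  proof -
    have i2: "Suc (2 * i) < 2 ^ Suc n" using i by auto
    have t1: "\<tau> (2 * i) \<in> {a..b}" "\<bar>f 0 (\<tau> (2 * i))\<bar> \<le> M" "\<tau> (Suc (2 * i)) \<in> {a..b}" "\<bar>f 0 (\<tau> (Suc (2 * i)))\<bar> \<le> M"
      using Suc.prems(7)[of "2 * i"] Suc.prems(7)[of "Suc (2 * i)"] i2 by auto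
    have g: "\<tau> (2 * i) + h \<le> \<tau> (Suc (2 * i))" using Suc.prems(8)[OF i2] .
    then have lt: "\<tau> (2 * i) < \<tau> (Suc (2 * i))" using Suc.prems(1) by linarith
    obtain z where z: "\<tau> (2 * i) < z" "z < \<tau> (Suc (2 * i))"
      "f 0 (\<tau> (Suc (2 * i))) - f 0 (\<tau> (2 * i)) = (\<tau> (Suc (2 * i)) - \<tau> (2 * i)) * f (Suc 0) z"
      using MVT2[OF lt, of "f 0" "f (Suc 0)"] Suc.prems(5)[of 0] t1 by auto
    have "h * \<bar>f 1 z\<bar> \<le> \<bar>(\<tau> (Suc (2 * i)) - \<tau> (2 * i)) * f (Suc 0) z\<bar>"
      unfolding abs_mult by (rule mult_mono) (use g in auto)
    also have "\<dots> \<le> 2 * M" using z(3) t1 by linarith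
    finally have "\<bar>f 1 z\<bar> \<le> 2 * M / h" using Suc.prems(1) by (simp add: field_simps)
    then show ?thesis using z by (intro exI[of _ z]) auto
  qed
  then obtain \<xi> where \<xi>: "\<And>i. i < 2 ^ n \<Longrightarrow> \<tau> (2 * i) \<le> \<xi> i \<and> \<xi> i \<le> \<tau> (Suc (2 * i)) \<and> \<bar>f 1 (\<xi> i)\<bar> \<le> 2 * M / h"
    by metis
  let ?\<kappa> = "1 + 2 * \<rho>"
  have \<kappa>: "?\<kappa> \<ge> 1" using \<rho> by simp
  have ih: "\<bar>f (Suc j) t\<bar> * L ^ j \<le> ?\<kappa> ^ n * (2 * M / h + A * L ^ n)" if "t \<in> {a..b}" "j \<le> n" for t j
  proof -
    have "\<bar>(\<lambda>j. f (Suc j)) j t\<bar> * (b - a) ^ j \<le> (1 + 2 * (b - a) / h) ^ n * (2 * M / h + A * (b - a) ^ n)"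
    proof (rule Suc.IH[where \<tau> = \<xi> and f = "\<lambda>j. f (Suc j)"])
      fix i :: nat assume "i < 2 ^ n"
      then show "\<xi> i \<in> {a..b} \<and> \<bar>f (Suc 0) (\<xi> i)\<bar> \<le> 2 * M / h"
        using \<xi>[of i] Suc.prems(7)[of "2 * i"] Suc.prems(7)[of "Suc (2 * i)"] by auto
    next
      fix i :: nat assume "Suc i < 2 ^ n"
      then show "\<xi> i + h \<le> \<xi> (Suc i)"
        using \<xi>[of i] \<xi>[of "Suc i"] Suc.prems(8)[of "Suc (2 * i)"] by auto
    qed (use Suc.prems that in auto)
    then show ?thesis by (simp add: L_def \<rho>_def)
  qed
  define X where "X = A * L ^ Suc n"
  have X: "X \<ge> 0" using L Suc.prems by (simp add: X_def)
  have main: "\<bar>f (Suc j) t\<bar> * L ^ Suc j \<le> ?\<kappa> ^ n * (2 * \<rho> * M + X)" if "t \<in> {a..b}" "j \<le> n" for t j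
  proof -
    have "\<bar>f (Suc j) t\<bar> * L ^ j * L \<le> ?\<kappa> ^ n * (2 * M / h + A * L ^ n) * L"
      by (intro mult_right_mono ih that L)
    then show ?thesis by (simp add: X_def \<rho>_def field_simps)
  qed
  have fin: "?\<kappa> ^ n * (M + (2 * \<rho> * M + X)) \<le> ?\<kappa> ^ Suc n * (M + X)"
  proof -
    have "M + (2 * \<rho> * M + X) \<le> ?\<kappa> * (M + X)"
      using X \<rho> by (simp add: algebra_simps)
    then have "?\<kappa> ^ n * (M + (2 * \<rho> * M + X)) \<le> ?\<kappa> ^ n * (?\<kappa> * (M + X))"
      by (intro mult_left_mono) (use \<rho> in auto)
    then show ?thesis by (simp add: algebra_simps)
  qed
  have goal: "\<bar>f j t\<bar> * L ^ j \<le> ?\<kappa> ^ Suc n * (M + X)"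
  proof (cases j)
    case (Suc k)
    have "\<bar>f j t\<bar> * L ^ j \<le> ?\<kappa> ^ n * (2 * \<rho> * M + X)"
      using main[OF Suc.prems(9), of k] Suc.prems(10) Suc by simp
    also have "\<dots> \<le> ?\<kappa> ^ n * (M + (2 * \<rho> * M + X))"
      by (intro mult_left_mono) (use Suc.prems(3) \<rho> X in auto)
    finally show ?thesis using fin by linarith
  next
    \<comment> \<open>The function itself is recovered from its small value at the node
      \<open>\<tau> 0\<close> and the bound just found for \<open>f 1\<close>.\<close>
    case 0
    have t0: "\<tau> 0 \<in> {a..b}" "\<bar>f 0 (\<tau> 0)\<bar> \<le> M" using Suc.prems(7)[of 0] by auto
    have "\<bar>f 0 t - f 0 (\<tau> 0)\<bar> \<le> ?\<kappa> ^ n * (2 * \<rho> * M + X)"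
    proof (cases "L = 0")
      case True
      then have "t = \<tau> 0" using t0 Suc.prems(9) by (auto simp: L_def)
      then show ?thesis using \<rho> X Suc.prems by simp
    next
      case False
      then have L0: "L > 0" using L by simp
      have "\<bar>f 0 t - f 0 (\<tau> 0)\<bar> \<le> (?\<kappa> ^ n * (2 * \<rho> * M + X) / L) * \<bar>t - \<tau> 0\<bar>"
      proof (rule field_differentiable_bound[of "{a..b}" "f 0" "f 1", simplified real_norm_def])
        show "(f 0 has_real_derivative f 1 z) (at z within {a..b})" if "z \<in> {a..b}" for z
          using Suc.prems(5)[of 0 z] that by (auto intro: has_field_derivative_at_within)
        show "\<bar>f 1 z\<bar> \<le> ?\<kappa> ^ n * (2 * \<rho> * M + X) / L" if "z \<in> {a..b}" for z
          using main[OF that, of 0] L0 by (simp add: field_simps)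
      qed (use t0 Suc.prems(9) in auto)
      also have "\<dots> \<le> (?\<kappa> ^ n * (2 * \<rho> * M + X) / L) * L"
        by (intro mult_left_mono) (use t0 Suc.prems(3,9) L0 \<rho> X in \<open>auto simp: L_def\<close>)
      finally show ?thesis using L0 by simp
    qed
    then have "\<bar>f 0 t\<bar> \<le> 1 * M + ?\<kappa> ^ n * (2 * \<rho> * M + X)" using t0 by linarith
    also have "\<dots> \<le> ?\<kappa> ^ n * M + ?\<kappa> ^ n * (2 * \<rho> * M + X)"
      using mult_right_mono[OF one_le_power[OF \<kappa>, of n] Suc.prems(3)] by linarith
    also have "\<dots> = ?\<kappa> ^ n * (M + (2 * \<rho> * M + X))" by (simp add: algebra_simps)
    finally show ?thesis using fin 0 by simp
  qed
  then show ?case by (simp add: L_def \<rho>_def X_def)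
qed

text \<open>Over a length \<open>1 / \<delta>\<close> the function \<open>u\<close> changes by a
  factor of at most \<open>exp 1\<close>, which is at most 3, so its primitive \<open>w\<close>
  gains at least \<open>u t / (3 * \<delta>)\<close> just before \<open>t\<close>. Starting at a
  minimum of \<open>\<bar>w\<bar>\<close> excludes cancellation with a negative initial value: an
  increasing \<open>w\<close> with \<open>w s < 0\<close> would have to cross 0 before
  \<open>t\<close>.\<close>

lemma exp_growth_aux:
  fixes w u u' :: "real \<Rightarrow> real"
  assumes "\<delta> > 0" "t - s \<ge> 1 / \<delta>"
    and w: "\<And>x. x \<in> {s..t} \<Longrightarrow> (w has_real_derivative u x) (at x)"
    and u: "\<And>x. x \<in> {s..t} \<Longrightarrow> (u has_real_derivative u' x) (at x)"
    and pos: "\<And>x. x \<in> {s..t} \<Longrightarrow> u x > 0 \<and> \<bar>u' x\<bar> \<le> \<delta> * u x"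
    and min: "\<And>x. x \<in> {s..t} \<Longrightarrow> \<bar>w s\<bar> \<le> \<bar>w x\<bar>"
  shows "w t > 0 \<and> u t \<le> 3 * \<delta> * w t"
proof -
  have d: "1 / \<delta> > 0" using assms(1) by simp
  define r where "r = t - 1 / \<delta>"
  have r: "s \<le> r" "r < t" using assms(2) d by (auto simp: r_def)
  have incr: "w x < w y" if "s \<le> x" "x < y" "y \<le> t" for x y
  proof (rule DERIV_pos_imp_increasing[OF that(2)])
    fix z assume "x \<le> z" "z \<le> y"
    then show "\<exists>d. (w has_real_derivative d) (at z) \<and> d > 0" using w[of z] pos[of z] that by auto
  qed
  have s0: "w s \<ge> 0"
  proof (rule ccontr)
    assume n: "\<not> w s \<ge> 0"
    have "w s < w t" using incr[of s t] r by auto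
    then have "w t > 0" using min[of t] n r by auto
    moreover have "continuous_on {s..t} w"
      using w by (meson DERIV_continuous continuous_at_imp_continuous_on)
    ultimately obtain z where "z \<in> {s..t}" "w z = 0"
      using IVT'[of w s 0 t] n r by auto
    then show False using min[of z] n by auto
  qed
  have ur: "u x \<ge> u t / 3" if x: "r \<le> x" "x < t" for x
  proof -
    obtain z where z: "x < z" "z < t" "ln (u t) - ln (u x) = (t - x) * (u' z / u z)"
    proof -
      have "\<exists>z. x < z \<and> z < t \<and> ln (u t) - ln (u x) = (t - x) * (u' z / u z)"
      proof (rule MVT2[OF x(2)])
        fix z assume "x \<le> z" "z \<le> t"
        then have "z \<in> {s..t}" using x r by auto
        then show "((\<lambda>x. ln (u x)) has_real_derivative u' z / u z) (at z)"
          using pos[of z] by (auto intro!: derivative_eq_intros u simp: field_simps)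
      qed
      then show thesis using that by blast
    qed
    have "z \<in> {s..t}" using z x r by auto
    then have "\<bar>u' z / u z\<bar> \<le> \<delta>" using pos[of z] by (auto simp: abs_mult field_simps)
    then have "\<bar>t - x\<bar> * \<bar>u' z / u z\<bar> \<le> (1 / \<delta>) * \<delta>"
      by (intro mult_mono) (use x d in \<open>auto simp: r_def\<close>)
    then have "(t - x) * (u' z / u z) \<le> (1 / \<delta>) * \<delta>"
      by (metis abs_ge_self abs_mult order_trans)
    then have "ln (u t) \<le> ln (u x) + 1" using z(3) assms(1) by simp
    then have "exp (ln (u t)) \<le> exp (ln (u x) + 1)" by simp
    then have "u t \<le> exp (ln (u x) + 1)" using pos[of t] r by simp
    also have "\<dots> = u x * exp 1" using pos[of x] x r by (simp add: exp_add)
    also have "\<dots> \<le> u x * 3" using pos[of x] x r exp_le by (intro mult_left_mono) auto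
    finally show ?thesis by simp
  qed
  obtain z where z: "r < z" "z < t" "w t - w r = (t - r) * u z"
    using MVT2[OF r(2), of w u] w r by auto
  have "(1 / \<delta>) * (u t / 3) \<le> (t - r) * u z"
    unfolding r_def using ur[of z] z d by (intro mult_mono) (use pos[of t] r in \<open>auto simp: r_def\<close>)
  moreover have "w r \<ge> 0" using s0 incr[of s r] r by (cases "s = r") auto
  moreover have "w t > 0" using s0 incr[of s t] r by auto
  ultimately have "(1 / \<delta>) * (u t / 3) \<le> w t" "w t > 0" using z(3) by linarith+
  then show ?thesis using assms(1) by (simp add: field_simps)
qed

lemma nonzero_const_sign:
  fixes u :: "real \<Rightarrow> real"
  assumes "continuous_on {a..b} u" "\<And>x. x \<in> {a..b} \<Longrightarrow> u x \<noteq> 0"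
  shows "(\<forall>x\<in>{a..b}. u x > 0) \<or> (\<forall>x\<in>{a..b}. u x < 0)"
proof (rule ccontr)
  assume "\<not> ?thesis"
  then obtain x y where xy: "x \<in> {a..b}" "y \<in> {a..b}" "u x < 0" "u y > 0" using assms(2) by (meson linorder_neqE_linordered_idom)
  have "connected (u ` {a..b})" by (intro connected_continuous_image assms) auto
  then have "0 \<in> u ` {a..b}" using xy unfolding connected_iff_interval by (meson imageI less_imp_le)
  then show False using assms(2) by auto
qed

text \<open>Passing from \<open>u\<close> to its primitive \<open>w\<close> worsens the logarithmic
  derivative only by a factor 3, except near the point \<open>s\<close> where
  \<open>\<bar>w\<bar>\<close> is smallest. Points to the left of \<open>s\<close> are reduced to
  points on the right by reflecting the line.\<close>

lemma log_derivative_step: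
  fixes w u u' :: "real \<Rightarrow> real"
  assumes "\<delta> > 0" "a \<le> b"
    and w: "\<And>x. x \<in> {a..b} \<Longrightarrow> (w has_real_derivative u x) (at x)"
    and u: "\<And>x. x \<in> {a..b} \<Longrightarrow> (u has_real_derivative u' x) (at x)"
    and nz: "\<And>x. x \<in> {a..b} \<Longrightarrow> u x \<noteq> 0 \<and> \<bar>u' x\<bar> \<le> \<delta> * \<bar>u x\<bar>"
  shows "\<exists>s\<in>{a..b}. \<forall>t\<in>{a..b}. \<bar>t - s\<bar> \<ge> 1 / \<delta> \<longrightarrow> w t \<noteq> 0 \<and> \<bar>u t\<bar> \<le> 3 * \<delta> * \<bar>w t\<bar>"
proof -
  have cw: "continuous_on {a..b} w" and cu: "continuous_on {a..b} u"
    using w u by (meson DERIV_continuous continuous_at_imp_continuous_on)+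
  have "\<exists>s\<in>{a..b}. \<forall>x\<in>{a..b}. \<bar>w s\<bar> \<le> \<bar>w x\<bar>"
    by (rule continuous_attains_inf) (use assms(2) in \<open>auto intro!: continuous_intros cw\<close>)
  then obtain s where s: "s \<in> {a..b}" "\<And>x. x \<in> {a..b} \<Longrightarrow> \<bar>w s\<bar> \<le> \<bar>w x\<bar>" by auto
  obtain \<sigma> :: real where \<sigma>: "\<sigma> = 1 \<or> \<sigma> = -1" "\<And>x. x \<in> {a..b} \<Longrightarrow> \<sigma> * u x > 0"
  proof -
    consider "\<forall>x\<in>{a..b}. u x > 0" | "\<forall>x\<in>{a..b}. u x < 0"
      using nonzero_const_sign[OF cu] nz by blast
    then show thesis using that[of 1] that[of "-1"] by cases auto
  qed
  have abs\<sigma>: "\<bar>u x\<bar> = \<sigma> * u x" if "x \<in> {a..b}" for x using \<sigma>(2)[OF that] \<sigma>(1) by auto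
  show ?thesis
  proof (intro bexI[of _ s] ballI impI s)
    fix t assume t: "t \<in> {a..b}" "1 / \<delta> \<le> \<bar>t - s\<bar>"
    show "w t \<noteq> 0 \<and> \<bar>u t\<bar> \<le> 3 * \<delta> * \<bar>w t\<bar>"
    proof (cases "s \<le> t")
      case True
      have "\<sigma> * w t > 0 \<and> \<sigma> * u t \<le> 3 * \<delta> * (\<sigma> * w t)"
      proof (rule exp_growth_aux[where s = s and u' = "\<lambda>x. \<sigma> * u' x" and w = "\<lambda>x. \<sigma> * w x" and u = "\<lambda>x. \<sigma> * u x"])
        fix x assume "x \<in> {s..t}"
        then have x: "x \<in> {a..b}" using s t by auto
        show "((\<lambda>x. \<sigma> * w x) has_real_derivative \<sigma> * u x) (at x)" by (intro DERIV_cmult w x)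
        show "((\<lambda>x. \<sigma> * u x) has_real_derivative \<sigma> * u' x) (at x)" by (intro DERIV_cmult u x)
        show "0 < \<sigma> * u x \<and> \<bar>\<sigma> * u' x\<bar> \<le> \<delta> * (\<sigma> * u x)"
          using nz[OF x] \<sigma> abs\<sigma>[OF x] x by (auto simp: abs_mult)
        show "\<bar>\<sigma> * w s\<bar> \<le> \<bar>\<sigma> * w x\<bar>" using s(2)[OF x] \<sigma>(1) by (auto simp: abs_mult)
      qed (use t True assms(1) in auto)
      then show ?thesis using abs\<sigma>[OF t(1)] \<sigma>(1) by auto
    next
      case False
      have "- \<sigma> * w (- (- t)) > 0 \<and> \<sigma> * u (- (- t)) \<le> 3 * \<delta> * (- \<sigma> * w (- (- t)))"
      proof (rule exp_growth_aux[where s = "- s" and t = "- t" and u' = "\<lambda>x. - \<sigma> * u' (- x)" and w = "\<lambda>x. - \<sigma> * w (- x)" and u = "\<lambda>x. \<sigma> * u (- x)"])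
        fix x assume "x \<in> {- s..- t}"
        then have x: "- x \<in> {a..b}" using s t by auto
        show "((\<lambda>x. - \<sigma> * w (- x)) has_real_derivative \<sigma> * u (- x)) (at x)"
          using DERIV_chain2[where f = w and g = uminus and x = x and s = UNIV, OF w[OF x] DERIV_minus[OF DERIV_ident]] by (auto intro!: derivative_eq_intros)
        show "((\<lambda>x. \<sigma> * u (- x)) has_real_derivative - \<sigma> * u' (- x)) (at x)"
          using DERIV_chain2[where f = u and g = uminus and x = x and s = UNIV, OF u[OF x] DERIV_minus[OF DERIV_ident]] by (auto intro!: derivative_eq_intros)
        show "0 < \<sigma> * u (- x) \<and> \<bar>- \<sigma> * u' (- x)\<bar> \<le> \<delta> * (\<sigma> * u (- x))"
          using nz[OF x] \<sigma> abs\<sigma>[OF x] x by (auto simp: abs_mult)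
        show "\<bar>- \<sigma> * w (- (- s))\<bar> \<le> \<bar>- \<sigma> * w (- x)\<bar>" using s(2)[OF x] \<sigma>(1) by (auto simp: abs_mult)
      qed (use t False assms(1) in auto)
      then show ?thesis using abs\<sigma>[OF t(1)] \<sigma>(1) by auto
    qed
  qed
qed

text \<open>Each step down by one derivative creates one exceptional point and leaves an interval on
  either side of it, on which the remaining steps run separately. The recursion N(n + 1) = 2 N(n) +
  1 is the source of \<open>2 ^ n\<close>.\<close>

lemma log_derivative_bound:
  fixes f :: "nat \<Rightarrow> real \<Rightarrow> real"
  assumes "\<delta> > 0"
    and "\<And>j t. j \<le> n \<Longrightarrow> t \<in> {a..b} \<Longrightarrow> (f j has_real_derivative f (Suc j) t) (at t)"
    and "\<And>t. t \<in> {a..b} \<Longrightarrow> f n t \<noteq> 0 \<and> \<bar>f (Suc n) t\<bar> \<le> \<delta> * \<bar>f n t\<bar>"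
  shows "\<exists>T. finite T \<and> card T < 2 ^ n \<and>
    (\<forall>t\<in>{a..b}. (\<forall>s\<in>T. \<bar>t - s\<bar> \<ge> 1 / \<delta>) \<longrightarrow> f 0 t \<noteq> 0 \<and> \<bar>f 1 t\<bar> \<le> 3 ^ n * \<delta> * \<bar>f 0 t\<bar>)"
  using assms
proof (induction n arbitrary: a b \<delta>)
  case 0
  then show ?case by (intro exI[of _ "{}"]) auto
next
  case (Suc n)
  show ?case
  proof (cases "a \<le> b")
    case False
    then show ?thesis by (intro exI[of _ "{}"]) auto
  next
    case True
    have "\<exists>s\<in>{a..b}. \<forall>t\<in>{a..b}. \<bar>t - s\<bar> \<ge> 1 / \<delta> \<longrightarrow> f n t \<noteq> 0 \<and> \<bar>f (Suc n) t\<bar> \<le> 3 * \<delta> * \<bar>f n t\<bar>"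
      by (rule log_derivative_step[where u' = "f (Suc (Suc n))"]) (use Suc.prems True in auto)
    then obtain s where s: "s \<in> {a..b}"
      "\<And>t. t \<in> {a..b} \<Longrightarrow> \<bar>t - s\<bar> \<ge> 1 / \<delta> \<Longrightarrow> f n t \<noteq> 0 \<and> \<bar>f (Suc n) t\<bar> \<le> 3 * \<delta> * \<bar>f n t\<bar>"
      by auto
    have d: "1 / \<delta> > 0" using Suc.prems(1) by simp
    have ih: "\<exists>T. finite T \<and> card T < 2 ^ n \<and>
      (\<forall>t\<in>{c..e}. (\<forall>s\<in>T. \<bar>t - s\<bar> \<ge> 1 / (3 * \<delta>)) \<longrightarrow> f 0 t \<noteq> 0 \<and> \<bar>f 1 t\<bar> \<le> 3 ^ n * (3 * \<delta>) * \<bar>f 0 t\<bar>)"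
      if ce: "\<And>t. t \<in> {c..e} \<Longrightarrow> t \<in> {a..b} \<and> \<bar>t - s\<bar> \<ge> 1 / \<delta>" for c e
      by (rule Suc.IH) (use Suc.prems s(2) ce in auto)
    obtain T1 where T1: "finite T1" "card T1 < 2 ^ n"
      "\<And>t. t \<in> {a..s - 1 / \<delta>} \<Longrightarrow> (\<forall>s\<in>T1. \<bar>t - s\<bar> \<ge> 1 / (3 * \<delta>)) \<Longrightarrow> f 0 t \<noteq> 0 \<and> \<bar>f 1 t\<bar> \<le> 3 ^ n * (3 * \<delta>) * \<bar>f 0 t\<bar>"
    proof -
      have "t \<in> {a..b} \<and> \<bar>t - s\<bar> \<ge> 1 / \<delta>" if "t \<in> {a..s - 1 / \<delta>}" for t
        using that s(1) d unfolding atLeastAtMost_iff by (intro conjI) linarith+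
      from ih[OF this] show thesis using that by blast
    qed
    obtain T2 where T2: "finite T2" "card T2 < 2 ^ n"
      "\<And>t. t \<in> {s + 1 / \<delta>..b} \<Longrightarrow> (\<forall>s\<in>T2. \<bar>t - s\<bar> \<ge> 1 / (3 * \<delta>)) \<Longrightarrow> f 0 t \<noteq> 0 \<and> \<bar>f 1 t\<bar> \<le> 3 ^ n * (3 * \<delta>) * \<bar>f 0 t\<bar>"
    proof -
      have "t \<in> {a..b} \<and> \<bar>t - s\<bar> \<ge> 1 / \<delta>" if "t \<in> {s + 1 / \<delta>..b}" for t
        using that s(1) d unfolding atLeastAtMost_iff by (intro conjI) linarith+
      from ih[OF this] show thesis using that by blast
    qed
    \<comment> \<open>The recursive uses have \<open>3 * \<delta>\<close> in place of
      \<open>\<delta>\<close> and hence a smaller radius of exclusion, so the single radius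
      \<open>1 / \<delta>\<close> serves for all exceptional points.\<close>
    have le: "1 / (3 * \<delta>) \<le> 1 / \<delta>" using Suc.prems(1) by (simp add: field_simps)
    show ?thesis
    proof (intro exI[of _ "insert s (T1 \<union> T2)"] conjI ballI impI)
      show "card (insert s (T1 \<union> T2)) < 2 ^ Suc n"
        using card_insert_if[of "T1 \<union> T2" s] card_Un_le[of T1 T2] T1(1,2) T2(1,2) by (auto split: if_splits)
      fix t assume t: "t \<in> {a..b}" "\<forall>r\<in>insert s (T1 \<union> T2). \<bar>t - r\<bar> \<ge> 1 / \<delta>"
      have "t \<in> {a..s - 1 / \<delta>} \<or> t \<in> {s + 1 / \<delta>..b}" using t by (auto simp: abs_if split: if_splits)
      moreover have "\<forall>r\<in>T1. \<bar>t - r\<bar> \<ge> 1 / (3 * \<delta>)" "\<forall>r\<in>T2. \<bar>t - r\<bar> \<ge> 1 / (3 * \<delta>)"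
        using t(2) le by (auto intro: order_trans[OF le])
      ultimately have "f 0 t \<noteq> 0 \<and> \<bar>f 1 t\<bar> \<le> 3 ^ n * (3 * \<delta>) * \<bar>f 0 t\<bar>"
        using T1(3)[of t] T2(3)[of t] by argo
      moreover have "(3::real) ^ n * (3 * \<delta>) = 3 ^ Suc n * \<delta>" by simp
      ultimately show "f 0 t \<noteq> 0" "\<bar>f 1 t\<bar> \<le> 3 ^ Suc n * \<delta> * \<bar>f 0 t\<bar>" by simp_all
    qed (use T1 T2 in auto)
  qed
qed


section \<open>Non-stationary phase with a polynomial weight\<close>

lemma oscillatory_bound:
  fixes \<Phi> \<Phi>1 \<Phi>2 \<Phi>3 :: "real \<Rightarrow> real"
  assumes L: "b = a + L" "L > 0" and m: "m > 0" and A: "A \<ge> 0"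
    and d: "\<And>x. x \<in> {a..b} \<Longrightarrow> (\<Phi> has_real_derivative \<Phi>1 x) (at x)"
      "\<And>x. x \<in> {a..b} \<Longrightarrow> (\<Phi>1 has_real_derivative \<Phi>2 x) (at x)"
      "\<And>x. x \<in> {a..b} \<Longrightarrow> (\<Phi>2 has_real_derivative \<Phi>3 x) (at x)"
    and bd: "\<And>x. x \<in> {a..b} \<Longrightarrow> \<bar>\<Phi>1 x\<bar> \<ge> m \<and> \<bar>\<Phi>2 x\<bar> \<le> A * m / L \<and> \<bar>\<Phi>3 x\<bar> \<le> A * m / L\<^sup>2"
  shows "norm (integral {a..b} (\<lambda>x. of_real (((x - a) * (b - x))\<^sup>2) * cis (\<Phi> x))) \<le> (2 + 7 * A + 3 * A\<^sup>2) * L ^ 3 / m\<^sup>2"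
proof -
  \<comment> \<open>The weight vanishes to second order at both ends, so two integrations by parts
    leave no boundary terms. Here \<open>q\<close> is (w / \<Phi>1)' / \<Phi>1 and \<open>q1\<close>
    is its derivative; the integral of \<open>w\<close> times \<open>cis \<Phi>\<close> is minus
    that of \<open>q1\<close> times \<open>cis \<Phi>\<close>.\<close>
  define w w1 w2 where "w x = ((x - a) * (b - x))\<^sup>2"
    and "w1 x = 2 * ((x - a) * (b - x)) * ((b - x) - (x - a))"
    and "w2 x = 2 * L\<^sup>2 - 12 * ((x - a) * (b - x))" for x :: real
  define p where "p x = inverse (\<Phi>1 x)" for x
  define q where "q x = w1 x * (p x)\<^sup>2 - w x * \<Phi>2 x * (p x) ^ 3" for x
  define q1 where "q1 x = w2 x * (p x)\<^sup>2 - 3 * w1 x * \<Phi>2 x * (p x) ^ 3 - w x * \<Phi>3 x * (p x) ^ 3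
     + 3 * w x * (\<Phi>2 x)\<^sup>2 * (p x) ^ 4" for x
  have nz: "\<Phi>1 x \<noteq> 0" if "x \<in> {a..b}" for x using bd[OF that] m by auto
  have p: "\<Phi>1 x * p x = 1" "\<bar>p x\<bar> \<le> 1 / m" if "x \<in> {a..b}" for x
    using bd[OF that] nz[OF that] m by (auto simp: p_def abs_inverse field_simps)
  have dw: "(w has_real_derivative w1 x) (at x)" for x
    unfolding w_def w1_def by (auto intro!: derivative_eq_intros simp: power2_eq_square algebra_simps)
  have dw1: "(w1 has_real_derivative w2 x) (at x)" for x
    unfolding w1_def w2_def using L by (auto intro!: derivative_eq_intros simp: power2_eq_square algebra_simps)
  have dp: "(p has_real_derivative - (\<Phi>2 x * (p x)\<^sup>2)) (at x)" if x: "x \<in> {a..b}" for x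
    unfolding p_def using nz[OF x]
    by (auto intro!: derivative_eq_intros d x simp: power2_eq_square algebra_simps)
  have dq: "(q has_real_derivative q1 x) (at x)" if x: "x \<in> {a..b}" for x
    unfolding q_def
    by (auto intro!: derivative_eq_intros dw dw1 dp d x simp: q1_def)
       (simp add: algebra_simps power2_eq_square power3_eq_cube power4_eq_xxxx)
  have cq: "\<Phi>1 x * q x = w1 x * p x - w x * \<Phi>2 x * (p x)\<^sup>2" if x: "x \<in> {a..b}" for x
  proof -
    have "\<Phi>1 x * q x = w1 x * p x * (\<Phi>1 x * p x) - w x * \<Phi>2 x * (p x)\<^sup>2 * (\<Phi>1 x * p x)"
      by (simp add: q_def algebra_simps power2_eq_square power3_eq_cube)
    then show ?thesis by (simp add: p(1)[OF x])
  qed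
  \<comment> \<open>Real and imaginary part of a primitive of (w + q1) cis \<Phi>. It packs both
    integrations by parts into one use of the fundamental theorem.\<close>
  define R where "R x = cos (\<Phi> x) * q x + sin (\<Phi> x) * (w x * p x)" for x
  define I where "I x = sin (\<Phi> x) * q x - cos (\<Phi> x) * (w x * p x)" for x
  have dR: "(R has_real_derivative cos (\<Phi> x) * (w x + q1 x)) (at x)" if x: "x \<in> {a..b}" for x
  proof -
    have "(R has_real_derivative cos (\<Phi> x) * (q1 x + w x * (\<Phi>1 x * p x)) + sin (\<Phi> x) * (w1 x * p x - w x * \<Phi>2 x * (p x)\<^sup>2 - \<Phi>1 x * q x)) (at x)"
      unfolding R_def
      by (auto intro!: derivative_eq_intros dw dw1 dp dq d x) (simp add: algebra_simps)
    then show ?thesis by (simp add: p(1)[OF x] cq[OF x] algebra_simps)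
  qed
  have dI: "(I has_real_derivative sin (\<Phi> x) * (w x + q1 x)) (at x)" if x: "x \<in> {a..b}" for x
  proof -
    have "(I has_real_derivative sin (\<Phi> x) * (q1 x + w x * (\<Phi>1 x * p x)) - cos (\<Phi> x) * (w1 x * p x - w x * \<Phi>2 x * (p x)\<^sup>2 - \<Phi>1 x * q x)) (at x)"
      unfolding I_def
      by (auto intro!: derivative_eq_intros dw dw1 dp dq d x) (simp add: algebra_simps)
    then show ?thesis by (simp add: p(1)[OF x] cq[OF x] algebra_simps)
  qed
  let ?\<Psi> = "\<lambda>x. complex_of_real (R x) + \<i> * complex_of_real (I x)"
  have d\<Psi>: "(?\<Psi> has_vector_derivative of_real (w x + q1 x) * cis (\<Phi> x)) (at x within {a..b})" if x: "x \<in> {a..b}" for x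
  proof -
    have "(R has_real_derivative cos (\<Phi> x) * (w x + q1 x)) (at x within {a..b})"
      "(I has_real_derivative sin (\<Phi> x) * (w x + q1 x)) (at x within {a..b})"
      using dR[OF x] dI[OF x]
      by (auto intro: has_field_derivative_at_within)
    then have "(?\<Psi> has_vector_derivative (of_real (cos (\<Phi> x) * (w x + q1 x)) + \<i> * of_real (sin (\<Phi> x) * (w x + q1 x)))) (at x within {a..b})"
      by (intro has_vector_derivative_add has_vector_derivative_mult_right has_vector_derivative_of_real)
    moreover have "of_real (cos (\<Phi> x) * (w x + q1 x)) + \<i> * of_real (sin (\<Phi> x) * (w x + q1 x)) = of_real (w x + q1 x) * cis (\<Phi> x)"
      by (simp add: complex_eq_iff algebra_simps)
    ultimately show ?thesis by simp
  qed
  have "?\<Psi> b - ?\<Psi> a = 0"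
    using L by (simp add: R_def I_def q_def w_def w1_def)
  then have int0: "((\<lambda>x. of_real (w x + q1 x) * cis (\<Phi> x)) has_integral 0) {a..b}"
    using fundamental_theorem_of_calculus[of a b ?\<Psi> "\<lambda>x. of_real (w x + q1 x) * cis (\<Phi> x)"] d\<Psi> L by auto
  have c\<Phi>: "continuous_on {a..b} \<Phi>"
    using d(1) by (meson DERIV_continuous continuous_at_imp_continuous_on)
  have cw: "continuous_on {a..b} w"
    using dw by (meson DERIV_continuous continuous_at_imp_continuous_on)
  have "(\<lambda>x. complex_of_real (w x) * cis (\<Phi> x)) integrable_on {a..b}"
    by (intro integrable_continuous_real continuous_intros cw c\<Phi>)
  then have int1: "((\<lambda>x. of_real (w x) * cis (\<Phi> x)) has_integral integral {a..b} (\<lambda>x. of_real (w x) * cis (\<Phi> x))) {a..b}"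
    by (rule integrable_integral)
  have int2: "((\<lambda>x. of_real (q1 x) * cis (\<Phi> x)) has_integral - integral {a..b} (\<lambda>x. of_real (w x) * cis (\<Phi> x))) {a..b}"
    using has_integral_diff[OF int0 int1] by (simp add: algebra_simps)
  \<comment> \<open>The four terms of \<open>q1\<close> contribute 2, 6 A, A and 3 A^2 times L^2 /
    m^2. The bound for \<open>w2\<close> uses that (x - a) (b - x) is at most L^2 / 4.\<close>
  have qb: "\<bar>q1 x\<bar> \<le> (2 + 7 * A + 3 * A\<^sup>2) * L\<^sup>2 / m\<^sup>2" if x: "x \<in> {a..b}" for x
  proof -
    define X Y where "X = x - a" and "Y = b - x"
    have XY: "0 \<le> X" "X \<le> L" "0 \<le> Y" "Y \<le> L" "X + Y = L" using x L by (auto simp: X_def Y_def)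
    have xy: "0 \<le> X * Y" "X * Y \<le> L * L" using XY by (auto intro: mult_mono)
    have bw: "\<bar>w x\<bar> \<le> L ^ 4"
    proof -
      have "(X * Y)\<^sup>2 \<le> (L * L)\<^sup>2" using xy by (intro power_mono) auto
      then show ?thesis by (simp add: w_def X_def Y_def power2_eq_square power4_eq_xxxx)
    qed
    have bw1: "\<bar>w1 x\<bar> \<le> 2 * L ^ 3"
    proof -
      have "\<bar>2 * (X * Y) * (Y - X)\<bar> \<le> (2 * (L * L)) * L"
        unfolding abs_mult using xy XY by (intro mult_mono) auto
      then show ?thesis by (simp add: w1_def X_def Y_def power3_eq_cube)
    qed
    have bw2: "\<bar>w2 x\<bar> \<le> 2 * L\<^sup>2"
    proof -
      have "4 * (X * Y) \<le> (X + Y)\<^sup>2" using zero_le_power2[of "X - Y"] by (simp add: power2_eq_square algebra_simps)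
      then have "4 * (X * Y) \<le> L\<^sup>2" using XY by simp
      then show ?thesis using xy unfolding w2_def X_def[symmetric] Y_def[symmetric] by (auto simp: abs_le_iff)
    qed
    have m0: "1 / m \<ge> 0" using m by simp
    have pp: "\<bar>p x\<bar> ^ k \<le> (1 / m) ^ k" for k by (intro power_mono p(2)[OF x]) auto
    have "\<bar>q1 x\<bar> \<le> \<bar>w2 x\<bar> * \<bar>p x\<bar> ^ 2 + 3 * \<bar>w1 x\<bar> * \<bar>\<Phi>2 x\<bar> * \<bar>p x\<bar> ^ 3 + \<bar>w x\<bar> * \<bar>\<Phi>3 x\<bar> * \<bar>p x\<bar> ^ 3
       + 3 * \<bar>w x\<bar> * \<bar>\<Phi>2 x\<bar> ^ 2 * \<bar>p x\<bar> ^ 4"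
    proof -
      have "\<bar>q1 x\<bar> \<le> \<bar>w2 x * (p x)\<^sup>2\<bar> + \<bar>3 * w1 x * \<Phi>2 x * (p x) ^ 3\<bar> + \<bar>w x * \<Phi>3 x * (p x) ^ 3\<bar>
         + \<bar>3 * w x * (\<Phi>2 x)\<^sup>2 * (p x) ^ 4\<bar>" unfolding q1_def by linarith
      then show ?thesis by (simp add: abs_mult power_abs)
    qed
    also have "\<dots> \<le> (2 * L\<^sup>2) * (1 / m) ^ 2 + 3 * (2 * L ^ 3) * (A * m / L) * (1 / m) ^ 3 + L ^ 4 * (A * m / L\<^sup>2) * (1 / m) ^ 3
       + 3 * L ^ 4 * (A * m / L) ^ 2 * (1 / m) ^ 4"
      using bd[OF x] bw bw1 bw2 L A m
      by (intro add_mono mult_mono pp power_mono) auto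
    also have "\<dots> = (2 + 7 * A + 3 * A\<^sup>2) * L\<^sup>2 / m\<^sup>2"
      using L(2) m by (simp add: field_simps power2_eq_square power3_eq_cube power4_eq_xxxx)
    finally show ?thesis .
  qed
  have "norm (- integral {a..b} (\<lambda>x. of_real (w x) * cis (\<Phi> x))) \<le> (2 + 7 * A + 3 * A\<^sup>2) * L\<^sup>2 / m\<^sup>2 * measure lborel {a..b}"
  proof (rule has_integral_bound_real[OF _ finite.emptyI int2])
    show "norm (of_real (q1 x) * cis (\<Phi> x)) \<le> (2 + 7 * A + 3 * A\<^sup>2) * L\<^sup>2 / m\<^sup>2" if "x \<in> {a..b} - {}" for x
      using qb[of x] that by (simp add: norm_mult)
  qed (use A in auto)
  moreover have "measure lborel {a..b} = L" using L by simp
  ultimately have "norm (integral {a..b} (\<lambda>x. of_real (w x) * cis (\<Phi> x))) \<le> (2 + 7 * A + 3 * A\<^sup>2) * L\<^sup>2 / m\<^sup>2 * L" by (simp only: norm_minus_cancel)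
  then show ?thesis unfolding w_def by (simp add: power2_eq_square power3_eq_cube mult.assoc)
qed

section \<open>Bounded Borel functions of bounded support\<close>

text \<open>On this class all integrals converge absolutely and Fubini applies without further
  conditions; general square integrable functions are reached at the very end by truncation. One
  constant bounds both the values and the support.\<close>

definition bfun :: "('a::euclidean_space \<Rightarrow> 'b::{banach, second_countable_topology}) \<Rightarrow> bool" where
  "bfun f \<longleftrightarrow> f \<in> borel_measurable borel \<and> (\<exists>B. \<forall>x. norm (f x) \<le> B \<and> (norm x > B \<longrightarrow> f x = 0))"

lemma bfunI:
  assumes "f \<in> borel_measurable borel" "\<And>x. norm (f x) \<le> B" "\<And>x. norm x > R \<Longrightarrow> f x = 0"
  shows "bfun f"
  unfolding bfun_def
proof (intro conjI assms(1) exI[of _ "max B R"] allI impI)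
  show "norm (f x) \<le> max B R" for x using assms(2)[of x] by simp
  show "f x = 0" if "max B R < norm x" for x using assms(3)[of x] that by simp
qed

lemma bfun_measurable: "bfun f \<Longrightarrow> f \<in> borel_measurable borel"
  by (simp add: bfun_def)

lemma bfunD:
  assumes "bfun f"
  shows "\<exists>B>0. (\<forall>x. norm (f x) \<le> B) \<and> (\<forall>x. norm x > B \<longrightarrow> f x = 0)"
proof -
  obtain B where B: "\<And>x. norm (f x) \<le> B \<and> (norm x > B \<longrightarrow> f x = 0)"
    using assms unfolding bfun_def by blast
  have "norm (f x) \<le> \<bar>B\<bar> + 1" "norm x > \<bar>B\<bar> + 1 \<Longrightarrow> f x = 0" for x
  proof -
    show "norm (f x) \<le> \<bar>B\<bar> + 1" using B[of x] by linarith
    assume "norm x > \<bar>B\<bar> + 1"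
    then have "norm x > B" by linarith
    then show "f x = 0" using B[of x] by simp
  qed
  then show ?thesis by (intro exI[of _ "\<bar>B\<bar> + 1"]) auto
qed

lemma bfun_integrable:
  assumes "bfun f" shows "integrable lborel f"
proof -
  obtain B where B: "B > 0" "\<And>x. norm (f x) \<le> B" "\<And>x. norm x > B \<Longrightarrow> f x = 0"
    using bfunD[OF assms] by blast
  show ?thesis
  proof (rule integrableI_bounded_set[where A = "cball 0 B" and B = B])
    show "emeasure lborel (cball (0::'a) B) < \<infinity>" by (intro emeasure_bounded_finite bounded_cball)
  qed (use B bfun_measurable[OF assms] in \<open>auto simp: not_le\<close>)
qed

lemma bfun_dominated:
  assumes "bfun g" "f \<in> borel_measurable borel" "\<And>x. norm (f x) \<le> C * norm (g x)"
  shows "bfun f"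
proof -
  obtain B where B: "B > 0" "\<And>x. norm (g x) \<le> B" "\<And>x. norm x > B \<Longrightarrow> g x = 0"
    using bfunD[OF assms(1)] by blast
  show ?thesis
  proof (rule bfunI[OF assms(2)])
    show "norm (f x) \<le> \<bar>C\<bar> * B" for x
    proof -
      have "norm (f x) \<le> \<bar>C\<bar> * norm (g x)"
        using assms(3)[of x] by (rule order_trans) (intro mult_right_mono, auto)
      also have "\<dots> \<le> \<bar>C\<bar> * B" by (intro mult_left_mono B(2)) auto
      finally show ?thesis .
    qed
    show "f x = 0" if "norm x > B" for x using assms(3)[of x] B(3)[OF that] by simp
  qed
qed

lemma bfun_Fubini:
  fixes f :: "'a::euclidean_space \<times> 'b::euclidean_space \<Rightarrow> 'c::{banach, second_countable_topology}"
  assumes "bfun f"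
  shows "(LINT p|lborel. f p) = (LINT x|lborel. LINT y|lborel. f (x, y))"
    and "(LINT y|lborel. LINT x|lborel. f (x, y)) = (LINT x|lborel. LINT y|lborel. f (x, y))"
proof -
  have i: "integrable (lborel \<Otimes>\<^sub>M lborel) (case_prod (\<lambda>x y. f (x, y)))"
    using bfun_integrable[OF assms] by (simp add: lborel_prod)
  show "(LINT y|lborel. LINT x|lborel. f (x, y)) = (LINT x|lborel. LINT y|lborel. f (x, y))"
    by (rule lborel_pair.Fubini_integral[OF i])
  show "(LINT p|lborel. f p) = (LINT x|lborel. LINT y|lborel. f (x, y))"
    using lborel_pair.integral_fst[OF i] by (simp add: lborel_prod)
qed

lemma bfun_section:
  fixes f :: "'a::euclidean_space \<times> 'b::euclidean_space \<Rightarrow> 'c::{banach, second_countable_topology}"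
  assumes "bfun f" shows "bfun (\<lambda>y. f (x, y))" "bfun (\<lambda>y. f (y, z))"
proof -
  obtain B where B: "B > 0" "\<And>x. norm (f x) \<le> B" "\<And>x. norm x > B \<Longrightarrow> f x = 0"
    using bfunD[OF assms] by blast
  note [measurable] = bfun_measurable[OF assms]
  have n: "norm (x, y) \<ge> norm y" "norm (y', z) \<ge> norm y'" for x y' :: 'a and y z :: 'b
    by (simp_all add: norm_Pair)
  show "bfun (\<lambda>y. f (x, y))"
  proof (rule bfunI[of _ B B])
    show "(\<lambda>y. f (x, y)) \<in> borel_measurable borel" by measurable
    show "f (x, y) = 0" if "norm y > B" for y
      using n(1)[of y x] that B(3)[of "(x, y)"] by simp
  qed (use B in auto)
  show "bfun (\<lambda>y. f (y, z))"
  proof (rule bfunI[of _ B B])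
    show "(\<lambda>y. f (y, z)) \<in> borel_measurable borel" by measurable
    show "f (y, z) = 0" if "norm y > B" for y
      using n(2)[of y z] that B(3)[of "(y, z)"] by simp
  qed (use B in auto)
qed

lemma bfun_swap:
  fixes f :: "'a::euclidean_space \<times> 'b::euclidean_space \<Rightarrow> 'c::{banach, second_countable_topology}"
  assumes "bfun f" shows "bfun (\<lambda>p. f (snd p, fst p))"
proof -
  obtain B where B: "B > 0" "\<And>x. norm (f x) \<le> B" "\<And>x. norm x > B \<Longrightarrow> f x = 0"
    using bfunD[OF assms] by blast
  note [measurable] = bfun_measurable[OF assms, unfolded borel_prod[symmetric]]
  show ?thesis
  proof (rule bfunI[of _ B B])
    show "(\<lambda>p. f (snd p, fst p)) \<in> borel_measurable borel" unfolding borel_prod[symmetric] by measurable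
    show "f (snd p, fst p) = 0" if "norm p > B" for p :: "'b \<times> 'a"
      using B(3)[of "(snd p, fst p)"] that by (simp add: norm_prod_def add.commute)
  qed (use B(2) in auto)
qed

lemma bfun_partial_integral:
  fixes f :: "'a::euclidean_space \<times> 'b::euclidean_space \<Rightarrow> 'c::{banach, second_countable_topology}"
  assumes "bfun f" shows "bfun (\<lambda>x. LINT y|lborel. f (x, y))"
proof -
  obtain B where B: "B > 0" "\<And>x. norm (f x) \<le> B" "\<And>x. norm x > B \<Longrightarrow> f x = 0"
    using bfunD[OF assms] by blast
  note [measurable] = bfun_measurable[OF assms]
  have n: "norm (x, y) \<ge> norm y" "norm (x, y) \<ge> norm x" for x :: 'a and y :: 'b
    by (simp_all add: norm_Pair)
  show ?thesis
  proof (rule bfunI[of _ "B * measure lborel (cball (0::'b) B)" B])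
    show "(\<lambda>x. LINT y|lborel. f (x, y)) \<in> borel_measurable borel" by measurable
    fix x :: 'a
    have "norm (LINT y|lborel. f (x, y)) \<le> (LINT y|lborel. indicator (cball (0::'b) B) y * B)"
    proof (rule Bochner_Integration.integral_norm_bound_integral)
      show "integrable lborel (\<lambda>y. f (x, y))" by (rule bfun_integrable[OF bfun_section(1)[OF assms]])
      show "integrable lborel (\<lambda>y. indicator (cball (0::'b) B) y * B :: real)"
        by (intro integrable_mult_left integrable_real_indicator emeasure_bounded_finite) auto
      fix y :: 'b
      show "norm (f (x, y)) \<le> indicator (cball 0 B) y * B"
        using n(1)[of y x] B(2)[of "(x, y)"] B(3)[of "(x, y)"] by (cases "norm y \<le> B") (auto simp: indicator_def)
    qed
    also have "\<dots> = B * measure lborel (cball (0::'b) B)" by simp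
    finally show "norm (LINT y|lborel. f (x, y)) \<le> B * measure lborel (cball (0::'b) B)" .
    show "(LINT y|lborel. f (x, y)) = 0" if "norm x > B"
    proof -
      have "f (x, y) = 0" for y using n(2)[of x y] that B(3)[of "(x, y)"] by simp
      then show ?thesis by simp
    qed
  qed
qed

lemma bfun_mult_bounded:
  fixes f :: "'a::euclidean_space \<Rightarrow> 'b::{banach, second_countable_topology, real_normed_algebra}"
  assumes "bfun f" "g \<in> borel_measurable borel" "\<And>x. norm (g x) \<le> B"
  shows "bfun (\<lambda>x. f x * g x)" "bfun (\<lambda>x. g x * f x)"
proof -
  note [measurable] = bfun_measurable[OF assms(1)] assms(2)
  have "norm (f x * g x) \<le> B * norm (f x)" "norm (g x * f x) \<le> B * norm (f x)" for x
  proof -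
    have "norm (f x) * norm (g x) \<le> norm (f x) * B" by (intro mult_left_mono assms(3)) auto
    then show "norm (f x * g x) \<le> B * norm (f x)" "norm (g x * f x) \<le> B * norm (f x)"
      using norm_mult_ineq[of "f x" "g x"] norm_mult_ineq[of "g x" "f x"] by (auto simp: mult.commute)
  qed
  then show "bfun (\<lambda>x. f x * g x)" "bfun (\<lambda>x. g x * f x)"
    by (auto intro!: bfun_dominated[OF assms(1), where C = B])
qed

lemma bfun_mult:
  fixes f :: "'a::euclidean_space \<Rightarrow> 'b::{banach, second_countable_topology, real_normed_algebra}"
  assumes "bfun f" "bfun g"
  shows "bfun (\<lambda>x. f x * g x)"
  using bfunD[OF assms(2)] bfun_mult_bounded(1)[OF assms(1) bfun_measurable[OF assms(2)]] by blast

lemma bfun_norm_power: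
  assumes "bfun f" shows "bfun (\<lambda>x. norm (f x) ^ Suc n)"
proof -
  note [measurable] = bfun_measurable[OF assms(1)]
  obtain B where B: "B > 0" "\<And>x. norm (f x) \<le> B" using bfunD[OF assms] by blast
  show ?thesis
  proof (rule bfun_dominated[OF assms, where C = "B ^ n"])
    show "norm (norm (f x) ^ Suc n) \<le> B ^ n * norm (f x)" for x
      using power_mono[OF B(2)[of x], of n] by (auto simp: mult.commute[of "norm (f x)"] intro: mult_right_mono)
  qed measurable
qed

lemma bfun_norm: "bfun f \<Longrightarrow> bfun (\<lambda>x. norm (f x))"
  using bfun_norm_power[of f 0] by simp

lemma bfun_cnj: "bfun f \<Longrightarrow> bfun (\<lambda>x. cnj (f x))"
  by (rule bfun_dominated[where C = 1 and g = f])
    (simp_all add: measurable_compose[OF bfun_measurable borel_measurable_continuous_onI[OF continuous_on_cnj[OF continuous_on_id]]])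

lemma bfun_tensor:
  fixes f :: "'a::euclidean_space \<Rightarrow> 'c::{banach, second_countable_topology, real_normed_algebra}"
    and g :: "'b::euclidean_space \<Rightarrow> 'c"
  assumes "bfun f" "bfun g"
  shows "bfun (\<lambda>p. f (fst p) * g (snd p))"
proof -
  note [measurable] = bfun_measurable[OF assms(1)] bfun_measurable[OF assms(2)]
  obtain B where B: "B > 0" "\<And>x. norm (f x) \<le> B" "\<And>x. norm x > B \<Longrightarrow> f x = 0" using bfunD[OF assms(1)] by blast
  obtain B' where B': "B' > 0" "\<And>x. norm (g x) \<le> B'" "\<And>x. norm x > B' \<Longrightarrow> g x = 0" using bfunD[OF assms(2)] by blast
  show ?thesis
  proof (rule bfunI[where B = "B * B'" and R = "B + B'"])
    show "(\<lambda>p. f (fst p) * g (snd p)) \<in> borel_measurable borel"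
      unfolding borel_prod[symmetric] by measurable
    fix p :: "'a \<times> 'b"
    have "norm (f (fst p)) * norm (g (snd p)) \<le> B * B'"
      by (intro mult_mono B B') (use B B' in auto)
    then show "norm (f (fst p) * g (snd p)) \<le> B * B'" using norm_mult_ineq order_trans by blast
    assume "norm p > B + B'"
    moreover have "norm p \<le> norm (fst p) + norm (snd p)" by (metis norm_Pair_le prod.collapse)
    ultimately have "norm (fst p) > B \<or> norm (snd p) > B'" by linarith
    then show "f (fst p) * g (snd p) = 0" using B(3) B'(3) by auto
  qed
qed

lemma integrable_indicator_Icc: "integrable lborel (\<lambda>x. indicator {a..b::real} x :: real)"
  by (intro integrable_real_indicator) (auto simp: emeasure_lborel_Icc_eq)

section \<open>Squared norms and the T T-star method\<close>

definition nsq :: "(real \<Rightarrow> complex) \<Rightarrow> real" where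
  "nsq f = (LINT x|lborel. (norm (f x))\<^sup>2)"

lemma nsq_nonneg: "nsq f \<ge> 0"
  unfolding nsq_def by (rule Bochner_Integration.integral_nonneg) auto

lemma bfun_nsq_integrable: "bfun f \<Longrightarrow> integrable lborel (\<lambda>x. (norm (f x))\<^sup>2)"
  using bfun_integrable[OF bfun_norm_power[of f 1]] by (simp add: power2_eq_square)

lemma Cauchy_Schwarz_integral:
  fixes f g :: "'a \<Rightarrow> real"
  assumes "integrable M (\<lambda>x. (f x)\<^sup>2)" "integrable M (\<lambda>x. (g x)\<^sup>2)" "integrable M (\<lambda>x. f x * g x)"
  shows "(LINT x|M. f x * g x)\<^sup>2 \<le> (LINT x|M. (f x)\<^sup>2) * (LINT x|M. (g x)\<^sup>2)"
proof -
  define a b c where "a = (LINT x|M. (f x)\<^sup>2)" and "b = (LINT x|M. f x * g x)" and "c = (LINT x|M. (g x)\<^sup>2)"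
  have a0: "a \<ge> 0" "c \<ge> 0" by (auto simp: a_def c_def)
  \<comment> \<open>The discriminant argument in homogeneous form, used below at the vertex (s, t) =
    (c, b). The case \<open>c = 0\<close> has no vertex and takes a special pair instead.\<close>
  have q: "a * s\<^sup>2 - 2 * b * s * t + c * t\<^sup>2 \<ge> 0" for s t
  proof -
    have "0 \<le> (LINT x|M. (s * f x - t * g x)\<^sup>2)" by (rule Bochner_Integration.integral_nonneg) auto
    also have "\<dots> = (LINT x|M. s\<^sup>2 * (f x)\<^sup>2 - 2 * s * t * (f x * g x) + t\<^sup>2 * (g x)\<^sup>2)"
      by (intro Bochner_Integration.integral_cong) (auto simp: power2_eq_square algebra_simps)
    also have "\<dots> = s\<^sup>2 * a - 2 * s * t * b + t\<^sup>2 * c"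
      unfolding a_def b_def c_def using assms by simp
    finally show ?thesis by (simp add: algebra_simps)
  qed
  have "b\<^sup>2 \<le> a * c"
  proof (cases "c = 0")
    case True
    have "b = 0"
    proof (rule ccontr)
      assume "b \<noteq> 0"
      then show False using q[of 1 "(a + 1) / (2 * b)"] True a0 by simp
    qed
    then show ?thesis using True by simp
  next
    case False
    then have "c > 0" using a0 by simp
    have "c * (a * c - b\<^sup>2) \<ge> 0" using q[of c b] by (simp add: power2_eq_square algebra_simps)
    then show ?thesis using \<open>c > 0\<close> by (simp add: zero_le_mult_iff)
  qed
  then show ?thesis by (simp add: a_def b_def c_def)
qed

lemma bfun_Cauchy_Schwarz:
  fixes f g :: "real \<Rightarrow> complex"
  assumes "bfun f" "bfun g"
  shows "(norm (LINT x|lborel. f x * g x))\<^sup>2 \<le> nsq f * nsq g"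
proof -
  have fg: "bfun (\<lambda>x. f x * g x)" by (intro bfun_mult assms)
  have "norm (LINT x|lborel. f x * g x) \<le> (LINT x|lborel. norm (f x) * norm (g x))"
    using integral_norm_bound[of lborel "\<lambda>x. f x * g x"] by (simp add: norm_mult)
  then have "(norm (LINT x|lborel. f x * g x))\<^sup>2 \<le> (LINT x|lborel. norm (f x) * norm (g x))\<^sup>2"
    by (intro power_mono) auto
  also have "\<dots> \<le> nsq f * nsq g" unfolding nsq_def
    by (intro Cauchy_Schwarz_integral bfun_nsq_integrable assms bfun_integrable bfun_mult bfun_norm)
  finally show ?thesis .
qed

lemma lborel_integral_shift:
  fixes f :: "real \<Rightarrow> 'b::{banach, second_countable_topology}"
  shows "(LINT x|lborel. f (c + x)) = (LINT x|lborel. f x)" "(LINT x|lborel. f (x + c)) = (LINT x|lborel. f x)"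
    "(LINT x|lborel. f (x - c)) = (LINT x|lborel. f x)" "(LINT x|lborel. f (c - x)) = (LINT x|lborel. f x)"
  using lborel_integral_real_affine[of 1 f c] lborel_integral_real_affine[of 1 f "- c"] lborel_integral_real_affine[of "-1" f c]
  by (simp_all add: algebra_simps)

lemma nsq_shift: "nsq (\<lambda>x. f (x + c)) = nsq f" "nsq (\<lambda>x. f (x - c)) = nsq f"
  unfolding nsq_def using lborel_integral_shift[of "\<lambda>x. (norm (f x))\<^sup>2" c] by simp_all

lemma bfun_shear:
  fixes K :: "real \<times> real \<Rightarrow> 'b::{banach, second_countable_topology}"
  assumes "bfun K" shows "bfun (\<lambda>p. K (fst p, snd p - fst p))" "bfun (\<lambda>p. K (fst p, fst p + snd p))"
proof -
  note [measurable] = bfun_measurable[OF assms, unfolded borel_prod[symmetric]]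
  obtain B where B: "B > 0" "\<And>x. norm (K x) \<le> B" "\<And>x. norm x > B \<Longrightarrow> K x = 0" using bfunD[OF assms] by blast
  have n: "norm p \<le> 4 * B" if "norm (fst p, z) \<le> B" "\<bar>snd p\<bar> \<le> \<bar>fst p\<bar> + \<bar>z\<bar>" for p :: "real \<times> real" and z :: real
  proof -
    have "\<bar>fst p\<bar> \<le> B" "\<bar>z\<bar> \<le> B" using that norm_fst_le[of "fst p" z] norm_snd_le[of z "fst p"] by simp_all
    then show ?thesis using norm_Pair_le[of "fst p" "snd p"] that(2) B(1) by simp
  qed
  show "bfun (\<lambda>p. K (fst p, snd p - fst p))"
  proof (rule bfunI[where B = B and R = "4 * B"])
    show "K (fst p, snd p - fst p) = 0" if "norm p > 4 * B" for p :: "real \<times> real"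
      using n[of p "snd p - fst p"] B(3)[of "(fst p, snd p - fst p)"] that by fastforce
    show "(\<lambda>p. K (fst p, snd p - fst p)) \<in> borel_measurable borel" unfolding borel_prod[symmetric] by measurable
  qed (use B(2) in auto)
  show "bfun (\<lambda>p. K (fst p, fst p + snd p))"
  proof (rule bfunI[where B = B and R = "4 * B"])
    show "K (fst p, fst p + snd p) = 0" if "norm p > 4 * B" for p :: "real \<times> real"
      using n[of p "fst p + snd p"] B(3)[of "(fst p, fst p + snd p)"] that by fastforce
    show "(\<lambda>p. K (fst p, fst p + snd p)) \<in> borel_measurable borel" unfolding borel_prod[symmetric] by measurable
  qed (use B(2) in auto)
qed

text \<open>The squared norm is an integral over u, x and x'. After x' = x + \<tau> and with \<tau>
  moved outermost, absolute values are taken in \<tau> only, so the oscillation in the other two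
  variables survives.\<close>

lemma TT_star:
  fixes K :: "real \<times> real \<Rightarrow> complex"
  assumes K: "bfun K"
  shows "nsq (\<lambda>u. LINT x|lborel. K (x, u)) \<le> (LINT \<tau>|lborel. norm (LINT x|lborel. LINT u|lborel. K (x, u) * cnj (K (x + \<tau>, u))))"
proof -
  note [measurable] = bfun_measurable[OF K, unfolded borel_prod[symmetric]]
    borel_measurable_continuous_onI[OF continuous_on_cnj[OF continuous_on_id], simplified]
  obtain B where B: "B > 0" "\<And>x. norm (K x) \<le> B" "\<And>x. norm x > B \<Longrightarrow> K x = 0" using bfunD[OF K] by blast
  define F where "F = (\<lambda>u x \<tau>. K (x, u) * cnj (K (x + \<tau>, u)))"
  \<comment> \<open>\<tau> is a difference of two first coordinates of points in the support of
    \<open>K\<close>, hence bounded as well. The variants \<open>bF2\<close> and \<open>bF3\<close>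
    reorder the same function for the successive interchanges of integrals.\<close>
  have F0: "F u x \<tau> = 0" if "norm (u, x, \<tau>) > 5 * B" for u x \<tau>
  proof (rule ccontr)
    assume "F u x \<tau> \<noteq> 0"
    then have "norm (x, u) \<le> B" "norm (x + \<tau>, u) \<le> B" using B(3) by (force simp: F_def not_less[symmetric])+
    then have "\<bar>x\<bar> \<le> B" "\<bar>u\<bar> \<le> B" "\<bar>x + \<tau>\<bar> \<le> B"
      using norm_fst_le[of x u] norm_snd_le[of u x] norm_fst_le[of "x + \<tau>" u] by auto
    moreover have "norm (u, x, \<tau>) \<le> \<bar>u\<bar> + (\<bar>x\<bar> + \<bar>\<tau>\<bar>)"
      using norm_Pair_le[of u "(x, \<tau>)"] norm_Pair_le[of x \<tau>] by simp
    ultimately show False using that by linarith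
  qed
  have Fb: "norm (F u x \<tau>) \<le> B * B" for u x \<tau>
    unfolding F_def norm_mult complex_mod_cnj by (intro mult_mono B) (use B in auto)
  have Fm: "(\<lambda>p. F (fst p) (fst (snd p)) (snd (snd p))) \<in> borel_measurable borel" unfolding F_def borel_prod[symmetric] by measurable
  have bF: "bfun (\<lambda>p. F (fst p) (fst (snd p)) (snd (snd p)))"
    by (rule bfunI[OF Fm, where B = "B * B" and R = "5 * B"]) (use Fb F0 in auto)
  have bFu: "bfun (\<lambda>p. F u (fst p) (snd p))" for u using bfun_section(1)[OF bF, of u] by simp
  have bF2: "bfun (\<lambda>p. F (fst (fst p)) (snd p) (snd (fst p)))"
  proof (rule bfunI[where B = "B * B" and R = "5 * B"])
    show "(\<lambda>p. F (fst (fst p)) (snd p) (snd (fst p))) \<in> borel_measurable borel" unfolding F_def borel_prod[symmetric] by measurable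
    fix p :: "(real \<times> real) \<times> real" assume "norm p > 5 * B"
    moreover have "norm p = norm (fst (fst p), snd p, snd (fst p))"
      by (simp add: norm_prod_def power2_eq_square algebra_simps)
    ultimately show "F (fst (fst p)) (snd p) (snd (fst p)) = 0" using F0 by simp
  qed (use Fb in auto)
  have bF3: "bfun (\<lambda>p. F (snd p) (fst p) \<tau>)" for \<tau>
  proof (rule bfunI[where B = "B * B" and R = "5 * B"])
    show "(\<lambda>p. F (snd p) (fst p) \<tau>) \<in> borel_measurable borel" unfolding F_def borel_prod[symmetric] by measurable
    fix p :: "real \<times> real" assume "norm p > 5 * B"
    moreover have "norm p \<le> norm (snd p, fst p, \<tau>)"
      by (simp add: norm_prod_def power2_eq_square algebra_simps)
    ultimately show "F (snd p) (fst p) \<tau> = 0" using F0 by simp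
  qed (use Fb in auto)
  have "complex_of_real (nsq (\<lambda>u. LINT x|lborel. K (x, u))) =
      (LINT u|lborel. (LINT x|lborel. K (x, u)) * cnj (LINT x|lborel. K (x, u)))"
    unfolding nsq_def by (simp add: complex_norm_square[symmetric] flip: integral_complex_of_real)
  also have "\<dots> = (LINT u|lborel. LINT x|lborel. LINT \<tau>|lborel. F u x \<tau>)"
  proof (intro Bochner_Integration.integral_cong refl)
    fix u
    have iK: "integrable lborel (\<lambda>x. K (x, u))" by (rule bfun_integrable[OF bfun_section(2)[OF K]])
    have "(LINT \<tau>|lborel. F u x \<tau>) = K (x, u) * cnj (LINT t|lborel. K (t, u))" for x
    proof -
      have "(LINT \<tau>|lborel. F u x \<tau>) = (LINT \<tau>|lborel. K (x, u) * cnj (K (\<tau>, u)))"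
        unfolding F_def using lborel_integral_shift(1)[of "\<lambda>t. K (x, u) * cnj (K (t, u))" x] by simp
      then show ?thesis using iK by (simp add: integral_cnj)
    qed
    then show "(LINT x|lborel. K (x, u)) * cnj (LINT x|lborel. K (x, u)) = (LINT x|lborel. LINT \<tau>|lborel. F u x \<tau>)"
      using iK by simp
  qed
  also have "\<dots> = (LINT u|lborel. LINT \<tau>|lborel. LINT x|lborel. F u x \<tau>)"
    using bfun_Fubini(2)[OF bFu] by simp
  also have "\<dots> = (LINT \<tau>|lborel. LINT u|lborel. LINT x|lborel. F u x \<tau>)"
    using bfun_Fubini(2)[OF bfun_partial_integral[OF bF2]] by simp
  also have "\<dots> = (LINT \<tau>|lborel. LINT x|lborel. LINT u|lborel. F u x \<tau>)"
    using bfun_Fubini(2)[OF bF3] by simp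
  finally have "nsq (\<lambda>u. LINT x|lborel. K (x, u)) = norm (LINT \<tau>|lborel. LINT x|lborel. LINT u|lborel. F u x \<tau>)"
    by (metis abs_of_nonneg norm_of_real nsq_nonneg)
  also have "\<dots> \<le> (LINT \<tau>|lborel. norm (LINT x|lborel. LINT u|lborel. F u x \<tau>))"
    by (rule Bochner_Integration.integral_norm_bound)
  finally show ?thesis by (simp add: F_def)
qed

lemma cis_borel_measurable [measurable]: "cis \<in> borel_measurable borel"
  by (intro borel_measurable_continuous_onI continuous_intros)

lemma cnj_borel_measurable [measurable]: "cnj \<in> borel_measurable borel"
  by (intro borel_measurable_continuous_onI continuous_intros)

lemma integral_inverse_quadratic_le:
  fixes c l :: real
  assumes "c > 0" "l \<ge> 0"
  shows "(LINT s|lborel. 1 / (1 + (c * s)\<^sup>2) * indicator {- l..l} s) \<le> pi / c"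
proof -
  have "(LINT s|lborel. 1 / (1 + (c * s)\<^sup>2) * indicator {- l..l} s) = arctan (c * l) / c - arctan (c * (- l)) / c"
  proof (rule integral_FTC_Icc_real)
    fix x
    show "((\<lambda>s. arctan (c * s) / c) has_real_derivative 1 / (1 + (c * x)\<^sup>2)) (at x)"
      using assms by (auto intro!: derivative_eq_intros simp: divide_inverse)
    show "isCont (\<lambda>s. 1 / (1 + (c * s)\<^sup>2)) x"
      using zero_le_power2[of "c * x"] by (intro continuous_intros) linarith
  qed (use assms in auto)
  also have "\<dots> = 2 * arctan (c * l) / c" by (simp add: arctan_minus)
  also have "\<dots> \<le> pi / c" using arctan_ubound[of "c * l"] assms by (intro divide_right_mono) auto
  finally show ?thesis .
qed

text \<open>Schur's test: the product of the two values of \<open>G\<close> is at most the mean of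
  their squares, and integrating \<open>k (y - z)\<close> over either variable gives the same
  number.\<close>

lemma Schur_bound:
  fixes k :: "real \<Rightarrow> real" and G :: "real \<Rightarrow> complex"
  assumes k: "bfun k" "\<And>s. k s \<ge> 0" "\<And>s. k (- s) = k s" and G: "bfun G"
  shows "(LINT y|lborel. LINT z|lborel. norm (G y) * norm (G z) * k (y - z)) \<le> (LINT s|lborel. k s) * nsq G"
proof -
  note [measurable] = bfun_measurable[OF k(1)] bfun_measurable[OF G]
  obtain Bk where Bk: "Bk > 0" "\<And>x. norm (k x) \<le> Bk" "\<And>x. norm x > Bk \<Longrightarrow> k x = 0" using bfunD[OF k(1)] by blast
  obtain B where B: "B > 0" "\<And>x. norm (G x) \<le> B" "\<And>x. norm x > B \<Longrightarrow> G x = 0" using bfunD[OF G] by blast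
  have far: "norm (fst p) > B \<or> \<bar>fst p - snd p\<bar> > Bk" if "norm p > 2 * B + Bk" for p :: "real \<times> real"
    using that norm_Pair_le[of "fst p" "snd p"] by auto
  have b: "bfun (\<lambda>p. (norm (G (fst p)))\<^sup>2 * k (fst p - snd p))"
  proof (rule bfunI[where B = "B\<^sup>2 * Bk" and R = "2 * B + Bk"])
    show "(\<lambda>p. (norm (G (fst p)))\<^sup>2 * k (fst p - snd p)) \<in> borel_measurable borel"
      unfolding borel_prod[symmetric] by measurable
    show "norm ((norm (G (fst p)))\<^sup>2 * k (fst p - snd p)) \<le> B\<^sup>2 * Bk" for p
      using B Bk by (auto simp: abs_mult intro!: mult_mono power_mono)
    show "(norm (G (fst p)))\<^sup>2 * k (fst p - snd p) = 0" if "norm p > 2 * B + Bk" for p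
      using far[OF that] B(3) Bk(3) by auto
  qed
  have b2: "bfun (\<lambda>p. norm (G (fst p)) * norm (G (snd p)) * k (fst p - snd p))"
    by (rule bfun_mult_bounded(1)[OF bfun_tensor[OF bfun_norm[OF G] bfun_norm[OF G]], of _ Bk])
      (use Bk(2) in \<open>auto simp: borel_prod[symmetric]\<close>)
  let ?N = "\<lambda>y. (norm (G y))\<^sup>2"
  have e1: "(LINT y|lborel. LINT z|lborel. ?N y * k (y - z)) = (LINT s|lborel. k s) * nsq G"
    using lborel_integral_shift(4)[of k] by (simp add: nsq_def mult.commute)
  have bb: "bfun (\<lambda>p. (norm (G (snd p)))\<^sup>2 * k (fst p - snd p))"
  proof (rule bfunI[where B = "B\<^sup>2 * Bk" and R = "2 * B + Bk"])
    show "(\<lambda>p. (norm (G (snd p)))\<^sup>2 * k (fst p - snd p)) \<in> borel_measurable borel"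
      unfolding borel_prod[symmetric] by measurable
    show "norm ((norm (G (snd p)))\<^sup>2 * k (fst p - snd p)) \<le> B\<^sup>2 * Bk" for p
      using B Bk by (auto simp: abs_mult intro!: mult_mono power_mono)
    show "(norm (G (snd p)))\<^sup>2 * k (fst p - snd p) = 0" if "norm p > 2 * B + Bk" for p
      using far[of "prod.swap p"] B(3)[of "snd p"] Bk(3)[of "fst p - snd p"] that by (auto simp: norm_prod_def abs_minus_commute add.commute)
  qed
  have e2: "(LINT y|lborel. LINT z|lborel. ?N z * k (y - z)) = (LINT s|lborel. k s) * nsq G"
    using bfun_Fubini(2)[OF bb] lborel_integral_shift(3)[of k] by (simp add: nsq_def mult.commute)
  have "(LINT p|lborel. norm (G (fst p)) * norm (G (snd p)) * k (fst p - snd p)) \<le>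
     (LINT p|lborel. ((norm (G (fst p)))\<^sup>2 * k (fst p - snd p) + (norm (G (snd p)))\<^sup>2 * k (fst p - snd p)) / 2)"
  proof (rule integral_mono)
    fix p :: "real \<times> real"
    have "norm (G (fst p)) * norm (G (snd p)) \<le> ((norm (G (fst p)))\<^sup>2 + (norm (G (snd p)))\<^sup>2) / 2"
      using zero_le_power2[of "norm (G (fst p)) - norm (G (snd p))"] by (simp add: power2_eq_square algebra_simps)
    from mult_right_mono[OF this k(2)[of "fst p - snd p"]]
    show "norm (G (fst p)) * norm (G (snd p)) * k (fst p - snd p) \<le>
      ((norm (G (fst p)))\<^sup>2 * k (fst p - snd p) + (norm (G (snd p)))\<^sup>2 * k (fst p - snd p)) / 2"
      by (simp add: algebra_simps)
  qed (use bfun_integrable[OF b] bfun_integrable[OF bb] bfun_integrable[OF b2] in auto)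
  also have "\<dots> = (LINT s|lborel. k s) * nsq G"
    using bfun_integrable[OF b] bfun_integrable[OF bb] bfun_Fubini(1)[OF b] bfun_Fubini(1)[OF bb] e1 e2 by simp
  finally show ?thesis using bfun_Fubini(1)[OF b2] by simp
qed

text \<open>Duality in \<open>F\<close> leaves the norm of an oscillatory operator applied to
  \<open>G\<close> over the support of \<open>F\<close>. There the indicator may be replaced by the
  larger weight \<open>w\<close>, which can vanish smoothly at the ends; expanding the square then
  gives a kernel in (y, z) that oscillates in x and is summed by Schur's test.\<close>

lemma oscillatory_operator_bound:
  fixes \<Theta> :: "real \<times> real \<Rightarrow> real" and F G :: "real \<Rightarrow> complex" and w k :: "real \<Rightarrow> real"
  assumes \<Theta>: "\<Theta> \<in> borel_measurable borel" and F: "bfun F" and G: "bfun G"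
    and w: "bfun w" "\<And>x. w x \<ge> 0" "\<And>x. F x \<noteq> 0 \<Longrightarrow> w x \<ge> 1"
    and k: "bfun k" "\<And>s. k s \<ge> 0" "\<And>s. k (- s) = k s"
    and ker: "\<And>y z. G y \<noteq> 0 \<Longrightarrow> G z \<noteq> 0 \<Longrightarrow>
        norm (LINT x|lborel. of_real (w x) * cis (\<Theta> (x, y) - \<Theta> (x, z))) \<le> k (y - z)"
  shows "(norm (LINT x|lborel. LINT y|lborel. cis (\<Theta> (x, y)) * F x * G y))\<^sup>2 \<le> nsq F * ((LINT s|lborel. k s) * nsq G)"
proof -
  note [measurable] = bfun_measurable[OF F] bfun_measurable[OF G] bfun_measurable[OF w(1)] bfun_measurable[OF k(1)]
    \<Theta>[unfolded borel_prod[symmetric]]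
  define T where "T x = (LINT y|lborel. cis (\<Theta> (x, y)) * G y)" for x
  have cG: "bfun (\<lambda>y. cis (\<Theta> (x, y)) * G y)" for x
    by (rule bfun_mult_bounded(2)[OF G, of _ 1]) auto
  have Tm [measurable]: "T \<in> borel_measurable borel" unfolding T_def by measurable
  have Tb: "norm (T x) \<le> (LINT y|lborel. norm (G y))" for x
    unfolding T_def using Bochner_Integration.integral_norm_bound[of lborel "\<lambda>y. cis (\<Theta> (x, y)) * G y"] by (simp add: norm_mult)
  \<comment> \<open>\<open>T\<close> need not have bounded support. Restricting it to the set where
    \<open>F\<close> is nonzero leaves the pairing unchanged and puts it into the class
    \<open>bfun\<close>.\<close>
  define T1 where "T1 x = (if F x \<noteq> 0 then T x else 0)" for x
  have T1: "bfun T1"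
  proof -
    obtain B where B: "B > 0" "\<And>x. norm (F x) \<le> B" "\<And>x. norm x > B \<Longrightarrow> F x = 0" using bfunD[OF F] by blast
    show ?thesis
    proof (rule bfunI)
      show "T1 \<in> borel_measurable borel" unfolding T1_def by measurable
      show "norm (T1 x) \<le> (LINT y|lborel. norm (G y))" for x
        using Tb[of x] order_trans[OF norm_ge_zero Tb[of x]] by (simp add: T1_def)
    qed (use B(3) in \<open>auto simp: T1_def\<close>)
  qed
  have wT: "bfun (\<lambda>x. w x * (norm (T x))\<^sup>2)"
    by (rule bfun_mult_bounded(1)[OF w(1), where B = "(LINT y|lborel. norm (G y))\<^sup>2"])
      (auto intro!: power_mono Tb)
  have "(LINT x|lborel. LINT y|lborel. cis (\<Theta> (x, y)) * F x * G y) = (LINT x|lborel. F x * T1 x)"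
  proof (intro Bochner_Integration.integral_cong refl)
    fix x
    have "(LINT y|lborel. cis (\<Theta> (x, y)) * F x * G y) = (LINT y|lborel. F x * (cis (\<Theta> (x, y)) * G y))"
      by (simp add: mult_ac)
    also have "\<dots> = F x * T x" using bfun_integrable[OF cG[of x]] by (simp add: T_def)
    finally show "(LINT y|lborel. cis (\<Theta> (x, y)) * F x * G y) = F x * T1 x" by (simp add: T1_def)
  qed
  then have "(norm (LINT x|lborel. LINT y|lborel. cis (\<Theta> (x, y)) * F x * G y))\<^sup>2 \<le> nsq F * nsq T1"
    using bfun_Cauchy_Schwarz[OF F T1] by simp
  also have "nsq T1 \<le> (LINT x|lborel. w x * (norm (T x))\<^sup>2)"
    unfolding nsq_def
  proof (rule integral_mono)
    show "(norm (T1 x))\<^sup>2 \<le> w x * (norm (T x))\<^sup>2" for x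
      using mult_right_mono[OF w(3)[of x], of "(norm (T x))\<^sup>2"] w(2)[of x] by (auto simp: T1_def)
  qed (use bfun_nsq_integrable[OF T1] bfun_integrable[OF wT] in auto)
  also have "\<dots> \<le> (LINT s|lborel. k s) * nsq G"
  proof -
    define H where "H x q = of_real (w x) * cis (\<Theta> (x, fst q) - \<Theta> (x, snd q)) * (G (fst q) * cnj (G (snd q)))"
      for x :: real and q :: "real \<times> real"
    have GG: "bfun (\<lambda>q. G (fst q) * cnj (G (snd q)))" by (rule bfun_tensor[OF G bfun_cnj[OF G]])
    have "bfun (\<lambda>p. (of_real (w (fst p)) * (G (fst (snd p)) * cnj (G (snd (snd p))))) * cis (\<Theta> (fst p, fst (snd p)) - \<Theta> (fst p, snd (snd p))))"
    proof (rule bfun_mult_bounded(1)[where B = 1])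
      have wc: "bfun (\<lambda>x. complex_of_real (w x))"
        by (rule bfun_dominated[OF w(1), where C = 1]) auto
      show "bfun (\<lambda>p. complex_of_real (w (fst p)) * (G (fst (snd p)) * cnj (G (snd (snd p)))))"
        using bfun_tensor[OF wc GG] .
      show "(\<lambda>p. cis (\<Theta> (fst p, fst (snd p)) - \<Theta> (fst p, snd (snd p)))) \<in> borel_measurable borel"
        unfolding borel_prod[symmetric] by measurable
    qed auto
    then have bH: "bfun (\<lambda>p. H (fst p) (snd p))" by (simp add: H_def mult_ac)
    have "of_real (w x * (norm (T x))\<^sup>2) = (LINT q|lborel. H x q)" for x
    proof -
      have "(LINT q|lborel. H x q) = (LINT y|lborel. LINT z|lborel. H x (y, z))"
        using bfun_Fubini(1)[OF bfun_section(1)[OF bH, of x]] by simp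
      also have "\<dots> = (LINT y|lborel. LINT z|lborel. (of_real (w x) * (cis (\<Theta> (x, y)) * G y)) * cnj (cis (\<Theta> (x, z)) * G z))"
        by (simp add: H_def cis_cnj cis_divide[symmetric] divide_inverse cis_inverse mult_ac)
      also have "\<dots> = of_real (w x) * (T x * cnj (T x))"
        using bfun_integrable[OF cG[of x]] bfun_integrable[OF bfun_cnj[OF cG[of x]]]
        by (simp add: T_def integral_cnj del: complex_cnj_mult)
      finally show ?thesis by (simp add: complex_norm_square[symmetric])
    qed
    then have "of_real (LINT x|lborel. w x * (norm (T x))\<^sup>2) = (LINT x|lborel. LINT q|lborel. H x q)"
      by (simp flip: integral_complex_of_real)
    also have "\<dots> = (LINT q|lborel. LINT x|lborel. H x q)"
      using bfun_Fubini(2)[OF bH] by simp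
    finally have "\<bar>LINT x|lborel. w x * (norm (T x))\<^sup>2\<bar> = norm (LINT q|lborel. LINT x|lborel. H x q)"
      by (metis norm_of_real)
    also have "\<dots> \<le> (LINT q|lborel. norm (G (fst q)) * norm (G (snd q)) * k (fst q - snd q))"
    proof (rule Bochner_Integration.integral_norm_bound_integral)
      have "bfun (\<lambda>p. H (snd p) (fst p))" using bfun_swap[OF bH] by simp
      from bfun_integrable[OF bfun_partial_integral[OF this]]
      show "integrable lborel (\<lambda>q. LINT x|lborel. H x q)" by simp
      obtain Bk where Bk: "Bk > 0" "\<And>x. norm (k x) \<le> Bk" using bfunD[OF k(1)] by blast
      show "integrable lborel (\<lambda>q. norm (G (fst q)) * norm (G (snd q)) * k (fst q - snd q))"
        by (rule bfun_integrable[OF bfun_mult_bounded(1)[OF bfun_tensor[OF bfun_norm[OF G] bfun_norm[OF G]], of _ Bk]])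
          (use Bk(2) in \<open>auto simp: borel_prod[symmetric]\<close>)
      fix q :: "real \<times> real"
      have "(LINT x|lborel. H x q) = (G (fst q) * cnj (G (snd q))) * (LINT x|lborel. of_real (w x) * cis (\<Theta> (x, fst q) - \<Theta> (x, snd q)))"
        unfolding H_def by (simp add: mult.commute)
      then have "norm (LINT x|lborel. H x q) = norm (G (fst q)) * norm (G (snd q)) * norm (LINT x|lborel. of_real (w x) * cis (\<Theta> (x, fst q) - \<Theta> (x, snd q)))"
        by (simp add: norm_mult)
      also have "\<dots> \<le> norm (G (fst q)) * norm (G (snd q)) * k (fst q - snd q)"
      proof (cases "G (fst q) = 0 \<or> G (snd q) = 0")
        case False
        then show ?thesis using ker[of "fst q" "snd q"] by (intro mult_left_mono) auto
      qed auto
      finally show "norm (LINT x|lborel. H x q) \<le> norm (G (fst q)) * norm (G (snd q)) * k (fst q - snd q)" .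
    qed
    also have "\<dots> \<le> (LINT s|lborel. k s) * nsq G"
    proof -
      obtain Bk where Bk: "Bk > 0" "\<And>x. norm (k x) \<le> Bk" using bfunD[OF k(1)] by blast
      have "bfun (\<lambda>q. norm (G (fst q)) * norm (G (snd q)) * k (fst q - snd q))"
        by (rule bfun_mult_bounded(1)[OF bfun_tensor[OF bfun_norm[OF G] bfun_norm[OF G]], of _ Bk])
          (use Bk(2) in \<open>auto simp: borel_prod[symmetric]\<close>)
      from bfun_Fubini(1)[OF this] Schur_bound[OF k G] show ?thesis by simp
    qed
    finally show ?thesis by simp
  qed
  finally show ?thesis by (simp add: mult_left_mono nsq_nonneg)
qed

section \<open>The trilinear form and its reduction to bilinear slices\<close>

text \<open>The form without cut-off and with the parameter inside the phase. Localisation is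
  carried entirely by the supports of the functions.\<close>

definition trif :: "(real \<times> real \<Rightarrow> real) \<Rightarrow> (real \<Rightarrow> complex) \<Rightarrow> (real \<Rightarrow> complex) \<Rightarrow> (real \<Rightarrow> complex) \<Rightarrow> complex" where
  "trif S f1 f2 f3 = (LINT p|lborel. cis (S p) * (f1 (fst p) * f2 (snd p) * f3 (fst p + snd p)))"

lemma bfun_trif:
  assumes "S \<in> borel_measurable borel" "bfun f1" "bfun f2" "bfun f3"
  shows "bfun (\<lambda>p. cis (S p) * (f1 (fst p) * f2 (snd p) * f3 (fst p + snd p)))"
proof -
  note [measurable] = assms(1)[unfolded borel_prod[symmetric]] bfun_measurable[OF assms(4)]
  obtain B where B: "\<And>x. norm (f3 x) \<le> B" using bfunD[OF assms(4)] by blast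
  have 1: "bfun (\<lambda>p. f1 (fst p) * f2 (snd p) * f3 (fst p + snd p))"
    by (rule bfun_mult_bounded(1)[OF bfun_tensor[OF assms(2,3)], of _ B]) (auto simp: B borel_prod[symmetric])
  show ?thesis
    by (rule bfun_mult_bounded(2)[OF 1, of _ 1]) (auto simp: borel_prod[symmetric])
qed

text \<open>In the variables x and u = x + y the form pairs \<open>f3\<close> with an integral over
  x, to which \<open>TT_star\<close> applies. At fixed u, moving x by \<tau> moves y by
  -\<tau>.\<close>

lemma trif_TT_star:
  assumes S: "S \<in> borel_measurable borel" and f: "bfun f1" "bfun f2" "bfun f3"
  shows "(norm (trif S f1 f2 f3))\<^sup>2 \<le> nsq f3 * (LINT \<tau>|lborel. norm (LINT x|lborel. LINT y|lborel.
     cis (S (x, y) - S (x + \<tau>, y - \<tau>)) * (f1 x * cnj (f1 (x + \<tau>))) * (f2 y * cnj (f2 (y - \<tau>)))))"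
proof -
  note [measurable] = S[unfolded borel_prod[symmetric]]
  define K where "K p = cis (S (fst p, snd p - fst p)) * (f1 (fst p) * f2 (snd p - fst p))" for p
  have "bfun (\<lambda>p. cis (S p) * (f1 (fst p) * f2 (snd p)))"
    by (rule bfun_mult_bounded(2)[OF bfun_tensor[OF f(1,2)], of _ 1]) (auto simp: borel_prod[symmetric])
  from bfun_shear(1)[OF this] have K: "bfun K" by (simp add: K_def[abs_def])
  have Kf: "bfun (\<lambda>p. K p * f3 (snd p))"
  proof -
    note [measurable] = bfun_measurable[OF f(3)]
    obtain B where B: "\<And>x. norm (f3 x) \<le> B" using bfunD[OF f(3)] by blast
    show ?thesis by (rule bfun_mult_bounded(1)[OF K, of _ B]) (auto simp: B borel_prod[symmetric])
  qed
  have "trif S f1 f2 f3 = (LINT x|lborel. LINT y|lborel. cis (S (x, y)) * (f1 x * f2 y * f3 (x + y)))"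
    unfolding trif_def using bfun_Fubini(1)[OF bfun_trif[OF S f]] by simp
  also have "\<dots> = (LINT x|lborel. LINT u|lborel. K (x, u) * f3 u)"
  proof (rule Bochner_Integration.integral_cong[OF refl])
    fix x
    show "(LINT y|lborel. cis (S (x, y)) * (f1 x * f2 y * f3 (x + y))) = (LINT u|lborel. K (x, u) * f3 u)"
      using lborel_integral_shift(3)[of "\<lambda>y. cis (S (x, y)) * (f1 x * f2 y * f3 (x + y))" x]
      by (simp add: K_def mult.assoc)
  qed
  also have "\<dots> = (LINT u|lborel. f3 u * (LINT x|lborel. K (x, u)))"
    using bfun_Fubini(2)[OF Kf] by (simp add: mult.commute)
  finally have e: "trif S f1 f2 f3 = (LINT u|lborel. f3 u * (LINT x|lborel. K (x, u)))" .
  have P: "bfun (\<lambda>u. LINT x|lborel. K (x, u))"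
    using bfun_partial_integral[OF bfun_swap[OF K]] by simp
  have "(norm (trif S f1 f2 f3))\<^sup>2 \<le> nsq f3 * nsq (\<lambda>u. LINT x|lborel. K (x, u))"
    unfolding e by (rule bfun_Cauchy_Schwarz[OF f(3) P])
  also have "\<dots> \<le> nsq f3 * (LINT \<tau>|lborel. norm (LINT x|lborel. LINT u|lborel. K (x, u) * cnj (K (x + \<tau>, u))))"
    by (intro mult_left_mono TT_star K nsq_nonneg)
  also have "(\<lambda>\<tau>. LINT x|lborel. LINT u|lborel. K (x, u) * cnj (K (x + \<tau>, u))) = (\<lambda>\<tau>. LINT x|lborel. LINT y|lborel.
     cis (S (x, y) - S (x + \<tau>, y - \<tau>)) * (f1 x * cnj (f1 (x + \<tau>))) * (f2 y * cnj (f2 (y - \<tau>))))"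
  proof (rule ext, rule Bochner_Integration.integral_cong[OF refl])
    fix \<tau> x
    have "(LINT u|lborel. K (x, u) * cnj (K (x + \<tau>, u))) = (LINT y|lborel. K (x, x + y) * cnj (K (x + \<tau>, x + y)))"
      using lborel_integral_shift(1)[of "\<lambda>u. K (x, u) * cnj (K (x + \<tau>, u))" x] by simp
    then show "(LINT u|lborel. K (x, u) * cnj (K (x + \<tau>, u))) = (LINT y|lborel.
       cis (S (x, y) - S (x + \<tau>, y - \<tau>)) * (f1 x * cnj (f1 (x + \<tau>))) * (f2 y * cnj (f2 (y - \<tau>))))"
      by (simp add: K_def cis_cnj cis_divide[symmetric] divide_inverse cis_inverse mult_ac)
  qed
  finally show ?thesis .
qed

text \<open>The slices at fixed \<tau> are measured by these norms. Their integrability in \<tau>,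
  with a product as value, allows the slices to be summed by Cauchy-Schwarz.\<close>

lemma nsq_autocorrelation:
  assumes "bfun f"
  shows "bfun (\<lambda>\<tau>. nsq (\<lambda>x. f x * cnj (f (x + \<tau>))))" "(LINT \<tau>|lborel. nsq (\<lambda>x. f x * cnj (f (x + \<tau>)))) = (nsq f)\<^sup>2"
proof -
  have "bfun (\<lambda>p. (norm (f (fst p)))\<^sup>2 * (norm (f (snd p)))\<^sup>2)"
    using bfun_tensor[OF bfun_norm_power[OF assms, of 1] bfun_norm_power[OF assms, of 1]] by (simp add: power2_eq_square)
  from bfun_shear(2)[OF this]
  have b: "bfun (\<lambda>p. (norm (f (fst p)))\<^sup>2 * (norm (f (fst p + snd p)))\<^sup>2)" by simp
  show "bfun (\<lambda>\<tau>. nsq (\<lambda>x. f x * cnj (f (x + \<tau>))))"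
    using bfun_partial_integral[OF bfun_swap[OF b]] by (simp add: nsq_def norm_mult power_mult_distrib)
  have "(LINT \<tau>|lborel. nsq (\<lambda>x. f x * cnj (f (x + \<tau>)))) = (LINT x|lborel. LINT \<tau>|lborel. (norm (f x))\<^sup>2 * (norm (f (x + \<tau>)))\<^sup>2)"
    using bfun_Fubini(2)[OF b] by (simp add: nsq_def norm_mult power_mult_distrib)
  also have "\<dots> = (nsq f)\<^sup>2"
    using lborel_integral_shift(1)[of "\<lambda>x. (norm (f x))\<^sup>2"] by (simp add: nsq_def power2_eq_square)
  finally show "(LINT \<tau>|lborel. nsq (\<lambda>x. f x * cnj (f (x + \<tau>)))) = (nsq f)\<^sup>2" .
qed

lemma integral_autocorrelation:
  assumes "bfun f"
  shows "(LINT x|lborel. norm (f x * cnj (f (x + \<tau>)))) \<le> nsq f" "bfun (\<lambda>x. f x * cnj (f (x + \<tau>)))"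
proof -
  note [measurable] = bfun_measurable[OF assms]
  obtain B where B: "\<And>x. norm (f x) \<le> B" using bfunD[OF assms] by blast
  show b: "bfun (\<lambda>x. f x * cnj (f (x + \<tau>)))"
    by (rule bfun_mult_bounded(1)[OF assms, of _ B]) (auto simp: B)
  have sh: "integrable lborel (\<lambda>x. (norm (f (x + \<tau>)))\<^sup>2)"
    using lborel_integrable_real_affine[OF bfun_nsq_integrable[OF assms], of 1 \<tau>] by (simp add: add.commute)
  have "(LINT x|lborel. norm (f x * cnj (f (x + \<tau>)))) \<le> (LINT x|lborel. ((norm (f x))\<^sup>2 + (norm (f (x + \<tau>)))\<^sup>2) / 2)"
  proof (rule integral_mono)
    fix x
    show "norm (f x * cnj (f (x + \<tau>))) \<le> ((norm (f x))\<^sup>2 + (norm (f (x + \<tau>)))\<^sup>2) / 2"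
      using zero_le_power2[of "norm (f x) - norm (f (x + \<tau>))"] by (simp add: norm_mult power2_eq_square algebra_simps)
  qed (use bfun_integrable[OF bfun_norm[OF b]] bfun_nsq_integrable[OF assms] sh in auto)
  also have "\<dots> = (nsq f + nsq (\<lambda>x. f (x + \<tau>))) / 2"
    unfolding nsq_def using bfun_nsq_integrable[OF assms] sh by simp
  finally show "(LINT x|lborel. norm (f x * cnj (f (x + \<tau>)))) \<le> nsq f" by (simp add: nsq_shift)
qed

text \<open>The slice bound behaves like (\<sigma> |\<tau>|)^(-1/2) and blows up at \<tau> = 0, so
  near 0 it is replaced by the trivial bound. The cube root arises from balancing the two.\<close>

lemma trif_decay_from_slices:
  assumes S: "S \<in> borel_measurable borel" and f: "bfun f1" "bfun f2" "bfun f3" and B: "B \<ge> 0" "\<sigma> > 0"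
    and sl: "\<And>\<tau>. \<tau> \<noteq> 0 \<Longrightarrow> (norm (LINT x|lborel. LINT y|lborel.
     cis (S (x, y) - S (x + \<tau>, y - \<tau>)) * (f1 x * cnj (f1 (x + \<tau>))) * (f2 y * cnj (f2 (y - \<tau>)))))\<^sup>2 \<le>
       B / (\<sigma> * \<bar>\<tau>\<bar>) * (nsq (\<lambda>x. f1 x * cnj (f1 (x + \<tau>))) * nsq (\<lambda>y. f2 y * cnj (f2 (y - \<tau>))))"
  shows "(norm (trif S f1 f2 f3))\<^sup>2 \<le> (2 + sqrt B) * \<sigma> powr (-1/3) * (nsq f1 * nsq f2 * nsq f3)"
proof -
  note [measurable] = S[unfolded borel_prod[symmetric]] bfun_measurable[OF f(1)] bfun_measurable[OF f(2)]
  define M where "M \<tau> = (LINT x|lborel. LINT y|lborel.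
     cis (S (x, y) - S (x + \<tau>, y - \<tau>)) * (f1 x * cnj (f1 (x + \<tau>))) * (f2 y * cnj (f2 (y - \<tau>))))" for \<tau>
  define F where "F \<tau> = nsq (\<lambda>x. f1 x * cnj (f1 (x + \<tau>)))" for \<tau>
  define G where "G \<tau> = nsq (\<lambda>y. f2 y * cnj (f2 (y - \<tau>)))" for \<tau>
  have G': "G \<tau> = nsq (\<lambda>x. f2 x * cnj (f2 (x + - \<tau>)))" for \<tau> by (simp add: G_def)
  have F0: "F \<tau> \<ge> 0" "G \<tau> \<ge> 0" for \<tau> by (auto simp: F_def G_def nsq_nonneg)
  have F: "bfun F" "(LINT \<tau>|lborel. F \<tau>) = (nsq f1)\<^sup>2"
    using nsq_autocorrelation[OF f(1)] by (auto simp: F_def[abs_def])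
  have G: "bfun G" "(LINT \<tau>|lborel. G \<tau>) = (nsq f2)\<^sup>2"
  proof -
    obtain R where R: "R > 0" "\<And>\<tau>. norm (nsq (\<lambda>x. f2 x * cnj (f2 (x + \<tau>)))) \<le> R"
        "\<And>\<tau>. norm \<tau> > R \<Longrightarrow> nsq (\<lambda>x. f2 x * cnj (f2 (x + \<tau>))) = 0"
      using bfunD[OF nsq_autocorrelation(1)[OF f(2)]] by blast
    show "bfun G"
    proof (rule bfunI[where B = R and R = R])
      have "(\<lambda>\<tau>. nsq (\<lambda>x. f2 x * cnj (f2 (x + \<tau>)))) \<in> borel_measurable borel"
        by (rule bfun_measurable[OF nsq_autocorrelation(1)[OF f(2)]])
      then show "G \<in> borel_measurable borel" unfolding G'[abs_def] by (rule measurable_compose[rotated]) measurable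
      show "norm (G \<tau>) \<le> R" for \<tau> using R(2)[of "- \<tau>"] by (simp add: G')
      show "G \<tau> = 0" if "norm \<tau> > R" for \<tau> using R(3)[of "- \<tau>"] that by (simp add: G')
    qed
    show "(LINT \<tau>|lborel. G \<tau>) = (nsq f2)\<^sup>2"
      using nsq_autocorrelation(2)[OF f(2)] lborel_integral_shift(4)[of "\<lambda>\<tau>. nsq (\<lambda>x. f2 x * cnj (f2 (x + \<tau>)))" 0]
      by (simp add: G'[abs_def])
  qed
  \<comment> \<open>Below \<open>t0\<close> the trivial bound costs \<open>2 * t0\<close>. Above it
    the slice bound costs the factor \<open>c\<close>, which for this choice equals
    \<open>sqrt B * t0\<close>.\<close>
  define t0 where "t0 = \<sigma> powr (-1/3)"
  have t0: "t0 > 0" using B by (simp add: t0_def)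
  define c where "c = sqrt (B / (\<sigma> * t0))"
  have ct: "c = sqrt B * t0"
  proof -
    have "\<sigma> * t0 = \<sigma> powr (2/3)" using B by (simp add: t0_def powr_mult_base)
    then have "sqrt (1 / (\<sigma> * t0)) = sqrt (\<sigma> powr (-2/3))" by (simp add: powr_minus_divide)
    also have "\<dots> = t0" using B by (simp add: t0_def powr_half_sqrt[symmetric] powr_powr)
    finally have "sqrt (1 / (\<sigma> * t0)) = t0" .
    moreover have "c = sqrt B * sqrt (1 / (\<sigma> * t0))" by (simp add: c_def flip: real_sqrt_mult)
    ultimately show ?thesis by simp
  qed
  have c0: "c \<ge> 0" using B t0 by (simp add: c_def)
  have Mtriv: "norm (M \<tau>) \<le> nsq f1 * nsq f2" for \<tau>
  proof -
    have b1: "bfun (\<lambda>x. f1 x * cnj (f1 (x + \<tau>)))" and b2: "bfun (\<lambda>y. f2 y * cnj (f2 (y - \<tau>)))"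
      using integral_autocorrelation(2)[OF f(1), of \<tau>] integral_autocorrelation(2)[OF f(2), of "- \<tau>"] by auto
    have b: "bfun (\<lambda>p. cis (S p - S (fst p + \<tau>, snd p - \<tau>)) * ((\<lambda>x. f1 x * cnj (f1 (x + \<tau>))) (fst p) * (\<lambda>y. f2 y * cnj (f2 (y - \<tau>))) (snd p)))"
      by (rule bfun_mult_bounded(2)[OF bfun_tensor[OF b1 b2], of _ 1]) (auto simp: borel_prod[symmetric])
    have "norm (M \<tau>) = norm (LINT p|lborel. cis (S p - S (fst p + \<tau>, snd p - \<tau>)) * ((\<lambda>x. f1 x * cnj (f1 (x + \<tau>))) (fst p) * (\<lambda>y. f2 y * cnj (f2 (y - \<tau>))) (snd p)))"
      unfolding M_def using bfun_Fubini(1)[OF b] by (simp add: mult.assoc)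
    also have "\<dots> \<le> (LINT p|lborel. norm ((\<lambda>x. f1 x * cnj (f1 (x + \<tau>))) (fst p)) * norm ((\<lambda>y. f2 y * cnj (f2 (y - \<tau>))) (snd p)))"
      by (rule order_trans[OF Bochner_Integration.integral_norm_bound]) (simp add: norm_mult)
    also have "\<dots> = (LINT x|lborel. norm (f1 x * cnj (f1 (x + \<tau>)))) * (LINT y|lborel. norm (f2 y * cnj (f2 (y - \<tau>))))"
      using bfun_Fubini(1)[OF bfun_tensor[OF bfun_norm[OF b1] bfun_norm[OF b2]]] by simp
    also have "\<dots> \<le> nsq f1 * nsq f2"
      using integral_autocorrelation(1)[OF f(1), of \<tau>] integral_autocorrelation(1)[OF f(2), of "- \<tau>"]
      by (intro mult_mono) (auto simp: nsq_nonneg)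
    finally show ?thesis .
  qed
  have sqF: "bfun (\<lambda>\<tau>. sqrt (F \<tau>))" "bfun (\<lambda>\<tau>. sqrt (G \<tau>))"
  proof -
    have "bfun (\<lambda>\<tau>. sqrt (H \<tau>))" if H: "bfun H" for H :: "real \<Rightarrow> real"
    proof -
      note [measurable] = bfun_measurable[OF H]
      obtain R where R: "R > 0" "\<And>\<tau>. norm (H \<tau>) \<le> R" "\<And>\<tau>. norm \<tau> > R \<Longrightarrow> H \<tau> = 0" using bfunD[OF H] by blast
      show ?thesis
      proof (rule bfunI[where B = "sqrt R" and R = R])
        show "norm (sqrt (H \<tau>)) \<le> sqrt R" for \<tau>
          using R(2)[of \<tau>] by (auto simp: abs_le_iff real_sqrt_minus[symmetric])
      qed (use R(3) in auto)
    qed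
    then show "bfun (\<lambda>\<tau>. sqrt (F \<tau>))" "bfun (\<lambda>\<tau>. sqrt (G \<tau>))" using F(1) G(1) by auto
  qed
  have CS: "(LINT \<tau>|lborel. sqrt (F \<tau>) * sqrt (G \<tau>)) \<le> nsq f1 * nsq f2"
  proof -
    have "(LINT \<tau>|lborel. sqrt (F \<tau>) * sqrt (G \<tau>))\<^sup>2 \<le> (LINT \<tau>|lborel. (sqrt (F \<tau>))\<^sup>2) * (LINT \<tau>|lborel. (sqrt (G \<tau>))\<^sup>2)"
      using F0 bfun_integrable[OF F(1)] bfun_integrable[OF G(1)] bfun_integrable[OF bfun_mult[OF sqF]]
      by (intro Cauchy_Schwarz_integral) auto
    also have "\<dots> = (nsq f1 * nsq f2)\<^sup>2" using F0 F(2) G(2) by (simp add: power_mult_distrib)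
    finally show ?thesis by (rule power2_le_imp_le) (simp add: nsq_nonneg)
  qed
  have pt: "norm (M \<tau>) \<le> nsq f1 * nsq f2 * indicator {- t0..t0} \<tau> + c * (sqrt (F \<tau>) * sqrt (G \<tau>))" for \<tau>
  proof (cases "\<tau> \<in> {- t0..t0}")
    case True
    then show ?thesis using Mtriv[of \<tau>] c0 F0[of \<tau>] by (simp add: add_increasing2)
  next
    case False
    then have \<tau>: "\<bar>\<tau>\<bar> > t0" by auto
    have "(norm (M \<tau>))\<^sup>2 \<le> B / (\<sigma> * \<bar>\<tau>\<bar>) * (F \<tau> * G \<tau>)" using sl[of \<tau>] \<tau> t0 by (auto simp: M_def F_def G_def)
    also have "\<dots> \<le> B / (\<sigma> * t0) * (F \<tau> * G \<tau>)"
      using \<tau> t0 B F0[of \<tau>] by (intro mult_right_mono divide_left_mono mult_left_mono) auto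
    also have "\<dots> = (c * (sqrt (F \<tau>) * sqrt (G \<tau>)))\<^sup>2"
      using B t0 F0[of \<tau>] by (simp add: c_def power_mult_distrib)
    finally have "norm (M \<tau>) \<le> c * (sqrt (F \<tau>) * sqrt (G \<tau>))"
      by (rule power2_le_imp_le) (use c0 F0[of \<tau>] in auto)
    then show ?thesis using False by simp
  qed
  have "(LINT \<tau>|lborel. norm (M \<tau>)) \<le> (LINT \<tau>|lborel. nsq f1 * nsq f2 * indicator {- t0..t0} \<tau> + c * (sqrt (F \<tau>) * sqrt (G \<tau>)))"
  proof (rule integral_mono')
    have "integrable lborel (\<lambda>\<tau>. indicator {- t0..t0} \<tau> :: real)" by (rule integrable_indicator_Icc)
    then show "integrable lborel (\<lambda>\<tau>. nsq f1 * nsq f2 * indicator {- t0..t0} \<tau> + c * (sqrt (F \<tau>) * sqrt (G \<tau>)))"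
      using bfun_integrable[OF bfun_mult[OF sqF]] by auto
    show "norm (M \<tau>) \<le> nsq f1 * nsq f2 * indicator {- t0..t0} \<tau> + c * (sqrt (F \<tau>) * sqrt (G \<tau>))" for \<tau> by (rule pt)
    show "0 \<le> nsq f1 * nsq f2 * indicator {- t0..t0} \<tau> + c * (sqrt (F \<tau>) * sqrt (G \<tau>))" for \<tau> by (rule order_trans[OF norm_ge_zero pt])
  qed
  also have "\<dots> = nsq f1 * nsq f2 * (2 * t0) + c * (LINT \<tau>|lborel. sqrt (F \<tau>) * sqrt (G \<tau>))"
  proof -
    have "integrable lborel (\<lambda>\<tau>. indicator {- t0..t0} \<tau> :: real)" by (rule integrable_indicator_Icc)
    then show ?thesis using bfun_integrable[OF bfun_mult[OF sqF]] t0 by simp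
  qed
  also have "\<dots> \<le> nsq f1 * nsq f2 * (2 * t0) + c * (nsq f1 * nsq f2)"
    by (intro add_left_mono mult_left_mono CS c0)
  also have "\<dots> = (2 + sqrt B) * t0 * (nsq f1 * nsq f2)" by (simp add: ct algebra_simps)
  finally have "nsq f3 * (LINT \<tau>|lborel. norm (M \<tau>)) \<le> nsq f3 * ((2 + sqrt B) * t0 * (nsq f1 * nsq f2))"
    by (intro mult_left_mono nsq_nonneg)
  then show ?thesis using trif_TT_star[OF S f] by (simp add: M_def t0_def mult_ac)
qed

section \<open>The estimate on a single square\<close>

lemma jet_double_difference:
  assumes g: "jet U g"
    and U: "\<And>s t. min 0 \<tau> \<le> s \<Longrightarrow> s \<le> max 0 \<tau> \<Longrightarrow> min z y \<le> t \<Longrightarrow> t \<le> max z y \<Longrightarrow> (x + s, t - s) \<in> U"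
  shows "\<exists>s t. min 0 \<tau> \<le> s \<and> s \<le> max 0 \<tau> \<and> min z y \<le> t \<and> t \<le> max z y \<and>
    g (Suc j) 0 (x, y) - g (Suc j) 0 (x + \<tau>, y - \<tau>) - g (Suc j) 0 (x, z) + g (Suc j) 0 (x + \<tau>, z - \<tau>)
      = - \<tau> * (y - z) * hjet g j 0 (x + s, t - s)"
proof -
  \<comment> \<open>The derivative along the antidiagonal. One mean value theorem along it in \<tau>
    and one in y turn the double difference of the x-derivative of order \<open>Suc j\<close> into
    \<tau> (y - z) times a value of the x-derivative of H of order \<open>j\<close>, up to
    sign.\<close>
  let ?D = "dird (1, -1) g"
  have J: "jet U ?D" by (rule jet_dird[OF g])
  have line: "((\<lambda>s. g (Suc j) 0 (x + s, c - s)) has_real_derivative ?D (Suc j) 0 (x + s, c - s)) (at s)"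
    if "(x + s, c - s) \<in> U" for s c
    using jet_line[OF g, of "(x, c)" s "(1, -1)" "Suc j" 0] that by simp
  have "\<exists>s. min 0 \<tau> \<le> s \<and> s \<le> max 0 \<tau> \<and>
    (g (Suc j) 0 (x + \<tau>, y - \<tau>) - g (Suc j) 0 (x + \<tau>, z - \<tau>)) - (g (Suc j) 0 (x + 0, y - 0) - g (Suc j) 0 (x + 0, z - 0))
      = (\<tau> - 0) * (?D (Suc j) 0 (x + s, y - s) - ?D (Suc j) 0 (x + s, z - s))"
    by (rule MVT_between) (auto intro!: DERIV_diff line U)
  then obtain s where s: "min 0 \<tau> \<le> s" "s \<le> max 0 \<tau>"
    "(g (Suc j) 0 (x + \<tau>, y - \<tau>) - g (Suc j) 0 (x + \<tau>, z - \<tau>)) - (g (Suc j) 0 (x, y) - g (Suc j) 0 (x, z))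
      = \<tau> * (?D (Suc j) 0 (x + s, y - s) - ?D (Suc j) 0 (x + s, z - s))" by auto
  have "\<exists>t. min z y \<le> t \<and> t \<le> max z y \<and>
     ?D (Suc j) 0 (x + s, y - s) - ?D (Suc j) 0 (x + s, z - s) = (y - z) * ?D (Suc j) (Suc 0) (x + s, t - s)"
  proof (rule MVT_between)
    fix t assume t: "min z y \<le> t" "t \<le> max z y"
    have "((\<lambda>t. ?D (Suc j) 0 (x + s, t)) has_real_derivative ?D (Suc j) (Suc 0) (x + s, t - s)) (at (t - s))"
      by (rule jet_dy[OF J U[OF s(1,2) t]])
    then show "((\<lambda>t. ?D (Suc j) 0 (x + s, t - s)) has_real_derivative ?D (Suc j) (Suc 0) (x + s, t - s)) (at t)"
      using DERIV_shift[of "\<lambda>t. ?D (Suc j) 0 (x + s, t)" "?D (Suc j) (Suc 0) (x + s, t - s)" t "- s"] by simp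
  qed
  then obtain t where t: "min z y \<le> t" "t \<le> max z y"
     "?D (Suc j) 0 (x + s, y - s) - ?D (Suc j) 0 (x + s, z - s) = (y - z) * ?D (Suc j) (Suc 0) (x + s, t - s)" by auto
  have "?D (Suc j) (Suc 0) p = hjet g j 0 p" for p
    by (simp add: dird_def hjet_def numeral_2_eq_2)
  then have "?D (Suc j) 0 (x + s, y - s) - ?D (Suc j) 0 (x + s, z - s) = (y - z) * hjet g j 0 (x + s, t - s)"
    using t(3) by simp
  then have "g (Suc j) 0 (x, y) - g (Suc j) 0 (x + \<tau>, y - \<tau>) - g (Suc j) 0 (x, z) + g (Suc j) 0 (x + \<tau>, z - \<tau>)
      = - \<tau> * (y - z) * hjet g j 0 (x + s, t - s)" using s(3) by (simp add: mult.assoc)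
  then show ?thesis using s(1,2) t(1,2) by blast
qed

text \<open>\<open>oscillatory_bound\<close> with \<open>L = 3 * l\<close>: its assumptions hold
  with \<open>9 * A\<close> for \<open>A\<close>, and \<open>(3 * l) ^ 3\<close> gives the factor
  27. Division by \<open>l ^ 4\<close> makes the weight of size one.\<close>

lemma weighted_oscillatory_integral:
  fixes \<Phi> :: "nat \<Rightarrow> real \<Rightarrow> real"
  assumes l: "l > 0" and m: "m > 0" and A: "A \<ge> 0"
    and d: "\<And>x j. x \<in> {a..a + 3 * l} \<Longrightarrow> j < 3 \<Longrightarrow> (\<Phi> j has_real_derivative \<Phi> (Suc j) x) (at x)"
    and bd: "\<And>x. x \<in> {a..a + 3 * l} \<Longrightarrow> \<bar>\<Phi> 1 x\<bar> \<ge> m \<and> \<bar>\<Phi> 2 x\<bar> \<le> A * m / l \<and> \<bar>\<Phi> 3 x\<bar> \<le> A * m / l\<^sup>2"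
  shows "norm (LINT x|lborel. of_real (((x - a) * (a + 3 * l - x))\<^sup>2 / l ^ 4 * indicator {a..a + 3 * l} x) * cis (\<Phi> 0 x))
    \<le> 27 * (2 + 63 * A + 243 * A\<^sup>2) / (l * m\<^sup>2)"
proof -
  let ?b = "a + 3 * l"
  let ?f = "\<lambda>x. complex_of_real (((x - a) * (?b - x))\<^sup>2) * cis (\<Phi> 0 x)"
  have "continuous_on {a..?b} (\<Phi> 0)"
    by (rule continuous_at_imp_continuous_on) (use DERIV_isCont[OF d[of _ 0]] in auto)
  then have c: "continuous_on {a..?b} ?f" by (intro continuous_intros)
  have "set_integrable lborel {a..?b} ?f" by (rule borel_integrable_atLeastAtMost'[OF c])
  from set_borel_integral_eq_integral(2)[OF this]
  have e: "(LINT x|lborel. indicator {a..?b} x *\<^sub>R ?f x) = integral {a..?b} ?f"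
    by (simp add: set_lebesgue_integral_def)
  have "norm (integral {a..?b} ?f) \<le> (2 + 7 * (9 * A) + 3 * (9 * A)\<^sup>2) * (3 * l) ^ 3 / m\<^sup>2"
  proof (rule oscillatory_bound[where ?\<Phi>1.0 = "\<Phi> 1" and ?\<Phi>2.0 = "\<Phi> 2" and ?\<Phi>3.0 = "\<Phi> 3"])
    fix x assume x: "x \<in> {a..?b}"
    show "(\<Phi> 0 has_real_derivative \<Phi> 1 x) (at x)" "(\<Phi> 1 has_real_derivative \<Phi> 2 x) (at x)" "(\<Phi> 2 has_real_derivative \<Phi> 3 x) (at x)"
      using d[OF x, of 0] d[OF x, of 1] d[OF x, of 2] by (simp_all add: numeral_2_eq_2 numeral_3_eq_3)
    have "A * m / l \<le> 9 * A * m / (3 * l)" "A * m / l\<^sup>2 \<le> 9 * A * m / (3 * l)\<^sup>2"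
      using A m l by (auto simp: field_simps power2_eq_square)
    then show "m \<le> \<bar>\<Phi> 1 x\<bar> \<and> \<bar>\<Phi> 2 x\<bar> \<le> 9 * A * m / (3 * l) \<and> \<bar>\<Phi> 3 x\<bar> \<le> 9 * A * m / (3 * l)\<^sup>2"
      using bd[OF x] by auto
  qed (use l m A in auto)
  then have "norm (complex_of_real (1 / l ^ 4) * integral {a..?b} ?f) \<le> 1 / l ^ 4 * ((2 + 7 * (9 * A) + 3 * (9 * A)\<^sup>2) * (3 * l) ^ 3 / m\<^sup>2)"
    unfolding norm_mult norm_of_real using l by (intro mult_mono) auto
  also have "\<dots> = 27 * (2 + 63 * A + 243 * A\<^sup>2) / (l * m\<^sup>2)"
    using l m by (simp add: field_simps power2_eq_square power3_eq_cube power4_eq_xxxx)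
  also have "complex_of_real (1 / l ^ 4) * integral {a..?b} ?f =
     (LINT x|lborel. of_real (((x - a) * (?b - x))\<^sup>2 / l ^ 4 * indicator {a..?b} x) * cis (\<Phi> 0 x))"
    unfolding e[symmetric] integral_mult_right_zero[symmetric]
    by (rule Bochner_Integration.integral_cong[OF refl]) (simp add: indicator_def)
  finally show ?thesis .
qed

text \<open>Large enough for both regimes of the kernel in \<open>box_estimate\<close>: 36 covers
  twice the trivial bound 18, the other summand covers the bound by
  \<open>weighted_oscillatory_integral\<close>.\<close>

definition boxK :: "real \<Rightarrow> real" where
  "boxK A = 54 * (27 * (2 + 63 * A + 243 * A\<^sup>2)) + 36"

text \<open>In x, the interval of length l carrying \<open>f1\<close> is enlarged once by l on each
  side for the weight and once more for a shift by |\<tau>| \<le> l; this is the interval where H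
  must be controlled. In y nothing has to be enlarged, since y, z, y - \<tau> and z - \<tau> all lie
  in the support of \<open>f2\<close>.\<close>

lemma box_estimate:
  assumes g: "jet U g" and gm: "g 0 0 \<in> borel_measurable borel"
    and l: "l > 0" and \<sigma>: "\<sigma> > 0" and A: "A \<ge> 0"
    and H: "\<And>x y. x \<in> {x0 - 2 * l..x0 + 3 * l} \<Longrightarrow> y \<in> {y0..y0 + l} \<Longrightarrow>
      (x, y) \<in> U \<and> \<sigma> \<le> \<bar>hjet g 0 0 (x, y)\<bar> \<and> \<bar>hjet g 1 0 (x, y)\<bar> \<le> A * \<sigma> / l \<and> \<bar>hjet g 2 0 (x, y)\<bar> \<le> A * \<sigma> / l\<^sup>2"
    and f: "bfun f1" "bfun f2" "bfun f3"
    and supp: "\<And>x. f1 x \<noteq> 0 \<Longrightarrow> x \<in> {x0..x0 + l}" "\<And>y. f2 y \<noteq> 0 \<Longrightarrow> y \<in> {y0..y0 + l}"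
  shows "(norm (trif (g 0 0) f1 f2 f3))\<^sup>2 \<le> (2 + sqrt (boxK A * pi)) * \<sigma> powr (-1/3) * (nsq f1 * nsq f2 * nsq f3)"
proof (rule trif_decay_from_slices[OF gm f])
  let ?K = "boxK A"
  have K0: "?K \<ge> 36" using A by (simp add: boxK_def)
  then show "?K * pi \<ge> 0" by simp
  show "\<sigma> > 0" by fact
  fix \<tau> :: real assume \<tau>0: "\<tau> \<noteq> 0"
  define \<Theta> where "\<Theta> p = g 0 0 p - g 0 0 (fst p + \<tau>, snd p - \<tau>)" for p
  define F where "F x = f1 x * cnj (f1 (x + \<tau>))" for x
  define G where "G y = f2 y * cnj (f2 (y - \<tau>))" for y
  have bF: "bfun F" and bG: "bfun G"
    using integral_autocorrelation(2)[OF f(1), of \<tau>] integral_autocorrelation(2)[OF f(2), of "- \<tau>"]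
    by (auto simp: F_def[abs_def] G_def[abs_def])
  have "(norm (LINT x|lborel. LINT y|lborel. cis (\<Theta> (x, y)) * F x * G y))\<^sup>2 \<le> ?K * pi / (\<sigma> * \<bar>\<tau>\<bar>) * (nsq F * nsq G)"
  proof (cases "\<bar>\<tau>\<bar> \<le> l")
    \<comment> \<open>The interval of length l cannot contain both x and x + \<tau>, so the slice
      vanishes.\<close>
    case False
    have "F x = 0" for x using supp(1)[of x] supp(1)[of "x + \<tau>"] False by (force simp: F_def)
    then show ?thesis using K0 \<sigma> by (simp add: nsq_nonneg)
  next
    case True
    define a where "a = x0 - l"
    define w where "w x = ((x - a) * (a + 3 * l - x))\<^sup>2 / l ^ 4 * indicator {a..a + 3 * l} x" for x
    \<comment> \<open>\<open>c * \<bar>y - z\<bar>\<close> is the lower bound for the phase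
      derivative times l, so it counts oscillations over the square. The kernel \<open>k\<close>
      interpolates between no decay and inverse square decay in this quantity.\<close>
    define c where "c = \<sigma> * \<bar>\<tau>\<bar> * l"
    have c: "c > 0" using \<sigma> l \<tau>0 by (simp add: c_def)
    define k where "k s = ?K * l * (1 / (1 + (c * s)\<^sup>2) * indicator {- l..l} s)" for s
    have den: "1 + (c * s)\<^sup>2 \<ge> 1" for s by simp
    \<comment> \<open>By the inequality of the means the weight is at most (9/4)^2 = 81/16.\<close>
    have w6: "0 \<le> w x" "w x \<le> 6 * indicator {a..a + 3 * l} x" for x
    proof -
      show "0 \<le> w x" by (simp add: w_def)
      show "w x \<le> 6 * indicator {a..a + 3 * l} x"
      proof (cases "x \<in> {a..a + 3 * l}")
        case True
        define X Y where "X = x - a" and "Y = a + 3 * l - x"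
        have XY: "X \<ge> 0" "Y \<ge> 0" "X + Y = 3 * l" using True by (auto simp: X_def Y_def)
        have "4 * (X * Y) \<le> (X + Y)\<^sup>2" using zero_le_power2[of "X - Y"] by (simp add: power2_eq_square algebra_simps)
        then have "X * Y \<le> 9 / 4 * l\<^sup>2" using XY by (simp add: power2_eq_square)
        then have "(X * Y)\<^sup>2 \<le> (9 / 4 * l\<^sup>2)\<^sup>2" using XY by (intro power_mono) auto
        also have "\<dots> \<le> 6 * l ^ 4" using l by (simp add: power2_eq_square power4_eq_xxxx)
        finally show ?thesis using True l by (simp add: w_def X_def Y_def field_simps)
      qed (simp add: w_def)
    qed
    have w1: "w x \<ge> 1" if "x \<in> {x0..x0 + l}" for x
    proof -
      define X Y where "X = x - a" and "Y = a + 3 * l - x"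
      have XY: "X \<ge> l" "Y \<ge> l" using that by (auto simp: X_def Y_def a_def)
      then have "l * l \<le> X * Y" using l by (intro mult_mono) auto
      then have "(l * l)\<^sup>2 \<le> (X * Y)\<^sup>2" using l by (intro power_mono) auto
      moreover have "x \<in> {a..a + 3 * l}" using that l by (auto simp: a_def)
      ultimately show ?thesis using l by (simp add: w_def X_def Y_def field_simps power2_eq_square power4_eq_xxxx)
    qed
    have bw: "bfun w"
    proof (rule bfunI[where B = 6 and R = "\<bar>a\<bar> + 3 * l"])
      show "w \<in> borel_measurable borel" unfolding w_def[abs_def] by measurable
      show "norm (w x) \<le> 6" for x using w6[of x] by (cases "x \<in> {a..a + 3 * l}") auto
    qed (use l in \<open>auto simp: w_def indicator_def\<close>)
    have bk: "bfun k"
    proof (rule bfunI[where B = "?K * l" and R = l])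
      show "k \<in> borel_measurable borel" unfolding k_def[abs_def] by measurable
      show "norm (k s) \<le> ?K * l" for s
      proof -
        have "\<bar>1 / (1 + (c * s)\<^sup>2) * indicator {- l..l} s\<bar> \<le> 1"
          by (auto simp: indicator_def divide_le_eq_1 add_pos_nonneg)
        then have "\<bar>?K * l\<bar> * \<bar>1 / (1 + (c * s)\<^sup>2) * indicator {- l..l} s\<bar> \<le> \<bar>?K * l\<bar> * 1" by (intro mult_left_mono) auto
        then show ?thesis unfolding k_def real_norm_def abs_mult using K0 l by simp
      qed
    qed (use l in \<open>auto simp: k_def indicator_def\<close>)
    \<comment> \<open>The integral is a multiple of l / c, so the side l cancels and only 1 /
      (\<sigma> |\<tau>|) remains.\<close>
    have ik: "(LINT s|lborel. k s) \<le> ?K * pi / (\<sigma> * \<bar>\<tau>\<bar>)"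
    proof -
      have "(LINT s|lborel. k s) = ?K * l * (LINT s|lborel. 1 / (1 + (c * s)\<^sup>2) * indicator {- l..l} s)"
        unfolding k_def by (rule integral_mult_right_zero)
      also have "\<dots> \<le> ?K * l * (pi / c)"
        by (intro mult_left_mono integral_inverse_quadratic_le) (use c l K0 in auto)
      also have "\<dots> = ?K * pi / (\<sigma> * \<bar>\<tau>\<bar>)" using l by (simp add: c_def)
      finally show ?thesis .
    qed
    have \<Theta>m: "\<Theta> \<in> borel_measurable borel"
      unfolding \<Theta>_def[abs_def] using gm unfolding borel_prod[symmetric] by measurable
    have "(norm (LINT x|lborel. LINT y|lborel. cis (\<Theta> (x, y)) * F x * G y))\<^sup>2 \<le> nsq F * ((LINT s|lborel. k s) * nsq G)"
    proof (rule oscillatory_operator_bound[OF \<Theta>m bF bG bw _ _ bk])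
      show "0 \<le> w x" for x by (rule w6)
      show "1 \<le> w x" if "F x \<noteq> 0" for x using w1 supp(1)[of x] that by (auto simp: F_def)
      show "0 \<le> k s" for s using K0 l by (simp add: k_def)
      show "k (- s) = k s" for s by (auto simp: k_def indicator_def)
      fix y z assume "G y \<noteq> 0" "G z \<noteq> 0"
      then have yz: "y \<in> {y0..y0 + l}" "y - \<tau> \<in> {y0..y0 + l}" "z \<in> {y0..y0 + l}" "z - \<tau> \<in> {y0..y0 + l}"
        using supp(2) by (force simp: G_def)+
      then have dyz: "y - z \<in> {- l..l}" by auto
      define \<Phi> where "\<Phi> j x = g j 0 (x, y) - g j 0 (x + \<tau>, y - \<tau>) - g j 0 (x, z) + g j 0 (x + \<tau>, z - \<tau>)" for j x
      let ?I = "LINT x|lborel. of_real (w x) * cis (\<Theta> (x, y) - \<Theta> (x, z))"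
      have I\<Phi>: "?I = (LINT x|lborel. of_real (w x) * cis (\<Phi> 0 x))"
        by (simp add: \<Theta>_def \<Phi>_def algebra_simps)
      have reg: "x + s \<in> {x0 - 2 * l..x0 + 3 * l} \<and> t - s \<in> {y0..y0 + l}"
        if "x \<in> {a..a + 3 * l}" "min 0 \<tau> \<le> s" "s \<le> max 0 \<tau>" "min z y \<le> t" "t \<le> max z y" for x s t
        using that yz True l by (auto simp: a_def min_def max_def split: if_splits)
      show "norm ?I \<le> k (y - z)"
      proof (cases "c * \<bar>y - z\<bar> \<ge> 1")
        \<comment> \<open>With less than one oscillation the integral of the weight suffices: it is
          at most 18 l, and the denominator of \<open>k\<close> is at most 2.\<close>
        case False
        have "norm ?I \<le> (LINT x|lborel. 6 * indicator {a..a + 3 * l} x)"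
        proof (rule Bochner_Integration.integral_norm_bound_integral)
          have "bfun (\<lambda>x. complex_of_real (w x))" by (rule bfun_dominated[OF bw, where C = 1]) (use bfun_measurable[OF bw] in auto)
          then have "bfun (\<lambda>x. of_real (w x) * cis (\<Theta> (x, y) - \<Theta> (x, z)))"
          proof (rule bfun_mult_bounded(1)[where B = 1])
            note [measurable] = \<Theta>m[unfolded borel_prod[symmetric]]
            show "(\<lambda>x. cis (\<Theta> (x, y) - \<Theta> (x, z))) \<in> borel_measurable borel" by measurable
          qed auto
          then show "integrable lborel (\<lambda>x. of_real (w x) * cis (\<Theta> (x, y) - \<Theta> (x, z)))" by (rule bfun_integrable)
          show "integrable lborel (\<lambda>x. 6 * indicator {a..a + 3 * l} x :: real)"
            by (intro integrable_mult_right integrable_indicator_Icc)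
        qed (use w6 in \<open>auto simp: norm_mult\<close>)
        also have "\<dots> = 18 * l" using l by simp
        also have "\<dots> \<le> k (y - z)"
        proof -
          have "(c * \<bar>y - z\<bar>)\<^sup>2 \<le> 1\<^sup>2" by (intro power_mono) (use False c in auto)
          then have "1 + (c * (y - z))\<^sup>2 \<le> 2" by (simp add: power_mult_distrib)
          then have "1 / 2 \<le> 1 / (1 + (c * (y - z))\<^sup>2)" by (intro divide_left_mono) (auto simp: add_pos_nonneg)
          then have "36 * l * (1 / 2) \<le> ?K * l * (1 / (1 + (c * (y - z))\<^sup>2))"
            by (intro mult_mono) (use K0 l in auto)
          then show ?thesis using dyz by (simp add: k_def)
        qed
        finally show ?thesis .
      next
        case T: True
        define m where "m = \<sigma> * \<bar>\<tau>\<bar> * \<bar>y - z\<bar>"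
        have ne: "y \<noteq> z" using T by auto
        have m: "m > 0" using \<sigma> \<tau>0 ne by (simp add: m_def)
        have cm: "c * \<bar>y - z\<bar> = m * l" by (simp add: c_def m_def)
        \<comment> \<open>The intermediate point depends on the order \<open>j\<close>. This is
          harmless because H and its x-derivatives are bounded uniformly over the enlarged
          square.\<close>
        have \<Phi>S: "\<exists>p. (fst p \<in> {x0 - 2 * l..x0 + 3 * l} \<and> snd p \<in> {y0..y0 + l}) \<and> \<bar>\<Phi> (Suc j) x\<bar> = \<bar>\<tau>\<bar> * \<bar>y - z\<bar> * \<bar>hjet g j 0 p\<bar>"
          if x: "x \<in> {a..a + 3 * l}" for x j
        proof -
          have "\<exists>s t. min 0 \<tau> \<le> s \<and> s \<le> max 0 \<tau> \<and> min z y \<le> t \<and> t \<le> max z y \<and>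
            g (Suc j) 0 (x, y) - g (Suc j) 0 (x + \<tau>, y - \<tau>) - g (Suc j) 0 (x, z) + g (Suc j) 0 (x + \<tau>, z - \<tau>)
              = - \<tau> * (y - z) * hjet g j 0 (x + s, t - s)"
            by (rule jet_double_difference[OF g]) (use H reg[OF x] in blast)
          then obtain s t where "min 0 \<tau> \<le> s" "s \<le> max 0 \<tau>" "min z y \<le> t" "t \<le> max z y"
            "\<Phi> (Suc j) x = - \<tau> * (y - z) * hjet g j 0 (x + s, t - s)" unfolding \<Phi>_def by blast
          then show ?thesis using reg[OF x, of s t] by (intro exI[of _ "(x + s, t - s)"]) (auto simp: abs_mult)
        qed
        have "norm ?I \<le> 27 * (2 + 63 * A + 243 * A\<^sup>2) / (l * m\<^sup>2)"
          unfolding I\<Phi> unfolding w_def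
        proof (rule weighted_oscillatory_integral[where \<Phi> = \<Phi>, OF l m A])
          fix x j assume x: "x \<in> {a..a + 3 * l}"
          have in1: "(x, y) \<in> U" "(x, z) \<in> U" "(x + \<tau>, y - \<tau>) \<in> U" "(x + \<tau>, z - \<tau>) \<in> U"
            using H reg[OF x, of 0 y] reg[OF x, of 0 z] reg[OF x, of \<tau> y] reg[OF x, of \<tau> z] by auto
          have sh: "((\<lambda>x. g j 0 (x + \<tau>, v)) has_real_derivative g (Suc j) 0 (x + \<tau>, v)) (at x)" if "(x + \<tau>, v) \<in> U" for v
            using jet_dx[OF g that, of j 0] DERIV_shift[of "\<lambda>t. g j 0 (t, v)" _ x \<tau>] by blast
          show "(\<Phi> j has_real_derivative \<Phi> (Suc j) x) (at x)"
            unfolding \<Phi>_def[abs_def] by (intro DERIV_add DERIV_diff jet_dx[OF g] sh in1)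
        next
          fix x assume x: "x \<in> {a..a + 3 * l}"
          obtain p where p: "fst p \<in> {x0 - 2 * l..x0 + 3 * l}" "snd p \<in> {y0..y0 + l}" "\<bar>\<Phi> (Suc 0) x\<bar> = \<bar>\<tau>\<bar> * \<bar>y - z\<bar> * \<bar>hjet g 0 0 p\<bar>" using \<Phi>S[OF x, of 0] by auto
          obtain q where q: "fst q \<in> {x0 - 2 * l..x0 + 3 * l}" "snd q \<in> {y0..y0 + l}" "\<bar>\<Phi> (Suc 1) x\<bar> = \<bar>\<tau>\<bar> * \<bar>y - z\<bar> * \<bar>hjet g 1 0 q\<bar>" using \<Phi>S[OF x, of 1] by auto
          obtain r where r: "fst r \<in> {x0 - 2 * l..x0 + 3 * l}" "snd r \<in> {y0..y0 + l}" "\<bar>\<Phi> (Suc 2) x\<bar> = \<bar>\<tau>\<bar> * \<bar>y - z\<bar> * \<bar>hjet g 2 0 r\<bar>" using \<Phi>S[OF x, of 2] by auto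
          have hb: "\<sigma> \<le> \<bar>hjet g 0 0 p\<bar>" "\<bar>hjet g 1 0 q\<bar> \<le> A * \<sigma> / l" "\<bar>hjet g 2 0 r\<bar> \<le> A * \<sigma> / l\<^sup>2"
            using H[OF p(1,2)] H[OF q(1,2)] H[OF r(1,2)] by simp_all
          have "\<bar>\<tau>\<bar> * \<bar>y - z\<bar> * \<sigma> \<le> \<bar>\<Phi> (Suc 0) x\<bar>" unfolding p(3) by (intro mult_left_mono hb) simp
          moreover have "\<bar>\<Phi> (Suc 1) x\<bar> \<le> \<bar>\<tau>\<bar> * \<bar>y - z\<bar> * (A * \<sigma> / l)" unfolding q(3) by (intro mult_left_mono hb) simp
          moreover have "\<bar>\<Phi> (Suc 2) x\<bar> \<le> \<bar>\<tau>\<bar> * \<bar>y - z\<bar> * (A * \<sigma> / l\<^sup>2)" unfolding r(3) by (intro mult_left_mono hb) simp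
          moreover have "Suc 0 = 1" "Suc 1 = 2" "Suc 2 = 3" by simp_all
          moreover have em: "\<bar>\<tau>\<bar> * \<bar>y - z\<bar> * \<sigma> = m" "\<bar>\<tau>\<bar> * \<bar>y - z\<bar> * (A * \<sigma> / l) = A * m / l"
            "\<bar>\<tau>\<bar> * \<bar>y - z\<bar> * (A * \<sigma> / l\<^sup>2) = A * m / l\<^sup>2"
            by (simp_all add: m_def)
          ultimately show "m \<le> \<bar>\<Phi> 1 x\<bar> \<and> \<bar>\<Phi> 2 x\<bar> \<le> A * m / l \<and> \<bar>\<Phi> 3 x\<bar> \<le> A * m / l\<^sup>2"
            by metis
        qed
        also have "\<dots> = 27 * (2 + 63 * A + 243 * A\<^sup>2) * l * (1 / (m * l)\<^sup>2)"
          using l m by (simp add: field_simps power2_eq_square)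
        \<comment> \<open>Since m l is at least 1 here, 1 / (m l)^2 is at most 2 / (1 + (m
          l)^2).\<close>
        also have "\<dots> \<le> ?K * l * (1 / (1 + (c * (y - z))\<^sup>2))"
        proof -
          have 1: "(c * (y - z))\<^sup>2 = (m * l)\<^sup>2" unfolding cm[symmetric] by (simp add: power_mult_distrib)
          have ml: "m * l \<ge> 1" using T cm by simp
          then have "1 \<le> (m * l)\<^sup>2" by simp
          then have "1 / (m * l)\<^sup>2 \<le> 2 * (1 / (1 + (m * l)\<^sup>2))" by (simp add: field_simps)
          then have "27 * (2 + 63 * A + 243 * A\<^sup>2) * l * (1 / (m * l)\<^sup>2) \<le> 27 * (2 + 63 * A + 243 * A\<^sup>2) * l * (2 * (1 / (1 + (m * l)\<^sup>2)))"
            using A l by (intro mult_left_mono) auto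
          also have "\<dots> = (54 * (2 + 63 * A + 243 * A\<^sup>2)) * l * (1 / (1 + (m * l)\<^sup>2))" by simp
          also have "\<dots> \<le> ?K * l * (1 / (1 + (m * l)\<^sup>2))"
            using A l by (intro mult_right_mono) (auto simp: boxK_def)
          finally show ?thesis by (simp add: 1)
        qed
        also have "\<dots> = k (y - z)" using dyz by (simp add: k_def)
        finally show ?thesis .
      qed
    qed
    also have "\<dots> \<le> nsq F * (?K * pi / (\<sigma> * \<bar>\<tau>\<bar>) * nsq G)"
      by (intro mult_left_mono mult_right_mono ik nsq_nonneg)
    finally show ?thesis by (simp add: mult_ac)
  qed
  then show "(norm (LINT x|lborel. LINT y|lborel.
     cis (g 0 0 (x, y) - g 0 0 (x + \<tau>, y - \<tau>)) * (f1 x * cnj (f1 (x + \<tau>))) * (f2 y * cnj (f2 (y - \<tau>)))))\<^sup>2 \<le>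
       ?K * pi / (\<sigma> * \<bar>\<tau>\<bar>) * (nsq (\<lambda>x. f1 x * cnj (f1 (x + \<tau>))) * nsq (\<lambda>y. f2 y * cnj (f2 (y - \<tau>))))"
    by (simp add: \<Theta>_def F_def[abs_def] G_def[abs_def])
qed

section \<open>Squares on which a function of finite order is almost constant\<close>

text \<open>The constant of \<open>node_bound\<close> for the spacing \<open>L / 2 ^ N\<close>; one
  family of equidistant nodes serves all orders up to \<open>N\<close>.\<close>

definition nodeK :: "nat \<Rightarrow> real" where
  "nodeK N = (1 + 2 ^ (N + 1)) ^ N"

lemma nodeK_ge_1: "nodeK N \<ge> 1"
  unfolding nodeK_def by (rule one_le_power) simp

lemma equidistant_node_bound:
  fixes f :: "nat \<Rightarrow> real \<Rightarrow> real"
  assumes L: "L > 0" and "n \<le> N" "M \<ge> 0" "A \<ge> 0"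
    and "\<And>j t. j < n \<Longrightarrow> t \<in> {a..a + L} \<Longrightarrow> (f j has_real_derivative f (Suc j) t) (at t)"
    and "\<And>t. t \<in> {a..a + L} \<Longrightarrow> \<bar>f n t\<bar> \<le> A"
    and "\<And>r. r < 2 ^ N \<Longrightarrow> \<bar>f 0 (a + real r * (L / 2 ^ N))\<bar> \<le> M"
    and "t \<in> {a..a + L}" "j \<le> n"
  shows "\<bar>f j t\<bar> * L ^ j \<le> nodeK N * (M + A * L ^ n)"
proof -
  have pw: "(2::nat) ^ n \<le> 2 ^ N" using assms(2) by (intro power_increasing) auto
  have "\<bar>f j t\<bar> * (a + L - a) ^ j \<le> (1 + 2 * (a + L - a) / (L / 2 ^ N)) ^ n * (M + A * (a + L - a) ^ n)"
  proof (rule node_bound[where f = f and \<tau> = "\<lambda>r. a + real r * (L / 2 ^ N)"])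
    show "a + real i * (L / 2 ^ N) \<in> {a..a + L} \<and> \<bar>f 0 (a + real i * (L / 2 ^ N))\<bar> \<le> M" if "i < 2 ^ n" for i :: nat
    proof -
      have i: "i < 2 ^ N" using that pw by linarith
      then have "real i \<le> 2 ^ N" by (metis less_imp_le of_nat_le_iff of_nat_numeral of_nat_power)
      then have "real i * (L / 2 ^ N) \<le> 2 ^ N * (L / 2 ^ N)" using L by (intro mult_right_mono) auto
      then show ?thesis using assms(7)[OF i] L by auto
    qed
    show "a + real i * (L / 2 ^ N) + L / 2 ^ N \<le> a + real (Suc i) * (L / 2 ^ N)" for i :: nat
      by (simp only: of_nat_Suc distrib_right)
  qed (use assms in auto)
  also have "\<dots> = (1 + 2 ^ (N + 1)) ^ n * (M + A * L ^ n)" using L by simp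
  also have "\<dots> \<le> nodeK N * (M + A * L ^ n)"
    unfolding nodeK_def using assms(2,3,4) L by (intro mult_right_mono power_increasing) auto
  finally show ?thesis by simp
qed

text \<open>The square of side l with corner (x, y), enlarged by 2 l on every side. This is the room
  needed by \<open>box_estimate\<close>, and it is compatible with halving in the sense of
  \<open>star_child_subset\<close>.\<close>

definition star :: "real \<Rightarrow> real \<Rightarrow> real \<Rightarrow> (real \<times> real) set" where
  "star x y l = {x - 2 * l..x + 3 * l} \<times> {y - 2 * l..y + 3 * l}"

text \<open>The hypotheses on H after rescaling to unit size, chosen so that all later constants
  depend on \<open>d\<close>, \<open>A\<close> and \<open>c\<close> alone. The square from -1 to 2
  contains the stars of all small squares with corner in the unit square, and order
  \<open>d + 4\<close> is the highest one met. Only the pure x-derivative appears; the y-version is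
  obtained from \<open>swapj\<close>.\<close>

definition finite_order_box :: "nat \<Rightarrow> real \<Rightarrow> real \<Rightarrow> (nat \<Rightarrow> nat \<Rightarrow> real \<times> real \<Rightarrow> real) \<Rightarrow> bool" where
  "finite_order_box d A c h \<longleftrightarrow> (\<exists>U. {-1..2} \<times> {-1..2} \<subseteq> U \<and> jet U h) \<and>
     (\<forall>i j p. i + j \<le> d + 4 \<longrightarrow> p \<in> {-1..2} \<times> {-1..2} \<longrightarrow> \<bar>h i j p\<bar> \<le> A) \<and>
     (\<exists>k\<le>d. \<forall>p\<in>{-1..2} \<times> {-1..2}. c \<le> \<bar>h k 0 p\<bar>)"

lemma finite_order_boxD:
  assumes "finite_order_box d A c h"
  shows "\<exists>U k. {-1..2} \<times> {-1..2} \<subseteq> U \<and> jet U h \<and> k \<le> d \<and> (\<forall>p\<in>{-1..2} \<times> {-1..2}. c \<le> \<bar>h k 0 p\<bar>)"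
    "i + j \<le> d + 4 \<Longrightarrow> p \<in> {-1..2} \<times> {-1..2} \<Longrightarrow> \<bar>h i j p\<bar> \<le> A"
  using assms unfolding finite_order_box_def by blast+

lemma star_subset:
  assumes "0 \<le> x" "x \<le> 1" "0 \<le> y" "y \<le> 1" "0 < l" "l \<le> 1 / 3"
  shows "star x y l \<subseteq> {-1..2} \<times> {-1..2}"
  using assms unfolding star_def by (auto simp: subset_iff)

text \<open>If |h| is at most M on the star, the node bound for the derivative of order
  \<open>k\<close> gives \<open>c * (5 * l) ^ k \<le> K * (M + A * (5 * l) ^ Suc k)\<close>. The
  choice of \<open>l1\<close> makes the last term at most half of the left side.\<close>

lemma sup_lower_bound:
  fixes d :: nat and A c :: real
  assumes A: "A > 0" and c: "c > 0"
  shows "\<exists>c1>0. \<exists>l1>0. \<forall>h. finite_order_box d A c h \<longrightarrow> (\<forall>x y l M. 0 \<le> x \<longrightarrow> x \<le> 1 \<longrightarrow> 0 \<le> y \<longrightarrow> y \<le> 1 \<longrightarrow> 0 < l \<longrightarrow> l \<le> l1 \<longrightarrow>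
     (\<forall>p\<in>star x y l. \<bar>h 0 0 p\<bar> \<le> M) \<longrightarrow> c1 * l ^ d \<le> M)"
proof -
  define K where "K = nodeK (d + 1)"
  have K: "K \<ge> 1" by (simp add: K_def nodeK_ge_1)
  define l1 where "l1 = min (1 / 3) (c / (10 * K * A))"
  have l1: "l1 > 0" using A c K by (simp add: l1_def)
  show ?thesis
  proof (rule exI[of _ "c / (2 * K)"], rule conjI, use c K in simp, rule exI[of _ l1], rule conjI[OF l1], intro allI impI)
    fix h x y l M
    assume h: "finite_order_box d A c h" and xy: "0 \<le> x" "x \<le> 1" "0 \<le> y" "y \<le> (1::real)" and l: "0 < l" "l \<le> l1"
      and M: "\<forall>p\<in>star x y l. \<bar>h 0 0 p\<bar> \<le> M"
    have l3: "l \<le> 1 / 3" and lA: "l \<le> c / (10 * K * A)" using l by (auto simp: l1_def)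
    note sub = star_subset[OF xy l(1) l3]
    obtain U k where U: "{-1..2} \<times> {-1..2} \<subseteq> U" "jet U h" and k: "k \<le> d" "\<forall>p\<in>{-1..2} \<times> {-1..2}. c \<le> \<bar>h k 0 p\<bar>"
      using finite_order_boxD(1)[OF h] by blast
    have st: "(t, y) \<in> star x y l" if "t \<in> {x - 2 * l..x - 2 * l + 5 * l}" for t
      using that l by (auto simp: star_def)
    have M0: "M \<ge> 0" using M st[of x] l by force
    have "\<bar>h k 0 (x, y)\<bar> * (5 * l) ^ k \<le> K * (M + A * (5 * l) ^ Suc k)"
      unfolding K_def
    proof (rule equidistant_node_bound[where f = "\<lambda>j t. h j 0 (t, y)" and a = "x - 2 * l" and L = "5 * l"])
      fix j t assume "t \<in> {x - 2 * l..x - 2 * l + 5 * l}"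
      then have "(t, y) \<in> U" using st sub U(1) by blast
      then show "((\<lambda>t. h j 0 (t, y)) has_real_derivative h (Suc j) 0 (t, y)) (at t)" by (rule jet_dx[OF U(2)])
    next
      fix t assume "t \<in> {x - 2 * l..x - 2 * l + 5 * l}"
      then have "(t, y) \<in> {-1..2} \<times> {-1..2}" using st sub by blast
      then show "\<bar>h (Suc k) 0 (t, y)\<bar> \<le> A" using finite_order_boxD(2)[OF h, of "Suc k" 0] k by auto
    next
      fix r :: nat assume "r < 2 ^ (d + 1)"
      then have "real r \<le> 2 ^ (d + 1)" by (metis less_imp_le of_nat_le_iff of_nat_numeral of_nat_power)
      then have "real r * (5 * l / 2 ^ (d + 1)) \<le> 2 ^ (d + 1) * (5 * l / 2 ^ (d + 1))" using l by (intro mult_right_mono) auto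
      then show "\<bar>h 0 0 (x - 2 * l + real r * (5 * l / 2 ^ (d + 1)), y)\<bar> \<le> M"
        using l by (intro M[rule_format] st) auto
    qed (use l M0 A k in auto)
    moreover have "c \<le> \<bar>h k 0 (x, y)\<bar>"
    proof -
      have "(x, y) \<in> {-1..2} \<times> {-1..2}" using xy by auto
      then show ?thesis using k(2) by blast
    qed
    then have "c * (5 * l) ^ k \<le> \<bar>h k 0 (x, y)\<bar> * (5 * l) ^ k" using l by (intro mult_right_mono) auto
    ultimately have "c * (5 * l) ^ k \<le> K * (M + A * (5 * l) ^ Suc k)" by linarith
    also have "\<dots> = K * M + K * A * 5 * l * (5 * l) ^ k" by (simp add: algebra_simps)
    also have "K * A * 5 * l \<le> c / 2" using lA K A by (simp add: field_simps)
    then have "K * M + K * A * 5 * l * (5 * l) ^ k \<le> K * M + c / 2 * (5 * l) ^ k"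
      using l by (intro add_left_mono mult_right_mono) auto
    finally have "c / 2 * (5 * l) ^ k \<le> K * M" by simp
    moreover have "l ^ d \<le> (5 * l) ^ k"
    proof -
      have "l ^ d \<le> l ^ k" using l l3 k(1) by (intro power_decreasing) auto
      also have "\<dots> \<le> (5 * l) ^ k" using l by (intro power_mono) auto
      finally show ?thesis .
    qed
    ultimately have "c / 2 * l ^ d \<le> K * M" using c mult_left_mono[of "l ^ d" "(5 * l) ^ k" "c / 2"] by linarith
    then show "c / (2 * K) * l ^ d \<le> M" using K by (simp add: field_simps)
  qed
qed

lemma card_nat_real_interval:
  fixes \<alpha> \<beta> :: real
  shows "finite {i::nat. \<alpha> < real i \<and> real i < \<beta>}" "card {i::nat. \<alpha> < real i \<and> real i < \<beta>} \<le> nat \<lceil>\<beta> - \<alpha>\<rceil> + 1"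
proof -
  let ?S = "{i::nat. \<alpha> < real i \<and> real i < \<beta>}"
  have sub: "?S \<subseteq> {nat \<lfloor>\<alpha>\<rfloor>..<nat \<lfloor>\<alpha>\<rfloor> + nat \<lceil>\<beta> - \<alpha>\<rceil> + 1}"
  proof
    fix i assume "i \<in> ?S"
    then have i: "\<alpha> < real i" "real i < \<beta>" by auto
    have "\<lfloor>\<alpha>\<rfloor> \<le> int i" using i by linarith
    then have "nat \<lfloor>\<alpha>\<rfloor> \<le> i" by linarith
    moreover have "int i < \<lfloor>\<alpha>\<rfloor> + \<lceil>\<beta> - \<alpha>\<rceil> + 1" using i by linarith
    then have "i < nat \<lfloor>\<alpha>\<rfloor> + nat \<lceil>\<beta> - \<alpha>\<rceil> + 1" by linarith
    ultimately show "i \<in> {nat \<lfloor>\<alpha>\<rfloor>..<nat \<lfloor>\<alpha>\<rfloor> + nat \<lceil>\<beta> - \<alpha>\<rceil> + 1}" by simp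
  qed
  then show "finite ?S" by (rule finite_subset) simp
  show "card ?S \<le> nat \<lceil>\<beta> - \<alpha>\<rceil> + 1" using card_mono[OF _ sub] by simp
qed

text \<open>On one horizontal line the logarithmic x-derivative is small away from fewer than 2^d
  points. This is used on \<open>2 ^ N\<close> equidistant lines through the star; an index is
  exceptional if its star comes near an exceptional point of one of these lines. The node bound in y
  carries the estimate from the lines to the whole star.\<close>

lemma few_steep_squares:
  fixes d :: nat and A c e :: real
  assumes A: "A > 0" and c: "c > 0" and e: "e > 0"
  shows "\<exists>N0. \<exists>l1>0. (d = 0 \<longrightarrow> N0 = 0) \<and> (\<forall>h. finite_order_box d A c h \<longrightarrow> (\<forall>y l. 0 \<le> y \<longrightarrow> y \<le> 1 \<longrightarrow> 0 < l \<longrightarrow> l \<le> l1 \<longrightarrow>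
     (\<exists>X. finite X \<and> card X \<le> N0 \<and> (\<forall>i. i \<notin> X \<longrightarrow> real i * l \<le> 1 \<longrightarrow> (\<forall>M. (\<forall>p\<in>star (real i * l) y l. \<bar>h 0 0 p\<bar> \<le> M) \<longrightarrow>
        (\<forall>p\<in>star (real i * l) y l. \<bar>h 1 0 p\<bar> * l \<le> e * M))))))"
proof -
  define N where "N = d + 3"
  define K where "K = nodeK N"
  have K: "K \<ge> 1" by (simp add: K_def nodeK_ge_1)
  \<comment> \<open>Half of \<open>e\<close> is reserved for the values on the lines, the other half
    for the remainder between the lines, which the last term of \<open>l1\<close> controls.\<close>
  define \<eta> where "\<eta> = e / (2 * K * 3 ^ d)"
  have \<eta>: "\<eta> > 0" using e K by (simp add: \<eta>_def)
  obtain c1 l0 where c1: "c1 > 0" "l0 > 0" and low0: "\<forall>h. finite_order_box d A c h \<longrightarrow> (\<forall>x y l M. 0 \<le> x \<longrightarrow> x \<le> 1 \<longrightarrow> 0 \<le> y \<longrightarrow> y \<le> 1 \<longrightarrow> 0 < l \<longrightarrow> l \<le> l0 \<longrightarrow>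
     (\<forall>p\<in>star x y l. \<bar>h 0 0 p\<bar> \<le> M) \<longrightarrow> c1 * l ^ d \<le> M)"
    using sup_lower_bound[OF A c, of d] by (elim exE conjE)
  note low = low0[rule_format]
  \<comment> \<open>The stars within \<open>l / \<eta>\<close> of a given point have indices in an
    open interval of length \<open>5 + 2 / \<eta>\<close>.\<close>
  define Z where "Z = nat \<lceil>5 + 2 / \<eta>\<rceil> + 1"
  define N0 where "N0 = 2 ^ N * ((2 ^ d - 1) * Z)"
  define l1 where "l1 = min (min l0 (1 / 3)) (min (\<eta> * c / A) (e * c1 / (2 * K * A * 5 ^ N)))"
  have l1: "l1 > 0" using A c K e \<eta> c1 by (simp add: l1_def)
  show ?thesis
  proof (rule exI[of _ N0], rule exI[of _ l1], intro conjI l1 allI impI)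
    \<comment> \<open>For d = 0 there are no exceptional points at all. The final sum over scales
      depends on this, since for d = 0 it has no geometric growth.\<close>
    show "N0 = 0" if "d = 0" using that by (simp add: N0_def)
    fix h y l
    assume h: "finite_order_box d A c h" and y: "0 \<le> y" "y \<le> (1::real)" and l: "0 < l" "l \<le> l1"
    have ll: "l \<le> l0" "l \<le> 1 / 3" "l \<le> \<eta> * c / A" "l \<le> e * c1 / (2 * K * A * 5 ^ N)" using l by (auto simp: l1_def)
    obtain U k where U: "{-1..2} \<times> {-1..2} \<subseteq> U" "jet U h" and k: "k \<le> d" "\<forall>p\<in>{-1..2} \<times> {-1..2}. c \<le> \<bar>h k 0 p\<bar>"
      using finite_order_boxD(1)[OF h] by blast
    define yr where "yr r = (y - 2 * l) + real r * (5 * l / 2 ^ N)" for r :: nat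
    have yr: "yr r \<in> {y - 2 * l..y + 3 * l}" "yr r \<in> {-1..2}" if "r < 2 ^ N" for r
    proof -
      have "real r \<le> 2 ^ N" using that by (metis less_imp_le of_nat_le_iff of_nat_numeral of_nat_power)
      then have "real r * (5 * l / 2 ^ N) \<le> 2 ^ N * (5 * l / 2 ^ N)" using l by (intro mult_right_mono) auto
      then show "yr r \<in> {y - 2 * l..y + 3 * l}" using l by (auto simp: yr_def)
      then show "yr r \<in> {-1..2}" using y ll(2) by auto
    qed
    have "\<exists>T. finite T \<and> card T < 2 ^ k \<and>
      (\<forall>t\<in>{-1..2}. (\<forall>s\<in>T. \<bar>t - s\<bar> \<ge> 1 / (\<eta> / l)) \<longrightarrow> h 0 0 (t, yr r) \<noteq> 0 \<and> \<bar>h 1 0 (t, yr r)\<bar> \<le> 3 ^ k * (\<eta> / l) * \<bar>h 0 0 (t, yr r)\<bar>)"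
      if r: "r < 2 ^ N" for r
    proof (rule log_derivative_bound[where f = "\<lambda>j t. h j 0 (t, yr r)"])
      fix t :: real assume "t \<in> {-1..2}"
      then have t: "(t, yr r) \<in> {-1..2} \<times> {-1..2}" using yr(2)[OF r] by blast
      then show "((\<lambda>t. h j 0 (t, yr r)) has_real_derivative h (Suc j) 0 (t, yr r)) (at t)" for j
        using U(1) by (intro jet_dx[OF U(2)]) blast
      have ck: "c \<le> \<bar>h k 0 (t, yr r)\<bar>" using k(2) t by blast
      have "\<bar>h (Suc k) 0 (t, yr r)\<bar> \<le> A" using finite_order_boxD(2)[OF h _ t, of "Suc k" 0] k by auto
      also have "\<dots> \<le> (\<eta> / l) * c" using ll(3) l A by (simp add: field_simps)
      also have "\<dots> \<le> (\<eta> / l) * \<bar>h k 0 (t, yr r)\<bar>" using ck \<eta> l by (intro mult_left_mono) auto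
      finally show "h k 0 (t, yr r) \<noteq> 0 \<and> \<bar>h (Suc k) 0 (t, yr r)\<bar> \<le> (\<eta> / l) * \<bar>h k 0 (t, yr r)\<bar>" using ck c by auto
    qed (use \<eta> l in auto)
    then have "\<exists>T. \<forall>r. r < 2 ^ N \<longrightarrow> finite (T r) \<and> card (T r) < 2 ^ k \<and>
      (\<forall>t\<in>{-1..2}. (\<forall>s\<in>T r. \<bar>t - s\<bar> \<ge> 1 / (\<eta> / l)) \<longrightarrow> h 0 0 (t, yr r) \<noteq> 0 \<and> \<bar>h 1 0 (t, yr r)\<bar> \<le> 3 ^ k * (\<eta> / l) * \<bar>h 0 0 (t, yr r)\<bar>)"
      by (intro choice) blast
    then obtain T where T: "\<And>r. r < 2 ^ N \<Longrightarrow> finite (T r) \<and> card (T r) < 2 ^ k"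
      "\<And>r t. r < 2 ^ N \<Longrightarrow> t \<in> {-1..2} \<Longrightarrow> (\<forall>s\<in>T r. \<bar>t - s\<bar> \<ge> 1 / (\<eta> / l)) \<Longrightarrow> \<bar>h 1 0 (t, yr r)\<bar> \<le> 3 ^ k * (\<eta> / l) * \<bar>h 0 0 (t, yr r)\<bar>"
      by blast
    define near where "near s = {i::nat. s / l - 3 - 1 / \<eta> < real i \<and> real i < s / l + 2 + 1 / \<eta>}" for s
    define X where "X = (\<Union>r<2 ^ N. \<Union>s\<in>T r. near s)"
    have fn: "finite (near s)" "card (near s) \<le> Z" for s
      using card_nat_real_interval[of "s / l - 3 - 1 / \<eta>" "s / l + 2 + 1 / \<eta>"] by (auto simp: near_def Z_def)
    have X1: "finite X" using T(1) fn by (auto simp: X_def)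
    have X2: "card X \<le> N0"
    proof -
      have 1: "card (\<Union>s\<in>T r. near s) \<le> (2 ^ d - 1) * Z" if r: "r < 2 ^ N" for r
      proof -
        have "card (\<Union>s\<in>T r. near s) \<le> (\<Sum>s\<in>T r. card (near s))" using T(1)[OF r] by (intro card_UN_le) auto
        also have "\<dots> \<le> (\<Sum>s\<in>T r. Z)" by (intro sum_mono fn)
        also have "\<dots> = card (T r) * Z" by simp
        also have "\<dots> \<le> (2 ^ d - 1) * Z"
        proof (intro mult_right_mono)
          have "(2::nat) ^ k \<le> 2 ^ d" using k(1) by (intro power_increasing) auto
          then show "card (T r) \<le> 2 ^ d - 1" using T(1)[OF r] by linarith
        qed auto
        finally show ?thesis .
      qed
      have "card X \<le> (\<Sum>r<2 ^ N. card (\<Union>s\<in>T r. near s))" unfolding X_def by (intro card_UN_le) auto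
      also have "\<dots> \<le> (\<Sum>r<(2::nat) ^ N. (2 ^ d - 1) * Z)" by (intro sum_mono 1) auto
      also have "\<dots> = N0" by (simp add: N0_def)
      finally show ?thesis .
    qed
    show "\<exists>X. finite X \<and> card X \<le> N0 \<and> (\<forall>i. i \<notin> X \<longrightarrow> real i * l \<le> 1 \<longrightarrow> (\<forall>M. (\<forall>p\<in>star (real i * l) y l. \<bar>h 0 0 p\<bar> \<le> M) \<longrightarrow>
        (\<forall>p\<in>star (real i * l) y l. \<bar>h 1 0 p\<bar> * l \<le> e * M)))"
    proof (intro exI[of _ X] conjI X1 X2 allI impI ballI)
      fix i M p
      assume i: "i \<notin> X" "real i * l \<le> 1" and M: "\<forall>p\<in>star (real i * l) y l. \<bar>h 0 0 p\<bar> \<le> M"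
        and p: "p \<in> star (real i * l) y l"
      have x0: "0 \<le> real i * l" using l by simp
      note sub = star_subset[OF x0 i(2) y l(1) ll(2)]
      obtain x z where xz: "p = (x, z)" by fastforce
      have x: "x \<in> {real i * l - 2 * l..real i * l + 3 * l}" and z: "z \<in> {y - 2 * l..(y - 2 * l) + 5 * l}"
        using p by (auto simp: xz star_def)
      have M0: "M \<ge> 0" using M p by force
      have x12: "x \<in> {-1..2}" using sub p xz by auto
      have node: "\<bar>h 1 0 (x, yr r)\<bar> \<le> 3 ^ d * (\<eta> / l) * M" if r: "r < 2 ^ N" for r
      proof -
        have far: "\<bar>x - s\<bar> \<ge> 1 / (\<eta> / l)" if s: "s \<in> T r" for s
        proof (rule ccontr)
          assume "\<not> ?thesis"
          then have "\<bar>x - s\<bar> < l / \<eta>" by simp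
          then have "s < real i * l + 3 * l + l / \<eta>" "real i * l - 2 * l - l / \<eta> < s" using x by auto
          then have "s / l < (real i * l + 3 * l + l / \<eta>) / l" "(real i * l - 2 * l - l / \<eta>) / l < s / l"
            using l by (simp_all add: divide_strict_right_mono)
          moreover have "(real i * l + 3 * l + l / \<eta>) / l = real i + 3 + 1 / \<eta>" "(real i * l - 2 * l - l / \<eta>) / l = real i - 2 - 1 / \<eta>"
            using l by (simp_all add: add_divide_distrib diff_divide_distrib)
          ultimately have "s / l < real i + 3 + 1 / \<eta>" "real i - 2 - 1 / \<eta> < s / l" by simp_all
          then have "i \<in> near s" by (simp add: near_def)
          then show False using i(1) s r by (auto simp: X_def)
        qed
        have "(x, yr r) \<in> star (real i * l) y l" using x yr(1)[OF r] by (auto simp: star_def)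
        then have hM: "\<bar>h 0 0 (x, yr r)\<bar> \<le> M" using M by blast
        have "\<bar>h 1 0 (x, yr r)\<bar> \<le> 3 ^ k * (\<eta> / l) * \<bar>h 0 0 (x, yr r)\<bar>"
          using T(2)[OF r x12] far by blast
        also have "\<dots> \<le> 3 ^ d * (\<eta> / l) * M"
          using k(1) \<eta> l hM by (intro mult_mono power_increasing) auto
        finally show ?thesis .
      qed
      \<comment> \<open>With \<open>N = d + 3\<close> the remainder, multiplied by l, is of order
        l^(d+4). This is small against M, which is at least \<open>c1 * l ^ d\<close>.\<close>
      have "\<bar>h 1 0 (x, z)\<bar> * (5 * l) ^ 0 \<le> K * (3 ^ d * (\<eta> / l) * M + A * (5 * l) ^ N)"
        unfolding K_def
      proof (rule equidistant_node_bound[where f = "\<lambda>j t. h 1 j (x, t)" and a = "y - 2 * l" and L = "5 * l"])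
        fix t assume "t \<in> {y - 2 * l..y - 2 * l + 5 * l}"
        then have "(x, t) \<in> star (real i * l) y l" using x by (auto simp: star_def)
        then have t: "(x, t) \<in> {-1..2} \<times> {-1..2}" using sub by blast
        then show "((\<lambda>t. h 1 j (x, t)) has_real_derivative h 1 (Suc j) (x, t)) (at t)" for j
          using U(1) by (intro jet_dy[OF U(2)]) blast
        show "\<bar>h 1 N (x, t)\<bar> \<le> A" using finite_order_boxD(2)[OF h _ t, of 1 N] by (simp add: N_def)
      next
        fix r :: nat assume "r < 2 ^ N"
        then show "\<bar>h 1 0 (x, y - 2 * l + real r * (5 * l / 2 ^ N))\<bar> \<le> 3 ^ d * (\<eta> / l) * M"
          using node by (simp add: yr_def)
      qed (use l M0 \<eta> A z in auto)
      then have "\<bar>h 1 0 p\<bar> * l \<le> K * (3 ^ d * (\<eta> / l) * M + A * (5 * l) ^ N) * l"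
        using l unfolding xz by (intro mult_right_mono) auto
      also have "\<dots> = K * 3 ^ d * \<eta> * M + K * A * 5 ^ N * l ^ 4 * l ^ d"
      proof -
        have 1: "(5 * l) ^ N * l = 5 ^ N * l ^ 4 * l ^ d"
          by (simp add: N_def power_mult_distrib power_add power4_eq_xxxx power3_eq_cube)
        have 2: "\<eta> / l * l = \<eta>" using l by simp
        have "K * (3 ^ d * (\<eta> / l) * M + A * (5 * l) ^ N) * l = K * 3 ^ d * (\<eta> / l * l) * M + K * A * ((5 * l) ^ N * l)"
          by (simp add: distrib_left distrib_right)
        then show ?thesis unfolding 1 2 by (simp add: mult.assoc)
      qed
      also have "K * 3 ^ d * \<eta> * M = e / 2 * M" using K by (simp add: \<eta>_def)
      also have "K * A * 5 ^ N * l ^ 4 * l ^ d \<le> e / 2 * M"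
      proof -
        have "l ^ 4 \<le> l ^ 1" using l ll(2) by (intro power_decreasing) auto
        then have "K * A * 5 ^ N * l ^ 4 \<le> K * A * 5 ^ N * l" using K A by (intro mult_left_mono) auto
        also have "\<dots> \<le> e / 2 * c1" using ll(4) K A by (simp add: field_simps)
        finally have "K * A * 5 ^ N * l ^ 4 * l ^ d \<le> e / 2 * c1 * l ^ d" using l by (intro mult_right_mono) auto
        also have "\<dots> = e / 2 * (c1 * l ^ d)" by simp
        also have "\<dots> \<le> e / 2 * M"
          using low[OF h x0 i(2) y l(1) ll(1), of M] M e by (intro mult_left_mono) auto
        finally show ?thesis .
      qed
      finally show "\<bar>h 1 0 p\<bar> * l \<le> e * M" by (simp add: field_simps)
    qed
  qed
qed

definition swapj :: "(nat \<Rightarrow> nat \<Rightarrow> real \<times> real \<Rightarrow> real) \<Rightarrow> nat \<Rightarrow> nat \<Rightarrow> real \<times> real \<Rightarrow> real" where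
  "swapj h i j p = h j i (snd p, fst p)"

text \<open>Comparing values over the whole star, rather than over the square, makes the property
  pass to smaller squares whose stars lie inside.\<close>

definition good_square :: "(nat \<Rightarrow> nat \<Rightarrow> real \<times> real \<Rightarrow> real) \<Rightarrow> real \<Rightarrow> real \<Rightarrow> real \<Rightarrow> bool" where
  "good_square h x y l \<longleftrightarrow> (\<forall>p\<in>star x y l. \<forall>q\<in>star x y l. \<bar>h 0 0 p\<bar> \<le> 2 * \<bar>h 0 0 q\<bar>)"

lemma jet_scale: "jet U g \<Longrightarrow> jet U (\<lambda>i j p. c * g i j p)"
  using jet_shift_diff[of U g c 0 0 0 0 0] by simp

text \<open>On a good square |H| is comparable to a single number \<sigma>, which by
  \<open>sup_lower_bound\<close> is at least a multiple of l^d. The node bound in x then yields the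
  scale-invariant bounds on two x-derivatives that \<open>box_estimate\<close> requires, because its
  remainder of order l^(d+3) is absorbed by \<sigma>.\<close>

lemma good_square_estimate:
  fixes d :: nat and A c :: real
  assumes A: "A > 0" and c: "c > 0"
  shows "\<exists>C>0. \<exists>l1>0. \<forall>U g. jet U g \<longrightarrow> {-1..2} \<times> {-1..2} \<subseteq> U \<longrightarrow> g 0 0 \<in> borel_measurable borel \<longrightarrow>
     finite_order_box d A c (hjet g) \<longrightarrow> (\<forall>lam x y l f1 f2 f3. lam \<noteq> 0 \<longrightarrow> 0 \<le> x \<longrightarrow> x \<le> 1 \<longrightarrow> 0 \<le> y \<longrightarrow> y \<le> 1 \<longrightarrow>
     0 < l \<longrightarrow> l \<le> l1 \<longrightarrow> good_square (hjet g) x y l \<longrightarrow> bfun f1 \<longrightarrow> bfun f2 \<longrightarrow> bfun f3 \<longrightarrow>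
     (\<forall>t. f1 t \<noteq> 0 \<longrightarrow> t \<in> {x..x + l}) \<longrightarrow> (\<forall>t. f2 t \<noteq> 0 \<longrightarrow> t \<in> {y..y + l}) \<longrightarrow>
     (norm (trif (\<lambda>p. lam * g 0 0 p) f1 f2 f3))\<^sup>2 \<le> C * (\<bar>lam\<bar> * l ^ d) powr (-1/3) * (nsq f1 * nsq f2 * nsq f3))"
proof -
  define N where "N = d + 3"
  define K where "K = nodeK N"
  have K: "K \<ge> 1" by (simp add: K_def nodeK_ge_1)
  obtain c1 l0 where c1: "c1 > 0" "l0 > 0" and low0: "\<forall>h. finite_order_box d A c h \<longrightarrow> (\<forall>x y l M. 0 \<le> x \<longrightarrow> x \<le> 1 \<longrightarrow> 0 \<le> y \<longrightarrow> y \<le> 1 \<longrightarrow> 0 < l \<longrightarrow> l \<le> l0 \<longrightarrow>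
     (\<forall>p\<in>star x y l. \<bar>h 0 0 p\<bar> \<le> M) \<longrightarrow> c1 * l ^ d \<le> M)"
    using sup_lower_bound[OF A c, of d] by (elim exE conjE)
  note low = low0[rule_format]
  define A' where "A' = K * (4 + 4 * A * 5 ^ N / c1)"
  have A': "A' > 0" using K A c1 by (simp add: A'_def add_pos_pos)
  define C where "C = (2 + sqrt (boxK A' * pi)) * (c1 / 4) powr (-1/3)"
  have bK: "boxK A' \<ge> 0" using A' by (simp add: boxK_def)
  have C: "C > 0" using c1 bK by (simp add: C_def add_pos_nonneg)
  define l1 where "l1 = min l0 (1 / 3)"
  have l1: "l1 > 0" using c1 by (simp add: l1_def)
  show ?thesis
  proof (rule exI[of _ C], rule conjI[OF C], rule exI[of _ l1], intro conjI l1 allI impI)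
    fix U g lam x y l and f1 f2 f3 :: "real \<Rightarrow> complex"
    assume g: "jet U g" and U: "{-1..2} \<times> {-1..2} \<subseteq> U" and gm: "g 0 0 \<in> borel_measurable borel"
      and h: "finite_order_box d A c (hjet g)" and lam: "lam \<noteq> (0::real)" and xy: "0 \<le> x" "x \<le> 1" "0 \<le> y" "y \<le> (1::real)"
      and l: "0 < l" "l \<le> l1" and good: "good_square (hjet g) x y l" and f: "bfun f1" "bfun f2" "bfun f3"
      and supp: "\<forall>t. f1 t \<noteq> 0 \<longrightarrow> t \<in> {x..x + l}" "\<forall>t. f2 t \<noteq> 0 \<longrightarrow> t \<in> {y..y + l}"
    have ll: "l \<le> l0" "l \<le> 1 / 3" using l by (auto simp: l1_def)
    note sub = star_subset[OF xy l(1) ll(2)]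
    let ?h = "hjet g"
    have jh: "jet U ?h" by (rule jet_hjet[OF g])
    \<comment> \<open>With half the value at the corner, goodness confines |H| to the range from
      \<sigma> to 4 \<sigma> on the star.\<close>
    define \<sigma> where "\<sigma> = \<bar>?h 0 0 (x, y)\<bar> / 2"
    have xy_in: "(x, y) \<in> star x y l" using l by (auto simp: star_def)
    have up: "\<bar>?h 0 0 p\<bar> \<le> 4 * \<sigma>" and dn: "\<sigma> \<le> \<bar>?h 0 0 p\<bar>" if "p \<in> star x y l" for p
      using good xy_in that unfolding good_square_def \<sigma>_def by fastforce+
    have "c1 * l ^ d \<le> 4 * \<sigma>" by (rule low[OF h xy l(1) ll(1)]) (rule up)
    then have \<sigma>l: "c1 / 4 * l ^ d \<le> \<sigma>" by simp
    have \<sigma>: "\<sigma> > 0"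
    proof -
      have "0 < c1 / 4 * l ^ d" using c1 l by simp
      then show ?thesis using \<sigma>l by linarith
    qed
    have der: "\<bar>?h j 0 p\<bar> * (5 * l) ^ j \<le> A' * \<sigma>" if p: "p \<in> star x y l" and j: "j \<le> 2" for j p
    proof -
      obtain t z where tz: "p = (t, z)" by fastforce
      have t: "t \<in> {x - 2 * l..x - 2 * l + 5 * l}" and z: "z \<in> {y - 2 * l..y + 3 * l}" using p by (auto simp: tz star_def)
      have inst: "(s, z) \<in> star x y l" if "s \<in> {x - 2 * l..x - 2 * l + 5 * l}" for s
        using that z by (auto simp: star_def)
      have "\<bar>?h j 0 (t, z)\<bar> * (5 * l) ^ j \<le> K * (4 * \<sigma> + A * (5 * l) ^ N)"
        unfolding K_def
      proof (rule equidistant_node_bound[where f = "\<lambda>j s. ?h j 0 (s, z)" and a = "x - 2 * l" and L = "5 * l"])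
        fix s assume s: "s \<in> {x - 2 * l..x - 2 * l + 5 * l}"
        show "((\<lambda>s. ?h j 0 (s, z)) has_real_derivative ?h (Suc j) 0 (s, z)) (at s)" for j
          using inst[OF s] sub U by (intro jet_dx[OF jh]) blast
        show "\<bar>?h N 0 (s, z)\<bar> \<le> A"
        proof (rule finite_order_boxD(2)[OF h])
          show "(s, z) \<in> {-1..2} \<times> {-1..2}" using inst[OF s] sub by blast
        qed (simp add: N_def)
      next
        fix r :: nat assume "r < 2 ^ N"
        then have "real r \<le> 2 ^ N" by (metis less_imp_le of_nat_le_iff of_nat_numeral of_nat_power)
        then have "real r * (5 * l / 2 ^ N) \<le> 2 ^ N * (5 * l / 2 ^ N)" using l by (intro mult_right_mono) auto
        then have "x - 2 * l + real r * (5 * l / 2 ^ N) \<in> {x - 2 * l..x - 2 * l + 5 * l}" using l by auto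
        then show "\<bar>?h 0 0 (x - 2 * l + real r * (5 * l / 2 ^ N), z)\<bar> \<le> 4 * \<sigma>" by (rule up[OF inst])
      qed (use l A \<sigma> t j in \<open>auto simp: N_def\<close>)
      also have "A * (5 * l) ^ N \<le> (4 * A * 5 ^ N / c1) * \<sigma>"
      proof -
        have "l ^ N \<le> l ^ d" using l ll(2) by (intro power_decreasing) (auto simp: N_def)
        also have "\<dots> \<le> 4 / c1 * \<sigma>" using \<sigma>l c1 by (simp add: field_simps)
        finally have "A * 5 ^ N * l ^ N \<le> A * 5 ^ N * (4 / c1 * \<sigma>)" using A by (intro mult_left_mono) auto
        then show ?thesis by (simp add: power_mult_distrib mult_ac)
      qed
      also have "K * (4 * \<sigma> + (4 * A * 5 ^ N / c1) * \<sigma>) = A' * \<sigma>" by (simp add: A'_def algebra_simps)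
      finally show ?thesis using K by (simp add: tz)
    qed
    let ?g = "\<lambda>i j p. lam * g i j p"
    have hs: "hjet ?g i j p = lam * ?h i j p" for i j p by (simp add: hjet_def algebra_simps)
    have "(norm (trif (?g 0 0) f1 f2 f3))\<^sup>2 \<le> (2 + sqrt (boxK A' * pi)) * (\<bar>lam\<bar> * \<sigma>) powr (-1/3) * (nsq f1 * nsq f2 * nsq f3)"
    proof (rule box_estimate[where g = ?g and U = U and l = l and ?x0.0 = x and ?y0.0 = y])
      show "jet U ?g" by (rule jet_scale[OF g])
      show "?g 0 0 \<in> borel_measurable borel" using gm by measurable
      fix t z assume "t \<in> {x - 2 * l..x + 3 * l}" "z \<in> {y..y + l}"
      then have p: "(t, z) \<in> star x y l" using l by (auto simp: star_def)
      have "\<bar>?h 1 0 (t, z)\<bar> * l \<le> A' * \<sigma>"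
      proof -
        have "\<bar>?h 1 0 (t, z)\<bar> * l \<le> \<bar>?h 1 0 (t, z)\<bar> * (5 * l) ^ 1" using l by (intro mult_left_mono) auto
        then show ?thesis using der[OF p, of 1] by linarith
      qed
      then have d1: "\<bar>?h 1 0 (t, z)\<bar> \<le> A' * \<sigma> / l" using l by (simp add: field_simps)
      have "\<bar>?h 2 0 (t, z)\<bar> * l\<^sup>2 \<le> A' * \<sigma>"
      proof -
        have "l\<^sup>2 \<le> (5 * l)\<^sup>2" using l by (intro power_mono) auto
        then have "\<bar>?h 2 0 (t, z)\<bar> * l\<^sup>2 \<le> \<bar>?h 2 0 (t, z)\<bar> * (5 * l)\<^sup>2" by (intro mult_left_mono) auto
        then show ?thesis using der[OF p, of 2] by linarith
      qed
      then have d2: "\<bar>?h 2 0 (t, z)\<bar> \<le> A' * \<sigma> / l\<^sup>2" using l by (simp add: field_simps)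
      show "(t, z) \<in> U \<and> \<bar>lam\<bar> * \<sigma> \<le> \<bar>hjet ?g 0 0 (t, z)\<bar> \<and> \<bar>hjet ?g 1 0 (t, z)\<bar> \<le> A' * (\<bar>lam\<bar> * \<sigma>) / l \<and> \<bar>hjet ?g 2 0 (t, z)\<bar> \<le> A' * (\<bar>lam\<bar> * \<sigma>) / l\<^sup>2"
      proof (intro conjI)
        show "(t, z) \<in> U" using p sub U by blast
        show "\<bar>lam\<bar> * \<sigma> \<le> \<bar>hjet ?g 0 0 (t, z)\<bar>" unfolding hs abs_mult by (intro mult_left_mono dn p) auto
        show "\<bar>hjet ?g 1 0 (t, z)\<bar> \<le> A' * (\<bar>lam\<bar> * \<sigma>) / l"
          using mult_left_mono[OF d1, of "\<bar>lam\<bar>"] unfolding hs abs_mult by (simp add: mult_ac)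
        show "\<bar>hjet ?g 2 0 (t, z)\<bar> \<le> A' * (\<bar>lam\<bar> * \<sigma>) / l\<^sup>2"
          using mult_left_mono[OF d2, of "\<bar>lam\<bar>"] unfolding hs abs_mult by (simp add: mult_ac)
      qed
    qed (use l \<sigma> lam A' f supp in auto)
    also have "\<dots> \<le> (2 + sqrt (boxK A' * pi)) * ((c1 / 4) powr (-1/3) * (\<bar>lam\<bar> * l ^ d) powr (-1/3)) * (nsq f1 * nsq f2 * nsq f3)"
    proof (intro mult_right_mono mult_left_mono)
      have "(\<bar>lam\<bar> * \<sigma>) powr (-1/3) \<le> (c1 / 4 * (\<bar>lam\<bar> * l ^ d)) powr (-1/3)"
      proof (rule powr_mono2')
        show "0 < c1 / 4 * (\<bar>lam\<bar> * l ^ d)" using c1 l lam by simp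
        show "c1 / 4 * (\<bar>lam\<bar> * l ^ d) \<le> \<bar>lam\<bar> * \<sigma>" using mult_left_mono[OF \<sigma>l, of "\<bar>lam\<bar>"] by (simp add: mult_ac)
      qed simp
      also have "\<dots> = (c1 / 4) powr (-1/3) * (\<bar>lam\<bar> * l ^ d) powr (-1/3)" by (rule powr_mult)
      finally show "(\<bar>lam\<bar> * \<sigma>) powr (-1/3) \<le> (c1 / 4) powr (-1/3) * (\<bar>lam\<bar> * l ^ d) powr (-1/3)" .
    qed (use bK in \<open>auto simp: nsq_nonneg\<close>)
    finally show "(norm (trif (\<lambda>p. lam * g 0 0 p) f1 f2 f3))\<^sup>2 \<le> C * (\<bar>lam\<bar> * l ^ d) powr (-1/3) * (nsq f1 * nsq f2 * nsq f3)"
      by (simp add: C_def mult.assoc)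
  qed
qed

text \<open>The star has side 5 l, so each variable changes h by at most 5 l times M / (20 l), that
  is M / 4. Together with the maximum M this leaves at least M / 2 everywhere; hence the 1/20 in the
  hypotheses.\<close>

lemma gentle_square_good:
  assumes h: "finite_order_box d A c h" and xy: "0 \<le> x" "x \<le> 1" "0 \<le> y" "y \<le> 1" and l: "0 < l" "l \<le> 1 / 3"
    and hx: "\<forall>M. (\<forall>p\<in>star x y l. \<bar>h 0 0 p\<bar> \<le> M) \<longrightarrow> (\<forall>p\<in>star x y l. \<bar>h 1 0 p\<bar> * l \<le> 1/20 * M)"
    and hy: "\<forall>M. (\<forall>p\<in>star x y l. \<bar>h 0 0 p\<bar> \<le> M) \<longrightarrow> (\<forall>p\<in>star x y l. \<bar>h 0 1 p\<bar> * l \<le> 1/20 * M)"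
  shows "good_square h x y l"
proof -
  obtain U where U: "{-1..2} \<times> {-1..2} \<subseteq> U" "jet U h"
    using finite_order_boxD(1)[OF h] by blast
  note sub = star_subset[OF xy l]
  have cont: "continuous_on (star x y l) (\<lambda>p. \<bar>h 0 0 p\<bar>)"
    using sub U(1) by (intro continuous_intros continuous_on_subset[OF jet_cont[OF U(2)]]) blast
  have comp: "compact (star x y l)" unfolding star_def by (intro compact_Times) auto
  have ne: "star x y l \<noteq> {}" using l by (auto simp: star_def)
  obtain pm where pm: "pm \<in> star x y l" "\<forall>p\<in>star x y l. \<bar>h 0 0 p\<bar> \<le> \<bar>h 0 0 pm\<bar>"
    using continuous_attains_sup[OF comp ne cont] by blast
  define M where "M = \<bar>h 0 0 pm\<bar>"
  have M: "\<forall>p\<in>star x y l. \<bar>h 0 0 p\<bar> \<le> M" using pm by (simp add: M_def)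
  have bx: "\<bar>h 1 0 p\<bar> \<le> M / (20 * l)" and by': "\<bar>h 0 1 p\<bar> \<le> M / (20 * l)" if "p \<in> star x y l" for p
  proof -
    have "\<bar>h 1 0 p\<bar> * l \<le> 1/20 * M" "\<bar>h 0 1 p\<bar> * l \<le> 1/20 * M" using hx[rule_format, of M p] hy[rule_format, of M p] M that by auto
    then show "\<bar>h 1 0 p\<bar> \<le> M / (20 * l)" "\<bar>h 0 1 p\<bar> \<le> M / (20 * l)" using l by (simp_all add: field_simps)
  qed
  have osc: "\<bar>h 0 0 p - h 0 0 q\<bar> \<le> M / 2" if p: "p \<in> star x y l" and q: "q \<in> star x y l" for p q
  proof -
    obtain p1 p2 q1 q2 where pq: "p = (p1, p2)" "q = (q1, q2)" by fastforce
    have r: "p1 \<in> {x - 2 * l..x + 3 * l}" "q1 \<in> {x - 2 * l..x + 3 * l}" "p2 \<in> {y - 2 * l..y + 3 * l}" "q2 \<in> {y - 2 * l..y + 3 * l}"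
      using p q by (auto simp: pq star_def)
    have s1: "(t, p2) \<in> star x y l" if "t \<in> {x - 2 * l..x + 3 * l}" for t using r that by (auto simp: star_def)
    have s2: "(q1, t) \<in> star x y l" if "t \<in> {y - 2 * l..y + 3 * l}" for t using r that by (auto simp: star_def)
    have "\<bar>h 0 0 (p1, p2) - h 0 0 (q1, p2)\<bar> \<le> M / (20 * l) * \<bar>p1 - q1\<bar>"
    proof (rule field_differentiable_bound[of "{x - 2 * l..x + 3 * l}" "\<lambda>t. h 0 0 (t, p2)" "\<lambda>t. h 1 0 (t, p2)", simplified real_norm_def])
      fix t assume t: "t \<in> {x - 2 * l..x + 3 * l}"
      have "(t, p2) \<in> U" using s1[OF t] sub U(1) by blast
      then show "((\<lambda>t. h 0 0 (t, p2)) has_real_derivative h 1 0 (t, p2)) (at t within {x - 2 * l..x + 3 * l})"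
        using jet_dx[OF U(2), of t p2 0 0] by (auto intro: has_field_derivative_at_within)
      show "\<bar>h 1 0 (t, p2)\<bar> \<le> M / (20 * l)" by (rule bx[OF s1[OF t]])
    qed (use r in auto)
    also have "\<dots> \<le> M / (20 * l) * (5 * l)" using r l by (intro mult_left_mono) (auto simp: M_def)
    finally have 1: "\<bar>h 0 0 (p1, p2) - h 0 0 (q1, p2)\<bar> \<le> M / 4" using l by simp
    have "\<bar>h 0 0 (q1, p2) - h 0 0 (q1, q2)\<bar> \<le> M / (20 * l) * \<bar>p2 - q2\<bar>"
    proof (rule field_differentiable_bound[of "{y - 2 * l..y + 3 * l}" "\<lambda>t. h 0 0 (q1, t)" "\<lambda>t. h 0 1 (q1, t)", simplified real_norm_def])
      fix t assume t: "t \<in> {y - 2 * l..y + 3 * l}"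
      have "(q1, t) \<in> U" using s2[OF t] sub U(1) by blast
      then show "((\<lambda>t. h 0 0 (q1, t)) has_real_derivative h 0 1 (q1, t)) (at t within {y - 2 * l..y + 3 * l})"
        using jet_dy[OF U(2), of q1 t 0 0] by (auto intro: has_field_derivative_at_within)
      show "\<bar>h 0 1 (q1, t)\<bar> \<le> M / (20 * l)" by (rule by'[OF s2[OF t]])
    qed (use r in auto)
    also have "\<dots> \<le> M / (20 * l) * (5 * l)" using r l by (intro mult_left_mono) (auto simp: M_def)
    finally have "\<bar>h 0 0 (q1, p2) - h 0 0 (q1, q2)\<bar> \<le> M / 4" using l by simp
    then show ?thesis using 1 unfolding pq by linarith
  qed
  show ?thesis unfolding good_square_def
  proof (intro ballI)
    fix p q assume p: "p \<in> star x y l" and q: "q \<in> star x y l"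
    have "\<bar>h 0 0 pm - h 0 0 q\<bar> \<le> M / 2" by (rule osc[OF pm(1) q])
    then have "M / 2 \<le> \<bar>h 0 0 q\<bar>" unfolding M_def by linarith
    then show "\<bar>h 0 0 p\<bar> \<le> 2 * \<bar>h 0 0 q\<bar>" using M[rule_format, OF p] by linarith
  qed
qed

text \<open>A bad square is steep in x or steep in y. Squares of the first kind are few in each row,
  those of the second kind few in each column; the second fact is the first one for
  \<open>swapj h\<close>. The bad squares of a fixed row need not be few altogether.\<close>

lemma few_bad_squares:
  fixes d :: nat and A c :: real
  assumes A: "A > 0" and c: "c > 0"
  shows "\<exists>N0. \<exists>l1>0. (d = 0 \<longrightarrow> N0 = 0) \<and> (\<forall>h l. finite_order_box d A c h \<longrightarrow> finite_order_box d A c (swapj h) \<longrightarrow> 0 < l \<longrightarrow> l \<le> l1 \<longrightarrow>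
     (\<exists>X Y. (\<forall>i. finite (X i) \<and> card (X i) \<le> N0 \<and> finite (Y i) \<and> card (Y i) \<le> N0) \<and>
       (\<forall>i j. real i * l \<le> 1 \<longrightarrow> real j * l \<le> 1 \<longrightarrow> \<not> good_square h (real i * l) (real j * l) l \<longrightarrow> i \<in> X j \<or> j \<in> Y i)))"
proof -
  obtain N0 l1 where N0: "d = 0 \<longrightarrow> N0 = 0" and l1: "l1 > 0" and st: "\<forall>h. finite_order_box d A c h \<longrightarrow> (\<forall>y l. 0 \<le> y \<longrightarrow> y \<le> 1 \<longrightarrow> 0 < l \<longrightarrow> l \<le> l1 \<longrightarrow>
     (\<exists>X. finite X \<and> card X \<le> N0 \<and> (\<forall>i. i \<notin> X \<longrightarrow> real i * l \<le> 1 \<longrightarrow> (\<forall>M. (\<forall>p\<in>star (real i * l) y l. \<bar>h 0 0 p\<bar> \<le> M) \<longrightarrow>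
        (\<forall>p\<in>star (real i * l) y l. \<bar>h 1 0 p\<bar> * l \<le> 1/20 * M)))))"
  proof -
    have "(1/20::real) > 0" by simp
    from few_steep_squares[OF A c this, of d] show thesis using that by (elim exE conjE)
  qed
  have l2: "min l1 (1 / 3) > 0" using l1 by simp
  show ?thesis
  proof (rule exI[of _ N0], rule exI[of _ "min l1 (1/3)"], intro conjI l2 N0 allI impI)
    fix h l assume h: "finite_order_box d A c h" and h': "finite_order_box d A c (swapj h)" and l: "0 < l" "l \<le> min l1 (1 / 3)"
    have l': "l \<le> l1" "l \<le> 1 / 3" using l by auto
    have ex: "\<exists>X. finite X \<and> card X \<le> N0 \<and> (real j * l \<le> 1 \<longrightarrow> (\<forall>i. i \<notin> X \<longrightarrow> real i * l \<le> 1 \<longrightarrow> (\<forall>M. (\<forall>p\<in>star (real i * l) (real j * l) l. \<bar>k 0 0 p\<bar> \<le> M) \<longrightarrow>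
        (\<forall>p\<in>star (real i * l) (real j * l) l. \<bar>k 1 0 p\<bar> * l \<le> 1/20 * M))))" if k: "finite_order_box d A c k" for k and j :: nat
    proof (cases "real j * l \<le> 1")
      case True
      have "0 \<le> real j * l" using l by simp
      from st[rule_format, OF k this True l(1) l'(1)] show ?thesis by blast
    qed (intro exI[of _ "{}"], simp)
    from choice[OF allI[OF ex[OF h]]] obtain X where X: "\<forall>j. finite (X j) \<and> card (X j) \<le> N0 \<and> (real j * l \<le> 1 \<longrightarrow> (\<forall>i. i \<notin> X j \<longrightarrow> real i * l \<le> 1 \<longrightarrow> (\<forall>M. (\<forall>p\<in>star (real i * l) (real j * l) l. \<bar>h 0 0 p\<bar> \<le> M) \<longrightarrow>
        (\<forall>p\<in>star (real i * l) (real j * l) l. \<bar>h 1 0 p\<bar> * l \<le> 1/20 * M))))" ..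
    from choice[OF allI[OF ex[OF h']]] obtain Y where Y: "\<forall>j. finite (Y j) \<and> card (Y j) \<le> N0 \<and> (real j * l \<le> 1 \<longrightarrow> (\<forall>i. i \<notin> Y j \<longrightarrow> real i * l \<le> 1 \<longrightarrow> (\<forall>M. (\<forall>p\<in>star (real i * l) (real j * l) l. \<bar>swapj h 0 0 p\<bar> \<le> M) \<longrightarrow>
        (\<forall>p\<in>star (real i * l) (real j * l) l. \<bar>swapj h 1 0 p\<bar> * l \<le> 1/20 * M))))" ..
    show "\<exists>X Y. (\<forall>i. finite (X i) \<and> card (X i) \<le> N0 \<and> finite (Y i) \<and> card (Y i) \<le> N0) \<and>
       (\<forall>i j. real i * l \<le> 1 \<longrightarrow> real j * l \<le> 1 \<longrightarrow> \<not> good_square h (real i * l) (real j * l) l \<longrightarrow> i \<in> X j \<or> j \<in> Y i)"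
    proof (rule exI[of _ X], rule exI[of _ Y], intro conjI allI impI)
      fix i j :: nat
      assume ij: "real i * l \<le> 1" "real j * l \<le> 1" and bad: "\<not> good_square h (real i * l) (real j * l) l"
      show "i \<in> X j \<or> j \<in> Y i"
      proof (rule ccontr)
        assume "\<not> ?thesis"
        then have nX: "i \<notin> X j" and nY: "j \<notin> Y i" by auto
        have "good_square h (real i * l) (real j * l) l"
        proof (rule gentle_square_good[OF h _ ij(1) _ ij(2) l(1) l'(2)])
          show "\<forall>M. (\<forall>p\<in>star (real i * l) (real j * l) l. \<bar>h 0 0 p\<bar> \<le> M) \<longrightarrow> (\<forall>p\<in>star (real i * l) (real j * l) l. \<bar>h 1 0 p\<bar> * l \<le> 1/20 * M)"
            by (rule mp[OF conjunct2[OF conjunct2[OF spec[OF X, of j]]] ij(2), THEN spec[of _ i], THEN mp, OF nX, THEN mp, OF ij(1)])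
          show "\<forall>M. (\<forall>p\<in>star (real i * l) (real j * l) l. \<bar>h 0 0 p\<bar> \<le> M) \<longrightarrow> (\<forall>p\<in>star (real i * l) (real j * l) l. \<bar>h 0 1 p\<bar> * l \<le> 1/20 * M)"
          proof (intro allI impI ballI)
            fix M p assume M: "\<forall>p\<in>star (real i * l) (real j * l) l. \<bar>h 0 0 p\<bar> \<le> M" and p: "p \<in> star (real i * l) (real j * l) l"
            have sw: "(snd q, fst q) \<in> star y x l \<longleftrightarrow> q \<in> star x y l" for q x y by (cases q) (auto simp: star_def)
            have "\<forall>q\<in>star (real j * l) (real i * l) l. \<bar>swapj h 0 0 q\<bar> \<le> M"
              using M sw by (auto simp: swapj_def)
            then have "\<forall>q\<in>star (real j * l) (real i * l) l. \<bar>swapj h 1 0 q\<bar> * l \<le> 1/20 * M"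
              by (rule mp[OF conjunct2[OF conjunct2[OF spec[OF Y, of i]]] ij(1), THEN spec[of _ j], THEN mp, OF nY, THEN mp, OF ij(2), THEN spec, THEN mp])
            moreover have "(snd p, fst p) \<in> star (real j * l) (real i * l) l" using p sw by blast
            ultimately have "\<bar>swapj h 1 0 (snd p, fst p)\<bar> * l \<le> 1/20 * M" by blast
            then show "\<bar>h 0 1 p\<bar> * l \<le> 1/20 * M" by (simp add: swapj_def)
          qed
        qed (use l in auto)
        then show False using bad by simp
      qed
    qed (use X Y in auto)
  qed
qed

section \<open>Decomposition of the form over grids\<close>

text \<open>Half-open intervals make adjacent pieces add up exactly, with no endpoint counted
  twice.\<close>

definition clip :: "real \<Rightarrow> real \<Rightarrow> (real \<Rightarrow> complex) \<Rightarrow> real \<Rightarrow> complex" where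
  "clip a b f x = (if a \<le> x \<and> x < b then f x else 0)"

lemma bfun_clip: "bfun f \<Longrightarrow> bfun (clip a b f)"
  by (rule bfun_dominated[where C = 1 and g = f]) (auto simp: clip_def[abs_def] dest: bfun_measurable)

lemma clip_nonzeroD: "clip a b f x \<noteq> 0 \<Longrightarrow> a \<le> x \<and> x < b \<and> f x \<noteq> 0"
  by (auto simp: clip_def split: if_splits)

lemma nsq_clip_add:
  assumes "bfun f" "a \<le> b" "b \<le> c"
  shows "nsq (clip a b f) + nsq (clip b c f) = nsq (clip a c f)"
proof -
  have "nsq (clip a b f) + nsq (clip b c f) = (LINT x|lborel. (norm (clip a b f x))\<^sup>2 + (norm (clip b c f x))\<^sup>2)"
    unfolding nsq_def by (simp add: bfun_nsq_integrable bfun_clip assms)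
  also have "\<dots> = nsq (clip a c f)"
    unfolding nsq_def by (rule Bochner_Integration.integral_cong) (use assms in \<open>auto simp: clip_def\<close>)
  finally show ?thesis .
qed

lemma nsq_clip_le: "bfun f \<Longrightarrow> nsq (clip a b f) \<le> nsq f"
  unfolding nsq_def by (intro integral_mono bfun_nsq_integrable bfun_clip) (auto simp: clip_def)

lemma clip_empty: "b \<le> a \<Longrightarrow> clip a b f = (\<lambda>_. 0)"
  by (auto simp: clip_def fun_eq_iff)

lemma sum_nsq_clip:
  assumes "bfun f" "h \<ge> 0"
  shows "(\<Sum>i<n. nsq (clip (a + real i * h) (a + real (Suc i) * h) f)) \<le> nsq f"
proof -
  have "(\<Sum>i<n. nsq (clip (a + real i * h) (a + real (Suc i) * h) f)) = nsq (clip a (a + real n * h) f)"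
  proof (induction n)
    case (Suc n)
    have "nsq (clip a (a + real n * h) f) + nsq (clip (a + real n * h) (a + real (Suc n) * h) f) = nsq (clip a (a + real (Suc n) * h) f)"
      by (rule nsq_clip_add) (use assms in \<open>auto simp: distrib_right\<close>)
    then show ?case by (simp add: Suc del: of_nat_Suc)
  qed (simp add: nsq_def clip_empty)
  then show ?thesis using nsq_clip_le[OF assms(1)] by simp
qed

lemma trif_add:
  assumes S: "S \<in> borel_measurable borel" and f: "bfun f1" "bfun f1'" "bfun f2" "bfun f2'" "bfun f3"
  shows "trif S (\<lambda>x. f1 x + f1' x) f2 f3 = trif S f1 f2 f3 + trif S f1' f2 f3"
    "trif S f1 (\<lambda>x. f2 x + f2' x) f3 = trif S f1 f2 f3 + trif S f1 f2' f3"
  unfolding trif_def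
  by (subst Bochner_Integration.integral_add[symmetric]; (intro bfun_integrable bfun_trif S f Bochner_Integration.integral_cong refl)?; simp add: algebra_simps)+

lemma trif_clip_add:
  assumes S: "S \<in> borel_measurable borel" and f: "bfun f1" "bfun f2" "bfun f3" and "a \<le> b" "b \<le> c"
  shows "trif S (clip a c f1) f2 f3 = trif S (clip a b f1) f2 f3 + trif S (clip b c f1) f2 f3"
    "trif S f1 (clip a c f2) f3 = trif S f1 (clip a b f2) f3 + trif S f1 (clip b c f2) f3"
proof -
  have e: "clip a c f = (\<lambda>x. clip a b f x + clip b c f x)" for f using assms(5,6) by (auto simp: clip_def fun_eq_iff)
  show "trif S (clip a c f1) f2 f3 = trif S (clip a b f1) f2 f3 + trif S (clip b c f1) f2 f3"
    unfolding e by (rule trif_add(1)[OF S bfun_clip[OF f(1)] bfun_clip[OF f(1)] f(2) f(2) f(3)])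
  show "trif S f1 (clip a c f2) f3 = trif S f1 (clip a b f2) f3 + trif S f1 (clip b c f2) f3"
    unfolding e by (rule trif_add(2)[OF S f(1) f(1) bfun_clip[OF f(2)] bfun_clip[OF f(2)] f(3)])
qed

lemma trif_zero: "trif S (\<lambda>_. 0) f2 f3 = 0" "trif S f1 (\<lambda>_. 0) f3 = 0"
  by (simp_all add: trif_def)

lemma trif_sum_clip:
  assumes S: "S \<in> borel_measurable borel" and f: "bfun f1" "bfun f2" "bfun f3" and h: "h \<ge> 0"
  shows "trif S (clip a (a + real n * h) f1) f2 f3 = (\<Sum>i<n. trif S (clip (a + real i * h) (a + real (Suc i) * h) f1) f2 f3)"
    "trif S f1 (clip a (a + real n * h) f2) f3 = (\<Sum>i<n. trif S f1 (clip (a + real i * h) (a + real (Suc i) * h) f2) f3)"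
proof -
  have le: "a \<le> a + real n * h" "a + real n * h \<le> a + real (Suc n) * h" for n using h by (auto simp: distrib_right)
  show "trif S (clip a (a + real n * h) f1) f2 f3 = (\<Sum>i<n. trif S (clip (a + real i * h) (a + real (Suc i) * h) f1) f2 f3)"
    by (induction n) (simp_all add: trif_zero clip_empty trif_clip_add(1)[OF S f le] del: of_nat_Suc)
  show "trif S f1 (clip a (a + real n * h) f2) f3 = (\<Sum>i<n. trif S f1 (clip (a + real i * h) (a + real (Suc i) * h) f2) f3)"
    by (induction n) (simp_all add: trif_zero clip_empty trif_clip_add(2)[OF S f le] del: of_nat_Suc)
qed

text \<open>Restricting the third function to the sum of the two intervals costs nothing and
  supplies the orthogonality in x + y.\<close>

lemma trif_clip3:
  assumes "\<And>x. f1 x \<noteq> 0 \<Longrightarrow> a \<le> x \<and> x < b" "\<And>x. f2 x \<noteq> 0 \<Longrightarrow> a' \<le> x \<and> x < b'"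
  shows "trif S f1 f2 f3 = trif S f1 f2 (clip (a + a') (b + b') f3)"
  unfolding trif_def
proof (rule Bochner_Integration.integral_cong[OF refl])
  fix p :: "real \<times> real"
  show "cis (S p) * (f1 (fst p) * f2 (snd p) * f3 (fst p + snd p)) =
    cis (S p) * (f1 (fst p) * f2 (snd p) * clip (a + a') (b + b') f3 (fst p + snd p))"
    using assms(1)[of "fst p"] assms(2)[of "snd p"] by (cases "f1 (fst p) = 0"; cases "f2 (snd p) = 0") (auto simp: clip_def)
qed

text \<open>Cauchy-Schwarz in y at fixed x, where the norm of \<open>f3\<close> is translation
  invariant, leaves the integral of |f1|; a second application on an interval of length
  \<open>l\<close> finishes.\<close>

lemma trif_trivial:
  assumes S: "S \<in> borel_measurable borel" and f: "bfun f1" "bfun f2" "bfun f3"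
    and supp: "\<And>x. f1 x \<noteq> 0 \<Longrightarrow> x \<in> {a..a + l}" and l: "l \<ge> 0"
  shows "(norm (trif S f1 f2 f3))\<^sup>2 \<le> l * (nsq f1 * nsq f2 * nsq f3)"
proof -
  have b: "bfun (\<lambda>p. norm (f1 (fst p) * f2 (snd p) * f3 (fst p + snd p)))"
    using bfun_norm[OF bfun_trif[OF S f]] by (simp add: norm_mult)
  have f3s: "bfun (\<lambda>y. f3 (x + y))" for x
  proof -
    note [measurable] = bfun_measurable[OF f(3)]
    obtain B where B: "B > 0" "\<And>x. norm (f3 x) \<le> B" "\<And>x. norm x > B \<Longrightarrow> f3 x = 0" using bfunD[OF f(3)] by blast
    show ?thesis
    proof (rule bfunI[where B = B and R = "B + \<bar>x\<bar>"])
      show "f3 (x + y) = 0" if "norm y > B + \<bar>x\<bar>" for y by (rule B(3)) (use that in auto)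
    qed (use B(2) in auto)
  qed
  have "norm (trif S f1 f2 f3) \<le> (LINT p|lborel. norm (f1 (fst p) * f2 (snd p) * f3 (fst p + snd p)))"
    unfolding trif_def using Bochner_Integration.integral_norm_bound[of lborel "\<lambda>p. cis (S p) * (f1 (fst p) * f2 (snd p) * f3 (fst p + snd p))"]
    by (simp add: norm_mult)
  also have "\<dots> = (LINT x|lborel. LINT y|lborel. norm (f1 x) * norm (f2 y * f3 (x + y)))"
    using bfun_Fubini(1)[OF b] by (simp add: norm_mult mult.assoc)
  also have "\<dots> \<le> (LINT x|lborel. norm (f1 x) * sqrt (nsq f2 * nsq f3))"
  proof (rule integral_mono')
    show "integrable lborel (\<lambda>x. norm (f1 x) * sqrt (nsq f2 * nsq f3))"
      using bfun_integrable[OF bfun_norm[OF f(1)]] by simp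
    fix x
    have f3n: "nsq (\<lambda>y. f3 (x + y)) = nsq f3" using nsq_shift(1)[of f3 x] by (simp add: add.commute)
    have "(LINT y|lborel. norm (f2 y * f3 (x + y)))\<^sup>2 \<le> nsq f2 * nsq (\<lambda>y. f3 (x + y))"
      unfolding nsq_def norm_mult
      by (intro Cauchy_Schwarz_integral bfun_nsq_integrable bfun_integrable bfun_mult bfun_norm f f3s)
    then have "(LINT y|lborel. norm (f2 y * f3 (x + y)))\<^sup>2 \<le> nsq f2 * nsq f3" unfolding f3n .
    then have "(LINT y|lborel. norm (f2 y * f3 (x + y))) \<le> sqrt (nsq f2 * nsq f3)" by (rule real_le_rsqrt)
    then show "(LINT y|lborel. norm (f1 x) * norm (f2 y * f3 (x + y))) \<le> norm (f1 x) * sqrt (nsq f2 * nsq f3)"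
      by (simp add: mult_left_mono)
  qed (simp add: nsq_nonneg)
  also have "\<dots> = (LINT x|lborel. norm (f1 x)) * sqrt (nsq f2 * nsq f3)" by simp
  finally have "(norm (trif S f1 f2 f3))\<^sup>2 \<le> ((LINT x|lborel. norm (f1 x)) * sqrt (nsq f2 * nsq f3))\<^sup>2"
    by (intro power_mono) auto
  also have "\<dots> = (LINT x|lborel. norm (f1 x) * indicator {a..a + l} x)\<^sup>2 * (nsq f2 * nsq f3)"
  proof -
    have "norm (f1 x) * indicator {a..a + l} x = norm (f1 x)" for x using supp[of x] by (auto simp: indicator_def)
    then show ?thesis by (simp only:) (simp add: power_mult_distrib nsq_nonneg)
  qed
  also have "\<dots> \<le> (nsq f1 * l) * (nsq f2 * nsq f3)"
  proof (intro mult_right_mono)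
    have e: "(indicator {a..a + l} x :: real)\<^sup>2 = indicator {a..a + l} x" for x by (simp add: indicator_def)
    have "(LINT x|lborel. norm (f1 x) * indicator {a..a + l} x)\<^sup>2 \<le> nsq f1 * (LINT x|lborel. (indicator {a..a + l} x)\<^sup>2)"
      unfolding nsq_def
    proof (intro Cauchy_Schwarz_integral bfun_nsq_integrable f)
      show "integrable lborel (\<lambda>x. (indicator {a..a + l} x :: real)\<^sup>2)" unfolding e by (rule integrable_indicator_Icc)
      show "integrable lborel (\<lambda>x. norm (f1 x) * indicator {a..a + l} x)"
        by (rule bfun_integrable, rule bfun_mult_bounded(1)[OF bfun_norm[OF f(1)], of _ 1]) (auto simp: indicator_def)
    qed
    then show "(LINT x|lborel. norm (f1 x) * indicator {a..a + l} x)\<^sup>2 \<le> nsq f1 * l" using l unfolding e by simp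
  qed (auto simp: nsq_nonneg)
  finally show ?thesis by (simp add: mult_ac)
qed

text \<open>Cauchy-Schwarz separates \<open>b\<close> from the product of \<open>a\<close> and
  \<open>c\<close>. Sparsity is spent on \<open>b\<close>, each value of which occurs at most
  \<open>N\<close> times. The squares of \<open>a i * c (i + j)\<close> can be summed over the full
  grid, since i and i + j determine j.\<close>

lemma sparse_sum_bound:
  fixes a b c :: "nat \<Rightarrow> real"
  assumes B: "B \<subseteq> {..<n} \<times> {..<n}" and sparse: "\<And>j. j < n \<Longrightarrow> card {i. (i, j) \<in> B} \<le> N"
    and W: "(\<Sum>s<2 * n. (c s)\<^sup>2) \<le> W"
  shows "(\<Sum>(i, j)\<in>B. a i * b j * c (i + j))\<^sup>2 \<le> real N * W * (\<Sum>i<n. (a i)\<^sup>2) * (\<Sum>j<n. (b j)\<^sup>2)"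
proof -
  have fB: "finite B" by (rule finite_subset[OF B]) simp
  have W0: "W \<ge> 0" by (rule order_trans[OF _ W]) (auto intro: sum_nonneg)
  have "(\<Sum>(i, j)\<in>B. a i * b j * c (i + j))\<^sup>2 = (\<Sum>p\<in>B. b (snd p) * (a (fst p) * c (fst p + snd p)))\<^sup>2"
    by (simp add: case_prod_beta mult_ac)
  also have "\<dots> \<le> (\<Sum>p\<in>B. (b (snd p))\<^sup>2) * (\<Sum>p\<in>B. (a (fst p) * c (fst p + snd p))\<^sup>2)"
    by (rule Cauchy_Schwarz_ineq_sum)
  also have "\<dots> \<le> (real N * (\<Sum>j<n. (b j)\<^sup>2)) * ((\<Sum>i<n. (a i)\<^sup>2) * W)"
  proof (rule mult_mono)
    have "(\<Sum>p\<in>B. (b (snd p))\<^sup>2) = (\<Sum>j<n. \<Sum>p\<in>{p\<in>B. snd p = j}. (b (snd p))\<^sup>2)"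
      by (rule sum.group[symmetric]) (use fB B in auto)
    also have "\<dots> = (\<Sum>j<n. real (card {i. (i, j) \<in> B}) * (b j)\<^sup>2)"
    proof (rule sum.cong[OF refl])
      fix j
      have "{p\<in>B. snd p = j} = (\<lambda>i. (i, j)) ` {i. (i, j) \<in> B}" by force
      then have "card {p\<in>B. snd p = j} = card {i. (i, j) \<in> B}" by (simp add: card_image inj_on_def)
      moreover have "(\<Sum>p\<in>{p\<in>B. snd p = j}. (b (snd p))\<^sup>2) = (\<Sum>p\<in>{p\<in>B. snd p = j}. (b j)\<^sup>2)" by (rule sum.cong) auto
      ultimately show "(\<Sum>p\<in>{p\<in>B. snd p = j}. (b (snd p))\<^sup>2) = real (card {i. (i, j) \<in> B}) * (b j)\<^sup>2" by simp
    qed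
    also have "\<dots> \<le> (\<Sum>j<n. real N * (b j)\<^sup>2)" by (intro sum_mono mult_right_mono) (use sparse in auto)
    finally show "(\<Sum>p\<in>B. (b (snd p))\<^sup>2) \<le> real N * (\<Sum>j<n. (b j)\<^sup>2)" by (simp add: sum_distrib_left)
    have "(\<Sum>p\<in>B. (a (fst p) * c (fst p + snd p))\<^sup>2) \<le> (\<Sum>p\<in>{..<n} \<times> {..<n}. (a (fst p) * c (fst p + snd p))\<^sup>2)"
      by (intro sum_mono2 B) auto
    also have "\<dots> = (\<Sum>i<n. (a i)\<^sup>2 * (\<Sum>j<n. (c (i + j))\<^sup>2))"
      unfolding sum_distrib_left sum.cartesian_product by (simp add: case_prod_beta power_mult_distrib)
    also have "\<dots> \<le> (\<Sum>i<n. (a i)\<^sup>2 * W)"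
    proof (intro sum_mono mult_left_mono)
      fix i assume i: "i \<in> {..<n}"
      have "(\<Sum>j<n. (c (i + j))\<^sup>2) = (\<Sum>s\<in>(\<lambda>j. i + j) ` {..<n}. (c s)\<^sup>2)" by (subst sum.reindex) auto
      also have "\<dots> \<le> (\<Sum>s<2 * n. (c s)\<^sup>2)" by (rule sum_mono2) (use i in auto)
      finally show "(\<Sum>j<n. (c (i + j))\<^sup>2) \<le> W" using W by linarith
    qed auto
    finally show "(\<Sum>p\<in>B. (a (fst p) * c (fst p + snd p))\<^sup>2) \<le> (\<Sum>i<n. (a i)\<^sup>2) * W" by (simp add: sum_distrib_right)
  qed (auto intro!: sum_nonneg mult_nonneg_nonneg)
  finally show ?thesis by (simp add: mult_ac)
qed

text \<open>The summand 0 is the left end of the grid in \<open>trif_sum_clip\<close> and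
  \<open>sum_nsq_clip\<close>, kept so that the terms match.\<close>

abbreviation dclip :: "real \<Rightarrow> nat \<Rightarrow> (real \<Rightarrow> complex) \<Rightarrow> real \<Rightarrow> complex" where
  "dclip h i f \<equiv> clip (0 + real i * h) (0 + real (Suc i) * h) f"

text \<open>On the piece (i, j) the third function matters on an interval of length 2 h starting at
  (i + j) h. These intervals cover each point at most twice, whence the factor 2. Sparsity in the
  other direction is treated by exchanging the roles of \<open>a\<close> and
  \<open>b\<close>.\<close>

lemma sum_pieces_bound:
  assumes S: "S \<in> borel_measurable borel" and f: "bfun f1" "bfun f2" "bfun f3" and h: "h > 0" and \<beta>: "\<beta> \<ge> 0"
    and B: "B \<subseteq> {..<n} \<times> {..<n}"
    and sparse: "(\<forall>j<n. card {i. (i, j) \<in> B} \<le> N) \<or> (\<forall>i<n. card {j. (i, j) \<in> B} \<le> N)"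
    and est: "\<And>i j F. (i, j) \<in> B \<Longrightarrow> bfun F \<Longrightarrow> (norm (trif S (dclip h i f1) (dclip h j f2) F))\<^sup>2 \<le> \<beta> * (nsq (dclip h i f1) * nsq (dclip h j f2) * nsq F)"
  shows "norm (\<Sum>(i, j)\<in>B. trif S (dclip h i f1) (dclip h j f2) f3) \<le> sqrt (2 * real N * \<beta>) * sqrt (nsq f1 * nsq f2 * nsq f3)"
proof -
  have fB: "finite B" by (rule finite_subset[OF B]) simp
  define a where "a i = sqrt (nsq (dclip h i f1))" for i
  define b where "b j = sqrt (nsq (dclip h j f2))" for j
  define c where "c s = sqrt (nsq (clip (real s * h) (real (s + 2) * h) f3))" for s :: nat
  have a2: "(\<Sum>i<n. (a i)\<^sup>2) \<le> nsq f1" and b2: "(\<Sum>i<n. (b i)\<^sup>2) \<le> nsq f2"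
    using sum_nsq_clip[OF f(1), of h 0 n] sum_nsq_clip[OF f(2), of h 0 n] h by (auto simp: a_def b_def nsq_nonneg)
  have c2: "(\<Sum>s<2 * n. (c s)\<^sup>2) \<le> 2 * nsq f3"
  proof -
    have "(c s)\<^sup>2 = nsq (clip (0 + real s * h) (0 + real (Suc s) * h) f3) + nsq (clip (h + real s * h) (h + real (Suc s) * h) f3)" for s
      using nsq_clip_add[OF f(3), of "real s * h" "real (Suc s) * h" "real (s + 2) * h"] h
      by (simp add: c_def nsq_nonneg algebra_simps)
    then have "(\<Sum>s<2 * n. (c s)\<^sup>2) = (\<Sum>s<2 * n. nsq (clip (0 + real s * h) (0 + real (Suc s) * h) f3)) + (\<Sum>s<2 * n. nsq (clip (h + real s * h) (h + real (Suc s) * h) f3))"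
      by (simp add: sum.distrib)
    then show ?thesis using sum_nsq_clip[OF f(3), of h 0 "2 * n"] sum_nsq_clip[OF f(3), of h h "2 * n"] h by linarith
  qed
  have one: "norm (trif S (dclip h i f1) (dclip h j f2) f3) \<le> sqrt \<beta> * (a i * b j * c (i + j))" if ij: "(i, j) \<in> B" for i j
  proof -
    let ?F = "clip (real (i + j) * h) (real (i + j + 2) * h) f3"
    have "trif S (dclip h i f1) (dclip h j f2) f3 = trif S (dclip h i f1) (dclip h j f2) (clip (0 + real i * h + (0 + real j * h)) (0 + real (Suc i) * h + (0 + real (Suc j) * h)) f3)"
      by (rule trif_clip3) (auto dest: clip_nonzeroD)
    also have "clip (0 + real i * h + (0 + real j * h)) (0 + real (Suc i) * h + (0 + real (Suc j) * h)) f3 = ?F"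
      by (simp add: algebra_simps)
    finally have "(norm (trif S (dclip h i f1) (dclip h j f2) f3))\<^sup>2 \<le> \<beta> * (nsq (dclip h i f1) * nsq (dclip h j f2) * nsq ?F)"
      using est[OF ij bfun_clip[OF f(3)]] by metis
    then have "norm (trif S (dclip h i f1) (dclip h j f2) f3) \<le> sqrt (\<beta> * (nsq (dclip h i f1) * nsq (dclip h j f2) * nsq ?F))"
      by (rule real_le_rsqrt)
    also have "\<dots> = sqrt \<beta> * (a i * b j * c (i + j))" by (simp add: a_def b_def c_def real_sqrt_mult)
    finally show ?thesis .
  qed
  have "norm (\<Sum>(i, j)\<in>B. trif S (dclip h i f1) (dclip h j f2) f3) \<le> (\<Sum>(i, j)\<in>B. sqrt \<beta> * (a i * b j * c (i + j)))"
    by (rule sum_norm_le) (use one in auto)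
  also have "\<dots> = sqrt \<beta> * (\<Sum>(i, j)\<in>B. a i * b j * c (i + j))" by (simp add: sum_distrib_left case_prod_beta)
  also have "\<dots> \<le> sqrt \<beta> * sqrt (2 * real N * (nsq f1 * nsq f2 * nsq f3))"
  proof (intro mult_left_mono real_le_rsqrt)
    have "(\<Sum>(i, j)\<in>B. a i * b j * c (i + j))\<^sup>2 \<le> real N * (2 * nsq f3) * (\<Sum>i<n. (a i)\<^sup>2) * (\<Sum>j<n. (b j)\<^sup>2)"
    proof (rule disjE[OF sparse])
      assume "\<forall>j<n. card {i. (i, j) \<in> B} \<le> N"
      then show ?thesis by (intro sparse_sum_bound[OF B _ c2]) auto
    next
      assume sp: "\<forall>i<n. card {j. (i, j) \<in> B} \<le> N"
      have "(\<Sum>(i, j)\<in>prod.swap ` B. b i * a j * c (i + j))\<^sup>2 \<le> real N * (2 * nsq f3) * (\<Sum>i<n. (b i)\<^sup>2) * (\<Sum>j<n. (a j)\<^sup>2)"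
      proof (rule sparse_sum_bound[OF _ _ c2])
        show "prod.swap ` B \<subseteq> {..<n} \<times> {..<n}" using B by auto
        fix j assume "j < n"
        have "{i. (i, j) \<in> prod.swap ` B} = {i. (j, i) \<in> B}" by force
        then show "card {i. (i, j) \<in> prod.swap ` B} \<le> N" using sp \<open>j < n\<close> by simp
      qed
      moreover have "(\<Sum>(i, j)\<in>prod.swap ` B. b i * a j * c (i + j)) = (\<Sum>(i, j)\<in>B. a i * b j * c (i + j))"
        by (subst sum.reindex) (auto simp: case_prod_beta add.commute mult.commute)
      ultimately show ?thesis by (simp add: mult_ac)
    qed
    also have "\<dots> \<le> real N * (2 * nsq f3) * nsq f1 * nsq f2"
      by (intro mult_mono a2 b2 order_refl) (auto simp: nsq_nonneg intro!: sum_nonneg mult_nonneg_nonneg)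
    finally show "(\<Sum>(i, j)\<in>B. a i * b j * c (i + j))\<^sup>2 \<le> 2 * real N * (nsq f1 * nsq f2 * nsq f3)" by (simp add: mult_ac)
  qed (use \<beta> in auto)
  also have "\<dots> = sqrt (2 * real N * \<beta>) * sqrt (nsq f1 * nsq f2 * nsq f3)" by (simp add: real_sqrt_mult)
  finally show ?thesis .
qed

section \<open>Repeated halving of the bad squares\<close>

lemma power_two_bracket:
  fixes z :: real
  assumes "z \<ge> 1"
  obtains M :: nat where "2 ^ M \<le> z" "z < 2 ^ Suc M"
proof -
  have ex: "\<exists>n. z < 2 ^ n" using real_arch_pow[of 2 z] by simp
  define n where "n = (LEAST n. z < 2 ^ n)"
  have n: "z < 2 ^ n" unfolding n_def by (rule LeastI_ex[OF ex])
  have "n \<noteq> 0" using n assms by (cases n) auto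
  then obtain M where M: "n = Suc M" by (cases n) auto
  have "\<not> z < 2 ^ M"
    using not_less_Least[of M "\<lambda>n. z < 2 ^ n"] M unfolding n_def by simp
  then show thesis using that[of M] n M by simp
qed

lemma card_div_two_preimage:
  fixes X :: "nat set"
  assumes "finite X"
  shows "card {i. i div 2 \<in> X} \<le> 2 * card X" "finite {i. i div 2 \<in> X}"
proof -
  have sub: "{i. i div 2 \<in> X} \<subseteq> (\<lambda>k. 2 * k) ` X \<union> (\<lambda>k. 2 * k + 1) ` X"
  proof
    fix i assume i: "i \<in> {i. i div 2 \<in> X}"
    have "i = 2 * (i div 2) \<or> i = 2 * (i div 2) + 1" by presburger
    then show "i \<in> (\<lambda>k. 2 * k) ` X \<union> (\<lambda>k. 2 * k + 1) ` X" using i by auto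
  qed
  have fin: "finite ((\<lambda>k. 2 * k) ` X \<union> (\<lambda>k. 2 * k + 1) ` X)" using assms by simp
  show "finite {i. i div 2 \<in> X}" by (rule finite_subset[OF sub fin])
  have "card {i. i div 2 \<in> X} \<le> card ((\<lambda>k. 2 * k) ` X \<union> (\<lambda>k. 2 * k + 1) ` X)" by (rule card_mono[OF fin sub])
  also have "\<dots> \<le> card ((\<lambda>k. 2 * k) ` X) + card ((\<lambda>k. 2 * k + 1) ` X)" by (rule card_Un_le)
  also have "\<dots> \<le> card X + card X" by (intro add_mono card_image_le assms)
  finally show "card {i. i div 2 \<in> X} \<le> 2 * card X" by simp
qed

lemma dclip_split:
  "h' = h / 2 \<Longrightarrow> 0 \<le> h \<Longrightarrow> bfun f1 \<Longrightarrow> bfun f2 \<Longrightarrow> bfun f3 \<Longrightarrow> S \<in> borel_measurable borel \<Longrightarrow>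
   trif S (dclip h i f1) f2 f3 = trif S (dclip h' (2 * i) f1) f2 f3 + trif S (dclip h' (2 * i + 1) f1) f2 f3"
  "h' = h / 2 \<Longrightarrow> 0 \<le> h \<Longrightarrow> bfun f1 \<Longrightarrow> bfun f2 \<Longrightarrow> bfun f3 \<Longrightarrow> S \<in> borel_measurable borel \<Longrightarrow>
   trif S f1 (dclip h i f2) f3 = trif S f1 (dclip h' (2 * i) f2) f3 + trif S f1 (dclip h' (2 * i + 1) f2) f3"
proof -
  assume h: "h' = h / 2" "0 \<le> h" and f: "bfun f1" "bfun f2" "bfun f3" and S: "S \<in> borel_measurable borel"
  have e: "dclip h i f = clip (real i * h) (real i * h + h) f" "dclip h' (2 * i) f = clip (real i * h) (real i * h + h / 2) f"
    "dclip h' (2 * i + 1) f = clip (real i * h + h / 2) (real i * h + h) f" for f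
  proof -
    have pts: "0 + real i * h = real i * h" "0 + real (Suc i) * h = real i * h + h"
      "0 + real (2 * i) * h' = real i * h" "0 + real (Suc (2 * i)) * h' = real i * h + h / 2"
      "0 + real (2 * i + 1) * h' = real i * h + h / 2" "0 + real (Suc (2 * i + 1)) * h' = real i * h + h"
      using h by (simp_all add: field_simps)
    show "dclip h i f = clip (real i * h) (real i * h + h) f" "dclip h' (2 * i) f = clip (real i * h) (real i * h + h / 2) f"
      "dclip h' (2 * i + 1) f = clip (real i * h + h / 2) (real i * h + h) f" unfolding pts by (rule refl)+
  qed
  show "trif S (dclip h i f1) f2 f3 = trif S (dclip h' (2 * i) f1) f2 f3 + trif S (dclip h' (2 * i + 1) f1) f2 f3"
    unfolding e by (rule trif_clip_add(1)[OF S f]) (use h in auto)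
  show "trif S f1 (dclip h i f2) f3 = trif S f1 (dclip h' (2 * i) f2) f3 + trif S f1 (dclip h' (2 * i + 1) f2) f3"
    unfolding e by (rule trif_clip_add(2)[OF S f]) (use h in auto)
qed

text \<open>Consequently the children of a good square are good, so that the bad squares of a
  generation are all found among the children of bad squares.\<close>

lemma star_child_subset:
  "0 \<le> l \<Longrightarrow> star (real i * (l / 2)) (real j * (l / 2)) (l / 2) \<subseteq> star (real (i div 2) * l) (real (j div 2) * l) l"
proof -
  assume l: "0 \<le> l"
  have "real (i div 2) * l \<le> real i * (l / 2) \<and> real i * (l / 2) \<le> real (i div 2) * l + l / 2" for i
  proof -
    have "i = 2 * (i div 2) \<or> i = 2 * (i div 2) + 1" by presburger
    then have "real i = 2 * real (i div 2) \<or> real i = 2 * real (i div 2) + 1" by linarith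
    then show ?thesis using l by (auto simp: distrib_right)
  qed
  from this[of i] this[of j] show ?thesis using l by (auto simp: star_def)
qed

lemma sum_over_children:
  fixes F F' :: "nat \<Rightarrow> nat \<Rightarrow> complex"
  assumes B: "B \<subseteq> {..<n} \<times> {..<n}"
    and F: "\<And>i j. F i j = F' (2 * i) (2 * j) + F' (2 * i + 1) (2 * j) + F' (2 * i) (2 * j + 1) + F' (2 * i + 1) (2 * j + 1)"
  shows "(\<Sum>(i, j)\<in>B. F i j) = (\<Sum>(i, j)\<in>{p\<in>{..<2 * n} \<times> {..<2 * n}. (fst p div 2, snd p div 2) \<in> B}. F' i j)"
proof -
  let ?C = "{p\<in>{..<2 * n} \<times> {..<2 * n}. (fst p div 2, snd p div 2) \<in> B}"
  have fB: "finite B" by (rule finite_subset[OF B]) simp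
  have "(\<Sum>(i, j)\<in>?C. F' i j) = (\<Sum>q\<in>B. \<Sum>p\<in>{p\<in>?C. (fst p div 2, snd p div 2) = q}. case_prod F' p)"
    by (rule sum.group[symmetric]) (use fB in auto)
  also have "\<dots> = (\<Sum>q\<in>B. case_prod F q)"
  proof (rule sum.cong[OF refl])
    fix q assume q: "q \<in> B"
    obtain i j where ij: "q = (i, j)" by fastforce
    have lt: "i < n" "j < n" using q B ij by auto
    have "{p\<in>?C. (fst p div 2, snd p div 2) = q} = {(2 * i, 2 * j), (2 * i + 1, 2 * j), (2 * i, 2 * j + 1), (2 * i + 1, 2 * j + 1)}" (is "?L = ?R")
    proof
      show "?L \<subseteq> ?R"
      proof
        fix p assume p: "p \<in> ?L"
        obtain a b where ab: "p = (a, b)" by fastforce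
        have "a div 2 = i" "b div 2 = j" using p ij ab by auto
        then have "a = 2 * i \<or> a = 2 * i + 1" "b = 2 * j \<or> b = 2 * j + 1" by presburger+
        then show "p \<in> ?R" using ab by auto
      qed
      show "?R \<subseteq> ?L" using lt q ij by auto
    qed
    then show "(\<Sum>p\<in>{p\<in>?C. (fst p div 2, snd p div 2) = q}. case_prod F' p) = case_prod F q"
      by (simp add: ij F)
  qed
  finally show ?thesis by simp
qed

text \<open>The decay exponent 1/6 of a good square of fixed size and the loss 2^(M d / 6) at 2^M
  \<le> |\<lambda>|^(1/(3+d)) combine to the exponent of the theorem.\<close>

lemma powr_exponent_identity:
  fixes D :: real
  assumes "D \<ge> 0"
  shows "- (1/6) + D / (6 * (3 + D)) = - (1 / (2 * (3 + D)))"
  using assms by (simp add: field_simps)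

lemma local_estimate:
  fixes d :: nat and A c :: real
  assumes A: "A > 0" and c: "c > 0"
  shows "\<exists>C>0. \<forall>U g. jet U g \<longrightarrow> {-1..2} \<times> {-1..2} \<subseteq> U \<longrightarrow> g 0 0 \<in> borel_measurable borel \<longrightarrow>
     finite_order_box d A c (hjet g) \<longrightarrow> finite_order_box d A c (swapj (hjet g)) \<longrightarrow>
     (\<forall>lam f1 f2 f3. lam \<noteq> 0 \<longrightarrow> bfun f1 \<longrightarrow> bfun f2 \<longrightarrow> bfun f3 \<longrightarrow>
       (\<forall>t. f1 t \<noteq> 0 \<longrightarrow> 0 \<le> t \<and> t < 1) \<longrightarrow> (\<forall>t. f2 t \<noteq> 0 \<longrightarrow> 0 \<le> t \<and> t < 1) \<longrightarrow>
       norm (trif (\<lambda>p. lam * g 0 0 p) f1 f2 f3) \<le> C * \<bar>lam\<bar> powr (- (1 / (2 * (3 + real d)))) * sqrt (nsq f1 * nsq f2 * nsq f3))"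
proof -
  obtain Cg lg where Cg: "Cg > 0" and lg: "lg > 0" and goodest: "\<forall>U g. jet U g \<longrightarrow> {-1..2} \<times> {-1..2} \<subseteq> U \<longrightarrow> g 0 0 \<in> borel_measurable borel \<longrightarrow>
     finite_order_box d A c (hjet g) \<longrightarrow> (\<forall>lam x y l f1 f2 f3. lam \<noteq> 0 \<longrightarrow> 0 \<le> x \<longrightarrow> x \<le> 1 \<longrightarrow> 0 \<le> y \<longrightarrow> y \<le> 1 \<longrightarrow>
     0 < l \<longrightarrow> l \<le> lg \<longrightarrow> good_square (hjet g) x y l \<longrightarrow> bfun f1 \<longrightarrow> bfun f2 \<longrightarrow> bfun f3 \<longrightarrow>
     (\<forall>t. f1 t \<noteq> 0 \<longrightarrow> t \<in> {x..x + l}) \<longrightarrow> (\<forall>t. f2 t \<noteq> 0 \<longrightarrow> t \<in> {y..y + l}) \<longrightarrow>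
     (norm (trif (\<lambda>p. lam * g 0 0 p) f1 f2 f3))\<^sup>2 \<le> Cg * (\<bar>lam\<bar> * l ^ d) powr (-1/3) * (nsq f1 * nsq f2 * nsq f3))"
    using good_square_estimate[OF A c, of d] by (elim exE conjE)
  obtain N0 lb where N00: "d = 0 \<longrightarrow> N0 = 0" and lb: "lb > 0" and few: "\<forall>h l. finite_order_box d A c h \<longrightarrow> finite_order_box d A c (swapj h) \<longrightarrow> 0 < l \<longrightarrow> l \<le> lb \<longrightarrow>
     (\<exists>X Y. (\<forall>i. finite (X i) \<and> card (X i) \<le> N0 \<and> finite (Y i) \<and> card (Y i) \<le> N0) \<and>
       (\<forall>i j. real i * l \<le> 1 \<longrightarrow> real j * l \<le> 1 \<longrightarrow> \<not> good_square h (real i * l) (real j * l) l \<longrightarrow> i \<in> X j \<or> j \<in> Y i))"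
    using few_bad_squares[OF A c, of d] by (elim exE conjE)
  \<comment> \<open>The initial grid is fine enough for both the estimate on good squares and the
    count of bad ones.\<close>
  obtain m0 where "(1 / 2) ^ m0 < min lg lb" using real_arch_pow_inv[of "min lg lb" "1/2"] lg lb by auto
  then have m0: "1 / 2 ^ m0 \<le> lg" "1 / 2 ^ m0 \<le> lb" by (auto simp: power_one_over)
  define e where "e = 1 / (2 * (3 + real d))"
  \<comment> \<open>Halving the side multiplies the bound for the norm on a good square, which
    contains (l^d)^(-1/6), by this factor.\<close>
  define q where "q = 2 powr (real d / 6)"
  have q1: "q \<ge> 1" unfolding q_def by (rule ge_one_powr_ge_zero) auto
  \<comment> \<open>The three terms belong to the good squares of the initial grid, the bad squares
    of the last grid, and the good children in between. For d = 0 the quotient is 1 / 0 = 0, and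
    \<open>N0 = 0\<close> as well.\<close>
  define C0 where "C0 = sqrt (2 * 2 ^ m0 * Cg) + 2 * sqrt (4 * real N0) + 2 * sqrt (4 * real N0 * Cg) * (q / (q - 1))"
  define C where "C = 1 + C0 + 2 ^ m0"
  have C0: "C0 \<ge> 0" using Cg q1 by (simp add: C0_def)
  have C: "C > 0" unfolding C_def using C0 zero_le_power[of "2::real" m0] by linarith
  show ?thesis
  proof (rule exI[of _ C], rule conjI[OF C], intro allI impI)
    fix U g and lam :: real and f1 f2 f3 :: "real \<Rightarrow> complex"
    assume g: "jet U g" and U: "{-1..2} \<times> {-1..2} \<subseteq> U" and gm: "g 0 0 \<in> borel_measurable borel"
      and hb: "finite_order_box d A c (hjet g)" "finite_order_box d A c (swapj (hjet g))" and lam: "lam \<noteq> 0"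
      and f: "bfun f1" "bfun f2" "bfun f3" and supp: "\<forall>t. f1 t \<noteq> 0 \<longrightarrow> 0 \<le> t \<and> t < 1" "\<forall>t. f2 t \<noteq> 0 \<longrightarrow> 0 \<le> t \<and> t < 1"
    define S where "S = (\<lambda>p. lam * g 0 0 p)"
    have S: "S \<in> borel_measurable borel" unfolding S_def using gm by measurable
    define P where "P = sqrt (nsq f1 * nsq f2 * nsq f3)"
    have P: "P \<ge> 0" by (simp add: P_def nsq_nonneg)
    define a where "a = \<bar>lam\<bar>"
    have a: "a > 0" using lam by (simp add: a_def)
    have triv: "norm (trif S f1 f2 f3) \<le> P"
    proof -
      have "(norm (trif S f1 f2 f3))\<^sup>2 \<le> 1 * (nsq f1 * nsq f2 * nsq f3)"
        by (rule trif_trivial[OF S f, of 0]) (use supp(1) in force)+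
      then show ?thesis unfolding P_def by (intro real_le_rsqrt) simp
    qed
    have "norm (trif S f1 f2 f3) \<le> C * a powr (- e) * P"
    \<comment> \<open>For bounded parameters the trivial estimate is enough. Otherwise the stopping
      scale is not coarser than the initial grid.\<close>
    proof (cases "a < (2 ^ m0) powr (3 + real d)")
      case True
      have e0: "e \<ge> 0" by (simp add: e_def)
      have "a \<le> (2 ^ m0) powr (3 + real d)" using True by simp
      then have "a powr e \<le> ((2 ^ m0) powr (3 + real d)) powr e" using a e0 by (intro powr_mono2) auto
      also have "\<dots> = (2 ^ m0) powr ((3 + real d) * e)" by (rule powr_powr)
      also have "(3 + real d) * e = 1 / 2" by (simp add: e_def field_simps)
      also have "(2 ^ m0) powr (1 / 2) \<le> (2 ^ m0 :: real) powr 1" by (intro powr_mono) auto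
      also have "\<dots> \<le> C" using C0 by (simp add: C_def)
      finally have "1 \<le> C * a powr (- e)" using a by (simp add: powr_minus field_simps)
      then show ?thesis using triv P mult_right_mono[of 1 "C * a powr (- e)" P] by simp
    next
      case False
      define z where "z = a powr (1 / (3 + real d))"
      have "((2 ^ m0) powr (3 + real d)) powr (1 / (3 + real d)) \<le> z"
        unfolding z_def using False by (intro powr_mono2) auto
      then have zm: "2 ^ m0 \<le> z" by (simp add: powr_powr)
      then have "z \<ge> 1" using one_le_power[of "2::real" m0] by linarith
      \<comment> \<open>The last grid: \<open>h M\<close> agrees with |\<lambda>|^(-1/(3+d)) up to a
        factor 2.\<close>
      then obtain M where M: "2 ^ M \<le> z" "z < 2 ^ Suc M" using power_two_bracket by metis
      have m0M: "m0 \<le> M"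
      proof (rule ccontr)
        assume "\<not> ?thesis"
        then have "(2::real) ^ Suc M \<le> 2 ^ m0" by (intro power_increasing) auto
        then show False using zm M by linarith
      qed
      define h where "h m = 1 / (2::real) ^ m" for m :: nat
      have h0: "h m > 0" for m by (simp add: h_def)
      have hS: "h (Suc m) = h m / 2" for m by (simp add: h_def)
      have hmono: "h m \<le> h m0" if "m \<ge> m0" for m
        unfolding h_def using that by (intro divide_left_mono power_increasing) auto
      have il: "real i * h m \<le> 1" if "i < 2 ^ m" for i m
      proof -
        have "real i \<le> 2 ^ m" using that by (metis less_imp_le of_nat_le_iff of_nat_numeral of_nat_power)
        then show ?thesis by (simp add: h_def)
      qed
      define \<Lambda> where "\<Lambda> m i j = trif S (dclip (h m) i f1) (dclip (h m) j f2) f3" for m i j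
      define Bd where "Bd m = {p\<in>{..<2 ^ m} \<times> {..<2 ^ m}. \<not> good_square (hjet g) (real (fst p) * h m) (real (snd p) * h m) (h m)}" for m
      define \<beta> where "\<beta> m = Cg * (a * h m ^ d) powr (-1/3)" for m
      have \<beta>0: "\<beta> m \<ge> 0" for m using Cg by (simp add: \<beta>_def)
      have fB: "finite (Bd m)" for m by (rule finite_subset[of _ "{..<2 ^ m} \<times> {..<2 ^ m}"]) (auto simp: Bd_def)
      have inI: "dclip (h m) i f t \<noteq> 0 \<Longrightarrow> t \<in> {real i * h m..real i * h m + h m}" for m i f t
        by (drule clip_nonzeroD) (auto simp: distrib_right)
      have claim1: "norm (\<Sum>(i, j)\<in>B. \<Lambda> m i j) \<le> sqrt (2 * real N * \<beta> m) * P"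
        if m: "m \<ge> m0" and B: "B \<subseteq> {..<2 ^ m} \<times> {..<2 ^ m}" and gd: "B \<inter> Bd m = {}"
          and sp: "(\<forall>j<2 ^ m. card {i. (i, j) \<in> B} \<le> N) \<or> (\<forall>i<2 ^ m. card {j. (i, j) \<in> B} \<le> N)" for m B N
        unfolding \<Lambda>_def P_def
      proof (rule sum_pieces_bound[OF S f h0 \<beta>0 B sp])
        fix i j and F :: "real \<Rightarrow> complex" assume ij: "(i, j) \<in> B" and F: "bfun F"
        have lt: "i < 2 ^ m" "j < 2 ^ m" using ij B by auto
        have good: "good_square (hjet g) (real i * h m) (real j * h m) (h m)" using ij gd lt by (auto simp: Bd_def)
        have hl: "h m \<le> lg" using hmono[OF m] m0 by (simp add: h_def)
        show "(norm (trif S (dclip (h m) i f1) (dclip (h m) j f2) F))\<^sup>2 \<le> \<beta> m * (nsq (dclip (h m) i f1) * nsq (dclip (h m) j f2) * nsq F)"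
          unfolding S_def \<beta>_def a_def
          by (rule goodest[rule_format, OF g U gm hb(1) lam _ il[OF lt(1)] _ il[OF lt(2)] h0 hl good bfun_clip[OF f(1)] bfun_clip[OF f(2)] F inI inI])
            (use h0[of m] in \<open>auto intro: mult_nonneg_nonneg less_imp_le\<close>)
      qed
      have claim2: "norm (\<Sum>(i, j)\<in>B. \<Lambda> m i j) \<le> sqrt (2 * real N * h m) * P"
        if B: "B \<subseteq> {..<2 ^ m} \<times> {..<2 ^ m}"
          and sp: "(\<forall>j<2 ^ m. card {i. (i, j) \<in> B} \<le> N) \<or> (\<forall>i<2 ^ m. card {j. (i, j) \<in> B} \<le> N)" for m B N
        unfolding \<Lambda>_def P_def
      proof (rule sum_pieces_bound[OF S f h0 less_imp_le[OF h0] B sp])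
        fix i j and F :: "real \<Rightarrow> complex" assume "bfun F"
        then show "(norm (trif S (dclip (h m) i f1) (dclip (h m) j f2) F))\<^sup>2 \<le> h m * (nsq (dclip (h m) i f1) * nsq (dclip (h m) j f2) * nsq F)"
          by (intro trif_trivial[OF S bfun_clip[OF f(1)] bfun_clip[OF f(2)] _ inI] less_imp_le[OF h0])
      qed
      have "\<exists>X Y. (\<forall>i. finite (X i) \<and> card (X i) \<le> N0 \<and> finite (Y i) \<and> card (Y i) \<le> N0) \<and>
          (\<forall>i j. (i, j) \<in> Bd m \<longrightarrow> i \<in> X j \<or> j \<in> Y i)" if m: "m \<ge> m0" for m
      proof -
        have hl: "h m \<le> lb" using hmono[OF m] m0 by (simp add: h_def)
        obtain X Y where XY: "\<forall>i. finite (X i) \<and> card (X i) \<le> N0 \<and> finite (Y i) \<and> card (Y i) \<le> N0"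
          "\<forall>i j. real i * h m \<le> 1 \<longrightarrow> real j * h m \<le> 1 \<longrightarrow> \<not> good_square (hjet g) (real i * h m) (real j * h m) (h m) \<longrightarrow> i \<in> X j \<or> j \<in> Y i"
          using few[rule_format, OF hb h0 hl] by (elim exE conjE)
        have "i \<in> X j \<or> j \<in> Y i" if "(i, j) \<in> Bd m" for i j
          using XY(2)[rule_format, OF il il, of i j] that by (auto simp: Bd_def)
        then show ?thesis using XY(1) by blast
      qed
      then have "\<exists>X. \<exists>Y. \<forall>m. m \<ge> m0 \<longrightarrow> (\<forall>i. finite (X m i) \<and> card (X m i) \<le> N0 \<and> finite (Y m i) \<and> card (Y m i) \<le> N0) \<and>
          (\<forall>i j. (i, j) \<in> Bd m \<longrightarrow> i \<in> X m j \<or> j \<in> Y m i)"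
        by metis
      then obtain X Y where XY0: "\<forall>m. m \<ge> m0 \<longrightarrow> (\<forall>i. finite (X m i) \<and> card (X m i) \<le> N0 \<and> finite (Y m i) \<and> card (Y m i) \<le> N0) \<and>
          (\<forall>i j. (i, j) \<in> Bd m \<longrightarrow> i \<in> X m j \<or> j \<in> Y m i)" by (elim exE)
      have XY: "finite (X m i)" "card (X m i) \<le> N0" "finite (Y m i)" "card (Y m i) \<le> N0" "(i, j) \<in> Bd m \<Longrightarrow> i \<in> X m j \<or> j \<in> Y m i"
        if "m \<ge> m0" for m i j using XY0 that by auto
      define W where "W m = (\<Sum>(i, j)\<in>Bd m. \<Lambda> m i j)" for m
      have total: "trif S f1 f2 f3 = (\<Sum>(i, j)\<in>{..<2 ^ m0} \<times> {..<2 ^ m0}. \<Lambda> m0 i j)"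
      proof -
        have f12: "f1 = clip 0 (0 + real (2 ^ m0) * h m0) f1" "f2 = clip 0 (0 + real (2 ^ m0) * h m0) f2"
          using supp by (auto simp: clip_def fun_eq_iff h_def)
        have "trif S f1 f2 f3 = trif S (clip 0 (0 + real (2 ^ m0) * h m0) f1) f2 f3" using f12(1) by simp
        also have "\<dots> = (\<Sum>i<2 ^ m0. trif S (dclip (h m0) i f1) f2 f3)"
          by (rule trif_sum_clip(1)[OF S f less_imp_le[OF h0]])
        also have "\<dots> = (\<Sum>i<2 ^ m0. trif S (dclip (h m0) i f1) (clip 0 (0 + real (2 ^ m0) * h m0) f2) f3)" using f12(2) by simp
        also have "\<dots> = (\<Sum>i<2 ^ m0. \<Sum>j<2 ^ m0. \<Lambda> m0 i j)"
          unfolding \<Lambda>_def by (intro sum.cong refl trif_sum_clip(2)[OF S bfun_clip[OF f(1)] f(2,3) less_imp_le[OF h0]])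
        finally show ?thesis by (simp add: sum.cartesian_product)
      qed
      have top: "norm (trif S f1 f2 f3) \<le> norm (W m0) + sqrt (2 * 2 ^ m0 * \<beta> m0) * P"
      proof -
        let ?A = "{..<2 ^ m0} \<times> {..<2 ^ m0} :: (nat \<times> nat) set"
        have "trif S f1 f2 f3 = (\<Sum>(i, j)\<in>?A - Bd m0. \<Lambda> m0 i j) + W m0"
          unfolding total W_def by (rule sum.subset_diff) (auto simp: Bd_def)
        then have "norm (trif S f1 f2 f3) \<le> norm (\<Sum>(i, j)\<in>?A - Bd m0. \<Lambda> m0 i j) + norm (W m0)"
          by (simp only: norm_triangle_ineq)
        moreover have "norm (\<Sum>(i, j)\<in>?A - Bd m0. \<Lambda> m0 i j) \<le> sqrt (2 * real (2 ^ m0) * \<beta> m0) * P"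
        proof (rule claim1)
          have "card {i. (i, j) \<in> ?A - Bd m0} \<le> 2 ^ m0" for j
            using card_mono[of "{..<2 ^ m0}" "{i. (i, j) \<in> ?A - Bd m0}"] by auto
          then show "(\<forall>j<2 ^ m0. card {i. (i, j) \<in> ?A - Bd m0} \<le> 2 ^ m0) \<or> (\<forall>i<2 ^ m0. card {j. (i, j) \<in> ?A - Bd m0} \<le> 2 ^ m0)" by blast
        qed auto
        moreover have "real (2 ^ m0) = 2 ^ m0" by simp
        ultimately show ?thesis by (simp only:)
      qed
      \<comment> \<open>Each bad square is replaced by its four children. Those that are again bad
        make up \<open>W (Suc m)\<close>. The others are good and are split according to whether
        their parent is exceptional in its row or only in its column; either part has at most
        \<open>2 * N0\<close> squares in each row or each column, respectively.\<close>
      have step: "norm (W m) \<le> norm (W (Suc m)) + 2 * sqrt (4 * real N0 * \<beta> (Suc m)) * P" if m: "m \<ge> m0" for m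
      proof -
        define Ch where "Ch = {p\<in>{..<2 * 2 ^ m} \<times> {..<2 * 2 ^ m}. (fst p div 2, snd p div 2) \<in> Bd m}"
        have m': "Suc m \<ge> m0" using m by simp
        have "W m = (\<Sum>(i, j)\<in>Ch. \<Lambda> (Suc m) i j)"
          unfolding W_def Ch_def
        proof (rule sum_over_children)
          show "Bd m \<subseteq> {..<2 ^ m} \<times> {..<2 ^ m}" by (auto simp: Bd_def)
          fix i j
          have "\<Lambda> m i j = trif S (dclip (h (Suc m)) (2 * i) f1) (dclip (h m) j f2) f3 + trif S (dclip (h (Suc m)) (2 * i + 1) f1) (dclip (h m) j f2) f3"
            unfolding \<Lambda>_def by (rule dclip_split(1)[OF hS less_imp_le[OF h0] f(1) bfun_clip[OF f(2)] f(3) S])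
          also have "trif S (dclip (h (Suc m)) (2 * i) f1) (dclip (h m) j f2) f3 = \<Lambda> (Suc m) (2 * i) (2 * j) + \<Lambda> (Suc m) (2 * i) (2 * j + 1)"
            unfolding \<Lambda>_def by (rule dclip_split(2)[OF hS less_imp_le[OF h0] bfun_clip[OF f(1)] f(2) f(3) S])
          also have "trif S (dclip (h (Suc m)) (2 * i + 1) f1) (dclip (h m) j f2) f3 = \<Lambda> (Suc m) (2 * i + 1) (2 * j) + \<Lambda> (Suc m) (2 * i + 1) (2 * j + 1)"
            unfolding \<Lambda>_def by (rule dclip_split(2)[OF hS less_imp_le[OF h0] bfun_clip[OF f(1)] f(2) f(3) S])
          finally show "\<Lambda> m i j = \<Lambda> (Suc m) (2 * i) (2 * j) + \<Lambda> (Suc m) (2 * i + 1) (2 * j) + \<Lambda> (Suc m) (2 * i) (2 * j + 1) + \<Lambda> (Suc m) (2 * i + 1) (2 * j + 1)"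
            by simp
        qed
        moreover have fCh: "finite Ch" by (rule finite_subset[of _ "{..<2 * 2 ^ m} \<times> {..<2 * 2 ^ m}"]) (auto simp: Ch_def)
        moreover have sub: "Bd (Suc m) \<subseteq> Ch"
        proof
          fix p assume p: "p \<in> Bd (Suc m)"
          obtain i j where ij: "p = (i, j)" by fastforce
          have lt: "i < 2 * 2 ^ m" "j < 2 * 2 ^ m" and nb: "\<not> good_square (hjet g) (real i * (h m / 2)) (real j * (h m / 2)) (h m / 2)"
            using p by (auto simp: Bd_def ij hS)
          have "\<not> good_square (hjet g) (real (i div 2) * h m) (real (j div 2) * h m) (h m)"
            using nb star_child_subset[OF less_imp_le[OF h0[of m]], of i j] unfolding good_square_def by blast
          then show "p \<in> Ch" using lt by (auto simp: Ch_def Bd_def ij)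
        qed
        ultimately have Wm: "W m = (\<Sum>(i, j)\<in>Ch - Bd (Suc m). \<Lambda> (Suc m) i j) + W (Suc m)"
          unfolding W_def using sum.subset_diff[OF sub fCh] by simp
        define B1 where "B1 = {p\<in>Ch - Bd (Suc m). fst p div 2 \<in> X m (snd p div 2)}"
        define B2 where "B2 = {p\<in>Ch - Bd (Suc m). fst p div 2 \<notin> X m (snd p div 2)}"
        have B12: "Ch - Bd (Suc m) = B1 \<union> B2" "B1 \<inter> B2 = {}" "finite B1" "finite B2"
          using fCh by (auto simp: B1_def B2_def)
        have ChS: "Ch \<subseteq> {..<2 ^ Suc m} \<times> {..<2 ^ Suc m}" by (auto simp: Ch_def)
        have n1: "norm (\<Sum>(i, j)\<in>B1. \<Lambda> (Suc m) i j) \<le> sqrt (2 * real (2 * N0) * \<beta> (Suc m)) * P"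
        proof (rule claim1[OF m'])
          have "card {i. (i, j) \<in> B1} \<le> 2 * N0" for j
          proof -
            have "card {i. (i, j) \<in> B1} \<le> card {i. i div 2 \<in> X m (j div 2)}"
              by (rule card_mono[OF card_div_two_preimage(2)[OF XY(1)[OF m]]]) (auto simp: B1_def)
            also have "\<dots> \<le> 2 * N0" using card_div_two_preimage(1)[OF XY(1)[OF m], of "j div 2"] XY(2)[OF m, of "j div 2"] by linarith
            finally show ?thesis .
          qed
          then show "(\<forall>j<2 ^ Suc m. card {i. (i, j) \<in> B1} \<le> 2 * N0) \<or> (\<forall>i<2 ^ Suc m. card {j. (i, j) \<in> B1} \<le> 2 * N0)" by blast
        qed (use ChS in \<open>auto simp: B1_def\<close>)
        have n2: "norm (\<Sum>(i, j)\<in>B2. \<Lambda> (Suc m) i j) \<le> sqrt (2 * real (2 * N0) * \<beta> (Suc m)) * P"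
        proof (rule claim1[OF m'])
          have "card {j. (i, j) \<in> B2} \<le> 2 * N0" for i
          proof -
            have "{j. (i, j) \<in> B2} \<subseteq> {j. j div 2 \<in> Y m (i div 2)}"
              using XY(5)[OF m] by (auto simp: B2_def Ch_def)
            then have "card {j. (i, j) \<in> B2} \<le> card {j. j div 2 \<in> Y m (i div 2)}"
              by (rule card_mono[OF card_div_two_preimage(2)[OF XY(3)[OF m]]])
            also have "\<dots> \<le> 2 * N0" using card_div_two_preimage(1)[OF XY(3)[OF m], of "i div 2"] XY(4)[OF m, of "i div 2"] by linarith
            finally show ?thesis .
          qed
          then show "(\<forall>j<2 ^ Suc m. card {i. (i, j) \<in> B2} \<le> 2 * N0) \<or> (\<forall>i<2 ^ Suc m. card {j. (i, j) \<in> B2} \<le> 2 * N0)" by blast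
        qed (use ChS in \<open>auto simp: B2_def\<close>)
        have "W m = (\<Sum>(i, j)\<in>B1. \<Lambda> (Suc m) i j) + (\<Sum>(i, j)\<in>B2. \<Lambda> (Suc m) i j) + W (Suc m)"
          unfolding Wm B12(1) using sum.union_disjoint[OF B12(3,4,2)] by simp
        then have "norm (W m) \<le> norm (\<Sum>(i, j)\<in>B1. \<Lambda> (Suc m) i j) + norm (\<Sum>(i, j)\<in>B2. \<Lambda> (Suc m) i j) + norm (W (Suc m))"
          by (metis norm_triangle_ineq norm_triangle_mono order_refl)
        then show ?thesis using n1 n2 by simp
      qed
      \<comment> \<open>At the stopping scale the remaining bad squares receive only the
        Cauchy-Schwarz bound.\<close>
      have bot: "norm (W M) \<le> 2 * sqrt (2 * real N0 * h M) * P"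
      proof -
        define B1 where "B1 = {p\<in>Bd M. fst p \<in> X M (snd p)}"
        define B2 where "B2 = {p\<in>Bd M. fst p \<notin> X M (snd p)}"
        have B12: "Bd M = B1 \<union> B2" "B1 \<inter> B2 = {}" "finite B1" "finite B2"
          using fB[of M] by (auto simp: B1_def B2_def)
        have BS: "Bd M \<subseteq> {..<2 ^ M} \<times> {..<2 ^ M}" by (auto simp: Bd_def)
        have n1: "norm (\<Sum>(i, j)\<in>B1. \<Lambda> M i j) \<le> sqrt (2 * real N0 * h M) * P"
        proof (rule claim2)
          have "card {i. (i, j) \<in> B1} \<le> N0" for j
            by (rule order_trans[OF card_mono[OF XY(1)[OF m0M, of j]] XY(2)[OF m0M, of j]]) (auto simp: B1_def)
          then show "(\<forall>j<2 ^ M. card {i. (i, j) \<in> B1} \<le> N0) \<or> (\<forall>i<2 ^ M. card {j. (i, j) \<in> B1} \<le> N0)" by blast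
        qed (use BS in \<open>auto simp: B1_def\<close>)
        have n2: "norm (\<Sum>(i, j)\<in>B2. \<Lambda> M i j) \<le> sqrt (2 * real N0 * h M) * P"
        proof (rule claim2)
          have "card {j. (i, j) \<in> B2} \<le> N0" for i
            by (rule order_trans[OF card_mono[OF XY(3)[OF m0M, of i]] XY(4)[OF m0M, of i]]) (use XY(5)[OF m0M] in \<open>auto simp: B2_def\<close>)
          then show "(\<forall>j<2 ^ M. card {i. (i, j) \<in> B2} \<le> N0) \<or> (\<forall>i<2 ^ M. card {j. (i, j) \<in> B2} \<le> N0)" by blast
        qed (use BS in \<open>auto simp: B2_def\<close>)
        have "W M = (\<Sum>(i, j)\<in>B1. \<Lambda> M i j) + (\<Sum>(i, j)\<in>B2. \<Lambda> M i j)"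
          unfolding W_def B12(1) by (rule sum.union_disjoint[OF B12(3,4,2)])
        then have "norm (W M) \<le> norm (\<Sum>(i, j)\<in>B1. \<Lambda> M i j) + norm (\<Sum>(i, j)\<in>B2. \<Lambda> M i j)"
          by (simp add: norm_triangle_ineq)
        then show ?thesis using n1 n2 by simp
      qed
      have tele: "norm (W m0) \<le> norm (W n) + (\<Sum>m=m0..<n. 2 * sqrt (4 * real N0 * \<beta> (Suc m)) * P)" if "n \<ge> m0" for n
        using that
      proof (induction n rule: dec_induct)
        case (step n)
        then show ?case using \<open>\<And>m. m0 \<le> m \<Longrightarrow> norm (W m) \<le> norm (W (Suc m)) + 2 * sqrt (4 * real N0 * \<beta> (Suc m)) * P\<close>[of n]
          by simp
      qed simp
      define E where "E = a powr (- e)"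
      define b where "b = a powr (-(1/6))"
      have E0: "E \<ge> 0" and b0: "b \<ge> 0" by (auto simp: E_def b_def)
      have sb: "sqrt (\<beta> m) = sqrt Cg * (b * q ^ m)" for m
      proof -
        have "(a * h m ^ d) powr (-1/3) = a powr (-1/3) * (h m ^ d) powr (-1/3)" by (rule powr_mult)
        also have "(h m ^ d) powr (-1/3) = 2 powr (real m * real d / 3)"
        proof -
          have "h m = 2 powr (- real m)" by (simp add: h_def powr_minus_divide powr_realpow)
          then have "h m ^ d = 2 powr (- real m * real d)" by (simp add: powr_realpow[symmetric] powr_powr)
          then show ?thesis by (simp add: powr_powr)
        qed
        finally have 1: "\<beta> m = Cg * (a powr (-1/3) * 2 powr (real m * real d / 3))" by (simp add: \<beta>_def)
        have 2: "(b * q ^ m)\<^sup>2 = a powr (-1/3) * 2 powr (real m * real d / 3)"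
        proof -
          have qm: "q ^ m = 2 powr (real d / 6 * real m)" by (simp add: q_def powr_realpow[symmetric] powr_powr)
          have "b\<^sup>2 = a powr (-1/3)" using a by (simp add: b_def power2_eq_square powr_add[symmetric])
          moreover have "(q ^ m)\<^sup>2 = 2 powr (real m * real d / 3)" unfolding qm by (simp add: power2_eq_square powr_add[symmetric] mult.commute)
          ultimately show ?thesis by (simp add: power_mult_distrib)
        qed
        have "b * q ^ m \<ge> 0" using b0 q1 by simp
        then show ?thesis unfolding 1 2[symmetric] by (simp add: real_sqrt_mult)
      qed
      have bq: "b * q ^ M \<le> E"
      proof -
        have qM: "q ^ M = (2 ^ M) powr (real d / 6)"
          by (simp add: q_def powr_realpow[symmetric] powr_powr mult.commute)
        also have "\<dots> \<le> z powr (real d / 6)" using M(1) by (intro powr_mono2) auto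
        also have "\<dots> = a powr (real d / (6 * (3 + real d)))" by (simp add: z_def powr_powr algebra_simps)
        finally have "b * q ^ M \<le> b * a powr (real d / (6 * (3 + real d)))" by (intro mult_left_mono b0)
        also have "\<dots> = a powr (- (1/6) + real d / (6 * (3 + real d)))" unfolding b_def by (rule powr_add[symmetric])
        also have "\<dots> = E" unfolding E_def e_def by (subst powr_exponent_identity) auto
        finally show ?thesis .
      qed
      have q0: "b * q ^ m0 \<le> E"
        using mult_left_mono[OF power_increasing[OF m0M q1] b0] bq by linarith
      have t1: "sqrt (2 * 2 ^ m0 * \<beta> m0) \<le> sqrt (2 * 2 ^ m0 * Cg) * E"
      proof -
        have "sqrt (2 * 2 ^ m0 * \<beta> m0) = sqrt (2 * 2 ^ m0 * Cg) * (b * q ^ m0)"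
          by (simp add: real_sqrt_mult sb)
        then show ?thesis using Cg q0 by (simp add: mult_left_mono)
      qed
      have t2: "sqrt (2 * real N0 * h M) \<le> sqrt (4 * real N0) * E"
      proof -
        have "h M \<le> 2 * a powr (- (1 / (3 + real d)))"
        proof -
          have "h M = 2 / 2 ^ Suc M" by (simp add: h_def)
          also have "\<dots> \<le> 2 / z" using M(2) \<open>z \<ge> 1\<close> by (intro divide_left_mono) auto
          finally show ?thesis by (simp add: z_def powr_minus_divide)
        qed
        also have "a powr (- (1 / (3 + real d))) = E\<^sup>2"
        proof -
          have ee: "- (1 / (3 + real d)) = - e + - e" by (simp add: e_def field_simps)
          show ?thesis unfolding ee powr_add E_def power2_eq_square by (rule refl)
        qed
        finally have "2 * real N0 * h M \<le> 2 * real N0 * (2 * E\<^sup>2)" by (intro mult_left_mono) auto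
        then have "sqrt (2 * real N0 * h M) \<le> sqrt (4 * real N0 * E\<^sup>2)" by simp
        then show ?thesis using E0 by (simp add: real_sqrt_mult)
      qed
      have t3: "(\<Sum>m=m0..<M. 2 * sqrt (4 * real N0 * \<beta> (Suc m)) * P) \<le> 2 * sqrt (4 * real N0 * Cg) * (q / (q - 1)) * E * P"
      proof (cases "d = 0")
        \<comment> \<open>Here \<open>q = 1\<close> and there is no geometric growth, but all terms
          vanish because \<open>N0 = 0\<close>.\<close>
        case True
        then show ?thesis using N00 by simp
      next
        case False
        then have q1': "q > 1" unfolding q_def by simp
        have "(\<Sum>m=m0..<M. 2 * sqrt (4 * real N0 * \<beta> (Suc m)) * P) = (\<Sum>m=m0..<M. (2 * sqrt (4 * real N0 * Cg) * b * P) * q ^ Suc m)"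
          by (rule sum.cong[OF refl]) (simp add: real_sqrt_mult sb)
        also have "\<dots> = (2 * sqrt (4 * real N0 * Cg) * b * P) * (\<Sum>m=m0..<M. q ^ Suc m)" by (rule sum_distrib_left[symmetric])
        also have "\<dots> \<le> (2 * sqrt (4 * real N0 * Cg) * b * P) * (q / (q - 1) * q ^ M)"
        proof (rule mult_left_mono)
          have "(\<Sum>m=m0..<M. q ^ Suc m) \<le> (\<Sum>m<M. q ^ Suc m)" using q1' by (intro sum_mono2) auto
          also have "\<dots> = q * (\<Sum>m<M. q ^ m)" by (simp add: sum_distrib_left)
          also have "\<dots> = q * ((q ^ M - 1) / (q - 1))" using q1' by (subst geometric_sum) auto
          also have "\<dots> \<le> q * (q ^ M / (q - 1))" using q1' by (intro mult_left_mono divide_right_mono) auto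
          finally show "(\<Sum>m=m0..<M. q ^ Suc m) \<le> q / (q - 1) * q ^ M" by simp
        qed (use Cg b0 P in auto)
        also have "\<dots> = (2 * sqrt (4 * real N0 * Cg) * P * (q / (q - 1))) * (b * q ^ M)" by simp
        also have "\<dots> \<le> (2 * sqrt (4 * real N0 * Cg) * P * (q / (q - 1))) * E"
          using q1' Cg P by (intro mult_left_mono bq) auto
        finally show ?thesis by (simp add: mult_ac)
      qed
      have "norm (trif S f1 f2 f3) \<le> (2 * sqrt (2 * real N0 * h M) * P + (\<Sum>m=m0..<M. 2 * sqrt (4 * real N0 * \<beta> (Suc m)) * P)) + sqrt (2 * 2 ^ m0 * \<beta> m0) * P"
        using top tele[OF m0M] bot by linarith
      also have "\<dots> \<le> (2 * (sqrt (4 * real N0) * E) * P + 2 * sqrt (4 * real N0 * Cg) * (q / (q - 1)) * E * P) + (sqrt (2 * 2 ^ m0 * Cg) * E) * P"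
        by (intro add_mono mult_right_mono mult_left_mono t1 t2 t3 P) auto
      also have "\<dots> = C0 * E * P" by (simp add: C0_def algebra_simps)
      also have "\<dots> \<le> C * E * P" using E0 P by (intro mult_right_mono) (auto simp: C_def add_nonneg_nonneg)
      finally show ?thesis by (simp add: E_def)
    qed
    then show "norm (trif (\<lambda>p. lam * g 0 0 p) f1 f2 f3) \<le> C * \<bar>lam\<bar> powr (- (1 / (2 * (3 + real d)))) * sqrt (nsq f1 * nsq f2 * nsq f3)"
      by (simp add: S_def a_def e_def P_def)
  qed
qed

section \<open>Homogeneity at the origin\<close>

definition vanishes :: "nat \<Rightarrow> (nat \<Rightarrow> nat \<Rightarrow> real \<times> real \<Rightarrow> real) \<Rightarrow> bool" where
  "vanishes n h \<longleftrightarrow> (\<forall>i j. i + j < n \<longrightarrow> h i j (0, 0) = 0)"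

lemma vanishes_dird: "vanishes (Suc n) h \<Longrightarrow> vanishes n (dird v h)"
  by (simp add: vanishes_def dird_def)

lemma vanishes_dird_funpow: "vanishes (n + m) h \<Longrightarrow> vanishes n ((dird v ^^ m) h)"
proof (induction m arbitrary: n)
  case (Suc m)
  then have "vanishes (Suc n) ((dird v ^^ m) h)" by simp
  then show ?case by (simp add: vanishes_dird)
qed simp

lemma vanishes_at_origin: "vanishes n h \<Longrightarrow> m < n \<Longrightarrow> (dird v ^^ m) h 0 0 (0, 0) = 0"
proof -
  assume "vanishes n h" "m < n"
  then have "vanishes (Suc 0 + m) h" by (auto simp: vanishes_def)
  then have "vanishes (Suc 0) ((dird v ^^ m) h)" by (rule vanishes_dird_funpow)
  then show ?thesis by (simp add: vanishes_def)
qed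

text \<open>All derivatives of order below n vanish at the origin, so Maclaurin's formula on the ray
  consists of its Lagrange remainder alone. The case \<open>n = 0\<close> is separate because the
  formula is stated for positive order.\<close>

lemma Taylor_ray:
  assumes h: "jet U h" and van: "vanishes n h" and r: "r > 0" and U: "\<And>t. 0 \<le> t \<Longrightarrow> t \<le> r \<Longrightarrow> t *\<^sub>R P \<in> U"
  shows "\<exists>t. 0 \<le> t \<and> t \<le> r \<and> h 0 0 (r *\<^sub>R P) = r ^ n / fact n * (dird P ^^ n) h 0 0 (t *\<^sub>R P)"
proof (cases "n = 0")
  case True
  then show ?thesis using r by (intro exI[of _ r]) auto
next
  case False
  let ?D = "\<lambda>m t. (dird P ^^ m) h 0 0 (t *\<^sub>R P)"
  have "\<exists>t>0. t < r \<and> h 0 0 (r *\<^sub>R P) = (\<Sum>m<n. ?D m 0 / fact m * r ^ m) + ?D n t / fact n * r ^ n"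
  proof (rule Maclaurin)
    show "\<forall>m t. m < n \<and> 0 \<le> t \<and> t \<le> r \<longrightarrow> (?D m has_real_derivative ?D (Suc m) t) (at t)"
    proof (intro allI impI)
      fix m t assume "m < n \<and> 0 \<le> t \<and> t \<le> r"
      then have "0 + t *\<^sub>R P \<in> U" using U[of t] by simp
      from jet_line[OF jet_dird_funpow[OF h, where v = P and n = m] this, of 0 0]
      show "(?D m has_real_derivative ?D (Suc m) t) (at t)" by simp
    qed
  qed (use r False in auto)
  moreover have "?D m 0 = 0" if "m < n" for m using vanishes_at_origin[OF van that] by (simp add: zero_prod_def)
  ultimately show ?thesis by (auto simp: mult.commute intro: less_imp_le)
qed

text \<open>Joint continuity in direction and base point makes the Taylor remainders uniform over
  rays near a given one.\<close>

lemma continuous_on_dird_funpow: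
  assumes h: "jet U h"
  shows "continuous_on (UNIV \<times> U) (\<lambda>q. (dird (fst q) ^^ n) h i j (snd q))"
proof (induction n arbitrary: i j)
  case 0
  show ?case by (simp, rule continuous_on_compose2[OF jet_cont[OF h]]) (auto intro!: continuous_intros)
next
  case (Suc n)
  show ?case unfolding funpow.simps comp_def dird_def[of _ "(dird _ ^^ n) h"]
    by (intro continuous_intros Suc)
qed

lemma dird_unit: "dird (1, 0) h = (\<lambda>i j. h (Suc i) j)" "dird (0, 1) h = (\<lambda>i j. h i (Suc j))"
  by (auto simp: dird_def fun_eq_iff)

lemma dird_unit_funpow: "(dird (1, 0) ^^ k) h = (\<lambda>i j. h (i + k) j)" "(dird (0, 1) ^^ k) h = (\<lambda>i j. h i (j + k))"
  by (induction k) (simp_all add: dird_unit)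

lemma dird_axis_funpow: "((dird (s, 0) ^^ i) ((dird (0, t) ^^ j) h)) a b p = s ^ i * t ^ j * h (a + i) (b + j) p"
proof -
  have 1: "(dird (0, t) ^^ j) h a b p = t ^ j * h a (b + j) p" for a b p
    by (induction j arbitrary: a b p) (simp_all add: dird_def mult_ac)
  show ?thesis
    by (induction i arbitrary: a b p) (simp_all add: dird_def 1 mult_ac)
qed

text \<open>Induction applied to \<open>dird p h\<close> and \<open>dird v h\<close> shows that both
  vanish to the next lower order. As \<open>p\<close> and \<open>v\<close> span the plane, Cramer's
  rule recovers the two coordinate derivatives.\<close>

lemma directional_derivatives_determine:
  assumes det: "fst p * snd v - snd p * fst v \<noteq> 0"
    and "\<And>k. k \<le> n \<Longrightarrow> (dird p ^^ (n - k)) ((dird v ^^ k) h) 0 0 (0, 0) = 0" and "i + j = n"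
  shows "h i j (0, 0) = 0"
  using assms(2,3)
proof (induction n arbitrary: h i j)
  case (Suc n)
  have dp: "dird p h a b (0, 0) = 0" if "a + b = n" for a b
  proof (rule Suc.IH[OF _ that])
    fix k assume k: "k \<le> n"
    have "(dird p ^^ (n - k)) ((dird v ^^ k) (dird p h)) = (dird p ^^ (Suc n - k)) ((dird v ^^ k) h)"
      unfolding Suc_diff_le[OF k] dird_funpow_commute[symmetric] funpow_Suc_right o_apply by (rule refl)
    then show "(dird p ^^ (n - k)) ((dird v ^^ k) (dird p h)) 0 0 (0, 0) = 0" using Suc.prems(1)[of k] k by simp
  qed
  have dv: "dird v h a b (0, 0) = 0" if "a + b = n" for a b
  proof (rule Suc.IH[OF _ that])
    fix k assume k: "k \<le> n"
    have "(dird p ^^ (n - k)) ((dird v ^^ k) (dird v h)) = (dird p ^^ (Suc n - Suc k)) ((dird v ^^ Suc k) h)"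
      unfolding funpow_Suc_right o_apply diff_Suc_Suc by (rule refl)
    then show "(dird p ^^ (n - k)) ((dird v ^^ k) (dird v h)) 0 0 (0, 0) = 0" using Suc.prems(1)[of "Suc k"] k by simp
  qed
  have both: "h (Suc a) b (0, 0) = 0 \<and> h a (Suc b) (0, 0) = 0" if ab: "a + b = n" for a b
  proof -
    define x y where "x = h (Suc a) b (0, 0)" and "y = h a (Suc b) (0, 0)"
    have e: "fst p * x + snd p * y = 0" "fst v * x + snd v * y = 0"
      using dp[OF ab] dv[OF ab] by (simp_all add: dird_def x_def y_def)
    have "(fst p * snd v - snd p * fst v) * x = snd v * (fst p * x + snd p * y) - snd p * (fst v * x + snd v * y)"
      "(fst p * snd v - snd p * fst v) * y = fst p * (fst v * x + snd v * y) - fst v * (fst p * x + snd p * y)"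
      by (simp_all add: algebra_simps)
    then have "(fst p * snd v - snd p * fst v) * x = 0" "(fst p * snd v - snd p * fst v) * y = 0"
      unfolding e by simp_all
    then show ?thesis using det by (simp add: x_def y_def)
  qed
  show ?case
  proof (cases i)
    case 0
    then show ?thesis using both[of 0 n] Suc.prems(2) by simp
  next
    case (Suc a)
    then show ?thesis using both[of a j] Suc.prems(2) by simp
  qed
qed simp

section \<open>Dilations and uniform bounds for the dilates of H\<close>

lemma bfun_affine:
  fixes f :: "real \<Rightarrow> complex"
  assumes "bfun f" "t \<noteq> 0" shows "bfun (\<lambda>x. f (a + t * x))"
proof -
  note [measurable] = bfun_measurable[OF assms(1)]
  obtain B where B: "B > 0" "\<And>x. norm (f x) \<le> B" "\<And>x. norm x > B \<Longrightarrow> f x = 0" using bfunD[OF assms(1)] by blast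
  show ?thesis
  proof (rule bfunI[where B = B and R = "(B + \<bar>a\<bar>) / \<bar>t\<bar>"])
    show "f (a + t * x) = 0" if "norm x > (B + \<bar>a\<bar>) / \<bar>t\<bar>" for x
    proof (rule B(3))
      have "B + \<bar>a\<bar> < \<bar>t * x\<bar>" using that assms(2) by (simp add: abs_mult field_simps)
      then show "norm (a + t * x) > B" by simp
    qed
  qed (use B(2) in auto)
qed

lemma trif_rescale:
  assumes S: "S \<in> borel_measurable borel" and f: "bfun f1" "bfun f2" "bfun f3" and t: "t > 0"
  shows "trif S f1 f2 f3 = of_real (t\<^sup>2) * trif (\<lambda>p. S (x0 + t * fst p, y0 + t * snd p)) (\<lambda>x. f1 (x0 + t * x)) (\<lambda>y. f2 (y0 + t * y)) (\<lambda>u. f3 (x0 + y0 + t * u))"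
proof -
  have bt: "bfun (\<lambda>x. f (a + t * x))" if "bfun f" for f :: "real \<Rightarrow> complex" and a
    by (rule bfun_affine[OF that]) (use t in simp)
  let ?S = "\<lambda>p. S (x0 + t * fst p, y0 + t * snd p)"
  have S': "?S \<in> borel_measurable borel" using S unfolding borel_prod[symmetric] by measurable
  have "trif S f1 f2 f3 = (LINT x|lborel. LINT y|lborel. cis (S (x, y)) * (f1 x * f2 y * f3 (x + y)))"
    unfolding trif_def using bfun_Fubini(1)[OF bfun_trif[OF S f]] by simp
  also have "\<dots> = \<bar>t\<bar> *\<^sub>R (LINT x|lborel. LINT y|lborel. cis (S (x0 + t * x, y)) * (f1 (x0 + t * x) * f2 y * f3 (x0 + t * x + y)))"
    by (rule lborel_integral_real_affine) (use t in auto)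
  also have "\<dots> = \<bar>t\<bar> *\<^sub>R (LINT x|lborel. \<bar>t\<bar> *\<^sub>R (LINT y|lborel. cis (S (x0 + t * x, y0 + t * y)) * (f1 (x0 + t * x) * f2 (y0 + t * y) * f3 (x0 + t * x + (y0 + t * y)))))"
    by (subst lborel_integral_real_affine[where c = t and t = y0]) (use t in auto)
  also have "\<dots> = of_real (t\<^sup>2) * (LINT x|lborel. LINT y|lborel. cis (?S (x, y)) * (f1 (x0 + t * x) * f2 (y0 + t * y) * f3 (x0 + y0 + t * (x + y))))"
  proof -
    have 1: "x0 + t * x + (y0 + t * y) = x0 + y0 + t * (x + y)" for x y by (simp add: algebra_simps)
    show ?thesis unfolding 1 using t by (simp add: scaleR_conv_of_real power2_eq_square)
  qed
  also have "(LINT x|lborel. LINT y|lborel. cis (?S (x, y)) * (f1 (x0 + t * x) * f2 (y0 + t * y) * f3 (x0 + y0 + t * (x + y)))) =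
     trif ?S (\<lambda>x. f1 (x0 + t * x)) (\<lambda>y. f2 (y0 + t * y)) (\<lambda>u. f3 (x0 + y0 + t * u))"
    unfolding trif_def using bfun_Fubini(1)[OF bfun_trif[OF S' bt[OF f(1)] bt[OF f(2)] bt[OF f(3)]]] by simp
  finally show ?thesis .
qed

lemma nsq_affine: "t \<noteq> 0 \<Longrightarrow> nsq (\<lambda>x. f (a + t * x)) = nsq f / \<bar>t\<bar>"
  unfolding nsq_def using lborel_integral_real_affine[of t "\<lambda>x. (norm (f x))\<^sup>2" a] by simp

lemma jet_swapj:
  assumes "jet U h" shows "jet ((\<lambda>p. (snd p, fst p)) -` U) (swapj h)"
  unfolding jet_def
proof (intro conjI allI impI)
  have c: "continuous_on UNIV (\<lambda>p::real \<times> real. (snd p, fst p))" by (intro continuous_intros)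
  show "open ((\<lambda>p. (snd p, fst p)) -` U)" by (rule open_vimage[OF jet_open[OF assms] c])
  fix i j
  show "continuous_on ((\<lambda>p. (snd p, fst p)) -` U) (swapj h i j)"
    unfolding swapj_def by (rule continuous_on_compose2[OF jet_cont[OF assms]]) (auto intro!: continuous_intros)
  fix x y assume "(x, y) \<in> (\<lambda>p. (snd p, fst p)) -` U"
  then have "(y, x) \<in> U" by simp
  from jet_dx[OF assms this] jet_dy[OF assms this]
  show "((\<lambda>t. swapj h i j (t, y)) has_real_derivative swapj h (Suc i) j (x, y)) (at x)"
    "((\<lambda>t. swapj h i j (x, t)) has_real_derivative swapj h i (Suc j) (x, y)) (at y)"
    by (simp_all add: swapj_def)
qed

lemma jet_shift: "jet U h \<Longrightarrow> jet U (\<lambda>i j. h (i + a) (j + b))"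
  using jet_shift_diff[of U h 1 a b 0 0 0] by simp

text \<open>A derivative of order i + j vanishes to order d - (i + j) at the origin, so Taylor's
  formula along rays applies. In effect the dilates r^(-d) h(r P) have bounded derivatives up to
  order d + 4, uniformly in r. For i + j > d the truncated difference is 0 and r^(i+j) \<le> r^d
  takes over.\<close>

lemma order_derivative_bound:
  assumes h: "jet U h" and U0: "(0, 0) \<in> U" and van: "vanishes d h"
  shows "\<exists>A>0. \<exists>r0>0. \<forall>r P i j. 0 < r \<longrightarrow> r < r0 \<longrightarrow> dist P p0 \<le> 1 \<longrightarrow> i + j \<le> d + 4 \<longrightarrow>
     r *\<^sub>R P \<in> U \<and> r ^ (i + j) * \<bar>h i j (r *\<^sub>R P)\<bar> \<le> A * r ^ d"
proof -
  obtain R where R: "R > 0" "cball (0, 0) R \<subseteq> U" using open_contains_cball[of U] jet_open[OF h] U0 by blast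
  define F where "F i j q = (dird (fst q) ^^ (d - (i + j))) (\<lambda>a b. h (a + i) (b + j)) 0 0 (snd q)" for i j and q :: "(real \<times> real) \<times> (real \<times> real)"
  let ?K = "cball p0 1 \<times> cball (0::real, 0::real) R"
  have comp: "compact ?K" by (intro compact_Times compact_cball)
  have "\<exists>B\<ge>0. \<forall>q\<in>?K. \<bar>F i j q\<bar> \<le> B" for i j
  proof -
    have "continuous_on ?K (F i j)"
      unfolding F_def by (rule continuous_on_subset[OF continuous_on_dird_funpow[OF jet_shift[OF h]]]) (use R in auto)
    then have "bounded (F i j ` ?K)" by (intro compact_imp_bounded compact_continuous_image comp)
    then obtain B where B: "\<forall>q\<in>?K. norm (F i j q) \<le> B" unfolding bounded_iff by auto
    have "\<bar>F i j q\<bar> \<le> \<bar>B\<bar>" if "q \<in> ?K" for q using B[rule_format, OF that] by simp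
    then show ?thesis by (intro exI[of _ "\<bar>B\<bar>"] conjI ballI abs_ge_zero)
  qed
  then have "\<exists>B. \<forall>i j. 0 \<le> B i j \<and> (\<forall>q\<in>?K. \<bar>F i j q\<bar> \<le> B i j)" by metis
  then obtain B where B: "\<And>i j. 0 \<le> B i j" "\<And>i j q. q \<in> ?K \<Longrightarrow> \<bar>F i j q\<bar> \<le> B i j" by blast
  define A where "A = 1 + (\<Sum>i\<le>d + 4. \<Sum>j\<le>d + 4. B i j)"
  have A: "A > 0" unfolding A_def by (rule add_pos_nonneg) (auto intro!: sum_nonneg B(1))
  have BA: "B i j \<le> A" if "i + j \<le> d + 4" for i j
  proof -
    have "B i j \<le> (\<Sum>j\<le>d + 4. B i j)" using that by (intro member_le_sum) (auto simp: B(1))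
    also have "\<dots> \<le> (\<Sum>i\<le>d + 4. \<Sum>j\<le>d + 4. B i j)" using that by (intro member_le_sum) (auto intro!: sum_nonneg B(1))
    finally show ?thesis by (simp add: A_def)
  qed
  define r0 where "r0 = min 1 (R / (norm p0 + 1))"
  have n0: "norm p0 + 1 > 0" using norm_ge_zero[of p0] by linarith
  have r0: "r0 > 0" using R n0 by (simp add: r0_def)
  show ?thesis
  proof (rule exI[of _ A], rule conjI[OF A], rule exI[of _ r0], rule conjI[OF r0], intro allI impI)
    fix r P i j assume r: "0 < r" "r < r0" and P: "dist P p0 \<le> 1" and ij: "i + j \<le> d + 4"
    have "norm P \<le> norm p0 + 1" using P norm_triangle_sub[of P p0] by (simp add: dist_norm)
    then have "r * norm P \<le> r * (norm p0 + 1)" using r by (intro mult_left_mono) auto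
    also have "\<dots> \<le> R" using r n0 by (simp add: r0_def field_simps)
    finally have rP: "r * norm P \<le> R" .
    have seg: "t *\<^sub>R P \<in> cball (0, 0) R" if "0 \<le> t" "t \<le> r" for t
    proof -
      have "t * norm P \<le> r * norm P" using that by (intro mult_right_mono) auto
      then show ?thesis using rP that by (simp add: zero_prod_def[symmetric])
    qed
    have segU: "t *\<^sub>R P \<in> U" if "0 \<le> t" "t \<le> r" for t using seg[OF that] R(2) by blast
    let ?h = "\<lambda>a b. h (a + i) (b + j)"
    have "vanishes (d - (i + j)) ?h" using van by (auto simp: vanishes_def)
    from Taylor_ray[OF jet_shift[OF h] this r(1) segU]
    obtain t where t: "0 \<le> t" "t \<le> r" and e: "h i j (r *\<^sub>R P) = r ^ (d - (i + j)) / fact (d - (i + j)) * F i j (P, t *\<^sub>R P)"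
      by (auto simp: F_def)
    have "(P, t *\<^sub>R P) \<in> ?K" using P seg[OF t] by (simp add: dist_commute)
    then have FA: "\<bar>F i j (P, t *\<^sub>R P)\<bar> \<le> A" using B(2) BA[OF ij] order_trans by blast
    have "\<bar>h i j (r *\<^sub>R P)\<bar> = r ^ (d - (i + j)) * (\<bar>F i j (P, t *\<^sub>R P)\<bar> / fact (d - (i + j)))"
      unfolding e using r by (simp add: abs_mult)
    also have "\<dots> \<le> r ^ (d - (i + j)) * A"
    proof (intro mult_left_mono)
      have "\<bar>F i j (P, t *\<^sub>R P)\<bar> / fact (d - (i + j)) \<le> \<bar>F i j (P, t *\<^sub>R P)\<bar> / 1"
        by (intro divide_left_mono) (auto simp: fact_ge_1)
      then show "\<bar>F i j (P, t *\<^sub>R P)\<bar> / fact (d - (i + j)) \<le> A" using FA by simp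
    qed (use r in auto)
    finally have "r ^ (i + j) * \<bar>h i j (r *\<^sub>R P)\<bar> \<le> r ^ (i + j) * (r ^ (d - (i + j)) * A)" using r by (intro mult_left_mono) auto
    also have "\<dots> = r ^ (i + j + (d - (i + j))) * A" by (simp add: power_add)
    also have "\<dots> \<le> r ^ d * A" using r A by (intro mult_right_mono power_decreasing) (auto simp: r0_def)
    finally show "r *\<^sub>R P \<in> U \<and> r ^ (i + j) * \<bar>h i j (r *\<^sub>R P)\<bar> \<le> A * r ^ d"
      using segU[of r] r by (simp add: mult.commute)
  qed
qed

text \<open>Since \<open>p0\<close> and \<open>v\<close> span the plane, some derivative taken
  \<open>d - k\<close> times along \<open>p0\<close> and \<open>k\<close> times along
  \<open>v\<close> is nonzero at the origin. It is the leading Taylor coefficient, along rays near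
  \<open>p0\<close>, of the k-fold derivative along \<open>v\<close>. The numbers \<open>m\<close>
  and \<open>n\<close> allow both coordinate directions to be treated at once.\<close>

lemma order_derivative_lower_bound:
  assumes h: "jet U h" and U0: "(0, 0) \<in> U" and van: "vanishes d h"
    and nv: "\<exists>i j. i + j = d \<and> h i j (0, 0) \<noteq> 0" and det: "fst p0 * snd v - snd p0 * fst v \<noteq> 0"
    and v: "\<And>k. (dird v ^^ k) h = (\<lambda>i j. h (i + k * m) (j + k * n))" and mn: "m + n = 1"
  shows "\<exists>k\<le>d. \<exists>c>0. \<exists>e>0. \<forall>r P. 0 < r \<longrightarrow> r < e \<longrightarrow> dist P p0 < e \<longrightarrow> c * r ^ d \<le> r ^ k * \<bar>h (k * m) (k * n) (r *\<^sub>R P)\<bar>"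
proof -
  have "\<exists>k\<le>d. (dird p0 ^^ (d - k)) ((dird v ^^ k) h) 0 0 (0, 0) \<noteq> 0"
    using directional_derivatives_determine[OF det, of d h] nv by blast
  then obtain k where k: "k \<le> d" and nz: "(dird p0 ^^ (d - k)) (\<lambda>i j. h (i + k * m) (j + k * n)) 0 0 (0, 0) \<noteq> 0"
    unfolding v by blast
  let ?h = "\<lambda>i j. h (i + k * m) (j + k * n)"
  define F where "F q = (dird (fst q) ^^ (d - k)) ?h 0 0 (snd q)" for q :: "(real \<times> real) \<times> (real \<times> real)"
  have F0: "F (p0, (0, 0)) \<noteq> 0" using nz by (simp add: F_def)
  have op: "open (UNIV \<times> U)" by (intro open_Times jet_open[OF h]) auto
  have "continuous_on (UNIV \<times> U) F" unfolding F_def by (rule continuous_on_dird_funpow[OF jet_shift[OF h]])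
  then have "\<forall>q\<in>UNIV \<times> U. isCont F q" using continuous_on_eq_continuous_at[OF op] by blast
  then have "isCont F (p0, (0, 0))" using U0 by (elim ballE[of _ _ "(p0, (0, 0))"]) simp_all
  define c0 where "c0 = \<bar>F (p0, (0, 0))\<bar> / 2"
  have c0: "c0 > 0" using F0 by (simp add: c0_def)
  obtain e1 where e1: "e1 > 0" "\<And>q. dist q (p0, (0, 0)) < e1 \<Longrightarrow> \<bar>F q - F (p0, (0, 0))\<bar> < c0"
    using \<open>isCont F (p0, (0, 0))\<close> c0 unfolding continuous_at_eps_delta dist_real_def by blast
  obtain R where R: "R > 0" "cball (0, 0) R \<subseteq> U" using open_contains_cball[of U] jet_open[OF h] U0 by blast
  define M where "M = norm p0 + 1"
  have M: "M > 0" using norm_ge_zero[of p0] unfolding M_def by linarith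
  define e where "e = min (min 1 (e1 / 2)) (min (R / M) (e1 / (2 * M)))"
  have e: "e > 0" using e1 R M by (simp add: e_def)
  have ee: "e \<le> 1" "e \<le> e1 / 2" "e \<le> R / M" "e \<le> e1 / (2 * M)" by (simp_all only: e_def min_le_iff_disj order_refl simp_thms)
  show ?thesis
  proof (rule exI[of _ k], rule conjI[OF k], rule exI[of _ "c0 / fact d"], rule conjI, use c0 in simp, rule exI[of _ e], rule conjI[OF e], intro allI impI)
    fix r P assume r: "0 < r" "r < e" and P: "dist P p0 < e"
    have nP: "norm P \<le> M" using P ee(1) norm_triangle_sub[of P p0] by (simp add: dist_norm M_def)
    have seg: "t * norm P \<le> R \<and> t * norm P < e1 / 2" if "0 \<le> t" "t \<le> r" for t
    proof -
      have "t * norm P \<le> r * M" using that nP r by (intro mult_mono) auto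
      moreover have "r * M < e * M" using r M by simp
      moreover have "e * M \<le> R" "e * M \<le> e1 / 2" using ee(3,4) M by (simp_all add: field_simps)
      ultimately show ?thesis by linarith
    qed
    have segU: "t *\<^sub>R P \<in> U" if "0 \<le> t" "t \<le> r" for t
    proof -
      have "t *\<^sub>R P \<in> cball (0, 0) R" using seg[OF that] that by (simp add: zero_prod_def[symmetric])
      then show ?thesis using R(2) by blast
    qed
    have "vanishes (d - k) ?h" using van mn k unfolding vanishes_def
    proof (intro allI impI)
      fix i j assume a: "\<forall>i j. i + j < d \<longrightarrow> h i j (0, 0) = 0" and b: "i + j < d - k"
      have "k * m + k * n = k" using mn by (metis distrib_left mult.right_neutral)
      then have "(i + k * m) + (j + k * n) < d" using b by linarith
      then show "h (i + k * m) (j + k * n) (0, 0) = 0" using a by blast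
    qed
    from Taylor_ray[OF jet_shift[OF h] this r(1) segU]
    obtain t where t: "0 \<le> t" "t \<le> r" and eq: "h (k * m) (k * n) (r *\<^sub>R P) = r ^ (d - k) / fact (d - k) * F (P, t *\<^sub>R P)"
      by (auto simp: F_def)
    have "dist (P, t *\<^sub>R P) (p0, (0, 0)) < e1"
    proof -
      have "dist (P, t *\<^sub>R P) (p0, (0, 0)) \<le> dist P p0 + dist (t *\<^sub>R P) (0, 0)"
        unfolding dist_Pair_Pair by (rule sqrt_sum_squares_le_sum) auto
      also have "dist (t *\<^sub>R P) (0, 0) = t * norm P" using t by (simp add: zero_prod_def[symmetric])
      finally show ?thesis using seg[OF t] P ee(2) by linarith
    qed
    from e1(2)[OF this] have "c0 \<le> \<bar>F (P, t *\<^sub>R P)\<bar>" unfolding c0_def by linarith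
    then have "c0 / fact d \<le> \<bar>F (P, t *\<^sub>R P)\<bar> / fact (d - k)"
      using c0 by (intro frac_le fact_mono) auto
    then have "r ^ d * (c0 / fact d) \<le> r ^ d * (\<bar>F (P, t *\<^sub>R P)\<bar> / fact (d - k))" using r by (intro mult_left_mono) auto
    also have "\<dots> = r ^ k * \<bar>h (k * m) (k * n) (r *\<^sub>R P)\<bar>"
    proof -
      have "r ^ d = r ^ k * r ^ (d - k)" using k by (simp add: power_add[symmetric])
      then show ?thesis unfolding eq using r by (simp add: abs_mult)
    qed
    finally show "c0 / fact d * r ^ d \<le> r ^ k * \<bar>h (k * m) (k * n) (r *\<^sub>R P)\<bar>" by (simp add: mult.commute)
  qed
qed

text \<open>A local estimate whose constant is the same for all dilates r, with freedom in the
  corner (x0, y0). The first feature serves the sum over annuli, the second a compactness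
  argument.\<close>

definition trif_bounded_near :: "(real \<times> real \<Rightarrow> real) \<Rightarrow> real \<Rightarrow> real \<times> real \<Rightarrow> bool" where
  "trif_bounded_near S e p0 \<longleftrightarrow> (\<exists>\<delta>>0. \<exists>r0>0. \<exists>C>0. \<forall>r x0 y0 lam f1 f2 f3. 0 < r \<longrightarrow> r < r0 \<longrightarrow> \<bar>x0 - fst p0\<bar> \<le> \<delta> \<longrightarrow> \<bar>y0 - snd p0\<bar> \<le> \<delta> \<longrightarrow> lam \<noteq> 0 \<longrightarrow>
     bfun f1 \<longrightarrow> bfun f2 \<longrightarrow> bfun f3 \<longrightarrow> (\<forall>t. f1 t \<noteq> 0 \<longrightarrow> r * x0 \<le> t \<and> t < r * (x0 + \<delta>)) \<longrightarrow> (\<forall>t. f2 t \<noteq> 0 \<longrightarrow> r * y0 \<le> t \<and> t < r * (y0 + \<delta>)) \<longrightarrow>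
     norm (trif (\<lambda>p. lam * S p) f1 f2 f3) \<le> C * \<bar>lam\<bar> powr (- e) * sqrt (nsq f1 * nsq f2 * nsq f3))"

text \<open>Off both axes \<open>p0\<close> is independent of (1, 0) and of (0, 1), so the dilates
  of H have a pure x-derivative and a pure y-derivative bounded below. Rescaling a small square near
  \<open>r *\<^sub>R p0\<close> to unit size then leads to \<open>local_estimate\<close>.\<close>

lemma regular_point_estimate:
  assumes g: "jet U g" and gm: "g 0 0 \<in> borel_measurable borel" and U0: "(0, 0) \<in> U" and van: "vanishes d (hjet g)"
    and nv: "\<exists>i j. i + j = d \<and> hjet g i j (0, 0) \<noteq> 0" and p0: "fst p0 \<noteq> 0" "snd p0 \<noteq> 0"
  shows "trif_bounded_near (g 0 0) (1 / (2 * (3 + real d))) p0"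
proof -
  let ?h = "hjet g"
  note jh = jet_hjet[OF g]
  obtain A rA where A: "A > 0" "rA > 0" and bd: "\<forall>r P i j. 0 < r \<longrightarrow> r < rA \<longrightarrow> dist P p0 \<le> 1 \<longrightarrow> i + j \<le> d + 4 \<longrightarrow>
     r *\<^sub>R P \<in> U \<and> r ^ (i + j) * \<bar>?h i j (r *\<^sub>R P)\<bar> \<le> A * r ^ d"
    using order_derivative_bound[OF jh U0 van, of p0] by (elim exE conjE)
  have "\<exists>k\<le>d. \<exists>c>0. \<exists>e>0. \<forall>r P. 0 < r \<longrightarrow> r < e \<longrightarrow> dist P p0 < e \<longrightarrow> c * r ^ d \<le> r ^ k * \<bar>?h (k * 1) (k * 0) (r *\<^sub>R P)\<bar>"
    by (rule order_derivative_lower_bound[OF jh U0 van nv, of _ "(1, 0)"]) (use p0 in \<open>auto simp: dird_unit_funpow\<close>)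
  then obtain k1 c1 e1 where k1: "k1 \<le> d" and c1: "c1 > 0" and e1: "e1 > 0" and lo1: "\<forall>r P. 0 < r \<longrightarrow> r < e1 \<longrightarrow> dist P p0 < e1 \<longrightarrow> c1 * r ^ d \<le> r ^ k1 * \<bar>?h (k1 * 1) (k1 * 0) (r *\<^sub>R P)\<bar>"
    by (elim exE conjE)
  have "\<exists>k\<le>d. \<exists>c>0. \<exists>e>0. \<forall>r P. 0 < r \<longrightarrow> r < e \<longrightarrow> dist P p0 < e \<longrightarrow> c * r ^ d \<le> r ^ k * \<bar>?h (k * 0) (k * 1) (r *\<^sub>R P)\<bar>"
    by (rule order_derivative_lower_bound[OF jh U0 van nv, of _ "(0, 1)"]) (use p0 in \<open>auto simp: dird_unit_funpow\<close>)
  then obtain k2 c2 e2 where k2: "k2 \<le> d" and c2: "c2 > 0" and e2: "e2 > 0" and lo2: "\<forall>r P. 0 < r \<longrightarrow> r < e2 \<longrightarrow> dist P p0 < e2 \<longrightarrow> c2 * r ^ d \<le> r ^ k2 * \<bar>?h (k2 * 0) (k2 * 1) (r *\<^sub>R P)\<bar>"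
    by (elim exE conjE)
  \<comment> \<open>In each coordinate the corner is off by at most \<delta> and the rescaled square
    from -1 to 2 adds at most 2 \<delta>, so its image stays within 6 \<delta> of
    \<open>p0\<close>.\<close>
  define \<delta> where "\<delta> = min 1 (min e1 e2) / 12"
  define r0 where "r0 = min (min 1 rA) (min e1 e2)"
  define c where "c = min c1 c2 * \<delta> ^ (3 + d)"
  have \<delta>: "\<delta> > 0" "\<delta> \<le> 1" "6 * \<delta> < 1" "6 * \<delta> < e1" "6 * \<delta> < e2" using e1 e2 by (auto simp: \<delta>_def)
  have r0: "r0 > 0" using e1 e2 A by (simp add: r0_def)
  have c: "c > 0" using c1 c2 \<delta> by (simp add: c_def)
  obtain C where C: "C > 0" and loc: "\<forall>U g. jet U g \<longrightarrow> {-1..2} \<times> {-1..2} \<subseteq> U \<longrightarrow> g 0 0 \<in> borel_measurable borel \<longrightarrow>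
     finite_order_box d A c (hjet g) \<longrightarrow> finite_order_box d A c (swapj (hjet g)) \<longrightarrow>
     (\<forall>lam f1 f2 f3. lam \<noteq> 0 \<longrightarrow> bfun f1 \<longrightarrow> bfun f2 \<longrightarrow> bfun f3 \<longrightarrow>
       (\<forall>t. f1 t \<noteq> 0 \<longrightarrow> 0 \<le> t \<and> t < 1) \<longrightarrow> (\<forall>t. f2 t \<noteq> 0 \<longrightarrow> 0 \<le> t \<and> t < 1) \<longrightarrow>
       norm (trif (\<lambda>p. lam * g 0 0 p) f1 f2 f3) \<le> C * \<bar>lam\<bar> powr (- (1 / (2 * (3 + real d)))) * sqrt (nsq f1 * nsq f2 * nsq f3))"
    using local_estimate[OF A(1) c, of d] by (elim exE conjE)
  define e where "e = 1 / (2 * (3 + real d))"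
  show ?thesis unfolding trif_bounded_near_def e_def[symmetric]
  proof (rule exI[of _ \<delta>], rule conjI[OF \<delta>(1)], rule exI[of _ r0], rule conjI[OF r0], rule exI[of _ C], rule conjI[OF C], intro allI impI)
    fix r x0 y0 lam :: real and f1 f2 f3 :: "real \<Rightarrow> complex"
    assume r: "0 < r" "r < r0" and xy: "\<bar>x0 - fst p0\<bar> \<le> \<delta>" "\<bar>y0 - snd p0\<bar> \<le> \<delta>" and lam: "lam \<noteq> 0" and f: "bfun f1" "bfun f2" "bfun f3"
      and supp: "\<forall>t. f1 t \<noteq> 0 \<longrightarrow> r * x0 \<le> t \<and> t < r * (x0 + \<delta>)" "\<forall>t. f2 t \<noteq> 0 \<longrightarrow> r * y0 \<le> t \<and> t < r * (y0 + \<delta>)"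
    have rr: "r < 1" "r < rA" "r < e1" "r < e2" using r by (auto simp: r0_def)
    define t where "t = r * \<delta>"
    have t: "t > 0" using r \<delta> by (simp add: t_def)
    let ?A = "affmap (r * x0, r * y0) (t, 0) (0, t)"
    define P where "P p = (x0 + \<delta> * fst p, y0 + \<delta> * snd p)" for p :: "real \<times> real"
    have AP: "?A p = r *\<^sub>R P p" for p by (simp add: affmap_def P_def t_def algebra_simps)
    have dP: "dist (P p) p0 \<le> 6 * \<delta>" if "p \<in> {-1..2} \<times> {-1..2}" for p
    proof -
      have b: "\<bar>fst p\<bar> \<le> 2" "\<bar>snd p\<bar> \<le> 2" using that by auto
      have "\<bar>\<delta> * fst p\<bar> \<le> \<delta> * 2" "\<bar>\<delta> * snd p\<bar> \<le> \<delta> * 2" unfolding abs_mult using b \<delta> by (auto intro!: mult_mono)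
      then have "\<bar>x0 + \<delta> * fst p - fst p0\<bar> \<le> 3 * \<delta>" "\<bar>y0 + \<delta> * snd p - snd p0\<bar> \<le> 3 * \<delta>" using xy by linarith+
      moreover have "dist (P p) p0 \<le> \<bar>x0 + \<delta> * fst p - fst p0\<bar> + \<bar>y0 + \<delta> * snd p - snd p0\<bar>"
        unfolding P_def dist_prod_def dist_real_def by (simp add: sqrt_sum_squares_le_sum_abs)
      ultimately show ?thesis by linarith
    qed
    \<comment> \<open>The three derivatives in H produce t^3 with t = r \<delta>, and H itself has
      size r^d. Division by r^(3+d) leaves bounds independent of r; the same power is put back into
      \<open>lam'\<close>.\<close>
    define G where "G i j p = 1 / r ^ (3 + d) * ((dird (t, 0) ^^ i) ((dird (0, t) ^^ j) g)) 0 0 (?A p)" for i j p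
    have jG: "jet (?A -` U) G" unfolding G_def[abs_def] by (rule jet_affmap[OF g])
    have Gv: "G i j p = 1 / r ^ (3 + d) * (t ^ i * t ^ j * g i j (r *\<^sub>R P p))" for i j p
      unfolding G_def dird_axis_funpow AP by simp
    have hG: "hjet G i j p = \<delta> ^ (3 + i + j) * (r ^ (i + j) * ?h i j (r *\<^sub>R P p) / r ^ d)" for i j p
    proof -
      have "t ^ (i + 2) * t ^ (j + 1) = t ^ (3 + i + j)" "t ^ (i + 1) * t ^ (j + 2) = t ^ (3 + i + j)"
        unfolding power_add[symmetric] by (rule arg_cong[where f = "(^) t"], simp)+
      then have "hjet G i j p = 1 / r ^ (3 + d) * (t ^ (3 + i + j) * ?h i j (r *\<^sub>R P p))"
        unfolding hjet_def Gv by (simp only: right_diff_distrib)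
      moreover have "t ^ (3 + i + j) = \<delta> ^ (3 + i + j) * (r ^ 3 * r ^ (i + j))"
        unfolding t_def power_mult_distrib by (simp add: power_add)
      moreover have "r ^ (3 + d) = r ^ 3 * r ^ d" by (rule power_add)
      ultimately show ?thesis using r by simp
    qed
    have sub: "{-1..2} \<times> {-1..2} \<subseteq> ?A -` U"
    proof
      fix p assume p: "p \<in> {-1..2::real} \<times> {-1..2::real}"
      have "dist (P p) p0 \<le> 1" using dP[OF p] \<delta> by linarith
      then have "r *\<^sub>R P p \<in> U" using bd[rule_format, of r "P p" 0 0] r rr by simp
      then show "p \<in> ?A -` U" by (simp add: AP)
    qed
    have up: "\<bar>hjet G i j p\<bar> \<le> A" if p: "p \<in> {-1..2} \<times> {-1..2}" and ij: "i + j \<le> d + 4" for i j p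
    proof -
      have "dist (P p) p0 \<le> 1" using dP[OF p] \<delta> by linarith
      then have "r ^ (i + j) * \<bar>?h i j (r *\<^sub>R P p)\<bar> \<le> A * r ^ d" using bd[rule_format, of r "P p" i j] r rr ij by simp
      then have "r ^ (i + j) * \<bar>?h i j (r *\<^sub>R P p)\<bar> / r ^ d \<le> A" using r by (simp add: field_simps)
      moreover have "\<delta> ^ (3 + i + j) \<le> 1" using \<delta> by (intro power_le_one) auto
      ultimately have "\<delta> ^ (3 + i + j) * (r ^ (i + j) * \<bar>?h i j (r *\<^sub>R P p)\<bar> / r ^ d) \<le> 1 * A"
        using r \<delta> by (intro mult_mono) auto
      then show ?thesis unfolding hG using r \<delta> by (simp add: abs_mult)
    qed
    have dn: "c \<le> \<bar>hjet G i j p\<bar>" if ij: "i + j \<le> d" and lo: "c' * r ^ d \<le> r ^ (i + j) * \<bar>?h i j (r *\<^sub>R P p)\<bar>" and c': "min c1 c2 \<le> c'" for i j p c'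
    proof -
      have "c' \<le> r ^ (i + j) * \<bar>?h i j (r *\<^sub>R P p)\<bar> / r ^ d" using lo r by (simp add: field_simps)
      moreover have "\<delta> ^ (3 + d) \<le> \<delta> ^ (3 + i + j)" using \<delta> ij by (intro power_decreasing) auto
      ultimately have "\<delta> ^ (3 + d) * min c1 c2 \<le> \<delta> ^ (3 + i + j) * (r ^ (i + j) * \<bar>?h i j (r *\<^sub>R P p)\<bar> / r ^ d)"
        using c' c1 c2 \<delta> by (intro mult_mono) auto
      then show ?thesis unfolding hG c_def using r \<delta> by (simp add: abs_mult mult.commute)
    qed
    have fob1: "finite_order_box d A c (hjet G)"
      unfolding finite_order_box_def
    proof (intro conjI)
      show "\<exists>U. {-1..2} \<times> {-1..2} \<subseteq> U \<and> jet U (hjet G)" using sub jet_hjet[OF jG] by blast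
      show "\<forall>i j p. i + j \<le> d + 4 \<longrightarrow> p \<in> {-1..2} \<times> {-1..2} \<longrightarrow> \<bar>hjet G i j p\<bar> \<le> A" using up by blast
      show "\<exists>k\<le>d. \<forall>p\<in>{-1..2} \<times> {-1..2}. c \<le> \<bar>hjet G k 0 p\<bar>"
      proof (intro exI[of _ k1] conjI k1 ballI)
        fix p assume p: "p \<in> {-1..2::real} \<times> {-1..2::real}"
        have "dist (P p) p0 < e1" using dP[OF p] \<delta> by linarith
        then have "c1 * r ^ d \<le> r ^ (k1 + 0) * \<bar>?h k1 0 (r *\<^sub>R P p)\<bar>" using lo1[rule_format, of r "P p"] r rr by simp
        from dn[OF _ this] k1 show "c \<le> \<bar>hjet G k1 0 p\<bar>" by simp
      qed
    qed
    have fob2: "finite_order_box d A c (swapj (hjet G))"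
      unfolding finite_order_box_def
    proof (intro conjI)
      have "{-1..2} \<times> {-1..2} \<subseteq> (\<lambda>p. (snd p, fst p)) -` (?A -` U)" using sub by (auto simp: subset_iff)
      then show "\<exists>U. {-1..2} \<times> {-1..2} \<subseteq> U \<and> jet U (swapj (hjet G))" using jet_swapj[OF jet_hjet[OF jG]] by blast
      show "\<forall>i j p. i + j \<le> d + 4 \<longrightarrow> p \<in> {-1..2} \<times> {-1..2} \<longrightarrow> \<bar>swapj (hjet G) i j p\<bar> \<le> A"
        unfolding swapj_def by (intro allI impI up) (auto simp: add.commute)
      show "\<exists>k\<le>d. \<forall>p\<in>{-1..2} \<times> {-1..2}. c \<le> \<bar>swapj (hjet G) k 0 p\<bar>"
      proof (intro exI[of _ k2] conjI k2 ballI)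
        fix p' assume p': "p' \<in> {-1..2::real} \<times> {-1..2::real}"
        define p where "p = (snd p', fst p')"
        have p: "p \<in> {-1..2} \<times> {-1..2}" using p' by (auto simp: p_def)
        have "dist (P p) p0 < e2" using dP[OF p] \<delta> by linarith
        then have "c2 * r ^ d \<le> r ^ (0 + k2) * \<bar>?h 0 k2 (r *\<^sub>R P p)\<bar>" using lo2[rule_format, of r "P p"] r rr by simp
        from dn[OF _ this] k2 show "c \<le> \<bar>swapj (hjet G) k2 0 p'\<bar>" by (simp add: swapj_def p_def)
      qed
    qed
    define F1 F2 F3 where "F1 x = f1 (r * x0 + t * x)" and "F2 y = f2 (r * y0 + t * y)" and "F3 u = f3 (r * x0 + r * y0 + t * u)" for x y u
    have bF: "bfun F1" "bfun F2" "bfun F3" unfolding F1_def F2_def F3_def using t by (auto intro!: bfun_affine f)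
    have nF: "nsq F1 = nsq f1 / t" "nsq F2 = nsq f2 / t" "nsq F3 = nsq f3 / t"
      unfolding F1_def F2_def F3_def using t by (simp_all add: nsq_affine)
    define lam' where "lam' = lam * r ^ (3 + d)"
    have l': "lam' \<noteq> 0" using lam r by (simp add: lam'_def)
    have phase: "lam' * G 0 0 p = lam * g 0 0 (r * x0 + t * fst p, r * y0 + t * snd p)" for p
      using r by (simp add: lam'_def Gv P_def t_def algebra_simps)
    have "norm (trif (\<lambda>p. lam' * G 0 0 p) F1 F2 F3) \<le> C * \<bar>lam'\<bar> powr (- e) * sqrt (nsq F1 * nsq F2 * nsq F3)"
      unfolding e_def
    proof (rule loc[rule_format, OF jG sub _ fob1 fob2 l' bF])
      have "(\<lambda>p. 1 / r ^ (3 + d) * g 0 0 (r * (x0 + \<delta> * fst p), r * (y0 + \<delta> * snd p))) \<in> borel_measurable borel"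
        using gm unfolding borel_prod[symmetric] by measurable
      then show "G 0 0 \<in> borel_measurable borel" unfolding Gv[abs_def] P_def by simp
      fix x assume "F1 x \<noteq> 0"
      then have "r * x0 \<le> r * x0 + t * x \<and> r * x0 + t * x < r * (x0 + \<delta>)" using supp(1) unfolding F1_def by blast
      then have "0 \<le> t * x" "t * x < t * 1" by (auto simp: t_def algebra_simps)
      then show "0 \<le> x \<and> x < 1" using t by (simp add: zero_le_mult_iff)
    next
      fix x assume "F2 x \<noteq> 0"
      then have "r * y0 \<le> r * y0 + t * x \<and> r * y0 + t * x < r * (y0 + \<delta>)" using supp(2) unfolding F2_def by blast
      then have "0 \<le> t * x" "t * x < t * 1" by (auto simp: t_def algebra_simps)
      then show "0 \<le> x \<and> x < 1" using t by (simp add: zero_le_mult_iff)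
    qed
    also have "\<dots> = C * (\<bar>lam\<bar> powr (- e) * r powr (- (1/2))) * (t powr (-3/2) * sqrt (nsq f1 * nsq f2 * nsq f3))"
    proof -
      have "\<bar>lam'\<bar> powr (- e) = \<bar>lam\<bar> powr (- e) * r powr (- (1/2))"
      proof -
        have "\<bar>lam'\<bar> = \<bar>lam\<bar> * r powr (3 + real d)" using r powr_realpow[of r "3 + d"] by (simp add: lam'_def abs_mult)
        then have "\<bar>lam'\<bar> powr (- e) = \<bar>lam\<bar> powr (- e) * r powr ((3 + real d) * - e)" by (simp add: powr_mult powr_powr)
        moreover have "(3 + real d) * - e = - (1/2)" by (simp add: e_def field_simps)
        ultimately show ?thesis by (simp only:)
      qed
      moreover have "sqrt (nsq F1 * nsq F2 * nsq F3) = t powr (-3/2) * sqrt (nsq f1 * nsq f2 * nsq f3)"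
      proof -
        have "nsq F1 * nsq F2 * nsq F3 = (t powr (-3/2))\<^sup>2 * (nsq f1 * nsq f2 * nsq f3)"
        proof -
          have "(t powr (-3/2))\<^sup>2 = t powr (-3)" by (simp add: power2_eq_square powr_add[symmetric])
          also have "\<dots> = 1 / t ^ 3" using t powr_realpow[of t 3] by (simp add: powr_minus_divide)
          finally show ?thesis unfolding nF by (simp add: power3_eq_cube)
        qed
        then show ?thesis by (simp add: real_sqrt_mult)
      qed
      ultimately show ?thesis by simp
    qed
    finally have est: "norm (trif (\<lambda>p. lam' * G 0 0 p) F1 F2 F3) \<le> C * (\<bar>lam\<bar> powr (- e) * r powr (- (1/2))) * (t powr (-3/2) * sqrt (nsq f1 * nsq f2 * nsq f3))" .
    have Sm: "(\<lambda>p. lam * g 0 0 p) \<in> borel_measurable borel" using gm by measurable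
    have "trif (\<lambda>p. lam * g 0 0 p) f1 f2 f3 = of_real (t\<^sup>2) * trif (\<lambda>p. lam' * G 0 0 p) F1 F2 F3"
      unfolding phase F1_def F2_def F3_def using trif_rescale[OF Sm f t, of "r * x0" "r * y0"] by simp
    then have "norm (trif (\<lambda>p. lam * g 0 0 p) f1 f2 f3) = t\<^sup>2 * norm (trif (\<lambda>p. lam' * G 0 0 p) F1 F2 F3)"
      by (simp add: norm_mult norm_power)
    also have "\<dots> \<le> t\<^sup>2 * (C * (\<bar>lam\<bar> powr (- e) * r powr (- (1/2))) * (t powr (-3/2) * sqrt (nsq f1 * nsq f2 * nsq f3)))"
      by (intro mult_left_mono est) auto
    also have "\<dots> = (t\<^sup>2 * t powr (-3/2) * r powr (- (1/2))) * (C * \<bar>lam\<bar> powr (- e) * sqrt (nsq f1 * nsq f2 * nsq f3))"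
      by (simp only: mult.assoc mult.commute mult.left_commute)
    \<comment> \<open>All powers of r cancel: t^2 comes from the change of variables, t^(-3/2) from
      the three norms and r^(-1/2) from \<open>lam'\<close>. What remains is \<delta>^(1/2).\<close>
    also have "\<dots> \<le> 1 * (C * \<bar>lam\<bar> powr (- e) * sqrt (nsq f1 * nsq f2 * nsq f3))"
    proof (rule mult_right_mono)
      have "t\<^sup>2 * t powr (-3/2) = t powr (1/2)"
      proof -
        have "t\<^sup>2 = t powr 2" using t powr_realpow[of t 2] by simp
        then have "t\<^sup>2 * t powr (-3/2) = t powr (2 + (-3/2))" by (simp only: powr_add)
        then show ?thesis by simp
      qed
      also have "\<dots> = r powr (1/2) * \<delta> powr (1/2)" unfolding t_def by (rule powr_mult)
      finally have "t\<^sup>2 * t powr (-3/2) * r powr (- (1/2)) = \<delta> powr (1/2) * (r powr (1/2) * r powr (- (1/2)))" by simp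
      also have "r powr (1/2) * r powr (- (1/2)) = 1" using r by (simp add: powr_add[symmetric])
      also have "\<delta> powr (1/2) * 1 \<le> 1" using \<delta> powr_mono2[of "1/2" \<delta> 1] by simp
      finally show "t\<^sup>2 * t powr (-3/2) * r powr (- (1/2)) \<le> 1" .
    qed (use C in \<open>intro mult_nonneg_nonneg; simp add: nsq_nonneg\<close>)
    finally show "norm (trif (\<lambda>p. lam * g 0 0 p) f1 f2 f3) \<le> C * \<bar>lam\<bar> powr (- e) * sqrt (nsq f1 * nsq f2 * nsq f3)" by simp
  qed
qed

section \<open>Permuting the three functions\<close>

lemma trif_swap:
  assumes S: "S \<in> borel_measurable borel" and f: "bfun f1" "bfun f2" "bfun f3"
  shows "trif S f1 f2 f3 = trif (\<lambda>p. S (snd p, fst p)) f2 f1 f3"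
proof -
  have S': "(\<lambda>p. S (snd p, fst p)) \<in> borel_measurable borel" using S unfolding borel_prod[symmetric] by measurable
  show ?thesis
    unfolding trif_def trans[OF bfun_Fubini(1) bfun_Fubini(2)[symmetric], OF bfun_trif[OF S f] bfun_trif[OF S f]]
      bfun_Fubini(1)[OF bfun_trif[OF S' f(2) f(1) f(3)]]
    by (simp add: mult.commute add.commute)
qed

text \<open>In the variables x' = -x and y' = x + y the sum x' + y' is y, so \<open>f2\<close> and
  \<open>f3\<close> exchange their roles.\<close>

lemma trif_shear:
  assumes S: "S \<in> borel_measurable borel" and f: "bfun f1" "bfun f2" "bfun f3"
  shows "trif S f1 f2 f3 = trif (\<lambda>p. S (- fst p, fst p + snd p)) (\<lambda>x. f1 (- x)) f3 f2"
proof -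
  have S': "(\<lambda>p. S (- fst p, fst p + snd p)) \<in> borel_measurable borel" using S unfolding borel_prod[symmetric] by measurable
  have f1': "bfun (\<lambda>x. f1 (- x))" using bfun_affine[OF f(1), of "-1" 0] by simp
  have "trif S f1 f2 f3 = (LINT x|lborel. LINT y|lborel. cis (S (x, y)) * (f1 x * f2 y * f3 (x + y)))"
    unfolding trif_def using bfun_Fubini(1)[OF bfun_trif[OF S f]] by simp
  also have "\<dots> = (LINT x|lborel. LINT y|lborel. cis (S (- x, y)) * (f1 (- x) * f2 y * f3 (- x + y)))"
    using lborel_integral_shift(4)[of "\<lambda>x. LINT y|lborel. cis (S (x, y)) * (f1 x * f2 y * f3 (x + y))" 0] by simp
  also have "\<dots> = (LINT x|lborel. LINT y|lborel. cis (S (- x, x + y)) * (f1 (- x) * f2 (x + y) * f3 (- x + (x + y))))"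
  proof -
    have "(LINT y|lborel. cis (S (- x, y)) * (f1 (- x) * f2 y * f3 (- x + y))) = (LINT y|lborel. cis (S (- x, x + y)) * (f1 (- x) * f2 (x + y) * f3 (- x + (x + y))))" for x
      by (rule lborel_integral_shift(1)[symmetric])
    then show ?thesis by simp
  qed
  also have "\<dots> = trif (\<lambda>p. S (- fst p, fst p + snd p)) (\<lambda>x. f1 (- x)) f3 f2"
    unfolding trif_def bfun_Fubini(1)[OF bfun_trif[OF S' f1' f(3) f(2)]] by (simp add: mult_ac)
  finally show ?thesis .
qed

lemma trif_bounded_near_swap:
  assumes S: "S \<in> borel_measurable borel" and tb: "trif_bounded_near (\<lambda>p. S (snd p, fst p)) e (snd p0, fst p0)"
  shows "trif_bounded_near S e p0"
proof -
  obtain \<delta> r0 C where \<delta>: "\<delta> > 0" and r0: "r0 > 0" and C: "C > 0" and est: "\<forall>r x0 y0 lam f1 f2 f3. 0 < r \<longrightarrow> r < r0 \<longrightarrow> \<bar>x0 - fst (snd p0, fst p0)\<bar> \<le> \<delta> \<longrightarrow> \<bar>y0 - snd (snd p0, fst p0)\<bar> \<le> \<delta> \<longrightarrow> lam \<noteq> 0 \<longrightarrow>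
     bfun f1 \<longrightarrow> bfun f2 \<longrightarrow> bfun f3 \<longrightarrow> (\<forall>t. f1 t \<noteq> 0 \<longrightarrow> r * x0 \<le> t \<and> t < r * (x0 + \<delta>)) \<longrightarrow> (\<forall>t. f2 t \<noteq> 0 \<longrightarrow> r * y0 \<le> t \<and> t < r * (y0 + \<delta>)) \<longrightarrow>
     norm (trif (\<lambda>p. lam * S (snd p, fst p)) f1 f2 f3) \<le> C * \<bar>lam\<bar> powr (- e) * sqrt (nsq f1 * nsq f2 * nsq f3)"
    using tb unfolding trif_bounded_near_def by (elim exE conjE)
  show ?thesis unfolding trif_bounded_near_def
  proof (rule exI[of _ \<delta>], rule conjI[OF \<delta>], rule exI[of _ r0], rule conjI[OF r0], rule exI[of _ C], rule conjI[OF C], intro allI impI)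
    fix r x0 y0 lam :: real and f1 f2 f3 :: "real \<Rightarrow> complex"
    assume a: "0 < r" "r < r0" "\<bar>x0 - fst p0\<bar> \<le> \<delta>" "\<bar>y0 - snd p0\<bar> \<le> \<delta>" "lam \<noteq> 0" and f: "bfun f1" "bfun f2" "bfun f3"
      and supp: "\<forall>t. f1 t \<noteq> 0 \<longrightarrow> r * x0 \<le> t \<and> t < r * (x0 + \<delta>)" "\<forall>t. f2 t \<noteq> 0 \<longrightarrow> r * y0 \<le> t \<and> t < r * (y0 + \<delta>)"
    have Sm: "(\<lambda>p. lam * S p) \<in> borel_measurable borel" using S by measurable
    have "norm (trif (\<lambda>p. lam * S (snd p, fst p)) f2 f1 f3) \<le> C * \<bar>lam\<bar> powr (- e) * sqrt (nsq f2 * nsq f1 * nsq f3)"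
      by (rule est[rule_format, of r y0 x0]) (use a f supp in auto)
    then show "norm (trif (\<lambda>p. lam * S p) f1 f2 f3) \<le> C * \<bar>lam\<bar> powr (- e) * sqrt (nsq f1 * nsq f2 * nsq f3)"
      unfolding trif_swap[OF Sm f] by (simp add: mult.commute)
  qed
qed

text \<open>The reflection moves the left corner in x to -x0 - \<delta> and reverses the half-open
  interval, while the interval for x + y has length 2 \<delta>. Taking \<delta> as a third of
  \<open>\<delta>1\<close> leaves room for all of this.\<close>

lemma trif_bounded_near_shear:
  assumes S: "S \<in> borel_measurable borel" and tb: "trif_bounded_near (\<lambda>p. S (- fst p, fst p + snd p)) e (- fst p0, fst p0 + snd p0)"
  shows "trif_bounded_near S e p0"
proof -
  obtain \<delta>1 r0 C where \<delta>1: "\<delta>1 > 0" and r0: "r0 > 0" and C: "C > 0" and est: "\<forall>r x0 y0 lam f1 f2 f3. 0 < r \<longrightarrow> r < r0 \<longrightarrow> \<bar>x0 - fst (- fst p0, fst p0 + snd p0)\<bar> \<le> \<delta>1 \<longrightarrow> \<bar>y0 - snd (- fst p0, fst p0 + snd p0)\<bar> \<le> \<delta>1 \<longrightarrow> lam \<noteq> 0 \<longrightarrow>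
     bfun f1 \<longrightarrow> bfun f2 \<longrightarrow> bfun f3 \<longrightarrow> (\<forall>t. f1 t \<noteq> 0 \<longrightarrow> r * x0 \<le> t \<and> t < r * (x0 + \<delta>1)) \<longrightarrow> (\<forall>t. f2 t \<noteq> 0 \<longrightarrow> r * y0 \<le> t \<and> t < r * (y0 + \<delta>1)) \<longrightarrow>
     norm (trif (\<lambda>p. lam * S (- fst p, fst p + snd p)) f1 f2 f3) \<le> C * \<bar>lam\<bar> powr (- e) * sqrt (nsq f1 * nsq f2 * nsq f3)"
    using tb unfolding trif_bounded_near_def by (elim exE conjE)
  define \<delta> where "\<delta> = \<delta>1 / 3"
  have \<delta>: "\<delta> > 0" using \<delta>1 by (simp add: \<delta>_def)
  show ?thesis unfolding trif_bounded_near_def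
  proof (rule exI[of _ \<delta>], rule conjI[OF \<delta>], rule exI[of _ r0], rule conjI[OF r0], rule exI[of _ C], rule conjI[OF C], intro allI impI)
    fix r x0 y0 lam :: real and f1 f2 f3 :: "real \<Rightarrow> complex"
    assume r: "0 < r" "r < r0" and xy: "\<bar>x0 - fst p0\<bar> \<le> \<delta>" "\<bar>y0 - snd p0\<bar> \<le> \<delta>" and lam: "lam \<noteq> 0" and f: "bfun f1" "bfun f2" "bfun f3"
      and supp: "\<forall>t. f1 t \<noteq> 0 \<longrightarrow> r * x0 \<le> t \<and> t < r * (x0 + \<delta>)" "\<forall>t. f2 t \<noteq> 0 \<longrightarrow> r * y0 \<le> t \<and> t < r * (y0 + \<delta>)"
    have Sm: "(\<lambda>p. lam * S p) \<in> borel_measurable borel" using S by measurable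
    let ?F = "clip (r * x0 + r * y0) (r * (x0 + \<delta>) + r * (y0 + \<delta>)) f3"
    have f1': "bfun (\<lambda>x. f1 (- x))" "nsq (\<lambda>x. f1 (- x)) = nsq f1" using bfun_affine[OF f(1), of "-1" 0] nsq_affine[of "-1" f1 0] by simp_all
    have rd: "r * \<delta> > 0" using r \<delta> by simp
    have d3: "\<delta>1 = 3 * \<delta>" by (simp add: \<delta>_def)
    have "trif (\<lambda>p. lam * S p) f1 f2 f3 = trif (\<lambda>p. lam * S p) f1 f2 ?F"
      by (rule trif_clip3) (use supp in auto)
    also have "\<dots> = trif (\<lambda>p. lam * S (- fst p, fst p + snd p)) (\<lambda>x. f1 (- x)) ?F f2"
      by (rule trif_shear[OF Sm f(1,2) bfun_clip[OF f(3)]])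
    finally have eq: "trif (\<lambda>p. lam * S p) f1 f2 f3 = trif (\<lambda>p. lam * S (- fst p, fst p + snd p)) (\<lambda>x. f1 (- x)) ?F f2" .
    have "norm (trif (\<lambda>p. lam * S p) f1 f2 f3) \<le> C * \<bar>lam\<bar> powr (- e) * sqrt (nsq (\<lambda>x. f1 (- x)) * nsq ?F * nsq f2)"
      unfolding eq
    proof (rule est[rule_format, of r "- x0 - \<delta>" "x0 + y0" lam "\<lambda>x. f1 (- x)" ?F f2, OF r _ _ lam f1'(1) bfun_clip[OF f(3)] f(2)])
      show "\<bar>- x0 - \<delta> - fst (- fst p0, fst p0 + snd p0)\<bar> \<le> \<delta>1" "\<bar>x0 + y0 - snd (- fst p0, fst p0 + snd p0)\<bar> \<le> \<delta>1"
        using xy \<delta>1 unfolding \<delta>_def fst_conv snd_conv by linarith+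
      fix t assume "f1 (- t) \<noteq> 0"
      then have "r * x0 \<le> - t" "- t < r * (x0 + \<delta>)" using supp(1) by auto
      then show "r * (- x0 - \<delta>) \<le> t \<and> t < r * (- x0 - \<delta> + \<delta>1)" unfolding d3 using rd by (simp add: algebra_simps)
    next
      fix t assume "?F t \<noteq> 0"
      then have "r * x0 + r * y0 \<le> t" "t < r * (x0 + \<delta>) + r * (y0 + \<delta>)" by (auto dest: clip_nonzeroD)
      then show "r * (x0 + y0) \<le> t \<and> t < r * (x0 + y0 + \<delta>1)" unfolding d3 using rd by (simp add: algebra_simps)
    qed
    also have "\<dots> \<le> C * \<bar>lam\<bar> powr (- e) * sqrt (nsq f1 * nsq f2 * nsq f3)"
    proof (intro mult_left_mono real_sqrt_le_mono)
      have "nsq f1 * nsq ?F * nsq f2 \<le> nsq f1 * nsq f3 * nsq f2"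
        by (intro mult_left_mono mult_right_mono nsq_clip_le f nsq_nonneg)
      then show "nsq (\<lambda>x. f1 (- x)) * nsq ?F * nsq f2 \<le> nsq f1 * nsq f2 * nsq f3" unfolding f1'(2) by (simp add: mult_ac)
    qed (use C in auto)
    finally show "norm (trif (\<lambda>p. lam * S p) f1 f2 f3) \<le> C * \<bar>lam\<bar> powr (- e) * sqrt (nsq f1 * nsq f2 * nsq f3)" .
  qed
qed

lemma hjet_swapj: "hjet (swapj g) i j p = - swapj (hjet g) i j p"
  by (simp add: hjet_def swapj_def)

lemma dird_funpow_diff: "(dird v ^^ n) (\<lambda>i j p. a i j p - b i j p) = (\<lambda>i j p. (dird v ^^ n) a i j p - (dird v ^^ n) b i j p)"
  by (induction n arbitrary: a b) (simp_all add: dird_def[abs_def] algebra_simps)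

text \<open>In the coordinates of the shear the operator \<open>\<partial>\<^sub>x\<partial>\<^sub>y(\<partial>\<^sub>x - \<partial>\<^sub>y)\<close> keeps its shape.\<close>

definition shearj :: "(nat \<Rightarrow> nat \<Rightarrow> real \<times> real \<Rightarrow> real) \<Rightarrow> nat \<Rightarrow> nat \<Rightarrow> real \<times> real \<Rightarrow> real" where
  "shearj g i j p = (dird (- 1, 1) ^^ i) ((dird (0, 1) ^^ j) g) 0 0 (- fst p, fst p + snd p)"

lemma affmap_shear: "affmap (0, 0) (- 1, 1) (0, 1) p = (- fst p, fst p + snd p)"
  by (simp add: affmap_def)

lemma jet_shearj: "jet U g \<Longrightarrow> jet ((\<lambda>p. (- fst p, fst p + snd p)) -` U) (shearj g)"
  using jet_affmap[of U g "(0, 0)" "(- 1, 1)" "(0, 1)" 1] unfolding affmap_shear shearj_def[abs_def] by simp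

text \<open>The new coordinate derivatives are \<partial>y - \<partial>x and \<partial>y, and their
  difference is -\<partial>x. The product of these three is again \<partial>x \<partial>y
  (\<partial>x - \<partial>y).\<close>

lemma hjet_shearj: "hjet (shearj g) = shearj (hjet g)"
proof (intro ext)
  fix i j p
  let ?v = "dird (- 1, 1)" and ?w = "dird (0, 1)"
  have 1: "(?v ^^ (i + a)) ((?w ^^ (j + b)) g) = (?v ^^ i) ((?w ^^ j) ((?v ^^ a) ((?w ^^ b) g)))" for a b
  proof -
    have "(?v ^^ a) ((?w ^^ j) k) = (?w ^^ j) ((?v ^^ a) k)" for k
      by (induction a) (simp_all add: dird_funpow_commute)
    then show ?thesis by (simp add: funpow_add)
  qed
  have "hjet g = (\<lambda>i j p. (?v ^^ 2) ((?w ^^ 1) g) i j p - (?v ^^ 1) ((?w ^^ 2) g) i j p)"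
    by (intro ext) (simp add: hjet_def dird_def numeral_2_eq_2)
  then show "hjet (shearj g) i j p = shearj (hjet g) i j p"
    unfolding hjet_def[of "shearj g"] shearj_def 1 dird_funpow_diff by (simp only: dird_funpow_diff)
qed

lemma vanishes_shearj:
  assumes "vanishes d h" shows "vanishes d (shearj h)"
  unfolding vanishes_def
proof (intro allI impI)
  fix i j assume ij: "i + j < d"
  then have "vanishes ((Suc 0 + i) + j) h" using assms by (simp add: vanishes_def)
  then have "vanishes (Suc 0) ((dird (- 1, 1) ^^ i) ((dird (0, 1) ^^ j) h))" by (intro vanishes_dird_funpow)
  then show "shearj h i j (0, 0) = 0" by (simp add: vanishes_def shearj_def)
qed

text \<open>The directions (-1, 1) and (0, 1) span the plane, so derivatives of order d along them
  cannot all vanish unless the partial derivatives of that order do.\<close>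

lemma nonvanishing_shearj:
  assumes "\<exists>i j. i + j = d \<and> h i j (0, 0) \<noteq> 0" shows "\<exists>i j. i + j = d \<and> shearj h i j (0, 0) \<noteq> 0"
proof (rule ccontr)
  assume n: "\<not> ?thesis"
  have "(dird (- 1, 1) ^^ (d - k)) ((dird (0, 1) ^^ k) h) 0 0 (0, 0) = 0" if "k \<le> d" for k
  proof -
    have "(d - k) + k = d" using that by simp
    then have "shearj h (d - k) k (0, 0) = 0" using n by blast
    then show ?thesis by (simp add: shearj_def)
  qed
  then have "h i j (0, 0) = 0" if "i + j = d" for i j
    using directional_derivatives_determine[of "(- 1, 1)" "(0, 1)" d h i j] that by simp
  then show False using assms by blast
qed

text \<open>The shear sends (a, 0) to (-a, a), which lies on neither axis. A point of the y-axis is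
  first moved to the x-axis by exchanging the variables; for this second use \<open>yz\<close> is
  stated for an arbitrary jet.\<close>

lemma nonzero_point_estimate:
  assumes g: "jet U g" and gm: "g 0 0 \<in> borel_measurable borel" and U0: "(0, 0) \<in> U" and van: "vanishes d (hjet g)"
    and nv: "\<exists>i j. i + j = d \<and> hjet g i j (0, 0) \<noteq> 0" and p0: "p0 \<noteq> (0, 0)"
  shows "trif_bounded_near (g 0 0) (1 / (2 * (3 + real d))) p0"
proof -
  have yz: "trif_bounded_near (g 0 0) (1 / (2 * (3 + real d))) p0"
    if g: "jet U g" and gm: "g 0 0 \<in> borel_measurable borel" and U0: "(0, 0) \<in> U" and van: "vanishes d (hjet g)"
    and nv: "\<exists>i j. i + j = d \<and> hjet g i j (0, 0) \<noteq> 0" and p0: "fst p0 \<noteq> 0" "snd p0 = 0" for g U p0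
  proof (rule trif_bounded_near_shear[OF gm])
    have s: "(\<lambda>p. g 0 0 (- fst p, fst p + snd p)) = shearj g 0 0" by (intro ext) (simp add: shearj_def)
    have m: "(\<lambda>p. g 0 0 (- fst p, fst p + snd p)) \<in> borel_measurable borel" using gm unfolding borel_prod[symmetric] by measurable
    show "trif_bounded_near (\<lambda>p. g 0 0 (- fst p, fst p + snd p)) (1 / (2 * (3 + real d))) (- fst p0, fst p0 + snd p0)"
      unfolding s
      by (rule regular_point_estimate[OF jet_shearj[OF g]])
        (use m U0 p0 van nv in \<open>simp_all add: s hjet_shearj vanishes_shearj nonvanishing_shearj\<close>)
  qed
  consider "fst p0 \<noteq> 0" "snd p0 \<noteq> 0" | "fst p0 \<noteq> 0" "snd p0 = 0" | "fst p0 = 0" "snd p0 \<noteq> 0"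
    using p0 by (metis prod.collapse)
  then show ?thesis
  proof cases
    case 1
    then show ?thesis by (rule regular_point_estimate[OF g gm U0 van nv])
  next
    case 2
    then show ?thesis by (rule yz[OF g gm U0 van nv])
  next
    case 3
    have s: "(\<lambda>p. g 0 0 (snd p, fst p)) = swapj g 0 0" by (intro ext) (simp add: swapj_def)
    have m: "(\<lambda>p. g 0 0 (snd p, fst p)) \<in> borel_measurable borel" using gm unfolding borel_prod[symmetric] by measurable
    have "vanishes d (hjet (swapj g))" using van by (simp add: vanishes_def hjet_swapj swapj_def add.commute)
    moreover have "\<exists>i j. i + j = d \<and> hjet (swapj g) i j (0, 0) \<noteq> 0"
    proof -
      obtain i j where "i + j = d" "hjet g i j (0, 0) \<noteq> 0" using nv by blast
      then have "j + i = d \<and> hjet (swapj g) j i (0, 0) \<noteq> 0" by (simp add: hjet_swapj swapj_def add.commute)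
      then show ?thesis by blast
    qed
    ultimately have "trif_bounded_near (swapj g 0 0) (1 / (2 * (3 + real d))) (snd p0, fst p0)"
      by (intro yz[OF jet_swapj[OF g]]) (use m 3 U0 in \<open>simp_all add: s\<close>)
    then show ?thesis by (intro trif_bounded_near_swap[OF gm]) (simp add: s)
  qed
qed

text \<open>The estimate near p already admits every corner within its radius, so finitely many p
  suffice and their radii and constants can be replaced by the extreme ones.\<close>

lemma uniform_estimate:
  assumes K: "compact K" and tb: "\<And>p. p \<in> K \<Longrightarrow> trif_bounded_near S e p"
  shows "\<exists>\<delta>>0. \<exists>r0>0. \<exists>C>0. \<forall>p\<in>K. \<forall>r lam f1 f2 f3. 0 < r \<longrightarrow> r < r0 \<longrightarrow> lam \<noteq> 0 \<longrightarrow>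
     bfun f1 \<longrightarrow> bfun f2 \<longrightarrow> bfun f3 \<longrightarrow> (\<forall>t. f1 t \<noteq> 0 \<longrightarrow> r * fst p \<le> t \<and> t < r * (fst p + \<delta>)) \<longrightarrow> (\<forall>t. f2 t \<noteq> 0 \<longrightarrow> r * snd p \<le> t \<and> t < r * (snd p + \<delta>)) \<longrightarrow>
     norm (trif (\<lambda>p. lam * S p) f1 f2 f3) \<le> C * \<bar>lam\<bar> powr (- e) * sqrt (nsq f1 * nsq f2 * nsq f3)"
proof -
  define Q where "Q p \<delta> r0 C \<longleftrightarrow> \<delta> > 0 \<and> r0 > 0 \<and> C > 0 \<and> (\<forall>r x0 y0 lam f1 f2 f3. 0 < r \<longrightarrow> r < r0 \<longrightarrow> \<bar>x0 - fst p\<bar> \<le> \<delta> \<longrightarrow> \<bar>y0 - snd p\<bar> \<le> \<delta> \<longrightarrow> lam \<noteq> 0 \<longrightarrow>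
     bfun f1 \<longrightarrow> bfun f2 \<longrightarrow> bfun f3 \<longrightarrow> (\<forall>t. f1 t \<noteq> 0 \<longrightarrow> r * x0 \<le> t \<and> t < r * (x0 + \<delta>)) \<longrightarrow> (\<forall>t. f2 t \<noteq> 0 \<longrightarrow> r * y0 \<le> t \<and> t < r * (y0 + \<delta>)) \<longrightarrow>
     norm (trif (\<lambda>p. lam * S p) f1 f2 f3) \<le> C * \<bar>lam\<bar> powr (- e) * sqrt (nsq f1 * nsq f2 * nsq f3))" for p \<delta> r0 C
  have "\<exists>q. Q p (fst q) (fst (snd q)) (snd (snd q))" if pK: "p \<in> K" for p
  proof -
    obtain \<delta> r0 C where "Q p \<delta> r0 C" using tb[OF pK] unfolding trif_bounded_near_def Q_def by blast
    then show ?thesis by (intro exI[of _ "(\<delta>, r0, C)"]) simp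
  qed
  then obtain q where q: "\<And>p. p \<in> K \<Longrightarrow> Q p (fst (q p)) (fst (snd (q p))) (snd (snd (q p)))" by metis
  define d r0 C where "d p = fst (q p)" and "r0 p = fst (snd (q p))" and "C p = snd (snd (q p))" for p
  have q: "Q p (d p) (r0 p) (C p)" if "p \<in> K" for p unfolding d_def r0_def C_def by (rule q[OF that])
  then have pos: "d p > 0" "r0 p > 0" "C p > 0" if "p \<in> K" for p using that unfolding Q_def by blast+
  obtain D where D: "D \<subseteq> K" "finite D" "K \<subseteq> (\<Union>p\<in>D. ball p (d p))"
    by (rule compactE_image[OF K, of K "\<lambda>p. ball p (d p)"]) (use pos in auto)
  define \<delta> where "\<delta> = Min (insert 1 (d ` D))"
  define r1 where "r1 = Min (insert 1 (r0 ` D))"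
  define B where "B = Max (insert 1 (C ` D))"
  have \<delta>: "\<delta> > 0" and r1: "r1 > 0" unfolding \<delta>_def r1_def using D pos by (auto simp: subset_iff)
  have B: "B > 0" unfolding B_def using D by (auto simp: Max_gr_iff)
  have le: "\<delta> \<le> d p" "r1 \<le> r0 p" "C p \<le> B" if "p \<in> D" for p
    unfolding \<delta>_def r1_def B_def using D that by (auto intro!: Min_le Max_ge)
  show ?thesis
  proof (rule exI[of _ \<delta>], rule conjI[OF \<delta>], rule exI[of _ r1], rule conjI[OF r1], rule exI[of _ B], rule conjI[OF B], intro ballI allI impI)
    fix p and r lam :: real and f1 f2 f3 :: "real \<Rightarrow> complex"
    assume p: "p \<in> K" and a: "0 < r" "r < r1" "lam \<noteq> 0" "bfun f1" "bfun f2" "bfun f3"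
      and supp: "\<forall>t. f1 t \<noteq> 0 \<longrightarrow> r * fst p \<le> t \<and> t < r * (fst p + \<delta>)" "\<forall>t. f2 t \<noteq> 0 \<longrightarrow> r * snd p \<le> t \<and> t < r * (snd p + \<delta>)"
    obtain p0 where p0: "p0 \<in> D" "dist p0 p < d p0" using D(3) p by auto
    have "r * (x + \<delta>) \<le> r * (x + d p0)" for x using a le[OF p0(1)] by simp
    then have supp': "\<forall>t. f1 t \<noteq> 0 \<longrightarrow> r * fst p \<le> t \<and> t < r * (fst p + d p0)" "\<forall>t. f2 t \<noteq> 0 \<longrightarrow> r * snd p \<le> t \<and> t < r * (snd p + d p0)"
      using supp by (meson less_le_trans)+
    have dp: "\<bar>fst p - fst p0\<bar> \<le> d p0" "\<bar>snd p - snd p0\<bar> \<le> d p0"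
      using dist_fst_le[of p p0] dist_snd_le[of p p0] p0(2) by (auto simp: dist_real_def dist_commute)
    have "norm (trif (\<lambda>p. lam * S p) f1 f2 f3) \<le> C p0 * \<bar>lam\<bar> powr (- e) * sqrt (nsq f1 * nsq f2 * nsq f3)"
    proof -
      have "p0 \<in> K" "r < r0 p0" using D(1) p0(1) a le(2)[OF p0(1)] by auto
      note q[OF this(1), unfolded Q_def, THEN conjunct2, THEN conjunct2, THEN conjunct2, rule_format, of r "fst p" "snd p" lam f1 f2 f3, OF a(1) this(2)]
      then show ?thesis using dp a supp' by simp
    qed
    also have "\<dots> \<le> B * \<bar>lam\<bar> powr (- e) * sqrt (nsq f1 * nsq f2 * nsq f3)"
      by (intro mult_right_mono le p0) (auto simp: nsq_nonneg)
    finally show "norm (trif (\<lambda>p. lam * S p) f1 f2 f3) \<le> B * \<bar>lam\<bar> powr (- e) * sqrt (nsq f1 * nsq f2 * nsq f3)" .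
  qed
qed

section \<open>Summation over dyadic annuli\<close>

lemma sum_telescope_le:
  fixes x t :: "nat \<Rightarrow> real"
  assumes "\<And>n. t (Suc n) + x n \<le> t n" "\<And>n. t n \<ge> 0" shows "(\<Sum>n<N. x n) \<le> t 0"
proof -
  have "(\<Sum>n<N. x n) + t N \<le> t 0"
  proof (induction N)
    case (Suc N)
    then show ?case using assms(1)[of N] by simp
  qed simp
  then show ?thesis using assms(2)[of N] by linarith
qed

text \<open>An interval on one side of 0 whose ends differ by a factor of at most 2 is disjoint from
  its dyadic dilates. The telescoping quantity is the squared norm over the interval between 0 and
  the outer end.\<close>

lemma sum_dilates_nsq_le:
  assumes f: "bfun f" and R: "R > 0" and uv: "u \<le> v" "0 < u \<and> v \<le> 2 * u \<or> v < 0 \<and> 2 * v \<le> u"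
  shows "(\<Sum>n<N. nsq (clip (R / 2 ^ n * u) (R / 2 ^ n * v) f)) \<le> nsq f"
proof -
  define r where "r n = R / 2 ^ n" for n :: nat
  have r0: "r n > 0" for n using R by (simp add: r_def)
  have r: "r n > 0" "r (Suc n) = r n / 2" "r n * u \<le> r n * v" for n
    using r0[of n] uv(1) by (simp, simp add: r_def, simp)
  show ?thesis unfolding r_def[symmetric]
  proof (rule disjE[OF uv(2)])
    assume a: "0 < u \<and> v \<le> 2 * u"
    have "(\<Sum>n<N. nsq (clip (r n * u) (r n * v) f)) \<le> nsq (clip 0 (r 0 * v) f)"
    proof (rule sum_telescope_le[where t = "\<lambda>n. nsq (clip 0 (r n * v) f)"])
      fix n
      have "r n * v \<le> r n * (2 * u)" using a r(1)[of n] by (intro mult_left_mono) auto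
      then have 1: "r (Suc n) * v \<le> r n * u" by (simp add: r(2))
      have 0: "0 \<le> r (Suc n) * v" "0 \<le> r n * u" using a uv(1) r(1)[of n] r(1)[of "Suc n"] by auto
      show "nsq (clip 0 (r (Suc n) * v) f) + nsq (clip (r n * u) (r n * v) f) \<le> nsq (clip 0 (r n * v) f)"
        using nsq_clip_add[OF f 0(1) 1] nsq_clip_add[OF f 0(2) r(3)] nsq_nonneg[of "clip (r (Suc n) * v) (r n * u) f"] by linarith
    qed (rule nsq_nonneg)
    then show "(\<Sum>n<N. nsq (clip (r n * u) (r n * v) f)) \<le> nsq f" using nsq_clip_le[OF f] order_trans by blast
  next
    assume a: "v < 0 \<and> 2 * v \<le> u"
    have "(\<Sum>n<N. nsq (clip (r n * u) (r n * v) f)) \<le> nsq (clip (r 0 * u) 0 f)"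
    proof (rule sum_telescope_le[where t = "\<lambda>n. nsq (clip (r n * u) 0 f)"])
      fix n
      have "r n * (2 * v) \<le> r n * u" using a r(1)[of n] by (intro mult_left_mono) auto
      then have 1: "r n * v \<le> r (Suc n) * u" by (simp add: r(2))
      have 0: "r (Suc n) * u \<le> 0" "r n * v \<le> 0" using a uv(1) r(1)[of n] r(1)[of "Suc n"] by (auto intro!: mult_nonneg_nonpos)
      show "nsq (clip (r (Suc n) * u) 0 f) + nsq (clip (r n * u) (r n * v) f) \<le> nsq (clip (r n * u) 0 f)"
        using nsq_clip_add[OF f 1 0(1)] nsq_clip_add[OF f r(3) 0(2)] nsq_nonneg[of "clip (r n * v) (r (Suc n) * u) f"] by linarith
    qed (rule nsq_nonneg)
    then show "(\<Sum>n<N. nsq (clip (r n * u) (r n * v) f)) \<le> nsq f" using nsq_clip_le[OF f] order_trans by blast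
  qed
qed

text \<open>Cauchy-Schwarz needs only two summable factors. This is why it is enough that two of x,
  y and x + y stay away from 0.\<close>

lemma sum_sqrt_triple_le:
  fixes a b c :: "nat \<Rightarrow> real"
  assumes n: "\<And>n. a n \<ge> 0" "\<And>n. b n \<ge> 0" "\<And>n. c n \<ge> 0" and s: "(\<Sum>n<N. a n) \<le> A" "(\<Sum>n<N. b n) \<le> B" and c: "\<And>n. c n \<le> C"
  shows "(\<Sum>n<N. sqrt (a n * b n * c n)) \<le> sqrt (A * B * C)"
proof -
  have C: "C \<ge> 0" using n(3)[of 0] c[of 0] by linarith
  have "(\<Sum>n<N. sqrt (a n * b n * c n)) \<le> (\<Sum>n<N. sqrt C * (sqrt (a n) * sqrt (b n)))"
  proof (rule sum_mono)
    fix i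
    have "sqrt (a i * b i * c i) \<le> sqrt (a i * b i * C)" by (intro real_sqrt_le_mono mult_left_mono c mult_nonneg_nonneg n)
    then show "sqrt (a i * b i * c i) \<le> sqrt C * (sqrt (a i) * sqrt (b i))" by (simp add: real_sqrt_mult mult_ac)
  qed
  also have "\<dots> = sqrt C * (\<Sum>n<N. sqrt (a n) * sqrt (b n))" by (simp add: sum_distrib_left)
  also have "\<dots> \<le> sqrt C * sqrt (A * B)"
  proof (intro mult_left_mono real_le_rsqrt)
    have "(\<Sum>n<N. sqrt (a n) * sqrt (b n))\<^sup>2 \<le> (\<Sum>n<N. (sqrt (a n))\<^sup>2) * (\<Sum>n<N. (sqrt (b n))\<^sup>2)"
      by (rule Cauchy_Schwarz_ineq_sum)
    also have "\<dots> = (\<Sum>n<N. a n) * (\<Sum>n<N. b n)" by (simp add: n)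
    also have "\<dots> \<le> A * B" using s by (intro mult_mono s) (auto intro!: sum_nonneg n order_trans[OF _ s(1)])
    finally show "(\<Sum>n<N. sqrt (a n) * sqrt (b n))\<^sup>2 \<le> A * B" .
  qed (use C in simp)
  also have "\<dots> = sqrt (A * B * C)" by (simp add: real_sqrt_mult)
  finally show ?thesis .
qed

text \<open>The interval from -r to r is cut into 4 m cells, so that for every m the inner half
  consists of the cells from m to 3 m - 1.\<close>

definition gridcell :: "real \<Rightarrow> nat \<Rightarrow> nat \<Rightarrow> (real \<Rightarrow> complex) \<Rightarrow> real \<Rightarrow> complex" where
  "gridcell r m i f = clip (r * (-1 + real i / (2 * real m))) (r * (-1 + real (Suc i) / (2 * real m))) f"

lemma bfun_gridcell: "bfun f \<Longrightarrow> bfun (gridcell r m i f)"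
  unfolding gridcell_def by (rule bfun_clip)

lemma trif_grid_sum:
  assumes S: "S \<in> borel_measurable borel" and f: "bfun f1" "bfun f2" "bfun f3" and r: "r > 0" and m: "m > 0"
  shows "trif S (clip (r * (-1 + real k / (2 * real m))) (r * (-1 + real (k + n) / (2 * real m))) f1)
      (clip (r * (-1 + real k / (2 * real m))) (r * (-1 + real (k + n) / (2 * real m))) f2) f3 =
    (\<Sum>(i, j)\<in>{k..<k + n} \<times> {k..<k + n}. trif S (gridcell r m i f1) (gridcell r m j f2) f3)"
proof -
  define a where "a = r * (-1 + real k / (2 * real m))"
  define h where "h = r / (2 * real m)"
  have h: "h \<ge> 0" using r by (simp add: h_def)
  have ah: "a + real i * h = r * (-1 + real (k + i) / (2 * real m))" for i
    by (simp add: a_def h_def add_divide_distrib algebra_simps)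
  have g: "clip (a + real i * h) (a + real (Suc i) * h) f = gridcell r m (k + i) f" for i f
    unfolding ah gridcell_def by simp
  let ?c = "clip a (a + real n * h)"
  have "trif S (?c f1) (?c f2) f3 = (\<Sum>i<n. trif S (gridcell r m (k + i) f1) (?c f2) f3)"
    using trif_sum_clip(1)[OF S f(1) bfun_clip[OF f(2)] f(3) h, of a n a "a + real n * h"] unfolding g .
  also have "\<dots> = (\<Sum>i<n. \<Sum>j<n. trif S (gridcell r m (k + i) f1) (gridcell r m (k + j) f2) f3)"
    using trif_sum_clip(2)[OF S bfun_gridcell[OF f(1)] f(2,3) h, of _ _ _ a n] unfolding g by simp
  also have "\<dots> = (\<Sum>i\<in>{k..<k + n}. \<Sum>j\<in>{k..<k + n}. trif S (gridcell r m i f1) (gridcell r m j f2) f3)"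
  proof -
    have "sum F {k..<k + n} = (\<Sum>i<n. F (k + i))" for F :: "nat \<Rightarrow> complex"
      using sum.shift_bounds_nat_ivl[of F 0 k n] by (simp add: lessThan_atLeast0 add.commute)
    then show ?thesis by simp
  qed
  also have "\<dots> = (\<Sum>(i, j)\<in>{k..<k + n} \<times> {k..<k + n}. trif S (gridcell r m i f1) (gridcell r m j f2) f3)"
    by (rule sum.cartesian_product)
  finally show ?thesis unfolding a_def[symmetric] ah[symmetric] .
qed

definition annulus_cells :: "nat \<Rightarrow> (nat \<times> nat) set" where
  "annulus_cells m = {0..<4 * m} \<times> {0..<4 * m} - {m..<3 * m} \<times> {m..<3 * m}"

lemma trif_annulus:
  assumes S: "S \<in> borel_measurable borel" and f: "bfun f1" "bfun f2" "bfun f3" and r: "r > 0" and m: "m > 0"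
  shows "trif S (clip (- r) r f1) (clip (- r) r f2) f3 =
    (\<Sum>(i, j)\<in>annulus_cells m. trif S (gridcell r m i f1) (gridcell r m j f2) f3) +
    trif S (clip (- (r / 2)) (r / 2) f1) (clip (- (r / 2)) (r / 2) f2) f3"
proof -
  let ?P = "\<lambda>(i, j). trif S (gridcell r m i f1) (gridcell r m j f2) f3"
  have e: "r * (-1 + real 0 / (2 * real m)) = - r" "r * (-1 + real (0 + 4 * m) / (2 * real m)) = r"
    "r * (-1 + real m / (2 * real m)) = - (r / 2)" "r * (-1 + real (m + 2 * m) / (2 * real m)) = r / 2"
    using m by (simp_all add: field_simps)
  have "trif S (clip (- r) r f1) (clip (- r) r f2) f3 = sum ?P ({0..<4 * m} \<times> {0..<4 * m})"
    using trif_grid_sum[OF S f r m, of 0 "4 * m"] unfolding e by simp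
  also have "\<dots> = sum ?P (annulus_cells m) + sum ?P ({m..<3 * m} \<times> {m..<3 * m})"
    unfolding annulus_cells_def by (rule sum.subset_diff) auto
  also have "sum ?P ({m..<3 * m} \<times> {m..<3 * m}) = trif S (clip (- (r / 2)) (r / 2) f1) (clip (- (r / 2)) (r / 2) f2) f3"
    using trif_grid_sum[OF S f r m, of m "2 * m"] unfolding e by simp
  finally show ?thesis .
qed

lemma annulus_cell_corner:
  assumes "(i, j) \<in> annulus_cells m" and m: "m > 0"
  defines "u \<equiv> -1 + real i / (2 * real m)" and "v \<equiv> -1 + real j / (2 * real m)"
  shows "\<bar>u\<bar> \<le> 1" "\<bar>v\<bar> \<le> 1" "\<bar>u\<bar> \<ge> 1 / 2 \<or> \<bar>v\<bar> \<ge> 1 / 2"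
proof -
  have a: "i < 4 * m" "j < 4 * m" "\<not> (m \<le> i \<and> i < 3 * m) \<or> \<not> (m \<le> j \<and> j < 3 * m)"
    using assms(1) by (auto simp: annulus_cells_def)
  have b: "\<bar>-1 + real k / (2 * real m)\<bar> \<le> 1" if "k < 4 * m" for k
  proof -
    have "real k / (2 * real m) \<le> 2" using that m by (simp add: field_simps)
    then show ?thesis by (simp add: abs_le_iff)
  qed
  have c: "\<bar>-1 + real k / (2 * real m)\<bar> \<ge> 1 / 2" if "\<not> (m \<le> k \<and> k < 3 * m)" for k
  proof -
    have "real k \<le> real m \<or> real k \<ge> 3 * real m" using that by linarith
    then have "real k / (2 * real m) \<le> 1 / 2 \<or> real k / (2 * real m) \<ge> 3 / 2" using m by (auto simp: field_simps)
    then show ?thesis by linarith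
  qed
  show "\<bar>u\<bar> \<le> 1" "\<bar>v\<bar> \<le> 1" "\<bar>u\<bar> \<ge> 1 / 2 \<or> \<bar>v\<bar> \<ge> 1 / 2" unfolding u_def v_def using a b c by blast+
qed

text \<open>\<open>away\<close> is the condition of \<open>sum_dilates_nsq_le\<close>. The ends of
  cells are multiples of w, so a cell starting at x violates it only if x is 0 or -w. In that case
  the other coordinate has absolute value at least 1/2 and dominates the sum. The bound m \<ge> 4,
  that is w \<le> 1/8, makes the interval for x + y, of length 2 w, satisfy the condition.\<close>

lemma sum_dilates_annulus_cell:
  assumes ij: "(i, j) \<in> annulus_cells m" and m: "m \<ge> 4" and f: "bfun f1" "bfun f2" "bfun f3" and R: "R > 0"
  defines "u \<equiv> -1 + real i / (2 * real m)" and "v \<equiv> -1 + real j / (2 * real m)" and "w \<equiv> 1 / (2 * real m)"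
  shows "(\<Sum>n<N. sqrt (nsq (gridcell (R / 2 ^ n) m i f1) * nsq (gridcell (R / 2 ^ n) m j f2) * nsq (clip (R / 2 ^ n * (u + v)) (R / 2 ^ n * (u + v + 2 * w)) f3)))
    \<le> sqrt (nsq f1 * nsq f2 * nsq f3)"
proof -
  define away where "away a b \<longleftrightarrow> 0 < a \<and> b \<le> 2 * a \<or> b < 0 \<and> 2 * b \<le> a" for a b :: real
  have w: "w > 0" "8 * w \<le> 1" using m by (auto simp: w_def field_simps)
  have cell: "gridcell r m i f = clip (r * u) (r * (u + w)) f" "gridcell r m j f = clip (r * v) (r * (v + w)) f" for r f
    by (simp_all add: gridcell_def u_def v_def w_def add_divide_distrib algebra_simps)
  have mult: "\<exists>k::int. -1 + real i / (2 * real m) = of_int k * w" for i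
    by (rule exI[of _ "int i - 2 * int m"]) (use m in \<open>simp add: w_def field_simps\<close>)
  have small: "x = 0 \<or> x = - w" if na: "\<not> away x (x + w)" and mx: "\<exists>k::int. x = of_int k * w" for x
  proof -
    obtain k :: int where k: "x = of_int k * w" using mx by blast
    have "\<not> k \<ge> 1"
    proof
      assume "k \<ge> 1"
      then have "1 * w \<le> of_int k * w" using w by (intro mult_right_mono) auto
      then have "x \<ge> w" using k by simp
      then show False using na w by (simp add: away_def)
    qed
    moreover have "\<not> k \<le> -2"
    proof
      assume "k \<le> -2"
      then have "of_int k * w \<le> -2 * w" using w by (intro mult_right_mono) auto
      then have "x \<le> - 2 * w" using k by simp
      then show False using na w by (simp add: away_def)
    qed
    ultimately have "k = 0 \<or> k = -1" by linarith
    then show ?thesis using k by auto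
  qed
  have big: "away x (x + w)" if "\<bar>x\<bar> \<ge> 1 / 2" for x
    using that w unfolding away_def by (cases "x \<ge> 0") auto
  have big2: "away (x + y) (x + y + 2 * w)" if "\<bar>x\<bar> \<ge> 1 / 2" "y = 0 \<or> y = - w" "\<exists>k::int. x = of_int k * w" for x y
    using that(1,2) w unfolding away_def by (cases "x \<ge> 0") auto
  have bnd: "nsq (clip a b f) \<le> nsq f" if "bfun f" for a b f using nsq_clip_le[OF that] .
  have S1: "(\<Sum>n<N. nsq (gridcell (R / 2 ^ n) m i f1)) \<le> nsq f1" if "away u (u + w)"
    unfolding cell by (rule sum_dilates_nsq_le[OF f(1) R]) (use w that in \<open>simp_all add: away_def\<close>)
  have S2: "(\<Sum>n<N. nsq (gridcell (R / 2 ^ n) m j f2)) \<le> nsq f2" if "away v (v + w)"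
    unfolding cell by (rule sum_dilates_nsq_le[OF f(2) R]) (use w that in \<open>simp_all add: away_def\<close>)
  have S3: "(\<Sum>n<N. nsq (clip (R / 2 ^ n * (u + v)) (R / 2 ^ n * (u + v + 2 * w)) f3)) \<le> nsq f3" if "away (u + v) (u + v + 2 * w)"
    by (rule sum_dilates_nsq_le[OF f(3) R]) (use w that in \<open>simp_all add: away_def\<close>)
  have B: "nsq (gridcell r m i f1) \<le> nsq f1" "nsq (gridcell r m j f2) \<le> nsq f2" for r
    unfolding gridcell_def by (rule nsq_clip_le f)+
  have uv: "\<bar>u\<bar> \<ge> 1 / 2 \<or> \<bar>v\<bar> \<ge> 1 / 2" unfolding u_def v_def by (rule annulus_cell_corner(3)[OF ij]) (use m in simp)
  consider "away u (u + w)" "away v (v + w)" | "away u (u + w)" "away (u + v) (u + v + 2 * w)" | "away v (v + w)" "away (u + v) (u + v + 2 * w)"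
  proof (cases "away u (u + w)"; cases "away v (v + w)")
    assume u: "away u (u + w)" and v: "\<not> away v (v + w)"
    then have "v = 0 \<or> v = - w" using small mult unfolding v_def by blast
    moreover have "\<bar>u\<bar> \<ge> 1 / 2" using uv big v by blast
    ultimately show thesis using that(2)[OF u] big2[of u v] mult unfolding u_def by blast
  next
    assume u: "\<not> away u (u + w)" and v: "away v (v + w)"
    then have "u = 0 \<or> u = - w" using small mult unfolding u_def by blast
    moreover have "\<bar>v\<bar> \<ge> 1 / 2" using uv big u by blast
    ultimately have "away (v + u) (v + u + 2 * w)" using big2[of v u] mult unfolding v_def by blast
    then show thesis using that(3)[OF v] by (simp add: add.commute)
  qed (use uv big that in blast)+
  then show ?thesis
  proof cases
    case 1
    show ?thesis by (rule sum_sqrt_triple_le[OF nsq_nonneg nsq_nonneg nsq_nonneg S1[OF 1(1)] S2[OF 1(2)] bnd[OF f(3)]])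
  next
    case 2
    have "(\<Sum>n<N. sqrt (nsq (gridcell (R / 2 ^ n) m i f1) * nsq (clip (R / 2 ^ n * (u + v)) (R / 2 ^ n * (u + v + 2 * w)) f3) * nsq (gridcell (R / 2 ^ n) m j f2))) \<le> sqrt (nsq f1 * nsq f3 * nsq f2)"
      by (rule sum_sqrt_triple_le[OF nsq_nonneg nsq_nonneg nsq_nonneg S1[OF 2(1)] S3[OF 2(2)] B(2)])
    then show ?thesis by (simp add: mult_ac)
  next
    case 3
    have "(\<Sum>n<N. sqrt (nsq (gridcell (R / 2 ^ n) m j f2) * nsq (clip (R / 2 ^ n * (u + v)) (R / 2 ^ n * (u + v + 2 * w)) f3) * nsq (gridcell (R / 2 ^ n) m i f1))) \<le> sqrt (nsq f2 * nsq f3 * nsq f1)"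
      by (rule sum_sqrt_triple_le[OF nsq_nonneg nsq_nonneg nsq_nonneg S2[OF 3(1)] S3[OF 3(2)] B(1)])
    then show ?thesis by (simp add: mult_ac)
  qed
qed

text \<open>The number of cells is fixed by compactness of the annulus. For each single cell the
  dilates over all annuli are summed first, by orthogonality.\<close>

lemma small_support_estimate:
  assumes g: "jet U g" and gm: "g 0 0 \<in> borel_measurable borel" and U0: "(0, 0) \<in> U" and van: "vanishes d (hjet g)"
    and nv: "\<exists>i j. i + j = d \<and> hjet g i j (0, 0) \<noteq> 0"
  shows "\<exists>R>0. \<exists>C>0. \<forall>lam f1 f2 f3. lam \<noteq> 0 \<longrightarrow> bfun f1 \<longrightarrow> bfun f2 \<longrightarrow> bfun f3 \<longrightarrow>
     norm (trif (\<lambda>p. lam * g 0 0 p) (clip (- R) R f1) (clip (- R) R f2) f3) \<le> C * \<bar>lam\<bar> powr (- (1 / (2 * (3 + real d)))) * sqrt (nsq f1 * nsq f2 * nsq f3)"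
proof -
  define e where "e = 1 / (2 * (3 + real d))"
  define K where "K = {p::real \<times> real. \<bar>fst p\<bar> \<le> 1 \<and> \<bar>snd p\<bar> \<le> 1 \<and> (1 / 2 \<le> \<bar>fst p\<bar> \<or> 1 / 2 \<le> \<bar>snd p\<bar>)}"
  have "compact K"
  proof -
    have "closed K" unfolding K_def
      by (intro closed_Collect_conj closed_Collect_disj closed_Collect_le continuous_intros)
    moreover have "K \<subseteq> cbox (-1, -1) (1, 1)" by (auto simp: K_def mem_box Basis_prod_def inner_prod_def)
    then have "bounded K" by (rule bounded_subset[OF bounded_cbox])
    ultimately show ?thesis by (simp add: compact_eq_bounded_closed)
  qed
  then have "\<exists>\<delta>>0. \<exists>r0>0. \<exists>C>0. \<forall>p\<in>K. \<forall>r lam f1 f2 f3. 0 < r \<longrightarrow> r < r0 \<longrightarrow> lam \<noteq> 0 \<longrightarrow>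
     bfun f1 \<longrightarrow> bfun f2 \<longrightarrow> bfun f3 \<longrightarrow> (\<forall>t. f1 t \<noteq> 0 \<longrightarrow> r * fst p \<le> t \<and> t < r * (fst p + \<delta>)) \<longrightarrow> (\<forall>t. f2 t \<noteq> 0 \<longrightarrow> r * snd p \<le> t \<and> t < r * (snd p + \<delta>)) \<longrightarrow>
     norm (trif (\<lambda>p. lam * g 0 0 p) f1 f2 f3) \<le> C * \<bar>lam\<bar> powr (- e) * sqrt (nsq f1 * nsq f2 * nsq f3)"
    unfolding e_def by (rule uniform_estimate) (rule nonzero_point_estimate[OF g gm U0 van nv], auto simp: K_def)
  then obtain \<delta> r0 C where \<delta>: "\<delta> > 0" and r0: "r0 > 0" and C: "C > 0" and est: "\<forall>p\<in>K. \<forall>r lam f1 f2 f3. 0 < r \<longrightarrow> r < r0 \<longrightarrow> lam \<noteq> 0 \<longrightarrow>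
     bfun f1 \<longrightarrow> bfun f2 \<longrightarrow> bfun f3 \<longrightarrow> (\<forall>t. f1 t \<noteq> 0 \<longrightarrow> r * fst p \<le> t \<and> t < r * (fst p + \<delta>)) \<longrightarrow> (\<forall>t. f2 t \<noteq> 0 \<longrightarrow> r * snd p \<le> t \<and> t < r * (snd p + \<delta>)) \<longrightarrow>
     norm (trif (\<lambda>p. lam * g 0 0 p) f1 f2 f3) \<le> C * \<bar>lam\<bar> powr (- e) * sqrt (nsq f1 * nsq f2 * nsq f3)"
    by (elim exE conjE)
  obtain m :: nat where m: "m \<ge> 4" "1 / (2 * real m) \<le> \<delta>"
  proof -
    obtain k :: nat where "1 / \<delta> < real k" using reals_Archimedean2 by blast
    then have "1 < real k * \<delta>" using \<delta> by (simp add: field_simps)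
    also have "\<dots> \<le> real (k + 4) * \<delta>" using \<delta> by simp
    also have "\<dots> \<le> 2 * (real (k + 4) * \<delta>)" using \<delta> by simp
    finally show thesis by (intro that[of "k + 4"]) (simp_all add: field_simps)
  qed
  have m0: "m > 0" using m by simp
  define R where "R = r0 / 2"
  \<comment> \<open>The summand 1 pays for the square that remains in the middle.\<close>
  define D where "D = real (card (annulus_cells m)) * C + 1"
  have R: "R > 0" "R < r0" using r0 by (simp_all add: R_def)
  have D: "D > 0" unfolding D_def using C by (intro add_nonneg_pos) auto
  show ?thesis unfolding e_def[symmetric]
  proof (rule exI[of _ R], rule conjI[OF R(1)], rule exI[of _ D], rule conjI[OF D], intro allI impI)
    fix lam :: real and f1 f2 f3 :: "real \<Rightarrow> complex" assume lam: "lam \<noteq> 0" and f: "bfun f1" "bfun f2" "bfun f3"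
    define S where "S p = lam * g 0 0 p" for p
    have Sm: "S \<in> borel_measurable borel" unfolding S_def using gm by measurable
    define F where "F = sqrt (nsq f1 * nsq f2 * nsq f3)"
    define r where "r n = R / 2 ^ n" for n :: nat
    define w where "w = 1 / (2 * real m)"
    have r: "r n > 0" "r n < r0" "r (Suc n) = r n / 2" for n
    proof -
      have "R / 2 ^ n \<le> R / 1" using R by (intro divide_left_mono) auto
      then show "r n > 0" "r n < r0" "r (Suc n) = r n / 2" using R by (simp_all add: r_def)
    qed
    define T where "T n = trif S (clip (- r n) (r n) f1) (clip (- r n) (r n) f2) f3" for n
    define P where "P n q = (case q of (i, j) \<Rightarrow> trif S (gridcell (r n) m i f1) (gridcell (r n) m j f2) f3)" for n q
    have Tn: "T n = (\<Sum>q\<in>annulus_cells m. P n q) + T (Suc n)" for n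
      unfolding T_def r(3) using trif_annulus[OF Sm f r(1) m0] by (simp add: P_def case_prod_beta)
    have T0: "T 0 = (\<Sum>n<N. \<Sum>q\<in>annulus_cells m. P n q) + T N" for N
    proof (induction N)
      case (Suc N)
      then show ?case using Tn[of N] by simp
    qed simp
    have fin: "finite (annulus_cells m)" by (simp add: annulus_cells_def)
    have Pn: "(\<Sum>n<N. norm (P n q)) \<le> C * \<bar>lam\<bar> powr (- e) * F" if q: "q \<in> annulus_cells m" for q N
    proof -
      obtain i j where ij: "q = (i, j)" by (cases q)
      define u v where "u = -1 + real i / (2 * real m)" and "v = -1 + real j / (2 * real m)"
      have cell: "gridcell r m i f = clip (r * u) (r * (u + w)) f" "gridcell r m j f = clip (r * v) (r * (v + w)) f" for r f
        by (simp_all add: gridcell_def u_def v_def w_def add_divide_distrib algebra_simps)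
      have uvK: "(u, v) \<in> K" using annulus_cell_corner[OF q[unfolded ij] m0] by (simp add: K_def u_def v_def)
      let ?F = "\<lambda>n. clip (r n * (u + v)) (r n * (u + v + 2 * w)) f3"
      have one: "norm (P n q) \<le> C * \<bar>lam\<bar> powr (- e) * sqrt (nsq (gridcell (r n) m i f1) * nsq (gridcell (r n) m j f2) * nsq (?F n))" for n
      proof -
        have eq: "P n q = trif S (gridcell (r n) m i f1) (gridcell (r n) m j f2) (clip (r n * u + r n * v) (r n * (u + w) + r n * (v + w)) f3)"
          unfolding P_def ij prod.case cell by (rule trif_clip3) (auto dest: clip_nonzeroD)
        have e2: "r n * u + r n * v = r n * (u + v)" "r n * (u + w) + r n * (v + w) = r n * (u + v + 2 * w)" by (simp_all add: algebra_simps)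
        have "norm (trif S (gridcell (r n) m i f1) (gridcell (r n) m j f2) (?F n)) \<le> C * \<bar>lam\<bar> powr (- e) * sqrt (nsq (gridcell (r n) m i f1) * nsq (gridcell (r n) m j f2) * nsq (?F n))"
          unfolding S_def
        proof (rule est[rule_format, OF uvK r(1,2) lam bfun_gridcell[OF f(1)] bfun_gridcell[OF f(2)] bfun_clip[OF f(3)]])
          have le: "r n * (x + w) \<le> r n * (x + \<delta>)" for x using r(1)[of n] m(2) by (intro mult_left_mono) (auto simp: w_def)
          fix t assume "gridcell (r n) m i f1 t \<noteq> 0"
          then show "r n * fst (u, v) \<le> t \<and> t < r n * (fst (u, v) + \<delta>)"
            using le[of u] unfolding cell by (auto dest!: clip_nonzeroD)
        next
          have le: "r n * (x + w) \<le> r n * (x + \<delta>)" for x using r(1)[of n] m(2) by (intro mult_left_mono) (auto simp: w_def)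
          fix t assume "gridcell (r n) m j f2 t \<noteq> 0"
          then show "r n * snd (u, v) \<le> t \<and> t < r n * (snd (u, v) + \<delta>)"
            using le[of v] unfolding cell by (auto dest!: clip_nonzeroD)
        qed
        then show ?thesis unfolding eq e2 .
      qed
      have "(\<Sum>n<N. norm (P n q)) \<le> (\<Sum>n<N. C * \<bar>lam\<bar> powr (- e) * sqrt (nsq (gridcell (r n) m i f1) * nsq (gridcell (r n) m j f2) * nsq (?F n)))"
        by (intro sum_mono one)
      also have "\<dots> = C * \<bar>lam\<bar> powr (- e) * (\<Sum>n<N. sqrt (nsq (gridcell (r n) m i f1) * nsq (gridcell (r n) m j f2) * nsq (?F n)))"
        by (simp add: sum_distrib_left)
      also have "\<dots> \<le> C * \<bar>lam\<bar> powr (- e) * F"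
        unfolding r_def F_def u_def v_def w_def
        by (intro mult_left_mono sum_dilates_annulus_cell[OF q[unfolded ij] m(1) f R(1)]) (use C in auto)
      finally show ?thesis .
    qed
    \<comment> \<open>Only finitely many annuli are removed: the Cauchy-Schwarz bound for the inner
      square tends to 0 with its side and is soon below the required size. Thus no infinite series
      occurs.\<close>
    obtain N where N: "2 * r N \<le> (\<bar>lam\<bar> powr (- e))\<^sup>2"
    proof -
      have p: "0 < (\<bar>lam\<bar> powr (- e))\<^sup>2 / (2 * R)" using lam R by simp
      obtain N where "(1 / 2) ^ N < (\<bar>lam\<bar> powr (- e))\<^sup>2 / (2 * R)" using real_arch_pow_inv[OF p, of "1 / 2"] by auto
      then show thesis using R by (intro that[of N]) (simp add: r_def field_simps)
    qed
    have "norm (T N) \<le> \<bar>lam\<bar> powr (- e) * F"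
    proof -
      let ?c = "clip (- r N) (r N)"
      have "(norm (T N))\<^sup>2 \<le> (2 * r N) * (nsq (?c f1) * nsq (?c f2) * nsq f3)"
        unfolding T_def
        by (rule trif_trivial[OF Sm bfun_clip[OF f(1)] bfun_clip[OF f(2)] f(3), where a = "- r N" and l = "2 * r N"]) (use r(1)[of N] in \<open>auto dest!: clip_nonzeroD\<close>)
      also have "\<dots> \<le> (\<bar>lam\<bar> powr (- e))\<^sup>2 * (nsq f1 * nsq f2 * nsq f3)"
        by (intro mult_mono N nsq_clip_le f order_refl mult_nonneg_nonneg nsq_nonneg) auto
      also have "\<dots> = (\<bar>lam\<bar> powr (- e) * F)\<^sup>2" by (simp add: F_def power_mult_distrib nsq_nonneg)
      finally show ?thesis by (rule power2_le_imp_le) (auto simp: F_def nsq_nonneg)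
    qed
    moreover have "norm (\<Sum>n<N. \<Sum>q\<in>annulus_cells m. P n q) \<le> real (card (annulus_cells m)) * (C * \<bar>lam\<bar> powr (- e) * F)"
    proof -
      have "norm (\<Sum>n<N. \<Sum>q\<in>annulus_cells m. P n q) = norm (\<Sum>q\<in>annulus_cells m. \<Sum>n<N. P n q)" by (subst sum.swap) (rule refl)
      also have "\<dots> \<le> (\<Sum>q\<in>annulus_cells m. C * \<bar>lam\<bar> powr (- e) * F)"
        by (rule sum_norm_le) (rule order_trans[OF norm_sum Pn])
      finally show ?thesis by simp
    qed
    ultimately have "norm (T 0) \<le> real (card (annulus_cells m)) * (C * \<bar>lam\<bar> powr (- e) * F) + \<bar>lam\<bar> powr (- e) * F"
      unfolding T0[of N] by (meson add_mono norm_triangle_le)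
    also have "\<dots> = D * \<bar>lam\<bar> powr (- e) * F" by (simp add: D_def algebra_simps)
    finally show "norm (trif (\<lambda>p. lam * g 0 0 p) (clip (- R) R f1) (clip (- R) R f2) f3) \<le> D * \<bar>lam\<bar> powr (- e) * sqrt (nsq f1 * nsq f2 * nsq f3)"
      by (simp add: T_def r_def F_def S_def[abs_def])
  qed
qed

section \<open>Cut-off functions and square integrable functions\<close>

text \<open>The form is defined over \<open>lebesgue\<close>, the completion of
  \<open>lborel\<close>, whereas the estimates use Borel functions. This and the next fact transfer
  measurability and integrals through almost everywhere equality.\<close>

lemma AE_eq_borel_measurable_completion:
  fixes f g :: "'a \<Rightarrow> 'b::topological_space"
  assumes g: "g \<in> borel_measurable M" and ae: "AE x in M. f x = g x"
  shows "f \<in> borel_measurable (completion M)"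
proof (rule measurableI)
  obtain N where N: "N \<in> null_sets M" "{x \<in> space M. \<not> f x = g x} \<subseteq> N"
    using ae unfolding eventually_ae_filter by blast
  fix A :: "'b set" assume "A \<in> sets borel"
  then have "g -` A \<inter> space M - N \<in> sets M" using measurable_sets[OF g] N(1) by blast
  moreover have "f -` A \<inter> space (completion M) = (g -` A \<inter> space M - N) \<union> (f -` A \<inter> space M \<inter> N)" using N(2) by auto
  ultimately show "f -` A \<inter> space (completion M) \<in> sets (completion M)" by (intro sets_completionI[OF _ _ N(1)]) auto
qed simp

lemma integral_completion_AE_eq:
  fixes f g :: "'a \<Rightarrow> 'b::{banach, second_countable_topology}"
  assumes g: "g \<in> borel_measurable M" and ae: "AE x in M. f x = g x"
  shows "integral\<^sup>L (completion M) f = integral\<^sup>L M g" "integrable (completion M) f \<longleftrightarrow> integrable M g"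
proof -
  note f = AE_eq_borel_measurable_completion[OF g ae]
  have ae': "AE x in completion M. f x = g x" by (rule AE_completion[OF ae])
  show "integral\<^sup>L (completion M) f = integral\<^sup>L M g"
    unfolding integral_cong_AE[OF f measurable_completion[OF g] ae'] by (rule integral_completion[OF g])
  show "integrable (completion M) f \<longleftrightarrow> integrable M g"
    unfolding integrable_cong_AE[OF f measurable_completion[OF g] ae'] by (rule integrable_completion[OF g])
qed

lemma L2_borel_representative:
  assumes "L2_fun f"
  shows "\<exists>g. g \<in> borel_measurable borel \<and> (AE x in lborel. f x = g x) \<and> integrable lborel (\<lambda>x. (norm (g x))\<^sup>2) \<and> L2_norm f = sqrt (nsq g)"
proof -
  have f: "f \<in> borel_measurable lebesgue" and i: "integrable lebesgue (\<lambda>x. (norm (f x))\<^sup>2)" using assms by (auto simp: L2_fun_def)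
  obtain u where u: "u \<in> borel_measurable lborel" "AE x in lborel. Re (f x) = u x"
    using completion_ex_borel_measurable_real[of "\<lambda>x. Re (f x)" lborel] f by auto
  obtain v where v: "v \<in> borel_measurable lborel" "AE x in lborel. Im (f x) = v x"
    using completion_ex_borel_measurable_real[of "\<lambda>x. Im (f x)" lborel] f by auto
  define g where "g x = complex_of_real (u x) + \<i> * complex_of_real (v x)" for x
  have g: "g \<in> borel_measurable lborel" using u(1) v(1) unfolding g_def by measurable
  have ae: "AE x in lborel. f x = g x" using u(2) v(2)
    by eventually_elim (simp add: g_def complex_eq_iff)
  have ae2: "AE x in lborel. (norm (f x))\<^sup>2 = (norm (g x))\<^sup>2" using ae by eventually_elim simp
  have g2: "(\<lambda>x. (norm (g x))\<^sup>2) \<in> borel_measurable lborel" using g by measurable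
  show ?thesis
    using g ae i integral_completion_AE_eq[OF g2 ae2] by (auto simp: L2_norm_def nsq_def intro!: exI[of _ g])
qed

text \<open>For fixed x the condition that x + y avoids a null set fails only for y in a translate
  of it, which is null. So all three exceptional sets are null in the plane.\<close>

lemma AE_lborel_pair:
  assumes "AE x in lborel. P (x::real)"
  shows "AE p in (lborel :: (real \<times> real) measure). P (fst p)" "AE p in (lborel :: (real \<times> real) measure). P (snd p)"
    "AE p in (lborel :: (real \<times> real) measure). P (fst p + snd p)"
proof -
  obtain N where N: "N \<in> null_sets lborel" "{x. \<not> P x} \<subseteq> N"
    using assms unfolding eventually_ae_filter by auto
  have [measurable]: "N \<in> sets borel" using N(1) by auto
  have ae: "AE x in lborel. x \<notin> N" using N(1) by (rule AE_not_in)
  have ae2: "AE y in lborel. x + y \<notin> N" for x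
    using AE_borel_affine[of 1 "\<lambda>x. x \<notin> N" x] ae by simp
  have "AE p in lborel \<Otimes>\<^sub>M lborel. fst p \<notin> N \<and> snd p \<notin> N \<and> fst p + snd p \<notin> (N :: real set)"
  proof (rule lborel_pair.AE_pair_measure)
    show "{p \<in> space (lborel \<Otimes>\<^sub>M lborel). fst p \<notin> N \<and> snd p \<notin> N \<and> fst p + snd p \<notin> N} \<in> sets (lborel \<Otimes>\<^sub>M lborel)"
      by measurable
    show "AE x in lborel. AE y in lborel. fst (x, y) \<notin> N \<and> snd (x, y) \<notin> N \<and> fst (x, y) + snd (x, y) \<notin> N"
      using ae
    proof eventually_elim
      fix x assume "x \<notin> N"
      then show "AE y in lborel. fst (x, y) \<notin> N \<and> snd (x, y) \<notin> N \<and> fst (x, y) + snd (x, y) \<notin> N"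
        using ae ae2[of x] by auto
    qed
  qed
  then have *: "AE p in lborel. fst p \<notin> N \<and> snd p \<notin> N \<and> fst p + snd p \<notin> N" unfolding lborel_prod .
  have P: "P x" if "x \<notin> N" for x using N(2) that by auto
  show "AE p in (lborel :: (real \<times> real) measure). P (fst p)" using * by eventually_elim (auto intro: P)
  show "AE p in (lborel :: (real \<times> real) measure). P (snd p)" using * by eventually_elim (auto intro: P)
  show "AE p in (lborel :: (real \<times> real) measure). P (fst p + snd p)" using * by eventually_elim (auto intro: P)
qed

text \<open>Nothing is known of \<open>S\<close> outside \<open>U\<close>, not even measurability.
  \<open>S'\<close> is a Borel phase with the same values wherever the cut-off is nonzero.\<close>

lemma trilinear_form_borel:
  assumes S': "S' \<in> borel_measurable borel" "\<And>p. \<phi> p \<noteq> 0 \<Longrightarrow> S' p = S p" and \<phi>: "\<phi> \<in> borel_measurable borel"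
    and g: "g1 \<in> borel_measurable borel" "g2 \<in> borel_measurable borel" "g3 \<in> borel_measurable borel"
    and ae: "AE x in lborel. f1 x = g1 x" "AE x in lborel. f2 x = g2 x" "AE x in lborel. f3 x = g3 x"
  shows "trilinear_form S \<phi> lam f1 f2 f3 = (LINT p|lborel. cis (lam * S' p) * (g1 (fst p) * g2 (snd p) * g3 (fst p + snd p)) * \<phi> p)"
  unfolding trilinear_form_def
proof (rule integral_completion_AE_eq(1))
  note [measurable] = g S'(1)[unfolded borel_prod[symmetric]] \<phi>[unfolded borel_prod[symmetric]] cis_borel_measurable
  show "(\<lambda>p. cis (lam * S' p) * (g1 (fst p) * g2 (snd p) * g3 (fst p + snd p)) * \<phi> p) \<in> borel_measurable lborel"
    unfolding measurable_lborel2 borel_prod[symmetric] by measurable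
  show "AE p in lborel. (case p of (x, y) \<Rightarrow> exp (\<i> * complex_of_real (lam * S (x, y))) * f1 x * f2 y * f3 (x + y) * \<phi> (x, y)) =
    cis (lam * S' p) * (g1 (fst p) * g2 (snd p) * g3 (fst p + snd p)) * \<phi> p"
    using AE_lborel_pair(1)[OF ae(1)] AE_lborel_pair(2)[OF ae(2)] AE_lborel_pair(3)[OF ae(3)]
  proof eventually_elim
    fix p :: "real \<times> real"
    assume e: "f1 (fst p) = g1 (fst p)" "f2 (snd p) = g2 (snd p)" "f3 (fst p + snd p) = g3 (fst p + snd p)"
    obtain x y where p: "p = (x, y)" by fastforce
    show "(case p of (x, y) \<Rightarrow> exp (\<i> * complex_of_real (lam * S (x, y))) * f1 x * f2 y * f3 (x + y) * \<phi> (x, y)) =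
      cis (lam * S' p) * (g1 (fst p) * g2 (snd p) * g3 (fst p + snd p)) * \<phi> p"
      using e S'(2)[of p] unfolding p by (cases "\<phi> (x, y) = 0") (simp_all add: cis_conv_exp mult.assoc)
  qed
qed

text \<open>Both the support and the values are cut. At each point the truncations are eventually
  equal to the function, and they never exceed it in modulus.\<close>

definition truncate :: "nat \<Rightarrow> (real \<Rightarrow> complex) \<Rightarrow> real \<Rightarrow> complex" where
  "truncate n g x = (if \<bar>x\<bar> \<le> real n \<and> norm (g x) \<le> real n then g x else 0)"

lemma bfun_truncate: "g \<in> borel_measurable borel \<Longrightarrow> bfun (truncate n g)"
  by (rule bfunI[where B = "real n" and R = "real n"]) (auto simp: truncate_def[abs_def])

lemma norm_truncate_le: "norm (truncate n g x) \<le> norm (g x)"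
  by (simp add: truncate_def)

lemma nsq_truncate_le: "integrable lborel (\<lambda>x. (norm (g x))\<^sup>2) \<Longrightarrow> nsq (truncate n g) \<le> nsq g"
  unfolding nsq_def by (rule integral_mono') (auto intro!: power_mono norm_truncate_le)

lemma truncate_tendsto: "(\<lambda>n. truncate n g x) \<longlonglongrightarrow> g x"
proof (rule tendsto_eventually)
  obtain N where "max \<bar>x\<bar> (norm (g x)) \<le> real N" using real_arch_simple by blast
  then have "truncate n g x = g x" if "n \<ge> N" for n using that by (simp add: truncate_def)
  then show "\<forall>\<^sub>F n in sequentially. truncate n g x = g x" unfolding eventually_sequentially by blast
qed

lemma bound_extends_to_square_integrable:
  assumes S: "S \<in> borel_measurable borel" and \<phi>: "\<phi> \<in> borel_measurable borel" and B: "B \<ge> 0"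
    and bd: "\<And>F1 F2 F3. bfun F1 \<Longrightarrow> bfun F2 \<Longrightarrow> bfun F3 \<Longrightarrow>
      norm (LINT p|lborel. cis (S p) * (F1 (fst p) * F2 (snd p) * F3 (fst p + snd p)) * \<phi> p) \<le> B * sqrt (nsq F1 * nsq F2 * nsq F3)"
    and g: "g1 \<in> borel_measurable borel" "g2 \<in> borel_measurable borel" "g3 \<in> borel_measurable borel"
    and i: "integrable lborel (\<lambda>x. (norm (g1 x))\<^sup>2)" "integrable lborel (\<lambda>x. (norm (g2 x))\<^sup>2)" "integrable lborel (\<lambda>x. (norm (g3 x))\<^sup>2)"
  shows "norm (LINT p|lborel. cis (S p) * (g1 (fst p) * g2 (snd p) * g3 (fst p + snd p)) * \<phi> p) \<le> B * sqrt (nsq g1 * nsq g2 * nsq g3)"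
proof -
  define W where "W h1 h2 h3 p = cis (S p) * (h1 (fst p) * h2 (snd p) * h3 (fst p + snd p)) * \<phi> p" for h1 h2 h3 :: "real \<Rightarrow> complex" and p
  have Wm: "W h1 h2 h3 \<in> borel_measurable lborel"
    if h [measurable]: "h1 \<in> borel_measurable borel" "h2 \<in> borel_measurable borel" "h3 \<in> borel_measurable borel" for h1 h2 h3
  proof -
    note [measurable] = S[unfolded borel_prod[symmetric]] \<phi>[unfolded borel_prod[symmetric]] cis_borel_measurable
    show ?thesis unfolding measurable_lborel2 borel_prod[symmetric] W_def[abs_def] by measurable
  qed
  show ?thesis
  proof (cases "integrable lborel (W g1 g2 g3)")
    case True
    let ?W = "\<lambda>n. W (truncate n g1) (truncate n g2) (truncate n g3)"
    have "(\<lambda>n. LINT p|lborel. ?W n p) \<longlonglongrightarrow> (LINT p|lborel. W g1 g2 g3 p)"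
    proof (rule integral_dominated_convergence[where w = "\<lambda>p. norm (W g1 g2 g3 p)"])
      show "integrable lborel (\<lambda>p. norm (W g1 g2 g3 p))" using True by simp
      show "AE p in lborel. (\<lambda>n. ?W n p) \<longlonglongrightarrow> W g1 g2 g3 p"
        unfolding W_def by (intro AE_I2 tendsto_intros truncate_tendsto)
      show "AE p in lborel. norm (?W n p) \<le> norm (W g1 g2 g3 p)" for n
        unfolding W_def norm_mult by (intro AE_I2 mult_mono mult_nonneg_nonneg norm_ge_zero order_refl norm_truncate_le)
    qed (intro Wm g bfun_measurable bfun_truncate)+
    then have lim: "(\<lambda>n. norm (LINT p|lborel. ?W n p)) \<longlonglongrightarrow> norm (LINT p|lborel. W g1 g2 g3 p)" by (rule tendsto_norm)
    have le: "norm (LINT p|lborel. ?W n p) \<le> B * sqrt (nsq g1 * nsq g2 * nsq g3)" for n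
    proof -
      have "norm (LINT p|lborel. ?W n p) \<le> B * sqrt (nsq (truncate n g1) * nsq (truncate n g2) * nsq (truncate n g3))"
        unfolding W_def by (intro bd bfun_truncate g)
      also have "\<dots> \<le> B * sqrt (nsq g1 * nsq g2 * nsq g3)"
        by (intro mult_left_mono real_sqrt_le_mono mult_mono nsq_truncate_le i mult_nonneg_nonneg nsq_nonneg B)
      finally show ?thesis .
    qed
    show ?thesis using LIMSEQ_le_const2[OF lim] le unfolding W_def by blast
  next
    \<comment> \<open>A non-integrable integrand has integral 0 by convention, so the bound holds
      trivially and integrability need not be proved.\<close>
    case False
    then have "(LINT p|lborel. W g1 g2 g3 p) = 0" by (rule not_integrable_integral_eq)
    then show ?thesis using B by (simp add: W_def nsq_nonneg)
  qed
qed

section \<open>The cut-off as a superposition of quadrants\<close>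

lemma smooth_on_has_vector_derivative:
  assumes "smooth_on U f" "(x, y) \<in> U"
  shows "((\<lambda>t. f (t, y)) has_vector_derivative partial_x f (x, y)) (at x)"
    "((\<lambda>t. f (x, t)) has_vector_derivative partial_y f (x, y)) (at y)"
proof -
  have "Ck_on (Suc 0) U f" using assms(1) by (simp only: smooth_on_def)
  then have "(\<lambda>t. f (t, y)) differentiable (at x)" "(\<lambda>t. f (x, t)) differentiable (at y)" using assms(2) by auto
  then show "((\<lambda>t. f (t, y)) has_vector_derivative partial_x f (x, y)) (at x)"
    "((\<lambda>t. f (x, t)) has_vector_derivative partial_y f (x, y)) (at y)"
    by (simp_all add: partial_x_def partial_y_def vector_derivative_works)
qed

lemma partial_vanishes:
  assumes W: "open W" "\<And>p. p \<in> W \<Longrightarrow> F p = 0" and p: "p \<in> W"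
  shows "partial_x F p = 0" "partial_y F p = 0"
proof -
  obtain x y where xy: "p = (x, y)" by fastforce
  have "open ((\<lambda>t. (t, y)) -` W)" "open ((\<lambda>t. (x, t)) -` W)" by (intro open_vimage W(1) continuous_intros)+
  then have o: "open {t. (t, y) \<in> W}" "open {t. (x, t) \<in> W}" by (simp_all add: vimage_def)
  have "((\<lambda>t. F (t, y)) has_vector_derivative 0) (at x)"
    by (rule has_vector_derivative_transform_within_open[OF has_vector_derivative_const o(1)]) (use p xy W(2) in auto)
  moreover have "((\<lambda>t. F (x, t)) has_vector_derivative 0) (at y)"
    by (rule has_vector_derivative_transform_within_open[OF has_vector_derivative_const o(2)]) (use p xy W(2) in auto)
  ultimately show "partial_x F p = 0" "partial_y F p = 0"
    by (simp_all add: xy partial_x_def partial_y_def vector_derivative_at)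
qed

lemma integral_derivative_half_line:
  fixes F f :: "real \<Rightarrow> complex"
  assumes d: "\<And>x. (F has_vector_derivative f x) (at x)" and c: "continuous_on UNIV f" and z: "\<And>x. x < - B \<Longrightarrow> F x = 0 \<and> f x = 0"
  shows "F x = (LINT s|lborel. (if s \<le> x then f s else 0))"
proof -
  define a where "a = min x (- B) - 1"
  have a: "a \<le> x" "a < - B" by (auto simp: a_def)
  have "(LINT s|lborel. indicator {a..x} s *\<^sub>R f s) = F x - F a"
    by (rule integral_FTC_Icc[OF a(1)]) (auto intro: has_vector_derivative_at_within d continuous_on_subset[OF c])
  moreover have "indicator {a..x} s *\<^sub>R f s = (if s \<le> x then f s else 0)" for s
    using z[of s] a by (auto simp: indicator_def not_le)
  ultimately show ?thesis using z[OF a(2)] by simp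
qed

lemma bfun_compact_support:
  fixes f :: "real \<times> real \<Rightarrow> complex"
  assumes c: "continuous_on UNIV f" and z: "\<And>p. norm p > R \<Longrightarrow> f p = 0"
  shows "bfun f"
proof -
  have "bounded (f ` cball 0 R)"
    by (intro compact_imp_bounded compact_continuous_image continuous_on_subset[OF c] compact_cball) auto
  then obtain B where "\<forall>x\<in>cball 0 R. norm (f x) \<le> B" unfolding bounded_iff by blast
  then have B: "norm (f p) \<le> B" if "norm p \<le> R" for p using that by simp
  show ?thesis
  proof (rule bfunI[where B = "\<bar>B\<bar>" and R = R])
    show "f \<in> borel_measurable borel" by (rule borel_measurable_continuous_onI[OF c])
    show "norm (f p) \<le> \<bar>B\<bar>" for p using B[of p] z[of p] by (cases "norm p \<le> R") auto
  qed (rule z)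
qed

text \<open>The density is the mixed second derivative of the cut-off. Integrating it from minus
  infinity, once in each variable, recovers the cut-off because everything vanishes outside a
  bounded set.\<close>

lemma test_function_density:
  assumes "test_function_on V \<phi>"
  shows "\<exists>\<psi>. bfun \<psi> \<and> (\<forall>p. \<phi> p = (LINT q|lborel. (if fst q \<le> fst p \<and> snd q \<le> snd p then \<psi> q else 0)))"
proof -
  have sm: "smooth_on UNIV \<phi>" and cpt: "compact (closure {p. \<phi> p \<noteq> 0})" using assms unfolding test_function_on_def by simp_all
  note sx = smooth_on_partial(1)[OF sm]
  note sxy = smooth_on_partial(2)[OF sx]
  define \<psi> where "\<psi> = partial_y (partial_x \<phi>)"
  obtain B where B: "\<And>p. \<phi> p \<noteq> 0 \<Longrightarrow> norm p \<le> B"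
    using compact_imp_bounded[OF cpt] closure_subset[of "{p. \<phi> p \<noteq> 0}"] unfolding bounded_iff by blast
  \<comment> \<open>An open set on which the cut-off is 0. Openness carries the vanishing over to
    its derivatives.\<close>
  define W where "W = {p::real \<times> real. B < \<bar>fst p\<bar>} \<union> {p. B < \<bar>snd p\<bar>}"
  have oW: "open W" unfolding W_def by (intro open_Un open_Collect_less continuous_intros)
  have W0: "\<phi> p = 0" if "p \<in> W" for p
  proof (rule ccontr)
    assume "\<phi> p \<noteq> 0"
    then have "norm p \<le> B" by (rule B)
    then show False using that norm_fst_le[of "fst p" "snd p"] norm_snd_le[of "snd p" "fst p"] by (auto simp: W_def)
  qed
  have W1: "partial_x \<phi> p = 0" if "p \<in> W" for p using partial_vanishes(1)[OF oW W0 that] by simp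
  have W2: "\<psi> p = 0" if "p \<in> W" for p unfolding \<psi>_def using partial_vanishes(2)[OF oW W1 that] by simp
  have c1: "continuous_on UNIV (partial_x \<phi>)" "continuous_on UNIV \<psi>" unfolding \<psi>_def by (rule smooth_on_partial(3)[OF sx] smooth_on_partial(3)[OF sxy])+
  have b: "bfun \<psi>"
  proof (rule bfun_compact_support[OF c1(2), of "2 * \<bar>B\<bar>"])
    fix p :: "real \<times> real" assume "norm p > 2 * \<bar>B\<bar>"
    moreover have "norm p \<le> \<bar>fst p\<bar> + \<bar>snd p\<bar>" unfolding norm_prod_def by (simp add: sqrt_sum_squares_le_sum_abs)
    ultimately have "p \<in> W" by (auto simp: W_def)
    then show "\<psi> p = 0" by (rule W2)
  qed
  have c2: "continuous_on UNIV (\<lambda>s. partial_x \<phi> (s, y))" "continuous_on UNIV (\<lambda>t. \<psi> (x, t))" for x y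
    by (rule continuous_on_compose2[OF c1(1)] continuous_on_compose2[OF c1(2)]; auto intro!: continuous_intros)+
  have eq1: "\<phi> (x, y) = (LINT s|lborel. (if s \<le> x then partial_x \<phi> (s, y) else 0))" for x y
    by (rule integral_derivative_half_line[where B = "\<bar>B\<bar>", OF smooth_on_has_vector_derivative(1)[OF sm] c2(1)]) (auto simp: W_def intro!: W0 W1)
  have eq2: "partial_x \<phi> (s, y) = (LINT t|lborel. (if t \<le> y then \<psi> (s, t) else 0))" for s y
    unfolding \<psi>_def
    by (rule integral_derivative_half_line[where B = "\<bar>B\<bar>", OF smooth_on_has_vector_derivative(2)[OF sx] c2(2)[unfolded \<psi>_def]]) (auto simp: W_def \<psi>_def[symmetric] intro!: W1 W2)
  have "\<phi> (x, y) = (LINT q|lborel. (if fst q \<le> x \<and> snd q \<le> y then \<psi> q else 0))" for x y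
  proof -
    note [measurable] = bfun_measurable[OF b, unfolded borel_prod[symmetric]]
    have K: "bfun (\<lambda>q. if fst q \<le> x \<and> snd q \<le> y then \<psi> q else 0)"
    proof (rule bfun_dominated[OF b, where C = 1])
      show "(\<lambda>q. if fst q \<le> x \<and> snd q \<le> y then \<psi> q else 0) \<in> borel_measurable borel" unfolding borel_prod[symmetric] by measurable
    qed simp
    have "(if s \<le> x then (LINT t|lborel. (if t \<le> y then \<psi> (s, t) else 0)) else 0) = (LINT t|lborel. (if s \<le> x \<and> t \<le> y then \<psi> (s, t) else 0))" for s
      by simp
    then show ?thesis unfolding bfun_Fubini(1)[OF K] eq1[of x y] eq2 by simp
  qed
  then show ?thesis using b by (intro exI[of _ \<psi>]) auto
qed

text \<open>Writing the cut-off as a superposition of quadrants reduces it to sharp truncations of \<open>f1\<close> and \<open>f2\<close>.\<close>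

lemma cutoff_superposition:
  assumes S: "S \<in> borel_measurable borel" and f: "bfun f1" "bfun f2" "bfun f3" and \<psi>: "bfun \<psi>"
    and \<phi>: "\<And>p. \<phi> p = (LINT q|lborel. (if fst q \<le> fst p \<and> snd q \<le> snd p then \<psi> q else 0))"
    and supp: "\<And>p. \<phi> p \<noteq> 0 \<Longrightarrow> \<bar>fst p\<bar> < R \<and> \<bar>snd p\<bar> < R"
  shows "(LINT p|lborel. cis (S p) * (f1 (fst p) * f2 (snd p) * f3 (fst p + snd p)) * \<phi> p) =
    (LINT q|lborel. \<psi> q * trif S (clip (- R) R (clip (fst q) R f1)) (clip (- R) R (clip (snd q) R f2)) f3)"
proof -
  define G where "G p = cis (S p) * (clip (- R) R f1 (fst p) * clip (- R) R f2 (snd p) * f3 (fst p + snd p))" for p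
  have bG: "bfun G" unfolding G_def by (intro bfun_trif S bfun_clip f)
  define K where "K z = (if fst (fst z) \<le> fst (snd z) \<and> snd (fst z) \<le> snd (snd z) then \<psi> (fst z) * G (snd z) else 0)" for z
  have bK: "bfun K"
  proof (rule bfun_dominated[OF bfun_tensor[OF \<psi> bG], where C = 1])
    note [measurable] = bfun_measurable[OF \<psi>, unfolded borel_prod[symmetric]] bfun_measurable[OF bG, unfolded borel_prod[symmetric]]
    show "K \<in> borel_measurable borel" unfolding K_def[abs_def] borel_prod[symmetric] by measurable
  qed (simp add: K_def)
  have "(LINT p|lborel. cis (S p) * (f1 (fst p) * f2 (snd p) * f3 (fst p + snd p)) * \<phi> p) = (LINT p|lborel. LINT q|lborel. K (q, p))"
  proof (rule Bochner_Integration.integral_cong[OF refl])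
    fix p :: "real \<times> real"
    have "cis (S p) * (f1 (fst p) * f2 (snd p) * f3 (fst p + snd p)) * \<phi> p = G p * \<phi> p"
      using supp[of p] by (cases "\<phi> p = 0") (auto simp: G_def clip_def)
    also have "\<dots> = (LINT q|lborel. G p * (if fst q \<le> fst p \<and> snd q \<le> snd p then \<psi> q else 0))"
      unfolding \<phi>[of p] by simp
    also have "\<dots> = (LINT q|lborel. K (q, p))"
      by (rule Bochner_Integration.integral_cong[OF refl]) (simp add: K_def)
    finally show "cis (S p) * (f1 (fst p) * f2 (snd p) * f3 (fst p + snd p)) * \<phi> p = (LINT q|lborel. K (q, p))" .
  qed
  also have "\<dots> = (LINT q|lborel. LINT p|lborel. K (q, p))" by (rule bfun_Fubini(2)[OF bK])
  also have "\<dots> = (LINT q|lborel. \<psi> q * trif S (clip (- R) R (clip (fst q) R f1)) (clip (- R) R (clip (snd q) R f2)) f3)"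
  proof (rule Bochner_Integration.integral_cong[OF refl])
    fix q :: "real \<times> real"
    have "(LINT p|lborel. K (q, p)) = (LINT p|lborel. \<psi> q * (cis (S p) * (clip (- R) R (clip (fst q) R f1) (fst p) * clip (- R) R (clip (snd q) R f2) (snd p) * f3 (fst p + snd p))))"
      by (rule Bochner_Integration.integral_cong[OF refl]) (auto simp: K_def G_def clip_def)
    then show "(LINT p|lborel. K (q, p)) = \<psi> q * trif S (clip (- R) R (clip (fst q) R f1)) (clip (- R) R (clip (snd q) R f2)) f3"
      by (simp add: trif_def)
  qed
  finally show ?thesis .
qed

lemma jet_cong:
  assumes g: "jet U g" and e: "\<And>i j p. p \<in> U \<Longrightarrow> g' i j p = g i j p"
  shows "jet U g'"
  unfolding jet_def
proof (intro conjI allI impI)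
  show o: "open U" by (rule jet_open[OF g])
  fix i j
  show "continuous_on U (g' i j)" by (rule continuous_on_eq[OF jet_cont[OF g, of i j]]) (simp add: e)
  fix x y assume xy: "(x, y) \<in> U"
  show "((\<lambda>t. g' i j (t, y)) has_real_derivative g' (Suc i) j (x, y)) (at x)"
    unfolding e[OF xy] by (rule iffD2[OF DERIV_cong_open(1)[OF o xy, of "g' i j" "g i j"]]) (simp_all add: e jet_dx[OF g xy])
  show "((\<lambda>t. g' i j (x, t)) has_real_derivative g' i (Suc j) (x, y)) (at y)"
    unfolding e[OF xy] by (rule iffD2[OF DERIV_cong_open(2)[OF o xy, of "g' i j" "g i j"]]) (simp_all add: e jet_dy[OF g xy])
qed

lemma bfun_cutoff_bound:
  assumes S: "S \<in> borel_measurable borel" and f: "bfun f1" "bfun f2" "bfun f3" and \<psi>: "bfun \<psi>"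
    and \<phi>: "\<And>p. \<phi> p = (LINT q|lborel. (if fst q \<le> fst p \<and> snd q \<le> snd p then \<psi> q else 0))"
    and supp: "\<And>p. \<phi> p \<noteq> 0 \<Longrightarrow> \<bar>fst p\<bar> < R \<and> \<bar>snd p\<bar> < R" and B: "B \<ge> 0"
    and est: "\<And>f1 f2. bfun f1 \<Longrightarrow> bfun f2 \<Longrightarrow> norm (trif S (clip (- R) R f1) (clip (- R) R f2) f3) \<le> B * sqrt (nsq f1 * nsq f2 * nsq f3)"
  shows "norm (LINT p|lborel. cis (S p) * (f1 (fst p) * f2 (snd p) * f3 (fst p + snd p)) * \<phi> p) \<le> (LINT q|lborel. norm (\<psi> q)) * B * sqrt (nsq f1 * nsq f2 * nsq f3)"
proof -
  let ?N = "sqrt (nsq f1 * nsq f2 * nsq f3)"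
  let ?F = "\<lambda>q. \<psi> q * trif S (clip (- R) R (clip (fst q) R f1)) (clip (- R) R (clip (snd q) R f2)) f3"
  have "norm (LINT q|lborel. ?F q) \<le> (LINT q|lborel. norm (?F q))" by (rule integral_norm_bound)
  also have "\<dots> \<le> (LINT q|lborel. norm (\<psi> q) * (B * ?N))"
  proof (rule integral_mono')
    show "integrable lborel (\<lambda>q. norm (\<psi> q) * (B * ?N))" using bfun_integrable[OF bfun_norm[OF \<psi>]] by simp
    fix q :: "real \<times> real"
    have "norm (trif S (clip (- R) R (clip (fst q) R f1)) (clip (- R) R (clip (snd q) R f2)) f3) \<le>
      B * sqrt (nsq (clip (fst q) R f1) * nsq (clip (snd q) R f2) * nsq f3)"
      by (intro est bfun_clip f)
    also have "\<dots> \<le> B * ?N"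
      by (intro mult_left_mono real_sqrt_le_mono mult_mono nsq_clip_le f order_refl mult_nonneg_nonneg nsq_nonneg B)
    finally show "norm (?F q) \<le> norm (\<psi> q) * (B * ?N)" unfolding norm_mult by (rule mult_left_mono) simp
  qed (use B in \<open>simp add: nsq_nonneg\<close>)
  finally show ?thesis
    by (subst cutoff_superposition[OF S f \<psi> \<phi> supp]) (simp_all add: mult.assoc)
qed

lemma trilinear_decay:
  assumes g: "jet U g" and U0: "(0, 0) \<in> U" and van: "vanishes d (hjet g)"
    and nv: "\<exists>i j. i + j = d \<and> hjet g i j (0, 0) \<noteq> 0" and S: "\<And>p. p \<in> U \<Longrightarrow> S p = g 0 0 p"
  shows "\<exists>R>0. \<forall>\<phi>. test_function_on (U \<inter> {p. \<bar>fst p\<bar> < R \<and> \<bar>snd p\<bar> < R}) \<phi> \<longrightarrow>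
      (\<exists>C>0. \<forall>lam f1 f2 f3. lam \<noteq> 0 \<longrightarrow> L2_fun f1 \<longrightarrow> L2_fun f2 \<longrightarrow> L2_fun f3 \<longrightarrow>
         norm (trilinear_form S \<phi> lam f1 f2 f3)
           \<le> C * \<bar>lam\<bar> powr (- (1 / (2 * (3 + real d)))) * L2_norm f1 * L2_norm f2 * L2_norm f3)"
proof -
  define e where "e = 1 / (2 * (3 + real d))"
  \<comment> \<open>Extension by 0 gives a phase that is Borel on the whole plane and has the same
    jet on \<open>U\<close>.\<close>
  define g' where "g' i j p = (if p \<in> U then g i j p else 0)" for i j p
  have jg: "jet U g'" by (rule jet_cong[OF g]) (simp add: g'_def)
  have h: "hjet g' i j (0, 0) = hjet g i j (0, 0)" for i j using U0 by (simp add: hjet_def g'_def)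
  have gm: "g' 0 0 \<in> borel_measurable borel"
  proof -
    have "(\<lambda>p. if p \<in> U then g 0 0 p else 0) = (\<lambda>p. indicator U p *\<^sub>R g 0 0 p)" by (auto simp: indicator_def)
    then show ?thesis unfolding g'_def
      using borel_measurable_continuous_on_indicator[OF borel_open[OF jet_open[OF g]] jet_cont[OF g, of 0 0]] by simp
  qed
  have "\<exists>R>0. \<exists>C>0. \<forall>lam f1 f2 f3. lam \<noteq> 0 \<longrightarrow> bfun f1 \<longrightarrow> bfun f2 \<longrightarrow> bfun f3 \<longrightarrow>
     norm (trif (\<lambda>p. lam * g' 0 0 p) (clip (- R) R f1) (clip (- R) R f2) f3) \<le> C * \<bar>lam\<bar> powr (- (1 / (2 * (3 + real d)))) * sqrt (nsq f1 * nsq f2 * nsq f3)"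
    by (rule small_support_estimate[OF jg gm U0]) (use van nv in \<open>simp_all add: vanishes_def h\<close>)
  then obtain R C where R: "R > 0" and C: "C > 0" and est: "\<forall>lam f1 f2 f3. lam \<noteq> 0 \<longrightarrow> bfun f1 \<longrightarrow> bfun f2 \<longrightarrow> bfun f3 \<longrightarrow>
     norm (trif (\<lambda>p. lam * g' 0 0 p) (clip (- R) R f1) (clip (- R) R f2) f3) \<le> C * \<bar>lam\<bar> powr (- e) * sqrt (nsq f1 * nsq f2 * nsq f3)"
    unfolding e_def by (elim exE conjE)
  show ?thesis unfolding e_def[symmetric]
  proof (rule exI[of _ R], rule conjI[OF R], intro allI impI)
    fix \<phi> assume tf: "test_function_on (U \<inter> {p. \<bar>fst p\<bar> < R \<and> \<bar>snd p\<bar> < R}) \<phi>"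
    have supp: "p \<in> U \<and> \<bar>fst p\<bar> < R \<and> \<bar>snd p\<bar> < R" if "\<phi> p \<noteq> 0" for p
    proof -
      have "p \<in> closure {p. \<phi> p \<noteq> 0}" using that closure_subset[of "{p. \<phi> p \<noteq> 0}"] by blast
      then show ?thesis using tf unfolding test_function_on_def by blast
    qed
    have \<phi>m: "\<phi> \<in> borel_measurable borel"
      using tf smooth_on_partial(3) unfolding test_function_on_def by (blast intro: borel_measurable_continuous_onI)
    obtain \<psi> where \<psi>: "bfun \<psi>" and \<phi>\<psi>: "\<And>p. \<phi> p = (LINT q|lborel. (if fst q \<le> fst p \<and> snd q \<le> snd p then \<psi> q else 0))"
      using test_function_density[OF tf] by blast
    define L where "L = (LINT q|lborel. norm (\<psi> q))"
    have L: "L \<ge> 0" unfolding L_def by (rule Bochner_Integration.integral_nonneg) simp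
    \<comment> \<open>The summand 1 keeps the constant positive even if the density vanishes almost
      everywhere.\<close>
    define D where "D = L * C + 1"
    have D: "D > 0" unfolding D_def using L C by (intro add_nonneg_pos mult_nonneg_nonneg) auto
    show "\<exists>C>0. \<forall>lam f1 f2 f3. lam \<noteq> 0 \<longrightarrow> L2_fun f1 \<longrightarrow> L2_fun f2 \<longrightarrow> L2_fun f3 \<longrightarrow>
         norm (trilinear_form S \<phi> lam f1 f2 f3) \<le> C * \<bar>lam\<bar> powr (- e) * L2_norm f1 * L2_norm f2 * L2_norm f3"
    proof (rule exI[of _ D], rule conjI[OF D], intro allI impI)
      fix lam :: real and f1 f2 f3
      assume lam: "lam \<noteq> 0" and f: "L2_fun f1" "L2_fun f2" "L2_fun f3"
      obtain g1 where g1: "g1 \<in> borel_measurable borel" "AE x in lborel. f1 x = g1 x" "integrable lborel (\<lambda>x. (norm (g1 x))\<^sup>2)" "L2_norm f1 = sqrt (nsq g1)"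
        using L2_borel_representative[OF f(1)] by blast
      obtain g2 where g2: "g2 \<in> borel_measurable borel" "AE x in lborel. f2 x = g2 x" "integrable lborel (\<lambda>x. (norm (g2 x))\<^sup>2)" "L2_norm f2 = sqrt (nsq g2)"
        using L2_borel_representative[OF f(2)] by blast
      obtain g3 where g3: "g3 \<in> borel_measurable borel" "AE x in lborel. f3 x = g3 x" "integrable lborel (\<lambda>x. (norm (g3 x))\<^sup>2)" "L2_norm f3 = sqrt (nsq g3)"
        using L2_borel_representative[OF f(3)] by blast
      define T where "T p = lam * g' 0 0 p" for p
      have Tm: "T \<in> borel_measurable borel" unfolding T_def using gm by measurable
      define B where "B = D * \<bar>lam\<bar> powr (- e)"
      have "trilinear_form S \<phi> lam f1 f2 f3 = (LINT p|lborel. cis (T p) * (g1 (fst p) * g2 (snd p) * g3 (fst p + snd p)) * \<phi> p)"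
        unfolding T_def by (rule trilinear_form_borel[OF gm _ \<phi>m g1(1) g2(1) g3(1) g1(2) g2(2) g3(2)]) (use supp S in \<open>auto simp: g'_def\<close>)
      moreover have "norm \<dots> \<le> B * sqrt (nsq g1 * nsq g2 * nsq g3)"
      proof (rule bound_extends_to_square_integrable[OF Tm \<phi>m _ _ g1(1) g2(1) g3(1) g1(3) g2(3) g3(3)])
        show "B \<ge> 0" using D by (simp add: B_def)
        fix F1 F2 F3 :: "real \<Rightarrow> complex" assume F: "bfun F1" "bfun F2" "bfun F3"
        have 1: "norm (LINT p|lborel. cis (T p) * (F1 (fst p) * F2 (snd p) * F3 (fst p + snd p)) * \<phi> p) \<le> L * (C * \<bar>lam\<bar> powr (- e)) * sqrt (nsq F1 * nsq F2 * nsq F3)"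
          unfolding L_def
        proof (rule bfun_cutoff_bound[OF Tm F \<psi> \<phi>\<psi>])
          show "0 \<le> C * \<bar>lam\<bar> powr (- e)" using C by simp
          fix h1 h2 :: "real \<Rightarrow> complex" assume h: "bfun h1" "bfun h2"
          show "norm (trif T (clip (- R) R h1) (clip (- R) R h2) F3) \<le> C * \<bar>lam\<bar> powr (- e) * sqrt (nsq h1 * nsq h2 * nsq F3)"
            unfolding T_def by (rule est[rule_format, OF lam h F(3)])
        qed (use supp in blast)
        have 2: "L * (C * \<bar>lam\<bar> powr (- e)) * sqrt (nsq F1 * nsq F2 * nsq F3) \<le> B * sqrt (nsq F1 * nsq F2 * nsq F3)"
          unfolding B_def mult.assoc[symmetric] by (intro mult_right_mono) (auto simp: D_def nsq_nonneg)
        show "norm (LINT p|lborel. cis (T p) * (F1 (fst p) * F2 (snd p) * F3 (fst p + snd p)) * \<phi> p) \<le> B * sqrt (nsq F1 * nsq F2 * nsq F3)" by (rule order_trans[OF 1 2])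
      qed
      ultimately show "norm (trilinear_form S \<phi> lam f1 f2 f3) \<le> D * \<bar>lam\<bar> powr (- e) * L2_norm f1 * L2_norm f2 * L2_norm f3"
        unfolding g1(4) g2(4) g3(4) B_def by (simp add: real_sqrt_mult mult.assoc)
    qed
  qed
qed

section \<open>Sharpness\<close>

lemma jet_rectangle_difference:
  assumes k: "jet U k" and sub: "\<And>\<xi> \<eta>. \<bar>\<xi>\<bar> \<le> \<bar>s\<bar> \<Longrightarrow> \<bar>\<eta>\<bar> \<le> \<bar>t\<bar> \<Longrightarrow> (\<xi>, \<eta>) \<in> U"
  shows "\<exists>\<xi> \<eta>. \<bar>\<xi>\<bar> \<le> \<bar>s\<bar> \<and> \<bar>\<eta>\<bar> \<le> \<bar>t\<bar> \<and> k 0 0 (s, t) - k 0 0 (s, 0) - k 0 0 (0, t) + k 0 0 (0, 0) = s * t * k 1 1 (\<xi>, \<eta>)"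
proof -
  have b: "\<bar>x\<bar> \<le> \<bar>r\<bar>" if "min 0 r \<le> x" "x \<le> max 0 r" for x r :: real using that by auto
  have "\<exists>\<xi>. min 0 s \<le> \<xi> \<and> \<xi> \<le> max 0 s \<and>
    (k 0 0 (s, t) - k 0 0 (s, 0)) - (k 0 0 (0, t) - k 0 0 (0, 0)) = (s - 0) * (k (Suc 0) 0 (\<xi>, t) - k (Suc 0) 0 (\<xi>, 0))"
    by (rule MVT_between) (intro DERIV_diff jet_dx[OF k] sub; auto dest: b)
  then obtain \<xi> where \<xi>: "min 0 s \<le> \<xi>" "\<xi> \<le> max 0 s"
    and 1: "(k 0 0 (s, t) - k 0 0 (s, 0)) - (k 0 0 (0, t) - k 0 0 (0, 0)) = s * (k (Suc 0) 0 (\<xi>, t) - k (Suc 0) 0 (\<xi>, 0))" by auto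
  have "\<exists>\<eta>. min 0 t \<le> \<eta> \<and> \<eta> \<le> max 0 t \<and> k (Suc 0) 0 (\<xi>, t) - k (Suc 0) 0 (\<xi>, 0) = (t - 0) * k (Suc 0) (Suc 0) (\<xi>, \<eta>)"
    by (rule MVT_between) (intro jet_dy[OF k] sub; auto dest: b simp: b[OF \<xi>])
  then obtain \<eta> where \<eta>: "min 0 t \<le> \<eta>" "\<eta> \<le> max 0 t" and 2: "k (Suc 0) 0 (\<xi>, t) - k (Suc 0) 0 (\<xi>, 0) = t * k (Suc 0) (Suc 0) (\<xi>, \<eta>)" by auto
  show ?thesis using b[OF \<xi>] b[OF \<eta>] 1 unfolding 2 by (intro exI[of _ \<xi>] exI[of _ \<eta>]) (simp add: algebra_simps)
qed

text \<open>Integrate \<open>(\<partial>\<^sub>x - \<partial>\<^sub>y)S\<close>, whose mixed derivative is \<open>O(\<delta>\<^sup>d)\<close>, along the antidiagonals.\<close>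

lemma degenerate_approximation:
  assumes g: "jet U g" and U0: "(0, 0) \<in> U" and van: "vanishes d (hjet g)"
  shows "\<exists>A>0. \<exists>\<rho>>0. \<exists>a b c. continuous_on {-\<rho>..\<rho>} a \<and> continuous_on {-\<rho>..\<rho>} b \<and> continuous_on {-\<rho>..\<rho>} c \<and>
    (\<forall>\<delta> x y. 0 < \<delta> \<longrightarrow> 2 * \<delta> \<le> \<rho> \<longrightarrow> \<bar>x\<bar> \<le> \<delta> \<longrightarrow> \<bar>y\<bar> \<le> \<delta> \<longrightarrow> (x, y) \<in> U \<and> \<bar>g 0 0 (x, y) - a x + b y - c (x + y)\<bar> \<le> A * \<delta> ^ (d + 3))"
proof -
  obtain A0 r0 where A0: "A0 > 0" "r0 > 0" and bd: "\<forall>r P i j. 0 < r \<longrightarrow> r < r0 \<longrightarrow> dist P (0, 0) \<le> 1 \<longrightarrow> i + j \<le> d + 4 \<longrightarrow>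
     r *\<^sub>R P \<in> U \<and> r ^ (i + j) * \<bar>hjet g i j (r *\<^sub>R P)\<bar> \<le> A0 * r ^ d"
    using order_derivative_bound[OF jet_hjet[OF g] U0 van, of "(0, 0)"] by (elim exE conjE)
  have near: "(x, y) \<in> U \<and> \<bar>hjet g 0 0 (x, y)\<bar> \<le> A0 * r ^ d" if r: "0 < r" "r < r0" and xy: "\<bar>x\<bar> + \<bar>y\<bar> \<le> r" for x y r
  proof -
    have "norm (x, y) \<le> r" using xy sqrt_sum_squares_le_sum_abs[of x y] by (simp add: norm_prod_def)
    then have "norm ((1 / r) *\<^sub>R (x, y)) \<le> 1" using r by (simp only: norm_scaleR) (simp add: field_simps)
    then have "dist ((1 / r) *\<^sub>R (x, y)) (0, 0) \<le> 1" by (simp add: dist_norm)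
    from bd[rule_format, OF r this, of 0 0] show ?thesis using r by simp
  qed
  \<comment> \<open>With 2 \<delta> \<le> \<rho> all points met on the antidiagonals lie within 8
    \<delta> < r0 of the origin in the sum norm.\<close>
  define \<rho> where "\<rho> = r0 / 8"
  have \<rho>: "\<rho> > 0" using A0 by (simp add: \<rho>_def)
  have inU: "(x, y) \<in> U" if "\<bar>x\<bar> + \<bar>y\<bar> < 8 * \<rho>" for x y
    using near[of "(\<bar>x\<bar> + \<bar>y\<bar> + 8 * \<rho>) / 2" x y] that \<rho> by (simp add: \<rho>_def)
  define k where "k i j p = g (Suc i) j p - g i (Suc j) p" for i j p
  have jk: "jet U k" using jet_shift_diff[OF g, of 1 1 0 "-1" 0 1] by (simp add: k_def[abs_def])
  have k11: "k 1 1 p = hjet g 0 0 p" for p by (simp add: k_def hjet_def numeral_2_eq_2)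
  have ck: "continuous_on {-(2 * \<rho>)..2 * \<rho>} (\<lambda>s. k 0 0 (s, 0))" "continuous_on {-(2 * \<rho>)..2 * \<rho>} (\<lambda>s. k 0 0 (0, s) - k 0 0 (0, 0))"
    by (intro continuous_intros continuous_on_compose2[OF jet_cont[OF jk]]; use \<rho> in \<open>auto intro!: inU\<close>)+
  \<comment> \<open>\<open>a\<close> and \<open>b\<close> are primitives of the two one-variable
    parts of \<open>k\<close>, which stands for (\<partial>x - \<partial>y) g. What they leave of
    \<open>k\<close> is a rectangle difference with one corner at the origin.\<close>
  obtain a where a: "\<And>x. x \<in> {-(2 * \<rho>)..2 * \<rho>} \<Longrightarrow> (a has_vector_derivative k 0 0 (x, 0)) (at x within {-(2 * \<rho>)..2 * \<rho>})"
    using antiderivative_continuous[OF ck(1)] by blast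
  obtain b where b: "\<And>x. x \<in> {-(2 * \<rho>)..2 * \<rho>} \<Longrightarrow> (b has_vector_derivative k 0 0 (0, x) - k 0 0 (0, 0)) (at x within {-(2 * \<rho>)..2 * \<rho>})"
    using antiderivative_continuous[OF ck(2)] by blast
  \<comment> \<open>\<open>c\<close> makes the error vanish at x = 0 on every antidiagonal.
    Elsewhere the error is thus x times the derivative along the antidiagonal at an intermediate
    point.\<close>
  define c where "c u = g 0 0 (0, u) - a 0 + b u" for u
  have nb: "at x within {-(2 * \<rho>)..2 * \<rho>} = at x" if "\<bar>x\<bar> < 2 * \<rho>" for x
    by (rule at_within_interior) (use that in auto)
  have inI: "x \<in> {-(2 * \<rho>)..2 * \<rho>}" if "\<bar>x\<bar> < 2 * \<rho>" for x using that by auto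
  have da: "(a has_real_derivative k 0 0 (x, 0)) (at x)" if "\<bar>x\<bar> < 2 * \<rho>" for x
    using a[OF inI[OF that]] unfolding nb[OF that] has_real_derivative_iff_has_vector_derivative .
  have db: "(b has_real_derivative k 0 0 (0, x) - k 0 0 (0, 0)) (at x)" if "\<bar>x\<bar> < 2 * \<rho>" for x
    using b[OF inI[OF that]] unfolding nb[OF that] has_real_derivative_iff_has_vector_derivative .
  have ca: "continuous_on {-\<rho>..\<rho>} a" and cb: "continuous_on {-\<rho>..\<rho>} b"
    using \<rho> by (auto intro!: continuous_at_imp_continuous_on DERIV_isCont[OF da] DERIV_isCont[OF db])
  have cc: "continuous_on {-\<rho>..\<rho>} c" unfolding c_def
    by (intro continuous_intros cb continuous_on_compose2[OF jet_cont[OF g]]; use \<rho> in \<open>auto intro!: inU\<close>)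
  define A where "A = 3 * 8 ^ d * A0"
  have A: "A > 0" using A0 by (simp add: A_def)
  have main: "(x, y) \<in> U \<and> \<bar>g 0 0 (x, y) - a x + b y - c (x + y)\<bar> \<le> A * \<delta> ^ (d + 3)"
    if \<delta>: "0 < \<delta>" "2 * \<delta> \<le> \<rho>" and xy: "\<bar>x\<bar> \<le> \<delta>" "\<bar>y\<bar> \<le> \<delta>" for \<delta> x y
  proof -
    define u where "u = x + y"
    define E where "E s = k 0 0 (s, u - s) - k 0 0 (s, 0) - k 0 0 (0, u - s) + k 0 0 (0, 0)" for s
    have s3: "\<bar>s\<bar> \<le> \<delta> \<and> \<bar>u - s\<bar> \<le> 3 * \<delta>" if "min 0 x \<le> s" "s \<le> max 0 x" for s
      using that xy by (auto simp: u_def)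
    have d1: "((\<lambda>s. g 0 0 (s, u - s)) has_real_derivative k 0 0 (s, u - s)) (at s)" if "\<bar>s\<bar> \<le> \<delta> \<and> \<bar>u - s\<bar> \<le> 3 * \<delta>" for s
    proof -
      have "(s, u - s) \<in> U" using that \<delta> \<rho> by (intro inU) linarith
      then show ?thesis using jet_line[OF g, of "(0, u)" s "(1, -1)" 0 0] by (simp add: k_def dird_def)
    qed
    have d2: "((\<lambda>s. b (u - s)) has_real_derivative - (k 0 0 (0, u - s) - k 0 0 (0, 0))) (at s)" if "\<bar>s\<bar> \<le> \<delta> \<and> \<bar>u - s\<bar> \<le> 3 * \<delta>" for s
    proof -
      have 1: "(b has_real_derivative k 0 0 (0, u - s) - k 0 0 (0, 0)) (at (u - s))" using that \<delta> \<rho> by (intro db) linarith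
      have 2: "((\<lambda>s. u - s) has_real_derivative -1) (at s)" by (auto intro!: derivative_eq_intros)
      show ?thesis using DERIV_chain2[where f = b and g = "\<lambda>s. u - s", OF 1 2] by simp
    qed
    have "\<exists>\<xi>. min 0 x \<le> \<xi> \<and> \<xi> \<le> max 0 x \<and>
      (g 0 0 (x, u - x) - a x + b (u - x)) - (g 0 0 (0, u - 0) - a 0 + b (u - 0)) = (x - 0) * (k 0 0 (\<xi>, u - \<xi>) - k 0 0 (\<xi>, 0) + - (k 0 0 (0, u - \<xi>) - k 0 0 (0, 0)))"
    proof (rule MVT_between)
      fix s assume "min 0 x \<le> s" "s \<le> max 0 x"
      from s3[OF this] have s: "\<bar>s\<bar> \<le> \<delta> \<and> \<bar>u - s\<bar> \<le> 3 * \<delta>" .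
      have "\<bar>s\<bar> < 2 * \<rho>" using s \<delta> \<rho> by linarith
      then show "((\<lambda>s. g 0 0 (s, u - s) - a s + b (u - s)) has_real_derivative
          k 0 0 (s, u - s) - k 0 0 (s, 0) + - (k 0 0 (0, u - s) - k 0 0 (0, 0))) (at s)"
        by (intro DERIV_add DERIV_diff d1[OF s] d2[OF s] da)
    qed
    then obtain \<xi> where \<xi>: "min 0 x \<le> \<xi>" "\<xi> \<le> max 0 x" and R: "g 0 0 (x, y) - a x + b y - c (x + y) = x * E \<xi>"
      by (auto simp: u_def c_def E_def algebra_simps)
    note \<xi>3 = s3[OF \<xi>]
    have rect: "\<bar>\<xi>'\<bar> + \<bar>\<eta>\<bar> \<le> 8 * \<delta>" if "\<bar>\<xi>'\<bar> \<le> \<bar>\<xi>\<bar>" "\<bar>\<eta>\<bar> \<le> \<bar>u - \<xi>\<bar>" for \<xi>' \<eta>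
      using that \<xi>3 \<delta> by linarith
    have \<delta>r: "0 < 8 * \<delta>" "8 * \<delta> < r0" using \<delta> \<rho> by (simp_all add: \<rho>_def)
    have "\<exists>\<xi>' \<eta>. \<bar>\<xi>'\<bar> \<le> \<bar>\<xi>\<bar> \<and> \<bar>\<eta>\<bar> \<le> \<bar>u - \<xi>\<bar> \<and> E \<xi> = \<xi> * (u - \<xi>) * k 1 1 (\<xi>', \<eta>)"
      unfolding E_def by (rule jet_rectangle_difference[OF jk]) (use near[OF \<delta>r rect] in blast)
    then obtain \<xi>' \<eta> where \<eta>: "\<bar>\<xi>'\<bar> \<le> \<bar>\<xi>\<bar>" "\<bar>\<eta>\<bar> \<le> \<bar>u - \<xi>\<bar>" and E: "E \<xi> = \<xi> * (u - \<xi>) * hjet g 0 0 (\<xi>', \<eta>)" unfolding k11 by blast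
    have H: "\<bar>hjet g 0 0 (\<xi>', \<eta>)\<bar> \<le> A0 * (8 * \<delta>) ^ d" using near[OF \<delta>r rect[OF \<eta>]] by blast
    \<comment> \<open>Three factors of order \<delta> come from x and from the two sides of the
      rectangle, and \<delta>^d comes from H.\<close>
    have "\<bar>x\<bar> * (\<bar>\<xi>\<bar> * \<bar>u - \<xi>\<bar> * \<bar>hjet g 0 0 (\<xi>', \<eta>)\<bar>) \<le> \<delta> * (\<delta> * (3 * \<delta>) * (A0 * (8 * \<delta>) ^ d))"
      using xy \<xi>3 H \<delta> by (intro mult_mono) auto
    then have "\<bar>x * E \<xi>\<bar> \<le> \<delta> * (\<delta> * (3 * \<delta>) * (A0 * (8 * \<delta>) ^ d))" unfolding E abs_mult .
    moreover have "\<delta> * (\<delta> * (3 * \<delta>) * (A0 * (8 * \<delta>) ^ d)) = A * \<delta> ^ (d + 3)"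
      by (simp add: A_def power_add power_mult_distrib power3_eq_cube)
    moreover have "(x, y) \<in> U" using xy \<delta> \<rho> by (intro inU) linarith
    ultimately show ?thesis unfolding R by simp
  qed
  show ?thesis
    by (rule exI[of _ A], rule conjI[OF A], rule exI[of _ \<rho>], rule conjI[OF \<rho>], rule exI[of _ a], rule exI[of _ b], rule exI[of _ c])
      (intro conjI ca cb cc allI impI; use main in blast)
qed

lemma norm_cis_minus_one_le: "norm (cis t - 1) \<le> \<bar>t\<bar>"
proof -
  have "(norm (cis t - 1))\<^sup>2 = 2 - 2 * cos t"
    unfolding cmod_power2 using sin_cos_squared_add[of t] by (simp add: power2_diff)
  also have "\<dots> = (2 * sin (t / 2))\<^sup>2" using cos_double_sin[of "t / 2"] by (simp add: power_mult_distrib)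
  also have "\<dots> \<le> t\<^sup>2" using abs_sin_x_le_abs_x[of "t / 2"] by (intro abs_le_square_iff[THEN iffD1]) (simp add: abs_mult)
  finally show ?thesis using abs_le_square_iff[of "norm (cis t - 1)" t] by simp
qed

lemma bfun_L2:
  assumes "bfun f" shows "L2_fun f" "L2_norm f = sqrt (nsq f)"
proof -
  note [measurable] = bfun_measurable[OF assms]
  have 1: "f \<in> borel_measurable lebesgue" by (intro measurable_completion) simp
  have m: "(\<lambda>x. (norm (f x))\<^sup>2) \<in> borel_measurable lborel" by simp
  show "L2_fun f" "L2_norm f = sqrt (nsq f)"
    using 1 integrable_completion[OF m] integral_completion[OF m] bfun_nsq_integrable[OF assms]
    by (simp_all add: L2_fun_def L2_norm_def nsq_def)
qed

lemma modulated_indicator: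
  fixes h :: "real \<Rightarrow> real"
  assumes h: "continuous_on {-\<rho>..\<rho>} h" and m: "0 \<le> m" "m \<le> \<rho>"
  defines "f \<equiv> \<lambda>x. if \<bar>x\<bar> \<le> m then cis (h x) else 0"
  shows "bfun f" "nsq f = 2 * m"
proof -
  define h' where "h' x = indicator {-\<rho>..\<rho>} x *\<^sub>R h x" for x
  have [measurable]: "h' \<in> borel_measurable borel"
    unfolding h'_def[abs_def] by (rule borel_measurable_continuous_on_indicator[OF _ h]) simp
  have f: "f = (\<lambda>x. if \<bar>x\<bar> \<le> m then cis (h' x) else 0)" using m by (intro ext) (auto simp: f_def h'_def indicator_def abs_le_iff)
  note [measurable] = cis_borel_measurable
  show "bfun f"
    by (rule bfunI[where B = 1 and R = m]) (auto simp: f_def, simp add: f[unfolded f_def])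
  have "nsq f = (LINT x|lborel. indicator {-m..m} x)"
    unfolding nsq_def by (rule Bochner_Integration.integral_cong) (auto simp: f_def indicator_def)
  then show "nsq f = 2 * m" using m by simp
qed

text \<open>On the square the integrand is \<open>cis \<theta>\<close> times \<phi> with |\<theta>|
  \<le> 1/4, and \<phi> is within |z| / 8 of z. Its distance from z is at most (1/4)(9/8)|z| + |z|/8
  < |z|/2, so at least half of the mass 4 \<delta>^2 |z| survives. \<open>f3\<close> has twice the
  range because it is evaluated at x + y.\<close>

lemma modulated_lower_bound:
  assumes S: "S \<in> borel_measurable borel" and \<phi>: "\<phi> \<in> borel_measurable borel" and \<delta>: "\<delta> > 0"
    and abc: "continuous_on {-\<rho>..\<rho>} a" "continuous_on {-\<rho>..\<rho>} b" "continuous_on {-\<rho>..\<rho>} c" and \<rho>: "2 * \<delta> \<le> \<rho>"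
    and R: "\<forall>x y. \<bar>x\<bar> \<le> \<delta> \<longrightarrow> \<bar>y\<bar> \<le> \<delta> \<longrightarrow> \<bar>lam * (S (x, y) - a x + b y - c (x + y))\<bar> \<le> 1 / 4"
    and \<phi>c: "\<forall>x y. \<bar>x\<bar> \<le> \<delta> \<longrightarrow> \<bar>y\<bar> \<le> \<delta> \<longrightarrow> norm (\<phi> (x, y) - z) \<le> norm z / 8"
    and f1_def: "f1 = (\<lambda>x. if \<bar>x\<bar> \<le> \<delta> then cis (- lam * a x) else 0)" and f2_def: "f2 = (\<lambda>x. if \<bar>x\<bar> \<le> \<delta> then cis (lam * b x) else 0)"
    and f3_def: "f3 = (\<lambda>x. if \<bar>x\<bar> \<le> 2 * \<delta> then cis (- lam * c x) else 0)"
  shows "2 * \<delta>\<^sup>2 * norm z \<le> norm (LINT p|lborel. cis (lam * S p) * (f1 (fst p) * f2 (snd p) * f3 (fst p + snd p)) * \<phi> p)"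
    "bfun f1" "bfun f2" "bfun f3" "nsq f1 = 2 * \<delta>" "nsq f2 = 2 * \<delta>" "nsq f3 = 4 * \<delta>"
proof -
  have c: "continuous_on {-\<rho>..\<rho>} (\<lambda>x. - lam * a x)" "continuous_on {-\<rho>..\<rho>} (\<lambda>x. lam * b x)" "continuous_on {-\<rho>..\<rho>} (\<lambda>x. - lam * c x)"
    by (intro continuous_intros abc)+
  show f: "bfun f1" "bfun f2" "bfun f3" unfolding f1_def f2_def f3_def
    using \<delta> \<rho> by (auto intro!: modulated_indicator(1)[OF c(1)] modulated_indicator(1)[OF c(2)] modulated_indicator(1)[OF c(3)] simp del: mult_minus_left)
  show "nsq f1 = 2 * \<delta>" "nsq f2 = 2 * \<delta>" "nsq f3 = 4 * \<delta>" unfolding f1_def f2_def f3_def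
    using \<delta> \<rho> modulated_indicator(2)[OF c(1), of \<delta>] modulated_indicator(2)[OF c(2), of \<delta>] modulated_indicator(2)[OF c(3), of "2 * \<delta>"] by simp_all
  define W where "W p = cis (lam * S p) * (f1 (fst p) * f2 (snd p) * f3 (fst p + snd p)) * \<phi> p" for p
  define I where "I p = indicator {-\<delta>..\<delta>} (fst p) * (indicator {-\<delta>..\<delta>} (snd p) :: real)" for p
  have "bfun (indicator {-\<delta>..\<delta>} :: real \<Rightarrow> real)"
    by (rule bfunI[where B = 1 and R = \<delta>]) (auto simp: indicator_def)
  then have bI: "bfun I" unfolding I_def by (intro bfun_tensor)
  have II: "(LINT p|lborel. I p) = 4 * \<delta>\<^sup>2"
    unfolding bfun_Fubini(1)[OF bI] using \<delta> by (simp add: I_def power2_eq_square)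
  have Wm: "W \<in> borel_measurable lborel"
  proof -
    note [measurable] = bfun_measurable[OF f(1)] bfun_measurable[OF f(2)] bfun_measurable[OF f(3)] S[unfolded borel_prod[symmetric]] \<phi>[unfolded borel_prod[symmetric]] cis_borel_measurable
    show ?thesis unfolding measurable_lborel2 borel_prod[symmetric] W_def[abs_def] by measurable
  qed
  have close: "norm (W p - of_real (I p) * z) \<le> I p * (norm z / 2)" for p
  proof (cases "\<bar>fst p\<bar> \<le> \<delta> \<and> \<bar>snd p\<bar> \<le> \<delta>")
    case True
    obtain x y where p: "p = (x, y)" by fastforce
    have xy: "\<bar>x\<bar> \<le> \<delta>" "\<bar>y\<bar> \<le> \<delta>" using True by (auto simp: p)
    define \<theta> where "\<theta> = lam * (S (x, y) - a x + b y - c (x + y))"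
    have \<theta>: "\<bar>\<theta>\<bar> \<le> 1 / 4" unfolding \<theta>_def by (rule R[rule_format, OF xy])
    have "cis (lam * S p) * (f1 (fst p) * f2 (snd p) * f3 (fst p + snd p)) = cis \<theta>"
      using xy by (simp add: p f1_def f2_def f3_def cis_mult \<theta>_def algebra_simps)
    then have W: "W p = cis \<theta> * \<phi> p" by (simp add: W_def)
    have I: "I p = 1" using xy by (simp add: I_def p abs_le_iff indicator_def)
    have 1: "norm (\<phi> p - z) \<le> norm z / 8" unfolding p by (rule \<phi>c[rule_format, OF xy])
    have 2: "norm (\<phi> p) \<le> norm z * (9 / 8)" using 1 norm_triangle_sub[of "\<phi> p" z] by simp
    have "norm (cis \<theta> - 1) * norm (\<phi> p) \<le> 1 / 4 * (norm z * (9 / 8))"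
      using norm_cis_minus_one_le[of \<theta>] \<theta> 2 by (intro mult_mono) auto
    then have 3: "norm ((cis \<theta> - 1) * \<phi> p) \<le> 1 / 4 * (norm z * (9 / 8))" by (simp only: norm_mult)
    have 4: "W p - of_real (I p) * z = (cis \<theta> - 1) * \<phi> p + (\<phi> p - z)" by (simp add: W I algebra_simps)
    show ?thesis unfolding 4 using norm_triangle_ineq[of "(cis \<theta> - 1) * \<phi> p" "\<phi> p - z"] 1 3 norm_ge_zero[of z] unfolding I by linarith
  next
    case False
    then have "W p = 0" "I p = 0" by (auto simp: W_def f1_def f2_def I_def indicator_def abs_le_iff)
    then show ?thesis by simp
  qed
  have iI: "integrable lborel I" by (rule bfun_integrable[OF bI])
  have i1: "integrable lborel (\<lambda>p. of_real (I p) * z)" using iI by simp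
  have i2: "integrable lborel (\<lambda>p. I p * (norm z / 2))" using iI by simp
  have m: "(\<lambda>p. W p - of_real (I p) * z) \<in> borel_measurable lborel" using Wm i1 by measurable
  have "integrable lborel (\<lambda>p. W p - of_real (I p) * z)"
  proof (rule Bochner_Integration.integrable_bound[OF i2 m], rule AE_I2)
    fix p show "norm (W p - of_real (I p) * z) \<le> norm (I p * (norm z / 2))" using close[of p] by simp
  qed
  note i3 = this
  have i4: "integrable lborel W" using Bochner_Integration.integrable_add[OF i3 i1] by simp
  have "norm (LINT p|lborel. (W p - of_real (I p) * z)) \<le> (LINT p|lborel. I p * (norm z / 2))"
    by (rule order_trans[OF integral_norm_bound integral_mono[OF integrable_norm[OF i3] i2 close]])
  moreover have "(LINT p|lborel. (W p - of_real (I p) * z)) = (LINT p|lborel. W p) - of_real (4 * \<delta>\<^sup>2) * z"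
    using i4 i1 by (simp add: II)
  moreover have "(LINT p|lborel. I p * (norm z / 2)) = 2 * \<delta>\<^sup>2 * norm z" by (simp add: II)
  ultimately have "norm ((LINT p|lborel. W p) - of_real (4 * \<delta>\<^sup>2) * z) \<le> 2 * \<delta>\<^sup>2 * norm z" by (simp only:)
  moreover have "norm (of_real (4 * \<delta>\<^sup>2) * z :: complex) = 4 * \<delta>\<^sup>2 * norm z" by (simp add: norm_mult norm_power)
  moreover have "norm (of_real (4 * \<delta>\<^sup>2) * z) \<le> norm (LINT p|lborel. W p) + norm ((LINT p|lborel. W p) - of_real (4 * \<delta>\<^sup>2) * z)"
    using norm_triangle_sub[of "of_real (4 * \<delta>\<^sup>2) * z" "LINT p|lborel. W p"] by (simp only: norm_minus_commute)
  ultimately have "4 * \<delta>\<^sup>2 * norm z \<le> norm (LINT p|lborel. W p) + 2 * \<delta>\<^sup>2 * norm z" by linarith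
  then show "2 * \<delta>\<^sup>2 * norm z \<le> norm (LINT p|lborel. cis (lam * S p) * (f1 (fst p) * f2 (snd p) * f3 (fst p + snd p)) * \<phi> p)"
    unfolding W_def by linarith
qed

text \<open>The test functions give a form of size \<delta>^2 against norms with product of size
  \<delta>^(3/2). At |\<lambda>| = 1 / (4 A \<delta>^(d+3)) the assumed bound would force
  \<delta>^(1/2) to be at most a multiple of |\<lambda>|^(-\<epsilon>), which has size \<delta>^(1/2
  + \<gamma>) with \<gamma> > 0. This fails for small \<delta>.\<close>

lemma trilinear_decay_sharp:
  assumes g: "jet U g" and U0: "(0, 0) \<in> U" and van: "vanishes d (hjet g)" and S: "\<And>p. p \<in> U \<Longrightarrow> S p = g 0 0 p"
    and \<phi>: "continuous_on UNIV \<phi>" and supp: "\<And>p. \<phi> p \<noteq> 0 \<Longrightarrow> p \<in> U" and nz: "\<phi> (0, 0) \<noteq> 0"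
    and \<epsilon>: "\<epsilon> > 1 / (2 * (3 + real d))"
  shows "\<not> (\<exists>C. \<forall>lam f1 f2 f3. \<bar>lam\<bar> \<ge> 1 \<longrightarrow> L2_fun f1 \<longrightarrow> L2_fun f2 \<longrightarrow> L2_fun f3 \<longrightarrow>
                 norm (trilinear_form S \<phi> lam f1 f2 f3)
                   \<le> C * \<bar>lam\<bar> powr (- \<epsilon>) * L2_norm f1 * L2_norm f2 * L2_norm f3)"
proof
  assume "\<exists>C. \<forall>lam f1 f2 f3. \<bar>lam\<bar> \<ge> 1 \<longrightarrow> L2_fun f1 \<longrightarrow> L2_fun f2 \<longrightarrow> L2_fun f3 \<longrightarrow>
                 norm (trilinear_form S \<phi> lam f1 f2 f3) \<le> C * \<bar>lam\<bar> powr (- \<epsilon>) * L2_norm f1 * L2_norm f2 * L2_norm f3"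
  then obtain C where C: "\<And>lam f1 f2 f3. \<bar>lam\<bar> \<ge> 1 \<Longrightarrow> L2_fun f1 \<Longrightarrow> L2_fun f2 \<Longrightarrow> L2_fun f3 \<Longrightarrow>
                 norm (trilinear_form S \<phi> lam f1 f2 f3) \<le> C * \<bar>lam\<bar> powr (- \<epsilon>) * L2_norm f1 * L2_norm f2 * L2_norm f3" by blast
  define S' where "S' p = (if p \<in> U then g 0 0 p else 0)" for p
  have Sm: "S' \<in> borel_measurable borel"
  proof -
    have "S' = (\<lambda>p. indicator U p *\<^sub>R g 0 0 p)" by (auto simp: S'_def indicator_def)
    then show ?thesis
      using borel_measurable_continuous_on_indicator[OF borel_open[OF jet_open[OF g]] jet_cont[OF g, of 0 0]] by simp
  qed
  have \<phi>m: "\<phi> \<in> borel_measurable borel" by (rule borel_measurable_continuous_onI[OF \<phi>])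
  obtain A \<rho> a b c where A: "A > 0" and \<rho>: "\<rho> > 0" and abc: "continuous_on {-\<rho>..\<rho>} a" "continuous_on {-\<rho>..\<rho>} b" "continuous_on {-\<rho>..\<rho>} c"
    and R: "\<forall>\<delta> x y. 0 < \<delta> \<longrightarrow> 2 * \<delta> \<le> \<rho> \<longrightarrow> \<bar>x\<bar> \<le> \<delta> \<longrightarrow> \<bar>y\<bar> \<le> \<delta> \<longrightarrow> (x, y) \<in> U \<and> \<bar>g 0 0 (x, y) - a x + b y - c (x + y)\<bar> \<le> A * \<delta> ^ (d + 3)"
    using degenerate_approximation[OF g U0 van] by (elim exE conjE)
  define z where "z = \<phi> (0, 0)"
  have z: "norm z > 0" using nz by (simp add: z_def)
  obtain \<eta> where \<eta>: "\<eta> > 0" "\<And>p. dist p (0, 0) < \<eta> \<Longrightarrow> dist (\<phi> p) z < norm z / 8"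
    using \<phi> z unfolding continuous_on_iff z_def by (metis UNIV_I divide_pos_pos zero_less_numeral)
  define \<gamma> where "\<gamma> = (3 + real d) * \<epsilon> - 1 / 2"
  have \<gamma>: "\<gamma> > 0"
  proof -
    have "(3 + real d) * (1 / (2 * (3 + real d))) < (3 + real d) * \<epsilon>" using \<epsilon> by (intro mult_strict_left_mono) auto
    moreover have "(3 + real d) * (1 / (2 * (3 + real d))) = 1 / 2" by (simp add: field_simps)
    ultimately show ?thesis unfolding \<gamma>_def by linarith
  qed
  define M where "M = 2 * \<bar>C\<bar> * (4 * A) powr \<epsilon> + 1"
  have M: "M > 0" unfolding M_def by (intro add_nonneg_pos mult_nonneg_nonneg) auto
  \<comment> \<open>The terms ensure, in this order, validity of the approximation, near constancy
    of the cut-off, |\<lambda>| \<ge> 1 by means of the next two, and the final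
    contradiction.\<close>
  define \<delta> where "\<delta> = min (min (\<rho> / 2) (\<eta> / 3)) (min (min 1 (1 / (4 * A))) ((norm z / (2 * M)) powr (1 / \<gamma>)))"
  have \<delta>: "\<delta> > 0" using \<rho> \<eta> A z M by (simp add: \<delta>_def)
  have \<delta>le: "\<delta> \<le> \<rho> / 2" "\<delta> \<le> \<eta> / 3" "\<delta> \<le> 1" "\<delta> \<le> 1 / (4 * A)" "\<delta> \<le> (norm z / (2 * M)) powr (1 / \<gamma>)"
    by (simp_all only: \<delta>_def min_le_iff_disj order_refl simp_thms)
  define lam where "lam = 1 / (4 * A * \<delta> ^ (d + 3))"
  have lam0: "lam > 0" using A \<delta> by (simp add: lam_def)
  have lam1: "\<bar>lam\<bar> \<ge> 1"
  proof -
    have "4 * A * \<delta> ^ (d + 3) \<le> 4 * A * \<delta> ^ 1" using A \<delta> \<delta>le by (intro mult_left_mono power_decreasing) auto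
    also have "\<dots> \<le> 1" using \<delta>le(4) A by (simp add: field_simps)
    finally show ?thesis using A \<delta> by (simp add: lam_def)
  qed
  have R4: "\<forall>x y. \<bar>x\<bar> \<le> \<delta> \<longrightarrow> \<bar>y\<bar> \<le> \<delta> \<longrightarrow> \<bar>lam * (S' (x, y) - a x + b y - c (x + y))\<bar> \<le> 1 / 4"
  proof (intro allI impI)
    fix x y assume xy: "\<bar>x\<bar> \<le> \<delta>" "\<bar>y\<bar> \<le> \<delta>"
    have r: "(x, y) \<in> U" "\<bar>g 0 0 (x, y) - a x + b y - c (x + y)\<bar> \<le> A * \<delta> ^ (d + 3)"
      using R[rule_format, of \<delta> x y] \<delta> \<delta>le(1) xy by auto
    have "lam * \<bar>S' (x, y) - a x + b y - c (x + y)\<bar> \<le> lam * (A * \<delta> ^ (d + 3))"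
      using r lam0 by (intro mult_left_mono) (auto simp: S'_def)
    also have "\<dots> = 1 / 4" using A \<delta> by (simp add: lam_def)
    finally show "\<bar>lam * (S' (x, y) - a x + b y - c (x + y))\<bar> \<le> 1 / 4" using lam0 by (simp add: abs_mult)
  qed
  have \<phi>4: "\<forall>x y. \<bar>x\<bar> \<le> \<delta> \<longrightarrow> \<bar>y\<bar> \<le> \<delta> \<longrightarrow> norm (\<phi> (x, y) - z) \<le> norm z / 8"
  proof (intro allI impI)
    fix x y assume xy: "\<bar>x\<bar> \<le> \<delta>" "\<bar>y\<bar> \<le> \<delta>"
    have "dist (x, y) (0, 0) \<le> \<bar>x\<bar> + \<bar>y\<bar>" using sqrt_sum_squares_le_sum_abs[of x y] by (simp add: dist_prod_def dist_real_def)
    also have "\<dots> < \<eta>" using xy \<delta>le(2) \<eta>(1) by linarith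
    finally show "norm (\<phi> (x, y) - z) \<le> norm z / 8" using \<eta>(2)[of "(x, y)"] by (simp add: dist_norm)
  qed
  define f1 where "f1 = (\<lambda>x. if \<bar>x\<bar> \<le> \<delta> then cis (- lam * a x) else 0)"
  define f2 where "f2 = (\<lambda>x. if \<bar>x\<bar> \<le> \<delta> then cis (lam * b x) else 0)"
  define f3 where "f3 = (\<lambda>x. if \<bar>x\<bar> \<le> 2 * \<delta> then cis (- lam * c x) else 0)"
  have \<rho>2: "2 * \<delta> \<le> \<rho>" using \<delta>le(1) by simp
  note mlb = modulated_lower_bound[OF Sm \<phi>m \<delta> abc \<rho>2 R4 \<phi>4 f1_def f2_def f3_def]
  have tf: "trilinear_form S \<phi> lam f1 f2 f3 = (LINT p|lborel. cis (lam * S' p) * (f1 (fst p) * f2 (snd p) * f3 (fst p + snd p)) * \<phi> p)"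
    by (rule trilinear_form_borel[OF Sm _ \<phi>m bfun_measurable[OF mlb(2)] bfun_measurable[OF mlb(3)] bfun_measurable[OF mlb(4)]])
      (use supp S in \<open>auto simp: S'_def\<close>)
  define q where "q = sqrt \<delta>"
  have q: "q > 0" "\<delta> = q\<^sup>2" "\<delta> powr (1 / 2) = q" using \<delta> by (simp_all add: q_def powr_half_sqrt)
  have norms: "L2_norm f1 = sqrt 2 * q" "L2_norm f2 = sqrt 2 * q" "L2_norm f3 = 2 * q"
    unfolding bfun_L2(2)[OF mlb(2)] bfun_L2(2)[OF mlb(3)] bfun_L2(2)[OF mlb(4)] mlb(5) mlb(6) mlb(7) q_def by (simp_all add: real_sqrt_mult)
  have "2 * \<delta>\<^sup>2 * norm z \<le> C * \<bar>lam\<bar> powr (- \<epsilon>) * L2_norm f1 * L2_norm f2 * L2_norm f3"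
    using mlb(1) C[OF lam1 bfun_L2(1)[OF mlb(2)] bfun_L2(1)[OF mlb(3)] bfun_L2(1)[OF mlb(4)]] unfolding tf by linarith
  also have "\<dots> = C * \<bar>lam\<bar> powr (- \<epsilon>) * (4 * q ^ 3)"
    unfolding norms by (simp add: power3_eq_cube)
  also have "\<dots> \<le> \<bar>C\<bar> * \<bar>lam\<bar> powr (- \<epsilon>) * (4 * q ^ 3)" using q by (intro mult_right_mono) auto
  finally have "(2 * q ^ 3) * (q * norm z) \<le> (2 * q ^ 3) * (2 * \<bar>C\<bar> * \<bar>lam\<bar> powr (- \<epsilon>))"
    unfolding q(2) by (simp add: power2_eq_square power3_eq_cube mult_ac)
  then have main: "q * norm z \<le> 2 * \<bar>C\<bar> * \<bar>lam\<bar> powr (- \<epsilon>)" using q(1) by (simp only: mult_le_cancel_left_pos zero_less_power zero_less_mult_iff zero_less_numeral simp_thms)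
  have lp: "\<bar>lam\<bar> powr (- \<epsilon>) = (4 * A) powr \<epsilon> * (q * \<delta> powr \<gamma>)"
  proof -
    have "\<bar>lam\<bar> powr (- \<epsilon>) = (4 * A * \<delta> ^ (d + 3)) powr \<epsilon>"
      using A \<delta> by (simp add: lam_def powr_minus_divide powr_divide)
    also have "\<dots> = (4 * A) powr \<epsilon> * (\<delta> powr real (d + 3)) powr \<epsilon>"
      using A \<delta> powr_realpow[OF \<delta>, of "d + 3"] by (simp only: powr_mult)
    also have "(\<delta> powr real (d + 3)) powr \<epsilon> = \<delta> powr (1 / 2 + \<gamma>)"
      by (simp add: powr_powr \<gamma>_def add.commute)
    also have "\<dots> = q * \<delta> powr \<gamma>" unfolding powr_add q(3) ..
    finally show ?thesis .
  qed
  have "q * norm z \<le> q * (2 * \<bar>C\<bar> * (4 * A) powr \<epsilon> * \<delta> powr \<gamma>)" using main unfolding lp by (simp add: mult_ac)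
  then have "norm z \<le> 2 * \<bar>C\<bar> * (4 * A) powr \<epsilon> * \<delta> powr \<gamma>" using q(1) by simp
  also have "\<dots> \<le> M * \<delta> powr \<gamma>" unfolding M_def by (intro mult_right_mono) auto
  also have "\<dots> \<le> M * (norm z / (2 * M))"
  proof (rule mult_left_mono)
    have "\<delta> powr \<gamma> \<le> ((norm z / (2 * M)) powr (1 / \<gamma>)) powr \<gamma>" using \<delta>le(5) \<delta> \<gamma> by (intro powr_mono2) auto
    also have "\<dots> = norm z / (2 * M)" using \<gamma> z M by (simp add: powr_powr)
    finally show "\<delta> powr \<gamma> \<le> norm z / (2 * M)" .
  qed (use M in simp)
  also have "\<dots> = norm z / 2" using M by simp
  finally show False using z by simp
qed

theorem theorem1p4:
  fixes S H :: "real \<times> real \<Rightarrow> real" and U :: "(real \<times> real) set" and d :: nat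
  assumes "open U" and "(0, 0) \<in> U"
    and "smooth_on U S"
    and "H = partial_x (partial_y (\<lambda>p. partial_x S p - partial_y S p))"
    and "finite_type_at_origin H"
    and "d = order_at_origin H"
  shows "\<exists>V. open V \<and> (0, 0) \<in> V \<and> V \<subseteq> U \<and>
    (\<forall>\<phi>. test_function_on V \<phi> \<longrightarrow>
      (\<exists>C>0. \<forall>lam f1 f2 f3. lam \<noteq> 0 \<longrightarrow> L2_fun f1 \<longrightarrow> L2_fun f2 \<longrightarrow> L2_fun f3 \<longrightarrow>
         norm (trilinear_form S \<phi> lam f1 f2 f3)
           \<le> C * \<bar>lam\<bar> powr (- (1 / (2 * (3 + real d)))) * L2_norm f1 * L2_norm f2 * L2_norm f3) \<and>
      (\<phi> (0, 0) \<noteq> 0 \<longrightarrow>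
         (\<forall>\<epsilon> > 1 / (2 * (3 + real d)).
            \<not> (\<exists>C. \<forall>lam f1 f2 f3. \<bar>lam\<bar> \<ge> 1 \<longrightarrow> L2_fun f1 \<longrightarrow> L2_fun f2 \<longrightarrow> L2_fun f3 \<longrightarrow>
                 norm (trilinear_form S \<phi> lam f1 f2 f3)
                   \<le> C * \<bar>lam\<bar> powr (- \<epsilon>) * L2_norm f1 * L2_norm f2 * L2_norm f3))))"
proof -
  define g where "g i j = (partial_x ^^ i) ((partial_y ^^ j) S)" for i j
  have g: "jet U g" unfolding g_def[abs_def] by (rule smooth_on_imp_jet[OF assms(1,3)])
  have S: "S p = g 0 0 p" for p by (simp add: g_def)
  have gx: "partial_x S p = g (Suc 0) 0 p" if "p \<in> U" for p by (simp add: g_def)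
  have gy: "partial_y S p = g 0 (Suc 0) p" if "p \<in> U" for p by (simp add: g_def)
  \<comment> \<open>The jet of \<partial>x S - \<partial>y S. It agrees with the function inside the
    definition of \<open>H\<close> only on \<open>U\<close>, so the derivatives of \<open>H\<close>
    at the origin are read off through \<open>jet_partial_funpow\<close>.\<close>
  define k where "k i j p = g (Suc i) j p - g i (Suc j) p" for i j p
  have jk: "jet U k" using jet_shift_diff[OF g, of 1 1 0 "-1" 0 1] by (simp add: k_def[abs_def])
  have ks: "k (a + 1) (b + 1) p = hjet g a b p" for a b p by (simp add: k_def hjet_def numeral_2_eq_2)
  have D: "partial_x S p - partial_y S p = k 0 0 p" if "p \<in> U" for p by (simp add: k_def gx[OF that] gy[OF that])
  have Hk: "H p = k 1 1 p" if p: "p \<in> U" for p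
    unfolding assms(4) using jet_partial_funpow[OF jk D p, of 1 1] by simp
  have H: "(partial_x ^^ \<alpha>) ((partial_y ^^ \<beta>) H) (0, 0) = hjet g \<alpha> \<beta> (0, 0)" for \<alpha> \<beta>
    unfolding ks[symmetric] by (rule jet_partial_funpow[OF jk Hk assms(2)])
  have ex: "\<exists>n \<alpha> \<beta>. n = \<alpha> + \<beta> \<and> hjet g \<alpha> \<beta> (0, 0) \<noteq> 0" using assms(5) unfolding finite_type_at_origin_def H by blast
  have d: "d = (LEAST n. \<exists>\<alpha> \<beta>. n = \<alpha> + \<beta> \<and> hjet g \<alpha> \<beta> (0, 0) \<noteq> 0)" unfolding assms(6) order_at_origin_def H ..
  have nv: "\<exists>i j. i + j = d \<and> hjet g i j (0, 0) \<noteq> 0" using LeastI_ex[OF ex] unfolding d[symmetric] by metis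
  have van: "vanishes d (hjet g)" unfolding vanishes_def
  proof (intro allI impI)
    fix i j assume "i + j < d"
    from not_less_Least[OF this[unfolded d]] show "hjet g i j (0, 0) = 0" by blast
  qed
  obtain R where R: "R > 0" and decay: "\<forall>\<phi>. test_function_on (U \<inter> {p. \<bar>fst p\<bar> < R \<and> \<bar>snd p\<bar> < R}) \<phi> \<longrightarrow>
      (\<exists>C>0. \<forall>lam f1 f2 f3. lam \<noteq> 0 \<longrightarrow> L2_fun f1 \<longrightarrow> L2_fun f2 \<longrightarrow> L2_fun f3 \<longrightarrow>
         norm (trilinear_form S \<phi> lam f1 f2 f3)
           \<le> C * \<bar>lam\<bar> powr (- (1 / (2 * (3 + real d)))) * L2_norm f1 * L2_norm f2 * L2_norm f3)"
    using trilinear_decay[OF g assms(2) van nv S] by (elim exE conjE)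
  define V where "V = U \<inter> {p. \<bar>fst p\<bar> < R \<and> \<bar>snd p\<bar> < R}"
  have oV: "open V" unfolding V_def by (intro open_Int assms(1) open_Collect_conj open_Collect_less continuous_intros)
  have sharp: "\<not> (\<exists>C. \<forall>lam f1 f2 f3. \<bar>lam\<bar> \<ge> 1 \<longrightarrow> L2_fun f1 \<longrightarrow> L2_fun f2 \<longrightarrow> L2_fun f3 \<longrightarrow>
       norm (trilinear_form S \<phi> lam f1 f2 f3) \<le> C * \<bar>lam\<bar> powr (- \<epsilon>) * L2_norm f1 * L2_norm f2 * L2_norm f3)"
    if test: "test_function_on V \<phi>" and nz: "\<phi> (0, 0) \<noteq> 0" and \<epsilon>: "\<epsilon> > 1 / (2 * (3 + real d))" for \<phi> \<epsilon>
  proof (rule trilinear_decay_sharp[where g = g and U = U and S = S and d = d and \<phi> = \<phi> and \<epsilon> = \<epsilon>])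
    show "jet U g" "(0, 0) \<in> U" "vanishes d (hjet g)" "\<phi> (0, 0) \<noteq> 0" "\<epsilon> > 1 / (2 * (3 + real d))" by (rule g assms(2) van nz \<epsilon>)+
    show "S p = g 0 0 p" for p by (rule S)
    show "continuous_on UNIV \<phi>" using test smooth_on_partial(3)[of UNIV \<phi>] unfolding test_function_on_def by blast
    show "p \<in> U" if "\<phi> p \<noteq> 0" for p
    proof -
      have "p \<in> closure {p. \<phi> p \<noteq> 0}" using that closure_subset[of "{p. \<phi> p \<noteq> 0}"] by blast
      then show ?thesis using test unfolding test_function_on_def V_def by blast
    qed
  qed
  show ?thesis
  proof (rule exI[of _ V], intro conjI)
    show "open V" by (rule oV)
    show "(0, 0) \<in> V" using assms(2) R by (simp add: V_def)
    show "V \<subseteq> U" by (simp add: V_def)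
  qed (intro allI impI conjI decay[folded V_def, rule_format] sharp)
qed

end
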